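(* Let $C$ be a regular, irreducible curve that is projective over a field $k$, of arithmetic genus $t$, with function field $F=k(C)$, and with a $k$-rational point $O$. For every integer $d\ge 3t+1$ the tame symbol induces isomorphisms $$F_d/F_{d-1}\xrightarrow{\ \cong\ }\coprod_{O\ne P\in C_d}k(P)^*\quad\text{and}\quad K_2(F)/F_{d-1}\xrightarrow{\ \cong\ }\coprod_{O\ne P\in C_{\ge d}}k(P)^*.$$ In particular, the tame symbol $T:K_2(F)\to\coprod_{P\in C}k(P)^*$ and its restriction $$F_{d-1}\to\coprod_{P\in\{O\}\cup C_{\le d-1}}k(P)^*$$ yield the same kernel and cokernel (via the natural inclusions).
   Context: $K_2(F)$ of a field $F$ is $F^*\otimes_{\mathbb Z}F^*/\langle a\otimes(1-a): a\in F,\ a\ne0,1\rangle$, written additively; the class of $a\otimes b$ is the symbol $\{a,b\}$. The tame symbol is the homomorphism $T:K_2(F)\to\coprod_{P}k(P)^*$ (direct sum over all closed points $P$ of $C$) with components $T_P(\{f,g\})=(-1)^{\mathrm{ord}_P(f)\,\mathrm{ord}_P(g)}\,\frac{f^{\mathrm{ord}_P(g)}}{g^{\mathrm{ord}_P(f)}}\big|_P$. "$P\in C$" always means $P$ is a closed point. $\deg(P)=[k(P):k]$; $C_d$, $C_{\le d}$, $C_{\ge d}$ denote the sets of closed points of $C$ of degree equal to $d$, at most $d$, at least $d$, respectively. $|(f)|$ is the support of the divisor $(f)$ of $f\in F^*$. For an integer $d$, $F_d$ is the subgroup of $K_2(F)$ generated by all symbols $\{f,g\}$ with $f,g\in F^*$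 and $|(f)|\cup|(g)|\subseteq C_{\le d}$. The existence of $O$ implies $H^0(C,\mathcal{O}_C)=k$, so that $t=\dim_kH^1(C,\mathcal{O}_C)\ge0$. *)

theory Defs
  imports "HOL-Algebra.Algebra" "HOL-Algebra.Algebraic_Closure_Type" "HOL-Analysis.Abstract_Topology" "HOL-Library.Extended_Nat"
begin

section \<open>Subrings of a field\<close>

text \<open>
  The ambient field \<open>F\<close> is a type of class \<^class>\<open>field\<close>; the HOL-Algebra notions are applied to
  the corresponding ring record.
\<close>

abbreviation Fr :: "'f::field ring"
  where "Fr \<equiv> ring_of_type_algebra"

abbreviation sub :: "'f::field set \<Rightarrow> 'f ring"
  where "sub A \<equiv> Fr\<lparr>carrier := A\<rparr>"

definition non_units :: "'f::field set \<Rightarrow> 'f set"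
  where "non_units A = A - Units (sub A)"

definition prime_spectrum :: "'f::field set \<Rightarrow> 'f set set"
  where "prime_spectrum A = {p. primeideal p (sub A)}"

definition Spec :: "'f::field set \<Rightarrow> 'f set topology"
  where "Spec A = topology_generated_by {{p \<in> prime_spectrum A. a \<notin> p} |a. a \<in> A}"

definition krull_dim :: "'f::field set \<Rightarrow> enat"
  where "krull_dim A = Sup {enat n |n. \<exists>p :: nat \<Rightarrow> 'f set.
           (\<forall>i\<le>n. p i \<in> prime_spectrum A) \<and> (\<forall>i<n. p i \<subset> p (Suc i))}"

definition regular_local_ring :: "'f::field set \<Rightarrow> bool"
  where "regular_local_ring A \<longleftrightarrow>
           subring A Fr \<and> noetherian_ring (sub A) \<and> maximalideal (non_units A) (sub A) \<and>
           (\<exists>S. finite S \<and> S \<subseteq> A \<and> enat (card S) = krull_dim A \<and>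
                non_units A = Idl\<^bsub>sub A\<^esub> S)"

section \<open>Integral schemes\<close>

text \<open>
  The structure sheaf of an integral scheme with function field \<open>F\<close> is a subsheaf of the constant
  sheaf \<open>F\<close>, and all its stalks are subrings of \<open>F\<close>. So such a scheme is given by its underlying
  space and by the stalk at each point; the sections over a nonempty open set are the elements of
  \<open>F\<close> that lie in all the stalks there. (A regular irreducible scheme is reduced, hence integral.)
\<close>

record ('p, 'f) scheme_data =
  space :: "'p topology"
  stalk :: "'p \<Rightarrow> 'f set"

definition sections :: "('p, 'f::field) scheme_data \<Rightarrow> 'p set \<Rightarrow> 'f set"
  where "sections C U = {f. \<forall>x\<in>U. f \<in> stalk C x}"

definition max_ideal :: "('p, 'f::field) scheme_data \<Rightarrow> 'p \<Rightarrow> 'f set"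
  where "max_ideal C x = non_units (stalk C x)"

definition irreducible_space :: "'p topology \<Rightarrow> bool"
  where "irreducible_space T \<longleftrightarrow>
           topspace T \<noteq> {} \<and>
           (\<forall>U V. openin T U \<and> openin T V \<and> U \<noteq> {} \<and> V \<noteq> {} \<longrightarrow> U \<inter> V \<noteq> {})"

definition topological_dim :: "'p topology \<Rightarrow> enat"
  where "topological_dim T = Sup {enat n |n. \<exists>Z :: nat \<Rightarrow> 'p set.
           (\<forall>i\<le>n. closedin T (Z i) \<and> irreducible_space (subtopology T (Z i))) \<and>
           (\<forall>i<n. Z i \<subset> Z (Suc i))}"

text \<open>
  An open subspace \<open>U\<close> is affine if the canonical map \<open>x \<mapsto> \<mm>\<^sub>x \<inter> A\<close> to the spectrum of its ring
  of sections \<open>A\<close> is an isomorphism of locally ringed spaces: a homeomorphism, with stalk at \<open>x\<close>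
  the localization of \<open>A\<close> at \<open>\<mm>\<^sub>x \<inter> A\<close>. That \<open>F\<close> is the fraction field of \<open>A\<close> says that
  \<open>F\<close> is the stalk at the generic point.
\<close>

definition affine_open :: "('p, 'f::field) scheme_data \<Rightarrow> 'p set \<Rightarrow> bool"
  where "affine_open C U \<longleftrightarrow>
           (let A = sections C U in
              openin (space C) U \<and> U \<noteq> {} \<and> subring A Fr \<and>
              (\<forall>f. \<exists>a\<in>A. \<exists>b\<in>A - {0}. f = a / b) \<and>
              homeomorphic_map (subtopology (space C) U) (Spec A) (\<lambda>x. max_ideal C x \<inter> A) \<and>
              (\<forall>x\<in>U. stalk C x = {a / b |a b. a \<in> A \<and> b \<in> A - max_ideal C x}))"

definition integral_scheme :: "('p, 'f::field) scheme_data \<Rightarrow> bool"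
  where "integral_scheme C \<longleftrightarrow>
           irreducible_space (space C) \<and>
           (\<forall>x\<in>topspace (space C). \<exists>U. x \<in> U \<and> affine_open C U)"

definition scheme_over :: "'f::field set \<Rightarrow> ('p, 'f) scheme_data \<Rightarrow> bool"
  where "scheme_over K C \<longleftrightarrow>
           subfield K Fr \<and> (\<forall>x\<in>topspace (space C). K \<subseteq> stalk C x)"

text \<open>
  A closed immersion over \<open>K\<close> of an integral scheme into \<open>n\<close>-dimensional projective space sends
  the generic point to a point with homogeneous coordinates \<open>c 0, \<dots>, c n\<close> in \<open>F\<close>. The inverse
  image of the \<open>i\<close>-th standard chart is empty if \<open>c i = 0\<close>; otherwise it is the set
  \<open>chart C n c i\<close>, and being a closed immersion means that this set is affine and that
  \<open>K[T\<^sub>0, \<dots>, T\<^sub>n]\<close> maps onto its ring of sections by \<open>T\<^sub>j \<mapsto> c j / c i\<close>.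
\<close>

definition chart :: "('p, 'f::field) scheme_data \<Rightarrow> nat \<Rightarrow> (nat \<Rightarrow> 'f) \<Rightarrow> nat \<Rightarrow> 'p set"
  where "chart C n c i = {x \<in> topspace (space C). \<forall>j\<le>n. c j / c i \<in> stalk C x}"

definition closed_immersion_in_projective_space ::
    "'f::field set \<Rightarrow> ('p, 'f) scheme_data \<Rightarrow> nat \<Rightarrow> (nat \<Rightarrow> 'f) \<Rightarrow> bool"
  where "closed_immersion_in_projective_space K C n c \<longleftrightarrow>
           (\<forall>i\<le>n. c i \<noteq> 0 \<longrightarrow>
              affine_open C (chart C n c i) \<and>
              sections C (chart C n c i) = generate_ring Fr (K \<union> {c j / c i |j. j \<le> n})) \<and>
           topspace (space C) = (\<Union>i\<in>{i. i \<le> n \<and> c i \<noteq> 0}. chart C n c i)"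

definition projective_over :: "'f::field set \<Rightarrow> ('p, 'f) scheme_data \<Rightarrow> bool"
  where "projective_over K C \<longleftrightarrow>
           scheme_over K C \<and> (\<exists>n c. closed_immersion_in_projective_space K C n c)"

definition regular_scheme :: "('p, 'f::field) scheme_data \<Rightarrow> bool"
  where "regular_scheme C \<longleftrightarrow> (\<forall>x\<in>topspace (space C). regular_local_ring (stalk C x))"

definition regular_projective_curve :: "'f::field set \<Rightarrow> ('p, 'f) scheme_data \<Rightarrow> bool"
  where "regular_projective_curve K C \<longleftrightarrow>
           integral_scheme C \<and> projective_over K C \<and> regular_scheme C \<and>
           topological_dim (space C) = 1"

section \<open>Arithmetic genus\<close>

text \<open>The \<open>K\<close>-dimension of \<open>V / W\<close> for \<open>K\<close>-subspaces \<open>W \<subseteq> V\<close> of the space of functions to \<open>F\<close>.\<close>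

definition quotient_dim :: "'f::field set \<Rightarrow> ('p \<Rightarrow> 'f) set \<Rightarrow> ('p \<Rightarrow> 'f) set \<Rightarrow> nat"
  where "quotient_dim K V W = (THE n. \<exists>b :: nat \<Rightarrow> 'p \<Rightarrow> 'f.
           (\<forall>i<n. b i \<in> V) \<and>
           (\<forall>v\<in>V. \<exists>!a. a \<in> {..<n} \<rightarrow>\<^sub>E K \<and> (\<lambda>x. v x - (\<Sum>i<n. a i * b i x)) \<in> W))"

text \<open>
  The constant sheaf \<open>F\<close> on the irreducible space \<open>C\<close> is flasque, so the long exact sequence of
  \<open>0 \<rightarrow> \<O> \<rightarrow> F \<rightarrow> F/\<O> \<rightarrow> 0\<close> identifies \<open>H\<^sup>1(C, \<O>)\<close> with the cokernel of the map from \<open>F\<close> to the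
  global sections of \<open>F/\<O>\<close>. Such a section is represented by a family of elements of \<open>F\<close>, one for
  each point, that is locally constant modulo \<open>\<O>\<close>.
\<close>

definition quotient_sections :: "('p, 'f::field) scheme_data \<Rightarrow> ('p \<Rightarrow> 'f) set"
  where "quotient_sections C =
           {s. \<forall>x\<in>topspace (space C). \<exists>U f. openin (space C) U \<and> x \<in> U \<and>
                 (\<forall>y\<in>U. s y - f \<in> stalk C y)}"

definition constant_quotient_sections :: "('p, 'f::field) scheme_data \<Rightarrow> ('p \<Rightarrow> 'f) set"
  where "constant_quotient_sections C =
           {s. \<exists>f. \<forall>y\<in>topspace (space C). s y - f \<in> stalk C y}"

definition h0 :: "'f::field set \<Rightarrow> ('p, 'f) scheme_data \<Rightarrow> nat"
  where "h0 K C = ring.dim Fr K (sections C (topspace (space C)))"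

definition h1 :: "'f::field set \<Rightarrow> ('p, 'f) scheme_data \<Rightarrow> nat"
  where "h1 K C = quotient_dim K (quotient_sections C) (constant_quotient_sections C)"

text \<open>This is \<open>1 - \<chi>(\<O>)\<close>; cohomology vanishes above degree \<open>1\<close>, the dimension of a curve.\<close>

definition arithmetic_genus :: "'f::field set \<Rightarrow> ('p, 'f) scheme_data \<Rightarrow> int"
  where "arithmetic_genus K C = 1 - (int (h0 K C) - int (h1 K C))"

section \<open>Closed points\<close>

definition closed_points :: "('p, 'f) scheme_data \<Rightarrow> 'p set"
  where "closed_points C = {P \<in> topspace (space C). closedin (space C) {P}}"

definition residue_field :: "('p, 'f::field) scheme_data \<Rightarrow> 'p \<Rightarrow> 'f set ring"
  where "residue_field C P = sub (stalk C P) Quot max_ideal C P"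

definition residue_class :: "('p, 'f::field) scheme_data \<Rightarrow> 'p \<Rightarrow> 'f \<Rightarrow> 'f set"
  where "residue_class C P f = max_ideal C P +>\<^bsub>sub (stalk C P)\<^esub> f"

definition point_degree :: "'f::field set \<Rightarrow> ('p, 'f) scheme_data \<Rightarrow> 'p \<Rightarrow> nat"
  where "point_degree K C P =
           ring.dim (residue_field C P) (residue_class C P ` K) (carrier (residue_field C P))"

definition rational_point :: "'f::field set \<Rightarrow> ('p, 'f) scheme_data \<Rightarrow> 'p \<Rightarrow> bool"
  where "rational_point K C P \<longleftrightarrow>
           P \<in> closed_points C \<and> residue_class C P ` K = carrier (residue_field C P)"

definition points_eq :: "'f::field set \<Rightarrow> ('p, 'f) scheme_data \<Rightarrow> int \<Rightarrow> 'p set"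
  where "points_eq K C d = {P \<in> closed_points C. int (point_degree K C P) = d}"

definition points_le :: "'f::field set \<Rightarrow> ('p, 'f) scheme_data \<Rightarrow> int \<Rightarrow> 'p set"
  where "points_le K C d = {P \<in> closed_points C. int (point_degree K C P) \<le> d}"

definition points_ge :: "'f::field set \<Rightarrow> ('p, 'f) scheme_data \<Rightarrow> int \<Rightarrow> 'p set"
  where "points_ge K C d = {P \<in> closed_points C. int (point_degree K C P) \<ge> d}"

text \<open>Only meaningful if \<open>f \<noteq> 0\<close> and \<open>P\<close> is a closed point of a regular curve.\<close>

definition ord_at :: "('p, 'f::field) scheme_data \<Rightarrow> 'p \<Rightarrow> 'f \<Rightarrow> int"
  where "ord_at C P f = (THE n. \<exists>\<pi>\<in>stalk C P. \<exists>u\<in>Units (sub (stalk C P)).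
           max_ideal C P = PIdl\<^bsub>sub (stalk C P)\<^esub> \<pi> \<and> f = u * \<pi> powi n)"

definition divisor_support :: "('p, 'f::field) scheme_data \<Rightarrow> 'f \<Rightarrow> 'p set"
  where "divisor_support C f = {P \<in> closed_points C. ord_at C P f \<noteq> 0}"

section \<open>The second K-group of a field\<close>

text \<open>The tensor product over the integers of two abelian groups, both written multiplicatively.\<close>

definition tensor_relations ::
    "('a, 'm) monoid_scheme \<Rightarrow> ('b, 'n) monoid_scheme \<Rightarrow> ('a \<times> 'b \<Rightarrow>\<^sub>0 int) set"
  where "tensor_relations G H =
           generate (free_Abelian_group (carrier G \<times> carrier H))
             ({frag_of (a \<otimes>\<^bsub>G\<^esub> a', b) - frag_of (a, b) - frag_of (a', b) |a a' b.
                 a \<in> carrier G \<and> a' \<in> carrier G \<and> b \<in> carrier H} \<union>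
              {frag_of (a, b \<otimes>\<^bsub>H\<^esub> b') - frag_of (a, b) - frag_of (a, b') |a b b'.
                 a \<in> carrier G \<and> b \<in> carrier H \<and> b' \<in> carrier H})"

definition tensor_group ::
    "('a, 'm) monoid_scheme \<Rightarrow> ('b, 'n) monoid_scheme \<Rightarrow> ('a \<times> 'b \<Rightarrow>\<^sub>0 int) set monoid"
  where "tensor_group G H =
           free_Abelian_group (carrier G \<times> carrier H) Mod tensor_relations G H"

definition pure_tensor ::
    "('a, 'm) monoid_scheme \<Rightarrow> ('b, 'n) monoid_scheme \<Rightarrow> 'a \<Rightarrow> 'b \<Rightarrow> ('a \<times> 'b \<Rightarrow>\<^sub>0 int) set"
  where "pure_tensor G H a b =
           tensor_relations G H #>\<^bsub>free_Abelian_group (carrier G \<times> carrier H)\<^esub> frag_of (a, b)"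

abbreviation Fstar :: "'f::field monoid"
  where "Fstar \<equiv> units_of Fr"

definition steinberg_relations :: "('f::field \<times> 'f \<Rightarrow>\<^sub>0 int) set set"
  where "steinberg_relations =
           generate (tensor_group Fstar Fstar)
             {pure_tensor Fstar Fstar a (1 - a) |a. a \<noteq> 0 \<and> a \<noteq> 1}"

definition K2 :: "('f::field \<times> 'f \<Rightarrow>\<^sub>0 int) set set monoid"
  where "K2 = tensor_group Fstar Fstar Mod steinberg_relations"

definition symbol :: "'f::field \<Rightarrow> 'f \<Rightarrow> ('f \<times> 'f \<Rightarrow>\<^sub>0 int) set set"
  where "symbol f g =
           steinberg_relations #>\<^bsub>tensor_group Fstar Fstar\<^esub> pure_tensor Fstar Fstar f g"

definition K2_filtration ::
    "'f::field set \<Rightarrow> ('p, 'f) scheme_data \<Rightarrow> int \<Rightarrow> ('f \<times> 'f \<Rightarrow>\<^sub>0 int) set set set"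
  where "K2_filtration K C d =
           generate K2 {symbol f g |f g. f \<noteq> 0 \<and> g \<noteq> 0 \<and>
             divisor_support C f \<union> divisor_support C g \<subseteq> points_le K C d}"

section \<open>The tame symbol\<close>

definition residue_units :: "('p, 'f::field) scheme_data \<Rightarrow> 'p set \<Rightarrow> ('p \<Rightarrow> 'f set) monoid"
  where "residue_units C S = sum_group S (\<lambda>P. units_of (residue_field C P))"

definition tame_at :: "('p, 'f::field) scheme_data \<Rightarrow> 'p \<Rightarrow> 'f \<Rightarrow> 'f \<Rightarrow> 'f set"
  where "tame_at C P f g =
           residue_class C P ((-1) powi (ord_at C P f * ord_at C P g) *
             (f powi ord_at C P g / g powi ord_at C P f))"

definition tame_symbol ::
    "('p, 'f::field) scheme_data \<Rightarrow> ('f \<times> 'f \<Rightarrow>\<^sub>0 int) set set \<Rightarrow> 'p \<Rightarrow> 'f set"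
  where "tame_symbol C = (THE T.
           T \<in> hom K2 (residue_units C (closed_points C)) \<inter> extensional (carrier K2) \<and>
           (\<forall>f g. f \<noteq> 0 \<longrightarrow> g \<noteq> 0 \<longrightarrow>
              (\<forall>P\<in>closed_points C. T (symbol f g) P = tame_at C P f g)))"

definition tame_part ::
    "('p, 'f::field) scheme_data \<Rightarrow> 'p set \<Rightarrow> ('f \<times> 'f \<Rightarrow>\<^sub>0 int) set set \<Rightarrow> 'p \<Rightarrow> 'f set"
  where "tame_part C S \<xi> = restrict (tame_symbol C \<xi>) S"

text \<open>The natural inclusion of the direct sum over \<open>S\<close> into the one over all closed points.\<close>

definition extend_by_one ::
    "('p, 'f::field) scheme_data \<Rightarrow> 'p set \<Rightarrow> ('p \<Rightarrow> 'f set) \<Rightarrow> 'p \<Rightarrow> 'f set"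
  where "extend_by_one C S y =
           (\<lambda>P\<in>closed_points C. if P \<in> S then y P else \<one>\<^bsub>residue_field C P\<^esub>)"

end

theory Submission
  imports Defs
begin

text \<open>
  Write \<open>L (d O)\<close> for the functions whose only pole is a pole of order at most \<open>d\<close> at \<open>O\<close>.
  Riemann's inequality, proved with repartitions, bounds its dimension from below by \<open>d + 1 - t\<close>.
  For a closed point \<open>P \<noteq> O\<close> of degree \<open>d \<ge> 3 t + 1\<close> there is a function \<open>\<pi>\<^sub>P\<close> with a simple zero at
  \<open>P\<close> all of whose other zeros and poles have degree less than \<open>d\<close>, and these functions generate the
  functions supported in degree at most \<open>d\<close> modulo those supported in degree less than \<open>d\<close>.
  If \<open>u\<close> and \<open>w\<close> are small functions that agree at \<open>P\<close>, then \<open>w - u = \<pi>\<^sub>P k\<close> with \<open>k\<close> supported in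
  lower degree, and the Steinberg relation for \<open>u / w\<close> puts \<open>{\<pi>\<^sub>P, u / w}\<close> into \<open>F\<^sub>d\<^sub>-\<^sub>1\<close>.
  Counting dimensions, every residue at \<open>P\<close> is a quotient of elements of \<open>L ((d - 1) O)\<close>, and products of
  residues are handled by writing \<open>u\<^sub>1\<close> and \<open>u\<^sub>2\<close> as \<open>g / h\<close> and \<open>h / j\<close> with a common \<open>h\<close>, which is where
  \<open>3 (d - t) > 2 d\<close> is needed. So the symbol \<open>{\<pi>\<^sub>P, g}\<close> depends modulo \<open>F\<^sub>d\<^sub>-\<^sub>1\<close> only on the residue of \<open>g\<close>
  at \<open>P\<close>, which gives the first isomorphism; the other assertions follow by induction on the degree.
\<close>

section \<open>Linear algebra over a subfield\<close>

text \<open>Geometry enters only through \<open>places\<close>: discrete valuations with finite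
  residue degrees, finite supports, and constants as the only functions without poles. The genus
  enters as the length \<open>t\<close> of a family that spans the adeles modulo \<open>W1\<close>.
  The obstacle in the K-theory is that the second entry \<open>c\<close> of a symbol
  \<open>{pf P, c}\<close> may be any function supported in degree below \<open>d\<close>, while
  agreement at \<open>P\<close> can be exploited only for functions with few poles: the quotient
  \<open>k\<close> of the difference by \<open>pf P\<close> must again be supported in low degree.
  This is a degree count. The divisor of \<open>pf P\<close> is \<open>P + E - (d + t) Q\<close>
  with \<open>E\<close> effective of degree \<open>t\<close>, so dividing by \<open>pf P\<close> a
  function that vanishes at \<open>P\<close> lowers the degree of its bounding divisor by exactly
  \<open>d\<close>. Differences of products of two elements of \<open>L (OD (d - 1))\<close> leave
  \<open>2 (d - 1) - d = d - 2\<close>; the other two counts leave \<open>3 t - 1\<close> and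
  \<open>3 t\<close>, and all of these must stay below \<open>d\<close>. The passage from few poles
  to arbitrary \<open>c\<close> goes through the set \<open>rep P\<close> of those \<open>c\<close>
  that can be traded, modulo lower degree, for a quotient of two elements of
  \<open>L (OD (d - 1))\<close>.\<close>

locale subfield_set =
  fixes K :: "'f::field set"
  assumes K_0 [simp]: "0 \<in> K"
    and K_1 [simp]: "1 \<in> K"
    and K_add [simp]: "a \<in> K \<Longrightarrow> b \<in> K \<Longrightarrow> a + b \<in> K"
    and K_uminus [simp]: "a \<in> K \<Longrightarrow> - a \<in> K"
    and K_mult [simp]: "a \<in> K \<Longrightarrow> b \<in> K \<Longrightarrow> a * b \<in> K"
    and K_inverse [simp]: "a \<in> K \<Longrightarrow> inverse a \<in> K"
begin

lemma K_diff [simp]: "a \<in> K \<Longrightarrow> b \<in> K \<Longrightarrow> a - b \<in> K"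
  using K_add[of a "- b"] by auto

lemma K_divide [simp]: "a \<in> K \<Longrightarrow> b \<in> K \<Longrightarrow> a / b \<in> K"
  by (auto simp: divide_inverse)

lemma K_sum [simp]: "(\<And>j. j \<in> J \<Longrightarrow> a j \<in> K) \<Longrightarrow> sum a J \<in> K"
  by (induction J rule: infinite_finite_induct) auto

text \<open>Gaussian elimination by induction on the equations: a nonzero coefficient of the new
  equation is the pivot, and without such a coefficient the new equation is void.\<close>

lemma homogeneous_system:
  assumes "finite I" "finite J" "card I < card J" "\<And>i j. i \<in> I \<Longrightarrow> j \<in> J \<Longrightarrow> a i j \<in> K"
  shows "\<exists>x. (\<forall>j\<in>J. x j \<in> K) \<and> (\<exists>j\<in>J. x j \<noteq> 0) \<and> (\<forall>i\<in>I. (\<Sum>j\<in>J. a i j * x j) = 0)"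
  using assms
proof (induction I arbitrary: J a rule: finite_induct)
  case empty
  then have "J \<noteq> {}" by auto
  then show ?case by (intro exI[of _ "\<lambda>_. 1"]) auto
next
  case (insert i0 I)
  show ?case
  proof (cases "\<forall>j\<in>J. a i0 j = 0")
    case True
    have "card I < card J" using insert by simp
    then obtain x where "\<forall>j\<in>J. x j \<in> K" "\<exists>j\<in>J. x j \<noteq> 0" "\<forall>i\<in>I. (\<Sum>j\<in>J. a i j * x j) = 0"
      using insert.IH[OF insert.prems(1), of a] insert.prems by auto
    then show ?thesis using True by (intro exI[of _ x]) auto
  next
    case False
    then obtain j0 where j0: "j0 \<in> J" "a i0 j0 \<noteq> 0" by blast
    define J' where "J' = J - {j0}"
    define b where "b = (\<lambda>i j. a i j - a i j0 * a i0 j / a i0 j0)"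
    have fin: "finite J'" and J: "J = insert j0 J'" "j0 \<notin> J'"
      using insert.prems j0 by (auto simp: J'_def)
    have "card I < card J'" using insert J fin by simp
    moreover have "b i j \<in> K" if "i \<in> I" "j \<in> J'" for i j
      unfolding b_def by (intro K_diff K_divide K_mult insert.prems(3)) (use that j0 J in auto)
    ultimately have "\<exists>x. (\<forall>j\<in>J'. x j \<in> K) \<and> (\<exists>j\<in>J'. x j \<noteq> 0) \<and>
        (\<forall>i\<in>I. (\<Sum>j\<in>J'. b i j * x j) = 0)"
      by (rule insert.IH[OF fin])
    then obtain x where x: "\<forall>j\<in>J'. x j \<in> K" "\<exists>j\<in>J'. x j \<noteq> 0"
        "\<forall>i\<in>I. (\<Sum>j\<in>J'. b i j * x j) = 0"
      by blast
    define s where "s = (\<Sum>j\<in>J'. a i0 j * x j)"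
    \<comment> \<open>Back substitution: the value at the pivot column is forced by equation
      \<open>i0\<close>, and the entries of \<open>b\<close> were chosen so that it solves the other
      equations as well.\<close>
    define y where "y = x(j0 := - s / a i0 j0)"
    have yx: "y j = x j" if "j \<in> J'" for j using that J(2) by (auto simp: y_def)
    have y0: "y j0 = - s / a i0 j0" by (simp add: y_def)
    have sum: "(\<Sum>j\<in>J. a i j * y j) = a i j0 * y j0 + (\<Sum>j\<in>J'. a i j * x j)" for i
      unfolding J(1) using fin J(2) by (simp add: yx)
    have sK: "s \<in> K" unfolding s_def
      by (intro K_sum K_mult insert.prems(3)) (use x J in auto)
    have "y j0 \<in> K" unfolding y0
      by (intro K_divide K_uminus sK insert.prems(3)) (use j0 in auto)
    moreover have "(\<Sum>j\<in>J. a i0 j * y j) = 0"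
      unfolding sum y0 using j0 by (simp add: s_def)
    moreover have "(\<Sum>j\<in>J. a i j * y j) = 0" if "i \<in> I" for i
    proof -
      have "(\<Sum>j\<in>J'. b i j * x j) = (\<Sum>j\<in>J'. a i j * x j) - a i j0 / a i0 j0 * s"
        unfolding b_def s_def sum_distrib_left sum_subtractf[symmetric]
        by (intro sum.cong) (auto simp: algebra_simps)
      then show ?thesis unfolding sum y0 using x(3) that by (simp add: algebra_simps)
    qed
    ultimately show ?thesis using x J yx by (intro exI[of _ y]) auto
  qed
qed

text \<open>After each solution a column where it is nonzero is deleted before the next one is
  sought. Later solutions therefore vanish at earlier pivots, which is the triangular shape.\<close>

lemma triangular_solutions:
  assumes "finite I" "finite J" "card I + r \<le> card J" "\<And>i j. i \<in> I \<Longrightarrow> j \<in> J \<Longrightarrow> a i j \<in> K"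
  shows "\<exists>x p. \<forall>k<r. (\<forall>j\<in>J. x k j \<in> K) \<and> p k \<in> J \<and> x k (p k) \<noteq> 0 \<and>
           (\<forall>i\<in>I. (\<Sum>j\<in>J. a i j * x k j) = 0) \<and> (\<forall>l<r. k < l \<longrightarrow> x l (p k) = 0)"
  using assms
proof (induction r arbitrary: J)
  case 0
  then show ?case by simp
next
  case (Suc r)
  then have "card I < card J" by simp
  then obtain x0 p0 where x0: "\<forall>j\<in>J. x0 j \<in> K" "p0 \<in> J" "x0 p0 \<noteq> 0"
      "\<forall>i\<in>I. (\<Sum>j\<in>J. a i j * x0 j) = 0"
    using homogeneous_system[of I J a] Suc.prems by auto
  define J' where "J' = J - {p0}"
  have J': "finite J'" "J = insert p0 J'" "p0 \<notin> J'" "card I + r \<le> card J'"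
    using Suc.prems x0 by (auto simp: J'_def)
  have "\<exists>x p. \<forall>k<r. (\<forall>j\<in>J'. x k j \<in> K) \<and> p k \<in> J' \<and> x k (p k) \<noteq> 0 \<and>
           (\<forall>i\<in>I. (\<Sum>j\<in>J'. a i j * x k j) = 0) \<and> (\<forall>l<r. k < l \<longrightarrow> x l (p k) = 0)"
    by (rule Suc.IH) (use Suc.prems J' in auto)
  then obtain x p where xp: "\<forall>k<r. (\<forall>j\<in>J'. x k j \<in> K) \<and> p k \<in> J' \<and> x k (p k) \<noteq> 0 \<and>
           (\<forall>i\<in>I. (\<Sum>j\<in>J'. a i j * x k j) = 0) \<and> (\<forall>l<r. k < l \<longrightarrow> x l (p k) = 0)"
    by blast
  define x' where "x' = (\<lambda>k. case k of 0 \<Rightarrow> x0 | Suc k \<Rightarrow> (x k)(p0 := 0))"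
  define p' where "p' = (\<lambda>k. case k of 0 \<Rightarrow> p0 | Suc k \<Rightarrow> p k)"
  have "(\<forall>j\<in>J. x' k j \<in> K) \<and> p' k \<in> J \<and> x' k (p' k) \<noteq> 0 \<and>
           (\<forall>i\<in>I. (\<Sum>j\<in>J. a i j * x' k j) = 0) \<and> (\<forall>l<Suc r. k < l \<longrightarrow> x' l (p' k) = 0)"
    if "k < Suc r" for k
  proof (cases k)
    case 0
    then show ?thesis using x0 by (auto simp: x'_def p'_def split: nat.splits)
  next
    case (Suc k')
    then have k': "k' < r" using that by simp
    have "(\<Sum>j\<in>J. a i j * x' k j) = (\<Sum>j\<in>J'. a i j * x k' j)" for i
      unfolding J'(2) using J' by (simp add: x'_def Suc) (intro sum.cong, auto)
    then show ?thesis using xp k' J'(2,3)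
      by (auto simp: x'_def p'_def Suc split: nat.splits)
  qed
  then show ?case by blast
qed

text \<open>Evaluating a relation at the pivot \<open>p k\<close> leaves one term: smaller indices
  vanish by induction, larger ones by triangularity. The coefficients \<open>c\<close> may thus
  range over all of \<open>F\<close>.\<close>

lemma independent_solutions:
  assumes "finite I" "finite J" "card I + r \<le> card J" "\<And>i j. i \<in> I \<Longrightarrow> j \<in> J \<Longrightarrow> a i j \<in> K"
  shows "\<exists>x. (\<forall>k<r. (\<forall>j\<in>J. x k j \<in> K) \<and> (\<forall>i\<in>I. (\<Sum>j\<in>J. a i j * x k j) = 0)) \<and>
           (\<forall>c. (\<forall>j\<in>J. (\<Sum>k<r. c k * x k j) = 0) \<longrightarrow> (\<forall>k<r. c k = 0))"
proof -
  obtain x p where xp: "\<forall>k<r. (\<forall>j\<in>J. x k j \<in> K) \<and> p k \<in> J \<and> x k (p k) \<noteq> 0 \<and>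
           (\<forall>i\<in>I. (\<Sum>j\<in>J. a i j * x k j) = 0) \<and> (\<forall>l<r. k < l \<longrightarrow> x l (p k) = (0::'f))"
    using triangular_solutions[where a = a, OF assms] by blast
  have "c k = 0" if c: "\<forall>j\<in>J. (\<Sum>k<r. c k * x k j) = 0" and "k < r" for c k
    using \<open>k < r\<close>
  proof (induction k rule: less_induct)
    case (less k)
    have "(\<Sum>l<r. c l * x l (p k)) = (\<Sum>l\<in>{k}. c l * x l (p k))"
    proof (intro sum.mono_neutral_right ballI)
      fix l assume "l \<in> {..<r} - {k}"
      then consider "l < k" | "k < l" "l < r" by fastforce
      then show "c l * x l (p k) = 0" using less xp by cases auto
    qed (use less in auto)
    then show "c k = 0" using c xp less by auto
  qed
  then show ?thesis using xp by (intro exI[of _ x]) blast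
qed

section \<open>Generation and independence modulo a subspace\<close>

definition subsp :: "('x \<Rightarrow> 'f) set \<Rightarrow> bool"
  where "subsp W \<longleftrightarrow> (\<lambda>_. 0) \<in> W \<and> (\<forall>s\<in>W. \<forall>s'\<in>W. (\<lambda>x. s x + s' x) \<in> W) \<and>
           (\<forall>c\<in>K. \<forall>s\<in>W. (\<lambda>x. c * s x) \<in> W)"

definition spanned :: "('x \<Rightarrow> 'f) set \<Rightarrow> 'i set \<Rightarrow> ('i \<Rightarrow> 'x \<Rightarrow> 'f) \<Rightarrow> ('x \<Rightarrow> 'f) set \<Rightarrow> bool"
  where "spanned W I e V \<longleftrightarrow>
           (\<forall>v\<in>V. \<exists>a. (\<forall>i\<in>I. a i \<in> K) \<and> (\<lambda>x. v x - (\<Sum>i\<in>I. a i * e i x)) \<in> W)"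

definition indep :: "('x \<Rightarrow> 'f) set \<Rightarrow> 'j set \<Rightarrow> ('j \<Rightarrow> 'x \<Rightarrow> 'f) \<Rightarrow> bool"
  where "indep W J v \<longleftrightarrow>
           (\<forall>a. (\<forall>j\<in>J. a j \<in> K) \<and> (\<lambda>x. \<Sum>j\<in>J. a j * v j x) \<in> W \<longrightarrow> (\<forall>j\<in>J. a j = 0))"

definition lin_indep :: "'j set \<Rightarrow> ('j \<Rightarrow> 'f) \<Rightarrow> bool"
  where "lin_indep J w \<longleftrightarrow>
           (\<forall>a. (\<forall>j\<in>J. a j \<in> K) \<and> (\<Sum>j\<in>J. a j * w j) = 0 \<longrightarrow> (\<forall>j\<in>J. a j = 0))"

lemma subsp_sum:
  assumes "subsp W" "\<And>j. j \<in> J \<Longrightarrow> c j \<in> K \<and> s j \<in> W"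
  shows "(\<lambda>x. \<Sum>j\<in>J. c j * s j x) \<in> W"
  using assms(2)
proof (induction J rule: infinite_finite_induct)
  case (insert j J)
  have "(\<lambda>x. c j * s j x) \<in> W" "(\<lambda>x. \<Sum>j\<in>J. c j * s j x) \<in> W"
    using insert assms(1) by (auto simp: subsp_def)
  then show ?case using insert assms(1) by (simp add: subsp_def)
qed (use assms(1) in \<open>auto simp: subsp_def\<close>)

lemma subsp_add: "subsp W \<Longrightarrow> s \<in> W \<Longrightarrow> s' \<in> W \<Longrightarrow> (\<lambda>x. s x + s' x) \<in> W"
  by (simp add: subsp_def)

lemma subsp_smult: "subsp W \<Longrightarrow> c \<in> K \<Longrightarrow> s \<in> W \<Longrightarrow> (\<lambda>x. c * s x) \<in> W"
  by (simp add: subsp_def)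

lemma subsp_diff:
  assumes "subsp W" "s \<in> W" "s' \<in> W" shows "(\<lambda>x. s x - s' x) \<in> W"
proof -
  have "(\<lambda>x. (-1) * s' x) \<in> W" by (rule subsp_smult) (use assms in simp_all)
  from subsp_add[OF assms(1,2) this] show ?thesis by simp
qed

text \<open>Each \<open>v j\<close> is expanded in the generators modulo \<open>W\<close>, and a
  nonzero solution of the homogeneous system for the coefficients is a relation. Working with
  functions on an arbitrary type lets the same lemma serve adeles and, with \<open>unit\<close> or
  \<open>bool\<close> as domain, one or two congruences between elements of the field.\<close>

lemma dependence:
  assumes W: "subsp W" and fin: "finite I" "finite J" and card: "card I < card J"
    and span: "spanned W I e V" and v: "\<And>j. j \<in> J \<Longrightarrow> v j \<in> V"
  shows "\<exists>x. (\<forall>j\<in>J. x j \<in> K) \<and> (\<exists>j\<in>J. x j \<noteq> 0) \<and> (\<lambda>y. \<Sum>j\<in>J. x j * v j y) \<in> W"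
proof -
  have "\<forall>j\<in>J. \<exists>a. (\<forall>i\<in>I. a i \<in> K) \<and> (\<lambda>x. v j x - (\<Sum>i\<in>I. a i * e i x)) \<in> W"
    using span v unfolding spanned_def by blast
  from bchoice[OF this] obtain a where
      "\<forall>j\<in>J. (\<forall>i\<in>I. a j i \<in> K) \<and> (\<lambda>x. v j x - (\<Sum>i\<in>I. a j i * e i x)) \<in> W" ..
  then have a: "\<And>j i. j \<in> J \<Longrightarrow> i \<in> I \<Longrightarrow> a j i \<in> K"
      "\<And>j. j \<in> J \<Longrightarrow> (\<lambda>x. v j x - (\<Sum>i\<in>I. a j i * e i x)) \<in> W" by simp_all
  obtain x where x: "\<forall>j\<in>J. x j \<in> K" "\<exists>j\<in>J. x j \<noteq> 0" "\<forall>i\<in>I. (\<Sum>j\<in>J. a j i * x j) = 0"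
    using homogeneous_system[OF fin card, of "\<lambda>i j. a j i"] a(1) by blast
  have "(\<Sum>j\<in>J. x j * v j y) = (\<Sum>j\<in>J. x j * (v j y - (\<Sum>i\<in>I. a j i * e i y)))" for y
  proof -
    have "(\<Sum>j\<in>J. x j * (\<Sum>i\<in>I. a j i * e i y)) = (\<Sum>j\<in>J. \<Sum>i\<in>I. a j i * x j * e i y)"
      by (simp add: sum_distrib_left mult_ac)
    also have "\<dots> = (\<Sum>i\<in>I. (\<Sum>j\<in>J. a j i * x j) * e i y)"
      by (subst sum.swap) (simp add: sum_distrib_right)
    also have "\<dots> = 0" using x(3) by simp
    finally show ?thesis by (simp add: right_diff_distrib sum_subtractf)
  qed
  moreover have "(\<lambda>y. \<Sum>j\<in>J. x j * (v j y - (\<Sum>i\<in>I. a j i * e i y))) \<in> W"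
    using x(1) a(2) by (intro subsp_sum[OF W]) auto
  ultimately show ?thesis using x(1,2) by auto
qed

lemma indep_card_le:
  assumes "subsp W" "finite I" "finite J" "spanned W I e V" "\<And>j. j \<in> J \<Longrightarrow> v j \<in> V" "indep W J v"
  shows "card J \<le> card I"
proof (rule ccontr)
  assume "\<not> ?thesis"
  then obtain x where "\<forall>j\<in>J. x j \<in> K" "\<exists>j\<in>J. x j \<noteq> 0" "(\<lambda>y. \<Sum>j\<in>J. x j * v j y) \<in> W"
    using dependence[OF assms(1-3) _ assms(4,5)] by fastforce
  then show False using assms(6) unfolding indep_def by blast
qed

text \<open>Adjoining \<open>v\<close> to the family produces a relation; its coefficient at
  \<open>v\<close> is nonzero because the family itself is independent, so the relation can be
  solved for \<open>v\<close>.\<close>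

lemma maximal_indep_spans:
  assumes W: "subsp W" and b: "\<And>i. i < n \<Longrightarrow> b i \<in> V" "indep W {..<n} b"
    and max: "\<And>b'. (\<And>i. i < Suc n \<Longrightarrow> b' i \<in> V) \<Longrightarrow> \<not> indep W {..<Suc n} b'"
  shows "spanned W {..<n} b V"
  unfolding spanned_def
proof
  fix v assume v: "v \<in> V"
  define b' where "b' = b(n := v)"
  have "b' i \<in> V" if "i < Suc n" for i using that v b by (auto simp: b'_def less_Suc_eq)
  then obtain a j where a: "\<forall>j<Suc n. a j \<in> K" "(\<lambda>x. \<Sum>j<Suc n. a j * b' j x) \<in> W" "j < Suc n" "a j \<noteq> 0"
    using max[of b'] unfolding indep_def by auto
  have sum: "(\<Sum>j<Suc n. a j * b' j x) = (\<Sum>j<n. a j * b j x) + a n * v x" for x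
    by (simp add: b'_def)
  have an: "a n \<noteq> 0"
  proof
    assume "a n = 0"
    then have "(\<lambda>x. \<Sum>j<n. a j * b j x) \<in> W" using a(2) unfolding sum by simp
    then have "\<forall>j<n. a j = 0" using b(2) a(1) unfolding indep_def by auto
    then show False using a(3,4) \<open>a n = 0\<close> by (auto simp: less_Suc_eq)
  qed
  have K: "inverse (a n) \<in> K" using a(1) by simp
  then have "(\<lambda>x. inverse (a n) * (\<Sum>j<Suc n. a j * b' j x)) \<in> W"
    by (intro subsp_smult W a(2))
  moreover have "inverse (a n) * (\<Sum>j<Suc n. a j * b' j x) = v x - (\<Sum>j<n. (- inverse (a n) * a j) * b j x)" for x
  proof -
    have "(\<Sum>j<n. (- inverse (a n) * a j) * b j x) = - (inverse (a n) * (\<Sum>j<n. a j * b j x))"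
      by (simp add: sum_distrib_left sum_negf mult_ac)
    then show ?thesis unfolding sum using an by (simp add: distrib_left)
  qed
  ultimately show "\<exists>a. (\<forall>i\<in>{..<n}. a i \<in> K) \<and> (\<lambda>x. v x - (\<Sum>i<n. a i * b i x)) \<in> W"
    using K a(1) by (intro exI[of _ "\<lambda>j. - inverse (a n) * a j"]) auto
qed

text \<open>A bound on the lengths of independent families allows one of greatest length to be
  chosen.\<close>

lemma finite_codim_basis:
  assumes W: "subsp W" 
    and bound: "\<And>(n::nat) b. (\<And>i. i < n \<Longrightarrow> b i \<in> V) \<Longrightarrow> indep W {..<n} b \<Longrightarrow> n \<le> (N::nat)"
  shows "\<exists>(n::nat) b. (\<forall>i<n. b i \<in> V) \<and> indep W {..<n} b \<and> spanned W {..<n} b V"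
proof -
  define S where "S = {n::nat. \<exists>b. (\<forall>i<n. b i \<in> V) \<and> indep W {..<n} b}"
  have S_iff: "n \<in> S \<longleftrightarrow> (\<exists>b. (\<forall>i<n. b i \<in> V) \<and> indep W {..<n} b)" for n
    unfolding S_def by simp
  have "S \<subseteq> {..N}" unfolding S_def using bound by blast
  moreover have "0 \<in> S" unfolding S_def indep_def by auto
  ultimately have M: "Max S \<in> S" "\<And>n. n \<in> S \<Longrightarrow> n \<le> Max S"
    using finite_subset[of S "{..N}"] Max_in[of S] Max_ge[of S] by fastforce+
  then obtain b where b: "\<forall>i<Max S. b i \<in> V" "indep W {..<Max S} b" unfolding S_def by blast
  have "\<not> indep W {..<Suc (Max S)} b'" if "\<And>i. i < Suc (Max S) \<Longrightarrow> b' i \<in> V" for b'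
  proof
    assume "indep W {..<Suc (Max S)} b'"
    then have "Suc (Max S) \<in> S" unfolding S_iff using that by blast
    then show False using M(2) by fastforce
  qed
  with b have "spanned W {..<Max S} b V"
    using maximal_indep_spans[OF W, of "Max S" b V] by simp
  then show ?thesis using b by blast
qed

end

section \<open>Fields with a set of discrete valuations\<close>

text \<open>Zero is adjoined by hand because valuations take integer values, so \<open>v P 0\<close>
  carries no information.\<close>

definition val_ge :: "('p \<Rightarrow> 'f::field \<Rightarrow> int) \<Rightarrow> 'p \<Rightarrow> int \<Rightarrow> 'f set"
  where "val_ge v P n = {f. f = 0 \<or> n \<le> v P f}"

text \<open>\<open>residue_basis\<close> says that the residue field at \<open>P\<close> has a
  \<open>K\<close>-basis of \<open>deg P\<close> elements, phrased through lifts to the valuation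
  ring. \<open>incomparable\<close> is the seed of weak approximation, and
  \<open>global_constant\<close> is the statement \<open>H^0 = K\<close>.\<close>

locale places = subfield_set K
  for K :: "'f::field set" +
  fixes Pts :: "'p set" and ord :: "'p \<Rightarrow> 'f \<Rightarrow> int" and deg :: "'p \<Rightarrow> nat" and Q :: 'p
  assumes ord_mult: "P \<in> Pts \<Longrightarrow> f \<noteq> 0 \<Longrightarrow> g \<noteq> 0 \<Longrightarrow> ord P (f * g) = ord P f + ord P g"
    and ord_add: "P \<in> Pts \<Longrightarrow> f \<noteq> 0 \<Longrightarrow> g \<noteq> 0 \<Longrightarrow> f + g \<noteq> 0 \<Longrightarrow>
           min (ord P f) (ord P g) \<le> ord P (f + g)"
    and ord_K: "P \<in> Pts \<Longrightarrow> c \<in> K \<Longrightarrow> c \<noteq> 0 \<Longrightarrow> ord P c = 0"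
    and uniformizer: "P \<in> Pts \<Longrightarrow> \<exists>\<pi>. \<pi> \<noteq> 0 \<and> ord P \<pi> = 1"
    and finite_support: "f \<noteq> 0 \<Longrightarrow> finite {P \<in> Pts. ord P f \<noteq> 0}"
    and residue_basis: "P \<in> Pts \<Longrightarrow> \<exists>u. (\<forall>i<deg P. u i \<in> val_ge ord P 0) \<and>
           (\<forall>f\<in>val_ge ord P 0. \<exists>a. (\<forall>i<deg P. a i \<in> K) \<and> f - (\<Sum>i<deg P. a i * u i) \<in> val_ge ord P 1) \<and>
           (\<forall>a. (\<forall>i<deg P. a i \<in> K) \<and> (\<Sum>i<deg P. a i * u i) \<in> val_ge ord P 1 \<longrightarrow> (\<forall>i<deg P. a i = 0))"
    and incomparable: "P \<in> Pts \<Longrightarrow> R \<in> Pts \<Longrightarrow> P \<noteq> R \<Longrightarrow> \<exists>z. z \<noteq> 0 \<and> 0 \<le> ord P z \<and> ord R z < 0"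
    and global_constant: "f \<noteq> 0 \<Longrightarrow> (\<And>P. P \<in> Pts \<Longrightarrow> 0 \<le> ord P f) \<Longrightarrow> f \<in> K"
    and Q: "Q \<in> Pts"
begin

abbreviation ge :: "'p \<Rightarrow> int \<Rightarrow> 'f set" where "ge \<equiv> val_ge ord"

lemma ge_iff: "f \<in> ge P n \<longleftrightarrow> f = 0 \<or> n \<le> ord P f" by (simp add: val_ge_def)

lemma ge_0 [simp]: "0 \<in> ge P n" by (simp add: ge_iff)

lemma ord_1 [simp]: "P \<in> Pts \<Longrightarrow> ord P 1 = 0" using ord_K[of P 1] by simp

lemma ord_uminus_1: "P \<in> Pts \<Longrightarrow> ord P (-1) = 0" using ord_K[of P "-1"] by simp

lemma ord_uminus [simp]:
  assumes "P \<in> Pts" shows "ord P (- f) = ord P f"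
proof (cases "f = 0")
  case False
  then show ?thesis using ord_mult[OF assms, of "-1" f] ord_uminus_1[OF assms] by simp
qed simp

lemma ord_inverse: assumes "P \<in> Pts" "f \<noteq> 0" shows "ord P (inverse f) = - ord P f"
  using ord_mult[of P f "inverse f"] assms by simp

lemma ord_divide: assumes "P \<in> Pts" "f \<noteq> 0" "g \<noteq> 0" shows "ord P (f / g) = ord P f - ord P g"
  using ord_mult[of P f "inverse g"] ord_inverse[of P g] assms by (simp add: divide_inverse)

lemma ord_power: assumes "P \<in> Pts" "f \<noteq> 0" shows "ord P (f ^ n) = int n * ord P f"
  by (induction n) (use assms in \<open>simp_all add: ord_mult algebra_simps\<close>)

lemma ord_powi: assumes "P \<in> Pts" "f \<noteq> 0" shows "ord P (f powi n) = n * ord P f"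
  using assms by (cases n rule: int_cases2) (simp_all add: power_int_minus ord_inverse ord_power)

lemma ge_mono: "f \<in> ge P n \<Longrightarrow> m \<le> n \<Longrightarrow> f \<in> ge P m"
  by (auto simp: ge_iff)

lemma ge_uminus: "P \<in> Pts \<Longrightarrow> f \<in> ge P n \<Longrightarrow> - f \<in> ge P n"
  by (auto simp: ge_iff)

lemma ge_add: "P \<in> Pts \<Longrightarrow> f \<in> ge P n \<Longrightarrow> g \<in> ge P n \<Longrightarrow> f + g \<in> ge P n"
  using ord_add[of P f g] by (cases "f = 0"; cases "g = 0"; cases "f + g = 0") (auto simp: ge_iff)

lemma ge_diff: "P \<in> Pts \<Longrightarrow> f \<in> ge P n \<Longrightarrow> g \<in> ge P n \<Longrightarrow> f - g \<in> ge P n"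
  using ge_add[of P f n "- g"] ge_uminus[of P g n] by simp

lemma ge_mult: "P \<in> Pts \<Longrightarrow> f \<in> ge P m \<Longrightarrow> g \<in> ge P n \<Longrightarrow> f * g \<in> ge P (m + n)"
  by (auto simp: ge_iff ord_mult)

lemma ge_mult': "P \<in> Pts \<Longrightarrow> f \<in> ge P m \<Longrightarrow> g \<in> ge P n \<Longrightarrow> k \<le> m + n \<Longrightarrow> f * g \<in> ge P k"
  using ge_mult ge_mono by blast

lemma ge_K: "P \<in> Pts \<Longrightarrow> c \<in> K \<Longrightarrow> c \<in> ge P 0"
  by (cases "c = 0") (auto simp: ge_iff ord_K)

lemma ge_smult: "P \<in> Pts \<Longrightarrow> c \<in> K \<Longrightarrow> f \<in> ge P n \<Longrightarrow> c * f \<in> ge P n"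
  using ge_mult[of P c 0 f n] ge_K by simp

lemma ge_sum: "P \<in> Pts \<Longrightarrow> (\<And>j. j \<in> J \<Longrightarrow> f j \<in> ge P n) \<Longrightarrow> sum f J \<in> ge P n"
  by (induction J rule: infinite_finite_induct) (auto intro: ge_add)

lemma ge_mult_iff:
  assumes "P \<in> Pts" "g \<noteq> 0" shows "f * g \<in> ge P n \<longleftrightarrow> f \<in> ge P (n - ord P g)"
  using assms by (cases "f = 0") (auto simp: ge_iff ord_mult)

text \<open>The term of strictly smaller order decides; otherwise subtracting \<open>g\<close> again
  would contradict \<open>ord_add\<close>.\<close>

lemma ord_add_eq:
  assumes "P \<in> Pts" "f \<noteq> 0" "g = 0 \<or> ord P f < ord P g"
  shows "f + g \<noteq> 0 \<and> ord P (f + g) = ord P f"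
proof (cases "g = 0")
  case False
  then have g: "g \<noteq> 0" "ord P f < ord P g" using assms by auto
  have nz: "f + g \<noteq> 0"
  proof
    assume "f + g = 0"
    then have "g = - f" by (simp add: eq_neg_iff_add_eq_0 add.commute)
    then show False using g assms by simp
  qed
  have "ord P f \<le> ord P (f + g)" using ord_add[OF assms(1,2) g(1) nz] g by simp
  moreover have "min (ord P (f + g)) (ord P (- g)) \<le> ord P ((f + g) + (- g))"
    by (rule ord_add) (use assms g nz in auto)
  ultimately show ?thesis using g nz assms by auto
qed (use assms in simp)

subsection \<open>Weak approximation\<close>

text \<open>The quotient of two witnesses of \<open>incomparable\<close>, taken in opposite
  directions.\<close>

lemma separate_two:
  assumes "P \<in> Pts" "R \<in> Pts" "P \<noteq> R"
  shows "\<exists>z. z \<noteq> 0 \<and> 0 < ord P z \<and> ord R z < 0"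
proof -
  obtain z where z: "z \<noteq> 0" "0 \<le> ord P z" "ord R z < 0" using incomparable assms by blast
  obtain w where w: "w \<noteq> 0" "0 \<le> ord R w" "ord P w < 0" using incomparable assms by blast
  show ?thesis by (rule exI[of _ "z / w"]) (use assms z w in \<open>simp add: ord_divide\<close>)
qed

text \<open>If the function found for \<open>S\<close> has no pole at the new point
  \<open>R\<close>, a high power of a function separating \<open>P\<close> from \<open>R\<close> is
  added to it.\<close>

lemma separate:
  assumes "finite S" "S \<subseteq> Pts" "P \<in> Pts" "P \<notin> S"
  shows "\<exists>z. z \<noteq> 0 \<and> 0 < ord P z \<and> (\<forall>R\<in>S. ord R z < 0)"
  using assms
proof (induction S rule: finite_induct)
  case empty
  then show ?case using uniformizer[of P] by auto
next
  case (insert R S)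
  then obtain z where z: "z \<noteq> 0" "0 < ord P z" "\<forall>T\<in>S. ord T z < 0" by auto
  show ?case
  proof (cases "ord R z < 0")
    case True
    then show ?thesis using z by auto
  next
    case False
    obtain y where y: "y \<noteq> 0" "0 < ord P y" "ord R y < 0"
      using separate_two[of P R] insert.prems by auto
    \<comment> \<open>Since \<open>r\<close> exceeds every \<open>\<bar>ord T z\<bar>\<close>, the
      functions \<open>z\<close> and \<open>y ^ r\<close> never have the same order at a
      \<open>T \<in> S\<close>. No cancellation occurs, and the sum keeps the pole of
      \<open>z\<close>.\<close>
    define r where "r = Suc (\<Sum>T\<in>S. nat \<bar>ord T z\<bar>)"
    have r: "\<bar>ord T z\<bar> < int r" if "T \<in> S" for T
    proof -
      have "nat \<bar>ord T z\<bar> \<le> (\<Sum>T\<in>S. nat \<bar>ord T z\<bar>)"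
        by (rule member_le_sum) (use that insert.hyps in auto)
      then have "nat \<bar>ord T z\<bar> < r" by (simp add: r_def)
      then show ?thesis by linarith
    qed
    have yr: "y ^ r \<noteq> 0" "\<And>T. T \<in> Pts \<Longrightarrow> ord T (y ^ r) = int r * ord T y"
      using y by (auto simp: ord_power)
    have rpos: "r > 0" by (simp add: r_def)
    have R: "R \<in> Pts" "S \<subseteq> Pts" using insert.prems by auto
    have ryR: "ord R (y ^ r) < 0" using yr(2)[OF R(1)] y(3) rpos by (simp add: mult_pos_neg)
    have 1: "y ^ r + z \<noteq> 0 \<and> ord R (y ^ r + z) = ord R (y ^ r)"
      by (rule ord_add_eq) (use ryR False R yr in auto)
    have 2: "ord T (z + y ^ r) < 0" if T: "T \<in> S" for T
    proof (cases "ord T z < ord T (y ^ r)")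
      case True
      have "ord T (z + y ^ r) = ord T z"
        using ord_add_eq[of T z "y ^ r"] T R z True by auto
      then show ?thesis using z T by simp
    next
      case False
      have "ord T (y ^ r) \<noteq> ord T z"
      proof
        assume eq: "ord T (y ^ r) = ord T z"
        have "ord T y \<noteq> 0" using eq yr(2)[of T] T R(2) bspec[OF z(3) T] by (auto dest: subsetD)
        then have "int r * 1 \<le> int r * \<bar>ord T y\<bar>" by (intro mult_left_mono) auto
        also have "\<dots> = \<bar>ord T z\<bar>" using eq yr(2)[of T] T R by (auto simp: abs_mult)
        finally show False using r[OF T] by simp
      qed
      then have "ord T (y ^ r) < ord T z" using False by simp
      then have "ord T (y ^ r + z) = ord T (y ^ r)"
        using ord_add_eq[of T "y ^ r" z] T R yr by auto
      then show ?thesis using \<open>ord T (y ^ r) < ord T z\<close> z T by (fastforce simp: add.commute)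
    qed
    have "1 * 1 \<le> int r * ord P y" by (rule mult_mono) (use rpos y in auto)
    then have "0 < ord P (y ^ r)" using yr(2)[of P] insert.prems by simp
    then have "0 < ord P (z + y ^ r)"
      using ord_add[of P z "y ^ r"] z yr 1 insert.prems by (auto simp: add.commute)
    then show ?thesis using 1 2 ryR by (intro exI[of _ "z + y ^ r"]) (auto simp: add.commute)
  qed
qed

text \<open>For \<open>y\<close> a high power of a separating function, \<open>1 / (1 + y)\<close>
  is close to \<open>1\<close> where \<open>y\<close> has a zero and close to \<open>0\<close> where
  it has a pole.\<close>

lemma approximate_one:
  assumes S: "finite S" "S \<subseteq> Pts" "P \<in> Pts" "P \<notin> S"
  shows "\<exists>w. w - 1 \<in> ge P m \<and> (\<forall>R\<in>S. w \<in> ge R m)"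
proof -
  obtain z where z: "z \<noteq> 0" "0 < ord P z" "\<forall>R\<in>S. ord R z < 0" using separate[OF S] by blast
  define k where "k = nat (max 1 m)"
  have k: "int k \<ge> 1" "int k \<ge> m" by (auto simp: k_def)
  define y where "y = z ^ k"
  have y: "y \<noteq> 0" "\<And>R. R \<in> Pts \<Longrightarrow> ord R y = int k * ord R z"
    using z by (auto simp: y_def ord_power)
  have "int k * 1 \<le> int k * ord P z" using z by (intro mult_left_mono) auto
  then have yP: "ord P y \<ge> int k" using y(2)[OF S(3)] by simp
  have 1: "1 + y \<noteq> 0 \<and> ord P (1 + y) = ord P 1"
    by (rule ord_add_eq) (use S yP k in auto)
  have "1 / (1 + y) - 1 = - (y / (1 + y))" using 1 by (simp add: field_simps)
  moreover have "- (y / (1 + y)) \<in> ge P m"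
    using 1 y(1) yP k S by (auto simp: ge_iff ord_divide)
  moreover have "1 / (1 + y) \<in> ge R m" if R: "R \<in> S" for R
  proof -
    have RP: "R \<in> Pts" using R S by auto
    have "ord R z \<le> - 1" using z R by auto
    then have "int k * ord R z \<le> int k * (- 1)" by (intro mult_left_mono) auto
    then have yR: "ord R y \<le> - int k" using y(2)[OF RP] by simp
    then have "y + 1 \<noteq> 0 \<and> ord R (y + 1) = ord R y"
      by (intro ord_add_eq) (use RP y k in auto)
    then show ?thesis using yR k RP 1 by (auto simp: ge_iff ord_divide add.commute)
  qed
  ultimately show ?thesis by (intro exI[of _ "1 / (1 + y)"]) auto
qed

theorem weak_approximation:
  assumes S: "finite S" "S \<subseteq> Pts"
  shows "\<exists>f. \<forall>P\<in>S. f - a P \<in> ge P n"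
proof -
  \<comment> \<open>The approximate idempotents must outweigh the pole of every \<open>a P\<close>
    at every point of \<open>S\<close>; this sum of absolute values bounds all those deficits at
    once.\<close>
  define m where "m = (\<Sum>R\<in>S. \<Sum>P\<in>S. \<bar>n - ord R (a P)\<bar>)"
  have m: "n - ord R (a P) \<le> m" if "R \<in> S" "P \<in> S" for R P
  proof -
    have "\<bar>n - ord R (a P)\<bar> \<le> (\<Sum>P\<in>S. \<bar>n - ord R (a P)\<bar>)"
      by (rule member_le_sum) (use that S in auto)
    also have "\<dots> \<le> m" unfolding m_def
      by (rule member_le_sum[of R S "\<lambda>R. \<Sum>P\<in>S. \<bar>n - ord R (a P)\<bar>"])
        (use that S in \<open>auto intro: sum_nonneg\<close>)
    finally show ?thesis by simp
  qed
  have "\<exists>w. w - 1 \<in> ge P m \<and> (\<forall>R\<in>S - {P}. w \<in> ge R m)" if "P \<in> S" for P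
    by (rule approximate_one) (use S that in auto)
  then have "\<forall>P\<in>S. \<exists>w. w - 1 \<in> ge P m \<and> (\<forall>R\<in>S - {P}. w \<in> ge R m)" by blast
  from bchoice[OF this] obtain w where
    w: "\<forall>P\<in>S. w P - 1 \<in> ge P m \<and> (\<forall>R\<in>S - {P}. w P \<in> ge R m)" ..
  have small: "a P * y \<in> ge R n" if "y \<in> ge R m" "R \<in> S" "P \<in> S" for y R P
    using ge_mult'[of R "a P" "ord R (a P)" y m n] that m[of R P] S by (auto simp: ge_iff)
  have "(\<Sum>P\<in>S. a P * w P) - a R \<in> ge R n" if R: "R \<in> S" for R
  proof -
    have "(\<Sum>P\<in>S. a P * w P) - a R = a R * (w R - 1) + (\<Sum>P\<in>S - {R}. a P * w P)"
      using S R by (simp add: sum.remove[of S R] algebra_simps)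
    also have "\<dots> \<in> ge R n"
      by (intro ge_add ge_sum small) (use R S w in auto)
    finally show ?thesis .
  qed
  then show ?thesis by blast
qed

subsection \<open>Divisors and adeles\<close>

definition unif :: "'p \<Rightarrow> 'f" where "unif P = (SOME \<pi>. \<pi> \<noteq> 0 \<and> ord P \<pi> = 1)"

definition res_basis :: "'p \<Rightarrow> nat \<Rightarrow> 'f"
  where "res_basis P = (SOME u. (\<forall>i<deg P. u i \<in> val_ge ord P 0) \<and>
           (\<forall>f\<in>val_ge ord P 0. \<exists>a. (\<forall>i<deg P. a i \<in> K) \<and> f - (\<Sum>i<deg P. a i * u i) \<in> val_ge ord P 1) \<and>
           (\<forall>a. (\<forall>i<deg P. a i \<in> K) \<and> (\<Sum>i<deg P. a i * u i) \<in> val_ge ord P 1 \<longrightarrow> (\<forall>i<deg P. a i = 0)))"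

text \<open>For fixed \<open>j\<close> these represent a basis of the functions with pole order at
  most \<open>j\<close> at \<open>P\<close> modulo those with pole order at most
  \<open>j - 1\<close>.\<close>

definition loc :: "'p \<Rightarrow> int \<Rightarrow> nat \<Rightarrow> 'f"
  where "loc P j i = unif P powi (- j) * res_basis P i"

lemma unif: assumes "P \<in> Pts" shows "unif P \<noteq> 0" "ord P (unif P) = 1"
  using someI_ex[OF uniformizer[OF assms]] by (auto simp: unif_def)

lemma res_basis:
  assumes "P \<in> Pts"
  shows "\<And>i. i < deg P \<Longrightarrow> res_basis P i \<in> ge P 0"
    and "\<And>f. f \<in> ge P 0 \<Longrightarrow> \<exists>a. (\<forall>i<deg P. a i \<in> K) \<and> f - (\<Sum>i<deg P. a i * res_basis P i) \<in> ge P 1"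
    and "\<And>a. (\<And>i. i < deg P \<Longrightarrow> a i \<in> K) \<Longrightarrow> (\<Sum>i<deg P. a i * res_basis P i) \<in> ge P 1 \<Longrightarrow> (\<forall>i<deg P. a i = 0)"
  using someI_ex[OF residue_basis[OF assms]] unfolding res_basis_def[symmetric] by blast+

lemma deg_pos: assumes "P \<in> Pts" shows "deg P > 0"
proof (rule ccontr)
  assume "\<not> deg P > 0"
  then have "1 \<in> ge P 1" using res_basis(2)[OF assms, of 1] assms by (auto simp: ge_iff)
  then show False using assms by (simp add: ge_iff)
qed

lemma loc_ge: "P \<in> Pts \<Longrightarrow> i < deg P \<Longrightarrow> loc P j i \<in> ge P (- j)"
  unfolding loc_def using unif[of P] ge_mult[of P "unif P powi (- j)" "- j" "res_basis P i" 0] res_basis(1)[of P i]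
  by (simp add: ge_iff[of "unif P powi (- j)"] ord_powi)

lemma loc_comb: "(\<Sum>i<deg P. c i * loc P j i) = unif P powi (- j) * (\<Sum>i<deg P. c i * res_basis P i)"
  by (simp add: loc_def sum_distrib_left mult_ac)

text \<open>Pole orders are removed one at a time from the top, each by expanding a leading
  coefficient in the residue basis.\<close>

lemma local_span:
  assumes P: "P \<in> Pts" and "a \<le> b" and f: "f \<in> ge P (- b)"
  shows "\<exists>c. (\<forall>j i. i < deg P \<longrightarrow> c j i \<in> K) \<and> f - (\<Sum>j\<in>{a<..b}. \<Sum>i<deg P. c j i * loc P j i) \<in> ge P (- a)"
  using \<open>a \<le> b\<close>
proof (induction a rule: int_le_induct)
  case base
  then show ?case using f by (intro exI[of _ "\<lambda>_ _. 0"]) simp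
next
  case (step a)
  then obtain c where c: "\<forall>j i. i < deg P \<longrightarrow> c j i \<in> K"
    and g: "f - (\<Sum>j\<in>{a<..b}. \<Sum>i<deg P. c j i * loc P j i) \<in> ge P (- a)" by blast
  define g where "g = f - (\<Sum>j\<in>{a<..b}. \<Sum>i<deg P. c j i * loc P j i)"
  \<comment> \<open>Multiplication by \<open>p\<close>, which has order \<open>a\<close>, moves the
    leading part of \<open>g\<close> into the valuation ring.\<close>
  define p where "p = unif P powi a"
  have p: "p \<noteq> 0" "ord P p = a" "unif P powi (- a) = inverse p"
    using unif[OF P] P by (auto simp: p_def ord_powi power_int_minus)
  have "g * p \<in> ge P 0" using g p P by (simp add: ge_mult_iff g_def)
  then obtain d where d: "\<forall>i<deg P. d i \<in> K" "g * p - (\<Sum>i<deg P. d i * res_basis P i) \<in> ge P 1"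
    using res_basis(2)[OF P] by blast
  define c' where "c' = c(a := d)"
  have "{a - 1<..b} = insert a {a<..b}" using step by auto
  then have "(\<Sum>j\<in>{a-1<..b}. \<Sum>i<deg P. c' j i * loc P j i)
     = (\<Sum>i<deg P. d i * loc P a i) + (\<Sum>j\<in>{a<..b}. \<Sum>i<deg P. c j i * loc P j i)"
    by (simp add: c'_def)
  then have "f - (\<Sum>j\<in>{a-1<..b}. \<Sum>i<deg P. c' j i * loc P j i) = g - (\<Sum>i<deg P. d i * loc P a i)"
    by (simp add: g_def)
  also have "\<dots> = (g * p - (\<Sum>i<deg P. d i * res_basis P i)) * inverse p"
    using p by (simp add: loc_comb left_diff_distrib)
  also have "\<dots> \<in> ge P (- (a - 1))"
    using d p P by (simp add: ge_mult_iff ord_inverse)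
  finally show ?case using c d(1) by (intro exI[of _ c']) (auto simp: c'_def)
qed

text \<open>Modulo \<open>ge P (- a)\<close> the lowest level disappears, so the induction
  hypothesis annihilates all higher levels. What remains is a relation in the residue basis.\<close>

lemma local_indep:
  assumes P: "P \<in> Pts" and "a \<le> b" and c: "\<And>j i. j \<in> {a<..b} \<Longrightarrow> i < deg P \<Longrightarrow> c j i \<in> K"
    and f: "(\<Sum>j\<in>{a<..b}. \<Sum>i<deg P. c j i * loc P j i) \<in> ge P (- a)"
  shows "\<forall>j\<in>{a<..b}. \<forall>i<deg P. c j i = 0"
  using \<open>a \<le> b\<close> c f
proof (induction a rule: int_le_induct)
  case base
  then show ?case by simp
next
  case (step a)
  define s where "s = (\<Sum>j\<in>{a<..b}. \<Sum>i<deg P. c j i * loc P j i)"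
  define t where "t = (\<Sum>i<deg P. c a i * loc P a i)"
  have set: "{a - 1<..b} = insert a {a<..b}" using step by auto
  have cK: "c j i \<in> K" if "j = a \<or> j \<in> {a<..b}" "i < deg P" for j i
    using step.prems(1)[of j i] that set by auto
  have ts: "t + s \<in> ge P (- (a - 1))" using step.prems(2) unfolding set by (simp add: s_def t_def)
  have "t \<in> ge P (- a)" unfolding t_def by (intro ge_sum ge_smult loc_ge) (use cK P in auto)
  then have "(t + s) - t \<in> ge P (- a)"
    using ts ge_mono[of "t + s" P "- (a - 1)" "- a"] P by (intro ge_diff) auto
  then have "s \<in> ge P (- a)" by simp
  then have IH: "\<forall>j\<in>{a<..b}. \<forall>i<deg P. c j i = 0"
    using step.IH cK unfolding s_def by blast
  then have "s = 0" unfolding s_def by (intro sum.neutral ballI) simp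
  define p where "p = unif P powi a"
  have p: "p \<noteq> 0" "ord P p = a" "unif P powi (- a) = inverse p"
    using unif[OF P] P by (auto simp: p_def ord_powi power_int_minus)
  have "(\<Sum>i<deg P. c a i * res_basis P i) * inverse p \<in> ge P (- (a - 1))"
    using ts \<open>s = 0\<close> unfolding t_def loc_comb p(3) by (simp add: mult.commute)
  then have "(\<Sum>i<deg P. c a i * res_basis P i) \<in> ge P 1"
    using p P by (simp add: ge_mult_iff ord_inverse)
  then have "\<forall>i<deg P. c a i = 0" using res_basis(3)[OF P] cK by blast
  then show ?case using IH set by auto
qed

end

section \<open>Divisors, their degrees, and adeles bounded by a divisor\<close>

context places
begin

definition fin :: "('p \<Rightarrow> int) \<Rightarrow> bool" where "fin D \<longleftrightarrow> finite {P \<in> Pts. D P \<noteq> 0}"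

definition degD :: "('p \<Rightarrow> int) \<Rightarrow> int" where "degD D = (\<Sum>P\<in>{P \<in> Pts. D P \<noteq> 0}. D P * int (deg P))"

lemma degD_eq: "finite S \<Longrightarrow> S \<subseteq> Pts \<Longrightarrow> {P \<in> Pts. D P \<noteq> 0} \<subseteq> S \<Longrightarrow> degD D = (\<Sum>P\<in>S. D P * int (deg P))"
  unfolding degD_def by (rule sum.mono_neutral_left) auto

lemma fin_0 [simp]: "fin (\<lambda>_. 0)" by (simp add: fin_def)

lemma fin_if:
  assumes "fin D" "fin E" and G: "\<And>P. P \<in> Pts \<Longrightarrow> D P = 0 \<Longrightarrow> E P = 0 \<Longrightarrow> G P = 0"
  shows "fin G"
proof -
  have "{P \<in> Pts. G P \<noteq> 0} \<subseteq> {P \<in> Pts. D P \<noteq> 0} \<union> {P \<in> Pts. E P \<noteq> 0}" using G by blast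
  then show ?thesis using assms(1,2) finite_subset unfolding fin_def by (metis (lifting) finite_UnI)
qed

lemma fin_add [simp]: "fin D \<Longrightarrow> fin E \<Longrightarrow> fin (\<lambda>P. D P + E P)"
  by (rule fin_if[of D E]) simp_all

lemma fin_diff [simp]: "fin D \<Longrightarrow> fin E \<Longrightarrow> fin (\<lambda>P. D P - E P)"
  by (rule fin_if[of D E]) simp_all

lemma fin_uminus [simp]: "fin D \<Longrightarrow> fin (\<lambda>P. - D P)"
  by (rule fin_if[of D D]) simp_all

lemma fin_scale [simp]: "fin D \<Longrightarrow> fin (\<lambda>P. c * D P)"
  by (rule fin_if[of D D]) simp_all

lemma fin_single [simp]: "fin (\<lambda>P. if P = R then n else 0)"
  unfolding fin_def by (rule finite_subset[of _ "{R}"]) auto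

lemma fin_ord [simp]: "f \<noteq> 0 \<Longrightarrow> fin (\<lambda>P. ord P f)"
  unfolding fin_def by (rule finite_support)

lemma fin_max [simp]: "fin D \<Longrightarrow> fin E \<Longrightarrow> fin (\<lambda>P. max (D P) (E P))"
  by (rule fin_if[of D E]) simp_all

lemma fin_sum [simp]: "(\<And>j. j \<in> J \<Longrightarrow> fin (D j)) \<Longrightarrow> fin (\<lambda>P. \<Sum>j\<in>J. D j P)"
  by (induction J rule: infinite_finite_induct) auto

lemma degD_add: assumes "fin D" "fin E" shows "degD (\<lambda>P. D P + E P) = degD D + degD E"
proof -
  let ?S = "{P \<in> Pts. D P \<noteq> 0} \<union> {P \<in> Pts. E P \<noteq> 0}"
  have fin: "finite ?S" using assms by (simp add: fin_def)
  have "degD (\<lambda>P. D P + E P) = (\<Sum>P\<in>?S. (D P + E P) * int (deg P))" by (rule degD_eq[OF fin]) auto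
  moreover have "degD D = (\<Sum>P\<in>?S. D P * int (deg P))" by (rule degD_eq[OF fin]) auto
  moreover have "degD E = (\<Sum>P\<in>?S. E P * int (deg P))" by (rule degD_eq[OF fin]) auto
  ultimately show ?thesis by (simp add: distrib_right sum.distrib)
qed

lemma degD_uminus: "degD (\<lambda>P. - D P) = - degD D"
  by (simp add: degD_def sum_negf)

lemma degD_diff: assumes "fin D" "fin E" shows "degD (\<lambda>P. D P - E P) = degD D - degD E"
  using degD_add[of D "\<lambda>P. - E P"] assms by (simp add: degD_uminus)

lemma degD_scale: assumes "fin D" shows "degD (\<lambda>P. c * D P) = c * degD D"
proof -
  have "degD (\<lambda>P. c * D P) = (\<Sum>P\<in>{P \<in> Pts. D P \<noteq> 0}. c * D P * int (deg P))"
    by (rule degD_eq[OF assms[unfolded fin_def]]) auto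
  then show ?thesis by (simp add: degD_def sum_distrib_left mult_ac)
qed

lemma degD_single: assumes "R \<in> Pts" shows "degD (\<lambda>P. if P = R then n else 0) = n * int (deg R)"
proof -
  have "degD (\<lambda>P. if P = R then n else 0) = (\<Sum>P\<in>{R}. (if P = R then n else 0) * int (deg P))"
    by (rule degD_eq) (use assms in auto)
  then show ?thesis by simp
qed

lemma degD_0 [simp]: "degD (\<lambda>_. 0) = 0" by (simp add: degD_def)

lemma degD_cong: assumes "\<And>P. P \<in> Pts \<Longrightarrow> D P = E P" shows "degD D = degD E"
proof -
  have "{P \<in> Pts. D P \<noteq> 0} = {P \<in> Pts. E P \<noteq> 0}" using assms by auto
  then show ?thesis unfolding degD_def using assms by (intro sum.cong) auto
qed

lemma degD_nonneg: "(\<And>P. P \<in> Pts \<Longrightarrow> 0 \<le> D P) \<Longrightarrow> 0 \<le> degD D"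
  unfolding degD_def by (intro sum_nonneg) auto

lemma degD_mono:
  assumes "fin D" "fin E" "\<And>P. P \<in> Pts \<Longrightarrow> D P \<le> E P" shows "degD D \<le> degD E"
  using degD_nonneg[of "\<lambda>P. E P - D P"] degD_diff[of E D] assms by simp

lemma degD_ge_term:
  assumes "fin D" "\<And>P. P \<in> Pts \<Longrightarrow> 0 \<le> D P" "R \<in> Pts"
  shows "D R * int (deg R) \<le> degD D"
proof -
  have "degD (\<lambda>P. if P = R then D R else 0) \<le> degD D"
    using assms by (intro degD_mono) auto
  then show ?thesis using degD_single[OF assms(3)] by simp
qed

definition adele :: "('p \<Rightarrow> int) \<Rightarrow> ('p \<Rightarrow> 'f) set"
  where "adele D = {s. \<forall>P\<in>Pts. s P \<in> ge P (- D P)}"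

definition L :: "('p \<Rightarrow> int) \<Rightarrow> 'f set"
  where "L D = {f. \<forall>P\<in>Pts. f \<in> ge P (- D P)}"

text \<open>Indexes a basis of \<open>adele D'\<close> modulo \<open>adele D\<close>: a place, a
  pole order that \<open>D'\<close> allows and \<open>D\<close> forbids, and a residue basis vector.
  Places where the divisors agree are removed so that the index set is visibly finite.\<close>

definition Idx :: "('p \<Rightarrow> int) \<Rightarrow> ('p \<Rightarrow> int) \<Rightarrow> ('p \<times> int \<times> nat) set"
  where "Idx D' D = (SIGMA P:{P\<in>Pts. D P \<noteq> D' P}. {D P<..D' P} \<times> {..<deg P})"

definition efun :: "'p \<times> int \<times> nat \<Rightarrow> 'p \<Rightarrow> 'f"
  where "efun \<iota> R = (case \<iota> of (P, j, i) \<Rightarrow> if R = P then loc P j i else 0)"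

lemma subsp_adele: "subsp (adele D)"
  by (auto simp: subsp_def adele_def intro: ge_add ge_smult)

lemma finite_neq: "fin D \<Longrightarrow> fin D' \<Longrightarrow> finite {P\<in>Pts. D P \<noteq> D' P}"
  using fin_diff[of D D'] by (simp add: fin_def)

lemma finite_Idx: "fin D \<Longrightarrow> fin D' \<Longrightarrow> finite (Idx D' D)"
  unfolding Idx_def by (intro finite_SigmaI finite_neq) simp_all

text \<open>Each unit of \<open>D' P - D P\<close> contributes \<open>deg P\<close> basis vectors,
  so the dimension of the quotient of adele spaces is a difference of degrees. All later dimension
  counts rest on this.\<close>

lemma card_Idx:
  assumes "fin D" "fin D'" "\<And>P. P \<in> Pts \<Longrightarrow> D P \<le> D' P"
  shows "int (card (Idx D' D)) = degD D' - degD D"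
proof -
  have "card (Idx D' D) = (\<Sum>P\<in>{P\<in>Pts. D P \<noteq> D' P}. nat (D' P - D P) * deg P)"
    unfolding Idx_def using finite_neq[OF assms(1,2)] by (subst card_SigmaI) (simp_all add: card_cartesian_product)
  also have "int \<dots> = (\<Sum>P\<in>{P\<in>Pts. D P \<noteq> D' P}. (D' P - D P) * int (deg P))"
    unfolding of_nat_sum using assms(3) by (intro sum.cong) auto
  also have "\<dots> = degD (\<lambda>P. D' P - D P)"
    by (rule degD_eq[OF finite_neq[OF assms(1,2)], symmetric]) auto
  finally show ?thesis using assms by (simp add: degD_diff)
qed

lemma efun_comb:
  assumes fin: "fin D" "fin D'" and R: "R \<in> Pts"
  shows "(\<Sum>\<iota>\<in>Idx D' D. a \<iota> * efun \<iota> R) =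
    (\<Sum>j\<in>{D R<..D' R}. \<Sum>i<deg R. a (R, j, i) * loc R j i)"
proof -
  let ?S = "{P\<in>Pts. D P \<noteq> D' P}"
  let ?T = "\<lambda>P. {D P<..D' P} \<times> {..<deg P}"
  have S: "finite ?S" using finite_neq[OF fin] .
  have "(\<Sum>\<iota>\<in>Idx D' D. a \<iota> * efun \<iota> R) = (\<Sum>P\<in>?S. \<Sum>ji\<in>?T P. a (P, ji) * efun (P, ji) R)"
    unfolding Idx_def using S by (subst sum.Sigma) (simp_all add: case_prod_unfold)
  also have "\<dots> = (\<Sum>P\<in>?S. if P = R then (\<Sum>ji\<in>?T R. a (R, ji) * efun (R, ji) R) else 0)"
    by (intro sum.cong) (auto simp: efun_def)
  also have "\<dots> = (if R \<in> ?S then (\<Sum>ji\<in>?T R. a (R, ji) * efun (R, ji) R) else 0)"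
    using S by simp
  also have "\<dots> = (\<Sum>ji\<in>?T R. a (R, ji) * efun (R, ji) R)" using R by auto
  also have "\<dots> = (\<Sum>j\<in>{D R<..D' R}. \<Sum>i<deg R. a (R, j, i) * loc R j i)"
    by (simp add: sum.cartesian_product efun_def case_prod_unfold)
  finally show ?thesis .
qed

lemma adele_spanned:
  assumes fin: "fin D" "fin D'" and le: "\<And>P. P \<in> Pts \<Longrightarrow> D P \<le> D' P"
  shows "spanned (adele D) (Idx D' D) efun (adele D')"
  unfolding spanned_def
proof
  fix s assume s: "s \<in> adele D'"
  have "\<forall>P\<in>Pts. \<exists>c. (\<forall>j i. i < deg P \<longrightarrow> c j i \<in> K) \<and>
      s P - (\<Sum>j\<in>{D P<..D' P}. \<Sum>i<deg P. c j i * loc P j i) \<in> ge P (- D P)"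
    using s le by (intro ballI local_span) (auto simp: adele_def)
  from bchoice[OF this] obtain c where c: "\<forall>P\<in>Pts. (\<forall>j i. i < deg P \<longrightarrow> c P j i \<in> K) \<and>
      s P - (\<Sum>j\<in>{D P<..D' P}. \<Sum>i<deg P. c P j i * loc P j i) \<in> ge P (- D P)" ..
  define a where "a = (\<lambda>(P, j, i). c P j i)"
  have "\<forall>\<iota>\<in>Idx D' D. a \<iota> \<in> K" using c by (auto simp: a_def Idx_def)
  moreover have "(\<lambda>R. s R - (\<Sum>\<iota>\<in>Idx D' D. a \<iota> * efun \<iota> R)) \<in> adele D"
    unfolding adele_def using c by (simp add: efun_comb[OF fin] a_def)
  ultimately show "\<exists>a. (\<forall>\<iota>\<in>Idx D' D. a \<iota> \<in> K) \<and> (\<lambda>R. s R - (\<Sum>\<iota>\<in>Idx D' D. a \<iota> * efun \<iota> R)) \<in> adele D"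
    by blast
qed

lemma adele_indep:
  assumes fin: "fin D" "fin D'" and le: "\<And>P. P \<in> Pts \<Longrightarrow> D P \<le> D' P"
  shows "indep (adele D) (Idx D' D) efun"
  unfolding indep_def
proof (intro allI impI ballI, elim conjE)
  fix a \<iota> assume a: "\<forall>\<iota>\<in>Idx D' D. a \<iota> \<in> K" "(\<lambda>R. \<Sum>\<iota>\<in>Idx D' D. a \<iota> * efun \<iota> R) \<in> adele D"
    and \<iota>: "\<iota> \<in> Idx D' D"
  obtain R j i where R: "\<iota> = (R, j, i)" "R \<in> Pts" "j \<in> {D R<..D' R}" "i < deg R"
    using \<iota> by (auto simp: Idx_def)
  have "\<forall>j\<in>{D R<..D' R}. \<forall>i<deg R. a (R, j, i) = 0"
  proof (rule local_indep[OF R(2) le[OF R(2)]])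
    show "a (R, j, i) \<in> K" if "j \<in> {D R<..D' R}" "i < deg R" for j i
      using a(1) that R(2) by (auto simp: Idx_def)
    show "(\<Sum>j\<in>{D R<..D' R}. \<Sum>i<deg R. a (R, j, i) * loc R j i) \<in> ge R (- D R)"
      using a(2) R(2) unfolding adele_def mem_Collect_eq efun_comb[OF fin R(2), of a, symmetric] by blast
  qed
  then show "a \<iota> = 0" using R by blast
qed

lemma efun_adele: assumes "\<iota> \<in> Idx D' D" shows "efun \<iota> \<in> adele D'"
  using assms by (auto simp: adele_def efun_def Idx_def intro!: ge_mono[OF loc_ge])

lemma L_0 [simp]: "0 \<in> L D" by (simp add: L_def)

lemma L_mono: "f \<in> L D \<Longrightarrow> (\<And>P. P \<in> Pts \<Longrightarrow> D P \<le> E P) \<Longrightarrow> f \<in> L E"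
  unfolding L_def by (auto intro: ge_mono)

lemma L_smult: "c \<in> K \<Longrightarrow> f \<in> L D \<Longrightarrow> c * f \<in> L D"
  unfolding L_def by (auto intro: ge_smult)

lemma L_diff: "f \<in> L D \<Longrightarrow> g \<in> L D \<Longrightarrow> f - g \<in> L D"
  unfolding L_def by (auto intro: ge_diff)

lemma L_sum: "(\<And>j. j \<in> J \<Longrightarrow> f j \<in> L D) \<Longrightarrow> sum f J \<in> L D"
  unfolding L_def by (auto intro: ge_sum)

lemma L_mult: "f \<in> L D \<Longrightarrow> g \<in> L E \<Longrightarrow> f * g \<in> L (\<lambda>P. D P + E P)"
  unfolding L_def by (auto intro: ge_mult')

lemma L_iff: "f \<noteq> 0 \<Longrightarrow> f \<in> L D \<longleftrightarrow> (\<forall>P\<in>Pts. - D P \<le> ord P f)"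
  by (auto simp: L_def ge_iff)

lemma L_const_iff: "(\<lambda>_. f) \<in> adele D \<longleftrightarrow> f \<in> L D" by (simp add: L_def adele_def)

text \<open>Such a function has no poles and is therefore constant, and a nonzero constant has no
  zero at \<open>R\<close>.\<close>

lemma L_negative:
  assumes "\<And>P. P \<in> Pts \<Longrightarrow> D P \<le> 0" "R \<in> Pts" "D R < 0" "f \<in> L D" shows "f = 0"
proof (rule ccontr)
  assume f: "f \<noteq> 0"
  have "0 \<le> ord P f" if "P \<in> Pts" for P using assms(1,4) f that by (fastforce simp: L_iff)
  then have "f \<in> K" using f global_constant by blast
  then have "ord R f = 0" using ord_K[OF assms(2)] f by blast
  then show False using assms(2-4) f by (auto simp: L_iff)
qed

text \<open>When \<open>L E\<close> is zero, the diagonal embedding is injective from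
  \<open>L D\<close> to \<open>adele D\<close> modulo \<open>adele E\<close>, whose dimension is
  known.\<close>

lemma L_card_bound:
  assumes J: "finite J" and w: "\<And>j. j \<in> J \<Longrightarrow> w j \<in> L D" "lin_indep J w"
    and E: "fin E" "fin D" "\<And>P. P \<in> Pts \<Longrightarrow> E P \<le> D P" "L E \<subseteq> {0}"
  shows "int (card J) \<le> degD D - degD E"
proof -
  have "card J \<le> card (Idx D E)"
  proof (rule indep_card_le[OF subsp_adele finite_Idx J adele_spanned])
    show "(\<lambda>_. w j) \<in> adele D" if "j \<in> J" for j using w(1)[OF that] by (simp add: L_const_iff)
    show "indep (adele E) J (\<lambda>j _. w j)"
      unfolding indep_def L_const_iff using E(4) w(2) unfolding lin_indep_def by blast
  qed (use E in auto)
  then show ?thesis using card_Idx[of E D] E by simp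
qed

subsection \<open>The degree of a principal divisor\<close>

definition zeros :: "'f \<Rightarrow> 'p \<Rightarrow> int" where "zeros x P = max 0 (ord P x)"

definition poles :: "'f \<Rightarrow> 'p \<Rightarrow> int" where "poles x P = (if x = 0 then 0 else max 0 (- ord P x))"

lemma fin_zeros [simp]: "x \<noteq> 0 \<Longrightarrow> fin (zeros x)"
  unfolding zeros_def[abs_def] by (intro fin_max) auto

lemma fin_poles [simp]: "fin (poles x)"
  unfolding poles_def[abs_def] by (cases "x = 0") (auto intro!: fin_max)

lemma poles_nonneg [simp]: "0 \<le> poles x P" by (simp add: poles_def)

lemma L_poles: "x \<in> L (poles x)" by (cases "x = 0") (auto simp: L_def poles_def ge_iff)

lemma L_power: "x \<in> L D \<Longrightarrow> x ^ n \<in> L (\<lambda>P. int n * D P)"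
proof (induction n)
  case 0
  then show ?case using ge_K by (simp add: L_def)
next
  case (Suc n)
  then show ?case using L_mult[of x D "x ^ n" "\<lambda>P. int n * D P"] by (simp add: algebra_simps)
qed

text \<open>In field-theoretic terms this is the bound of \<open>[F : K(x)]\<close> from below by
  the degree of the zero divisor of \<open>x\<close>. The \<open>z \<iota>\<close> lift a basis of
  the integral adeles modulo the zeros of \<open>x\<close>; a relation between the
  \<open>x ^ l * z \<iota>\<close>, divided by its lowest power of \<open>x\<close>, would become a
  relation in that basis.\<close>

lemma growth_family:
  assumes x: "x \<noteq> 0"
  shows "\<exists>(I :: ('p \<times> int \<times> nat) set) z. finite I \<and> int (card I) = degD (zeros x) \<and>
    (\<forall>m. lin_indep ({..m} \<times> I) (\<lambda>(l::nat, \<iota>). x ^ l * z \<iota>))"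
proof -
  let ?D = "\<lambda>P. - zeros x P"
  define I where "I = Idx (\<lambda>_. 0) ?D"
  have fD: "fin ?D" using x by simp
  have le: "?D P \<le> 0" for P by (simp add: zeros_def)
  have I: "finite I" "int (card I) = degD (zeros x)"
    unfolding I_def using finite_Idx[OF fD] card_Idx[OF fD] le by (simp_all add: degD_uminus)
  define S where "S = {P \<in> Pts. zeros x P \<noteq> 0}"
  have S: "finite S" "S \<subseteq> Pts" using fin_zeros[OF x] by (auto simp: S_def fin_def)
  \<comment> \<open>With this precision \<open>z \<iota>\<close> agrees with
    \<open>efun \<iota>\<close> to the order of \<open>x\<close> at every zero of
    \<open>x\<close>.\<close>
  define n where "n = (\<Sum>P\<in>S. \<bar>ord P x\<bar>)"
  have n: "ord P x \<le> n" if "P \<in> S" for P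
    using member_le_sum[of P S "\<lambda>P. \<bar>ord P x\<bar>"] that S by (auto simp: n_def)
  have "\<forall>\<iota>. \<exists>f. \<forall>R\<in>S. f - efun \<iota> R \<in> ge R n"
    using weak_approximation[OF S] by blast
  from choice[OF this] obtain z where z: "\<forall>\<iota>. \<forall>R\<in>S. z \<iota> - efun \<iota> R \<in> ge R n" ..
  have zx: "z \<iota> - efun \<iota> R \<in> ge R (ord R x)" if "R \<in> S" for \<iota> R
    using z that n[OF that] ge_mono by blast
  have pos: "ord R x \<ge> 0" if "R \<in> S" for R using that by (auto simp: S_def zeros_def)
  have e0: "efun \<iota> R \<in> ge R 0" if "\<iota> \<in> I" "R \<in> Pts" for \<iota> R
    using efun_adele[of \<iota> "\<lambda>_. 0" ?D] that by (auto simp: I_def adele_def)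
  have z0: "z \<iota> \<in> ge R 0" if "\<iota> \<in> I" "R \<in> S" for \<iota> R
    using ge_add[of R "efun \<iota> R" 0 "z \<iota> - efun \<iota> R"] e0[OF that(1)] zx[OF that(2), of \<iota>]
      ge_mono[OF _ pos[OF that(2)]] that S by auto
  have "lin_indep ({..m} \<times> I) (\<lambda>(l::nat, \<iota>). x ^ l * z \<iota>)" for m
    unfolding lin_indep_def
  proof (intro allI impI ballI, elim conjE, rule ccontr)
    fix a p assume aK: "\<forall>j\<in>{..m} \<times> I. a j \<in> K"
      and sum0: "(\<Sum>j\<in>{..m} \<times> I. a j * (case j of (l, \<iota>) \<Rightarrow> x ^ l * z \<iota>)) = 0"
      and p: "p \<in> {..m} \<times> I" "a p \<noteq> 0"
    define nz where "nz l \<longleftrightarrow> l \<le> m \<and> (\<exists>\<iota>\<in>I. a (l, \<iota>) \<noteq> 0)" for l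
    have "nz (fst p)" using p by (cases p) (auto simp: nz_def)
    define l0 where "l0 = (LEAST l. nz l)"
    have l0: "nz l0" "\<And>l. l < l0 \<Longrightarrow> \<not> nz l"
      using LeastI[of nz, OF \<open>nz (fst p)\<close>] not_less_Least[of _ nz] unfolding l0_def by blast+
    define s where "s l = (\<Sum>\<iota>\<in>I. a (l, \<iota>) * z \<iota>)" for l
    have "(\<Sum>l\<le>m. x ^ l * s l) = (\<Sum>l\<le>m. \<Sum>\<iota>\<in>I. a (l, \<iota>) * (x ^ l * z \<iota>))"
      unfolding s_def sum_distrib_left by (intro sum.cong refl) (simp add: mult_ac)
    also have "\<dots> = (\<Sum>j\<in>{..m} \<times> I. a j * (case j of (l, \<iota>) \<Rightarrow> x ^ l * z \<iota>))"
      unfolding sum.cartesian_product by (intro sum.cong refl) auto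
    finally have "(\<Sum>l\<le>m. x ^ l * s l) = 0" using sum0 by simp
    also have "(\<Sum>l\<le>m. x ^ l * s l) = (\<Sum>l\<in>{l0..m}. x ^ l * s l)"
    proof (rule sum.mono_neutral_right)
      show "\<forall>l\<in>{..m} - {l0..m}. x ^ l * s l = 0"
        using l0(2) by (auto simp: nz_def s_def intro!: sum.neutral)
    qed auto
    also have "\<dots> = x ^ l0 * (\<Sum>l\<in>{l0..m}. x ^ (l - l0) * s l)"
      unfolding sum_distrib_left
      by (intro sum.cong) (auto simp: power_add[symmetric] mult.assoc[symmetric])
    finally have eq: "(\<Sum>l\<in>{l0..m}. x ^ (l - l0) * s l) = 0" using x by simp
    have "l0 \<le> m" using l0(1) by (simp add: nz_def)
    then have "{l0..m} = insert l0 {Suc l0..m}" by auto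
    \<comment> \<open>The lowest nonzero coefficient \<open>s l0\<close> is a multiple of
      \<open>x\<close> by functions integral at the zeros of \<open>x\<close>.\<close>
    then have s0: "s l0 = - (\<Sum>l\<in>{Suc l0..m}. x ^ (l - l0) * s l)"
      using eq by (simp add: eq_neg_iff_add_eq_0)
    have aK': "a (l, \<iota>) \<in> K" if "l \<le> m" "\<iota> \<in> I" for l \<iota> using aK that by auto
    have "(\<lambda>R. \<Sum>\<iota>\<in>I. a (l0, \<iota>) * efun \<iota> R) \<in> adele ?D"
      unfolding adele_def
    proof (intro CollectI ballI)
      fix R assume R: "R \<in> Pts"
      show "(\<Sum>\<iota>\<in>I. a (l0, \<iota>) * efun \<iota> R) \<in> ge R (- (- zeros x R))"
      proof (cases "R \<in> S")
        case True
        have "x ^ (l - l0) * s l \<in> ge R (ord R x)" if "l \<in> {Suc l0..m}" for l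
        proof -
          have "1 * ord R x \<le> int (l - l0) * ord R x"
            by (rule mult_right_mono) (use that pos True in auto)
          then have "x ^ (l - l0) \<in> ge R (ord R x)" using R x by (simp add: ge_iff ord_power)
          moreover have "s l \<in> ge R 0" unfolding s_def
            by (intro ge_sum ge_smult z0 aK') (use R True that in auto)
          ultimately show ?thesis using ge_mult'[of R] R by fastforce
        qed
        then have "s l0 \<in> ge R (ord R x)" unfolding s0 by (intro ge_uminus ge_sum R) 
        moreover have "(\<Sum>\<iota>\<in>I. a (l0, \<iota>) * (z \<iota> - efun \<iota> R)) \<in> ge R (ord R x)"
          by (intro ge_sum ge_smult zx aK') (use R True \<open>l0 \<le> m\<close> in auto)
        ultimately have "s l0 - (\<Sum>\<iota>\<in>I. a (l0, \<iota>) * (z \<iota> - efun \<iota> R)) \<in> ge R (ord R x)"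
          using R by (intro ge_diff)
        then show ?thesis using pos[OF True]
          by (simp add: s_def right_diff_distrib sum_subtractf zeros_def)
      next
        case False
        then have "zeros x R = 0" using R by (simp add: S_def)
        then show ?thesis using R \<open>l0 \<le> m\<close> by (auto intro!: ge_sum ge_smult e0 aK')
      qed
    qed
    moreover have "indep (adele ?D) I efun"
      unfolding I_def by (rule adele_indep[OF fD fin_0 le])
    ultimately have "\<forall>\<iota>\<in>I. a (l0, \<iota>) = 0"
      unfolding indep_def using aK' \<open>l0 \<le> m\<close> by (elim allE[of _ "\<lambda>\<iota>. a (l0, \<iota>)"]) simp
    then show False using l0(1) by (simp add: nz_def)
  qed
  then show ?thesis using I by blast
qed

text \<open>One divisor \<open>C\<close>, independent of \<open>m\<close>, absorbs the poles of the
  finitely many \<open>z \<iota>\<close>. Hence \<open>dim L (m * poles x + C)\<close> grows at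
  least like \<open>m\<close> times the degree of \<open>zeros x\<close>.\<close>

lemma growth_family_L:
  assumes x: "x \<noteq> 0"
  shows "\<exists>(I :: ('p \<times> int \<times> nat) set) z C. finite I \<and> int (card I) = degD (zeros x) \<and>
    fin C \<and> (\<forall>P. 0 \<le> C P) \<and>
    (\<forall>m. lin_indep ({..m} \<times> I) (\<lambda>(l::nat, \<iota>). x ^ l * z \<iota>)) \<and>
    (\<forall>m. \<forall>(l, \<iota>)\<in>{..m} \<times> I. x ^ l * z \<iota> \<in> L (\<lambda>P. int m * poles x P + C P))"
proof -
  obtain I :: "('p \<times> int \<times> nat) set" and z where I: "finite I" "int (card I) = degD (zeros x)"
    "\<forall>m. lin_indep ({..m} \<times> I) (\<lambda>(l::nat, \<iota>). x ^ l * z \<iota>)"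
    using growth_family[OF x] by blast
  define C where "C = (\<lambda>P. \<Sum>\<iota>\<in>I. poles (z \<iota>) P)"
  have C: "fin C" "\<And>P. 0 \<le> C P" unfolding C_def by (auto intro: sum_nonneg)
  have "x ^ l * z \<iota> \<in> L (\<lambda>P. int m * poles x P + C P)" if "l \<le> m" "\<iota> \<in> I" for l m \<iota>
  proof (rule L_mono[OF L_mult[OF L_power[OF L_poles] L_poles]])
    fix P
    have "poles (z \<iota>) P \<le> C P" unfolding C_def
      by (rule member_le_sum[of \<iota> I "\<lambda>\<iota>. poles (z \<iota>) P"]) (use that I in auto)
    moreover have "int l * poles x P \<le> int m * poles x P" using that by (intro mult_right_mono) auto
    ultimately show "int l * poles x P + poles (z \<iota>) P \<le> int m * poles x P + C P" by simp
  qed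
  then show ?thesis using I C by (intro exI[of _ I] exI[of _ z] exI[of _ C]) auto
qed

text \<open>The dimension of \<open>L (m * poles x + C)\<close> grows at most like \<open>m\<close>
  times the degree of \<open>poles x\<close>; comparison with the growth from below gives the
  inequality.\<close>

lemma degD_zeros_le_poles:
  assumes x: "x \<noteq> 0"
  shows "degD (zeros x) \<le> degD (poles x)"
proof (rule ccontr)
  assume less: "\<not> ?thesis"
  obtain I :: "('p \<times> int \<times> nat) set" and z C where I: "finite I" "int (card I) = degD (zeros x)"
    and C: "fin C" "\<forall>P. 0 \<le> C P"
    and z: "\<forall>m. lin_indep ({..m} \<times> I) (\<lambda>(l::nat, \<iota>). x ^ l * z \<iota>)"
      "\<forall>m. \<forall>(l, \<iota>)\<in>{..m} \<times> I. x ^ l * z \<iota> \<in> L (\<lambda>P. int m * poles x P + C P)"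
    using growth_family_L[OF x] by blast
  let ?E = "\<lambda>P. if P = Q then - 1 else 0 :: int"
  \<comment> \<open>The constant error in the comparison is \<open>degD C + deg Q\<close>; taking
    \<open>m\<close> equal to it turns the estimate into
    \<open>(m + 1) * degD (zeros x) \<le> m * (degD (poles x) + 1)\<close>, which already
    contradicts a strict excess of zeros.\<close>
  define m where "m = nat (degD C + int (deg Q))"
  have m: "int m = degD C + int (deg Q)" unfolding m_def using degD_nonneg[of C] C by simp
  have Dm: "0 \<le> int m * poles x P + C P" for P using C(2) by (simp add: add_nonneg_nonneg)
  have le: "?E P \<le> int m * poles x P + C P" for P using Dm[of P] by (cases "P = Q") simp_all
  have E0: "L ?E \<subseteq> {0}" using L_negative[of ?E Q] Q by auto
  have "int (card ({..m} \<times> I)) \<le> degD (\<lambda>P. int m * poles x P + C P) - degD ?E"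
  proof (rule L_card_bound)
    show "(case j of (l, \<iota>) \<Rightarrow> x ^ l * z \<iota>) \<in> L (\<lambda>P. int m * poles x P + C P)" if "j \<in> {..m} \<times> I" for j
      using z(2) that by fastforce
  qed (use I C z E0 le in simp_all)
  also have "\<dots> = int m * degD (poles x) + degD C + int (deg Q)"
    using C Q by (simp add: degD_add degD_scale degD_single)
  finally have "(int m + 1) * degD (zeros x) \<le> int m * degD (poles x) + int m"
    using m I by (simp add: card_cartesian_product algebra_simps)
  also have "\<dots> = int m * (degD (poles x) + 1)" by (simp add: algebra_simps)
  also have "\<dots> \<le> int m * degD (zeros x)" using less by (intro mult_left_mono) auto
  finally have "degD (zeros x) \<le> 0" by (simp add: algebra_simps)
  moreover have "0 \<le> degD (poles x)" by (rule degD_nonneg) simp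
  ultimately show False using less by simp
qed

lemma degD_zeros_eq_poles:
  assumes x: "x \<noteq> 0" shows "degD (zeros x) = degD (poles x)"
proof -
  have "degD (zeros (inverse x)) = degD (poles x)" "degD (poles (inverse x)) = degD (zeros x)"
    using x by (auto intro!: degD_cong simp: zeros_def poles_def ord_inverse)
  then show ?thesis
    using degD_zeros_le_poles[OF x] degD_zeros_le_poles[of "inverse x"] x by simp
qed

theorem degD_principal:
  assumes x: "x \<noteq> 0" shows "degD (\<lambda>P. ord P x) = 0"
proof -
  have "degD (\<lambda>P. ord P x) = degD (\<lambda>P. zeros x P - poles x P)"
    using x by (intro degD_cong) (auto simp: zeros_def poles_def)
  then show ?thesis using x degD_zeros_eq_poles[OF x] by (simp add: degD_diff)
qed

lemma L_degD_nonneg: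
  assumes "f \<noteq> 0" "f \<in> L D" "fin D" shows "0 \<le> degD D"
  using degD_nonneg[of "\<lambda>P. ord P f + D P"] assms degD_add[of "\<lambda>P. ord P f" D] degD_principal[of f]
  by (fastforce simp: L_iff)

end

context subfield_set
begin

lemma indepD:
  "indep W J v \<Longrightarrow> (\<And>j. j \<in> J \<Longrightarrow> a j \<in> K) \<Longrightarrow> (\<lambda>x. \<Sum>j\<in>J. a j * v j x) \<in> W \<Longrightarrow> j \<in> J \<Longrightarrow> a j = 0"
  unfolding indep_def by blast

lemma lin_indepD:
  "lin_indep J w \<Longrightarrow> (\<And>j. j \<in> J \<Longrightarrow> a j \<in> K) \<Longrightarrow> (\<Sum>j\<in>J. a j * w j) = 0 \<Longrightarrow> j \<in> J \<Longrightarrow> a j = 0"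
  unfolding lin_indep_def by blast

end

context places
begin

subsection \<open>Finiteness of the first cohomology\<close>

definition adeles :: "('p \<Rightarrow> 'f) set"
  where "adeles = {s. finite {P \<in> Pts. s P \<notin> ge P 0}}"

text \<open>This is \<open>F + A(0)\<close>, diagonal functions plus integral adeles. The quotient
  of \<open>adeles\<close> by it is the adelic form of \<open>H^1\<close> of the structure
  sheaf.\<close>

definition W1 :: "('p \<Rightarrow> 'f) set"
  where "W1 = {s. \<exists>f. \<forall>P\<in>Pts. s P - f \<in> ge P 0}"

lemma subsp_W1: "subsp W1"
  unfolding subsp_def
proof (intro conjI ballI)
  show "(\<lambda>_. 0) \<in> W1" unfolding W1_def by (auto intro: exI[of _ 0])
next
  fix s s' assume "s \<in> W1" "s' \<in> W1"
  then obtain f f' where f: "\<forall>P\<in>Pts. s P - f \<in> ge P 0" "\<forall>P\<in>Pts. s' P - f' \<in> ge P 0"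
    unfolding W1_def by blast
  have "(s P + s' P) - (f + f') \<in> ge P 0" if "P \<in> Pts" for P
    using ge_add[of P "s P - f" 0 "s' P - f'"] f that by (simp add: algebra_simps)
  then show "(\<lambda>P. s P + s' P) \<in> W1" unfolding W1_def by blast
next
  fix c s assume c: "c \<in> K" "s \<in> W1"
  then obtain f where f: "\<forall>P\<in>Pts. s P - f \<in> ge P 0" unfolding W1_def by blast
  have "c * s P - c * f \<in> ge P 0" if "P \<in> Pts" for P
    using ge_smult[of P c "s P - f" 0] f c that by (simp add: algebra_simps)
  then show "(\<lambda>P. c * s P) \<in> W1" unfolding W1_def by blast
qed

lemma adeles_bound:
  assumes J: "finite J" and v: "\<And>j. j \<in> J \<Longrightarrow> v j \<in> adeles"
  shows "\<exists>D. fin D \<and> (\<forall>P. 0 \<le> D P) \<and> (\<forall>j\<in>J. v j \<in> adele D)"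
proof -
  define d where "d j P = (if v j P \<in> ge P 0 then 0 else max 0 (- ord P (v j P)))" for j P
  have "fin (d j)" if "j \<in> J" for j
  proof -
    have "{P \<in> Pts. d j P \<noteq> 0} \<subseteq> {P \<in> Pts. v j P \<notin> ge P 0}" by (auto simp: d_def)
    then show ?thesis using finite_subset v[OF that] unfolding fin_def adeles_def by blast
  qed
  moreover have d0: "0 \<le> d j P" for j P by (simp add: d_def)
  moreover have "v j P \<in> ge P (- (\<Sum>j\<in>J. d j P))" if "j \<in> J" for j P
  proof -
    have "d j P \<le> (\<Sum>j\<in>J. d j P)"
      by (rule member_le_sum[of j J "\<lambda>j. d j P"]) (use that J d0 in auto)
    moreover have "v j P \<in> ge P (- d j P)" by (auto simp: d_def ge_iff)
    ultimately show ?thesis using ge_mono by fastforce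
  qed
  ultimately show ?thesis
    by (intro exI[of _ "\<lambda>P. \<Sum>j\<in>J. d j P"] conjI fin_sum allI sum_nonneg) (simp_all add: adele_def)
qed

text \<open>A nonconstant \<open>x\<close> has a pole, and there the term of highest degree has
  strictly the smallest order. So \<open>x\<close> is transcendental over \<open>K\<close>.\<close>

lemma power_combination_nonzero:
  assumes x: "x \<notin> K" and c: "\<And>l. l \<le> m \<Longrightarrow> c l \<in> K" "l1 \<le> m" "c l1 \<noteq> 0"
  shows "(\<Sum>l\<le>m. c l * x ^ l) \<noteq> 0"
proof
  assume sum0: "(\<Sum>l\<le>m. c l * x ^ l) = 0"
  have x0: "x \<noteq> 0" using x by auto
  obtain P where P: "P \<in> Pts" "ord P x < 0" using global_constant[OF x0] x by force
  define A where "A = {l. l \<le> m \<and> c l \<noteq> 0}"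
  have A: "finite A" "l1 \<in> A" using c by (auto simp: A_def)
  define n where "n = Max A"
  have "n \<in> A" unfolding n_def using Max_in[of A] A by blast
  then have n: "n \<le> m" "c n \<noteq> 0" by (simp_all add: A_def)
  have after: "c l = 0" if "n < l" "l \<le> m" for l
    using Max_ge[of A l] that A(1) unfolding n_def[symmetric] by (auto simp: A_def)
  have "(\<Sum>l\<le>m. c l * x ^ l) = (\<Sum>l\<le>n. c l * x ^ l)"
    by (rule sum.mono_neutral_right) (use n after in auto)
  also have "{..n} = insert n {..<n}" by auto
  finally have "c n * x ^ n + (\<Sum>l<n. c l * x ^ l) = 0" using sum0 by simp
  then have eq: "c n * x ^ n = - (\<Sum>l<n. c l * x ^ l)" by (simp add: eq_neg_iff_add_eq_0)
  show False
  proof (cases "n = 0")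
    case True
    then show False using eq n by simp
  next
    case False
    have "c l * x ^ l \<in> ge P (int (n - 1) * ord P x)" if "l < n" for l
    proof (rule ge_smult[OF P(1) c(1)])
      have "int (n - 1) * ord P x \<le> int l * ord P x"
        by (rule mult_right_mono_neg) (use that P in auto)
      then show "x ^ l \<in> ge P (int (n - 1) * ord P x)" using P x0 by (simp add: ge_iff ord_power)
    qed (use that n in simp)
    then have "c n * x ^ n \<in> ge P (int (n - 1) * ord P x)"
      unfolding eq by (intro ge_uminus ge_sum P(1)) simp
    moreover have "ord P (c n * x ^ n) = int n * ord P x"
      using n x0 P c(1)[OF n(1)] by (simp add: ord_mult ord_power ord_K)
    ultimately have "int (n - 1) * ord P x \<le> int n * ord P x" using n x0 by (simp add: ge_iff)
    then show False using P(2) False by (simp add: of_nat_diff algebra_simps)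
  qed
qed

text \<open>The \<open>deg R + 1\<close> powers \<open>1, x, ..., x ^ deg R\<close> are dependent in
  the residue field at \<open>R\<close>; the relation gives a polynomial in \<open>x\<close> that
  vanishes at \<open>R\<close> and has poles only where \<open>x\<close> has.\<close>

lemma kill_one:
  assumes x: "x \<notin> K" and R: "R \<in> Pts" "0 \<le> ord R x"
  shows "\<exists>q r. q \<noteq> 0 \<and> 1 \<le> ord R q \<and> q \<in> L (\<lambda>P. int r * poles x P)"
proof -
  define W where "W = {s :: unit \<Rightarrow> 'f. s () \<in> ge R 1}"
  have W: "subsp W" using R by (auto simp: W_def subsp_def intro: ge_add ge_smult)
  have x0: "x \<noteq> 0" using x by auto
  have "spanned W {..<deg R} (\<lambda>i _. res_basis R i) {s. s () \<in> ge R 0}"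
    unfolding spanned_def
  proof
    fix s :: "unit \<Rightarrow> 'f" assume "s \<in> {s. s () \<in> ge R 0}"
    then obtain a where "\<forall>i<deg R. a i \<in> K" "s () - (\<Sum>i<deg R. a i * res_basis R i) \<in> ge R 1"
      using res_basis(2)[OF R(1), of "s ()"] by auto
    then show "\<exists>a. (\<forall>i\<in>{..<deg R}. a i \<in> K) \<and> (\<lambda>x. s x - (\<Sum>i<deg R. a i * res_basis R i)) \<in> W"
      by (auto simp: W_def)
  qed
  from dependence[OF W _ _ _ this, of "{..deg R}" "\<lambda>l _. x ^ l"] R x0
  obtain c where c: "\<forall>l\<in>{..deg R}. c l \<in> K" "\<exists>l\<in>{..deg R}. c l \<noteq> 0" "(\<Sum>l\<le>deg R. c l * x ^ l) \<in> ge R 1"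
    by (auto simp: W_def ge_iff ord_power)
  define q where "q = (\<Sum>l\<le>deg R. c l * x ^ l)"
  have "q \<noteq> 0" unfolding q_def using c power_combination_nonzero[OF x] by auto
  moreover have "q \<in> L (\<lambda>P. int (deg R) * poles x P)"
    unfolding q_def
  proof (intro L_sum L_smult)
    fix l assume l: "l \<in> {..deg R}"
    show "x ^ l \<in> L (\<lambda>P. int (deg R) * poles x P)"
      by (rule L_mono[OF L_power[OF L_poles]]) (use l in \<open>simp add: mult_right_mono\<close>)
  qed (use c in auto)
  ultimately show ?thesis using c by (auto simp: q_def ge_iff intro!: exI[of _ q])
qed

text \<open>A product of powers of the polynomials from \<open>kill_one\<close>. None of the factors
  has a pole in \<open>S\<close>, so the zeros already gained are not lost.\<close>

lemma kill:
  assumes x: "x \<notin> K" and S: "finite S" "S \<subseteq> Pts" "\<And>R. R \<in> S \<Longrightarrow> 0 \<le> ord R x"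
  shows "\<exists>q r. q \<noteq> 0 \<and> (\<forall>R\<in>S. int N \<le> ord R q) \<and> q \<in> L (\<lambda>P. int r * poles x P)"
  using S
proof (induction S rule: finite_induct)
  case empty
  show ?case by (rule exI[of _ 1], rule exI[of _ 0]) (auto simp: L_iff)
next
  case (insert R S)
  then obtain q r where q: "q \<noteq> 0" "\<forall>R\<in>S. int N \<le> ord R q" "q \<in> L (\<lambda>P. int r * poles x P)"
    by auto
  obtain q' r' where q': "q' \<noteq> 0" "1 \<le> ord R q'" "q' \<in> L (\<lambda>P. int r' * poles x P)"
    using kill_one[OF x, of R] insert.prems by auto
  have R: "R \<in> Pts" "S \<subseteq> Pts" using insert.prems by auto
  have nonneg: "0 \<le> ord T g" if "T \<in> insert R S" "g \<noteq> 0" "g \<in> L (\<lambda>P. int k * poles x P)" for T g k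
  proof -
    have "poles x T = 0" using insert.prems(2)[OF that(1)] by (simp add: poles_def)
    moreover have "T \<in> Pts" using that(1) R by blast
    ultimately show ?thesis using that(2,3) by (force simp: L_iff)
  qed
  have ord: "ord T (q * q' ^ N) = ord T q + int N * ord T q'" if "T \<in> Pts" for T
    using that q q' by (simp add: ord_mult ord_power)
  have "int N \<le> ord T (q * q' ^ N)" if "T \<in> insert R S" for T
  proof (cases "T = R")
    case True
    have "int N * 1 \<le> int N * ord R q'" using q' by (intro mult_left_mono) auto
    then show ?thesis using ord[OF R(1)] nonneg[of R q r] q True by simp
  next
    case False
    then have "T \<in> S" using that by simp
    then have "int N \<le> ord T q" "0 \<le> ord T q'" "T \<in> Pts" using q nonneg[OF that q'(1,3)] R by auto
    then show ?thesis using ord[of T] by (simp add: add_increasing2)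
  qed
  moreover have "q * q' ^ N \<in> L (\<lambda>P. int (r + N * r') * poles x P)"
    by (rule L_mono[OF L_mult[OF q(3) L_power[OF q'(3)]]]) (simp add: algebra_simps)
  ultimately show ?case using q q' by (intro exI[of _ "q * q' ^ N"] exI[of _ "r + N * r'"]) auto
qed

text \<open>A single function \<open>q\<close> moves independent classes \<open>b i\<close> into
  \<open>adele Dm\<close>, where \<open>Dm\<close> is a multiple of \<open>poles x\<close> plus a
  fixed divisor. There they are independent of the functions \<open>x ^ l * z \<iota>\<close>, and
  those alone already account for the degree of \<open>Dm\<close> up to a constant. That constant
  bounds the number of classes.\<close>

theorem H1_finite:
  "\<exists>N::nat. \<forall>n b. (\<forall>i<n. b i \<in> adeles) \<longrightarrow> indep W1 {..<n} b \<longrightarrow> n \<le> N"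
proof -
  define x where "x = unif Q"
  have x0: "x \<noteq> 0" and "ord Q x = 1" using unif[OF Q] by (auto simp: x_def)
  then have x: "x \<notin> K" using ord_K[OF Q, of x] by auto
  obtain I :: "('p \<times> int \<times> nat) set" and z C where I: "finite I" "int (card I) = degD (zeros x)"
    and C: "fin C" "\<forall>P. 0 \<le> C P"
    and z: "\<forall>m. lin_indep ({..m} \<times> I) (\<lambda>(l::nat, \<iota>). x ^ l * z \<iota>)"
      "\<forall>m. \<forall>(l, \<iota>)\<in>{..m} \<times> I. x ^ l * z \<iota> \<in> L (\<lambda>P. int m * poles x P + C P)"
    using growth_family_L[OF x0] by blast
  have "n \<le> nat (degD C + int (deg Q))" if b: "\<forall>i<n. b i \<in> adeles" "indep W1 {..<n} b" for n b
  proof -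
    obtain D where D: "fin D" "\<forall>P. 0 \<le> D P" "\<forall>i\<in>{..<n}. b i \<in> adele D"
      using adeles_bound[of "{..<n}" b] b by auto
    define M where "M = nat (degD D)"
    have DM: "D P \<le> int M" if "P \<in> Pts" for P
    proof -
      have "D P * 1 \<le> D P * int (deg P)"
        by (rule mult_left_mono) (use deg_pos[OF that] D(2) in auto)
      then show ?thesis using degD_ge_term[OF D(1) _ that] D(2) by (simp add: M_def)
    qed
    obtain q r where q: "q \<noteq> 0" "\<forall>R\<in>{P \<in> Pts. D P \<noteq> 0 \<and> 0 \<le> ord P x}. int M \<le> ord R q"
      "q \<in> L (\<lambda>P. int r * poles x P)"
    proof -
      have "finite {P \<in> Pts. D P \<noteq> 0 \<and> 0 \<le> ord P x}"
        by (rule finite_subset[OF _ D(1)[unfolded fin_def]]) blast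
      from kill[OF x this, of M] that show thesis by blast
    qed
    \<comment> \<open>The share \<open>r\<close> pays for the poles of \<open>q\<close>, the share
      \<open>M\<close> for the poles that \<open>D\<close> allows at poles of
      \<open>x\<close>.\<close>
    define m where "m = r + M"
    define Dm where "Dm = (\<lambda>P. int m * poles x P + C P)"
    have Dm: "D P - ord P q \<le> Dm P" if P: "P \<in> Pts" for P
    proof (cases "0 \<le> ord P x")
      case True
      then have p0: "poles x P = 0" by (simp add: poles_def)
      have "D P \<le> ord P q"
      proof (cases "D P = 0")
        case True
        then show ?thesis using q(1,3) p0 P by (auto simp: L_iff)
      next
        case False
        then have "int M \<le> ord P q" using q(2) True P by blast
        then show ?thesis using DM[OF P] by simp
      qed
      then show ?thesis using p0 C(2)[rule_format, of P] by (simp add: Dm_def)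
    next
      case False
      then have p1: "1 \<le> poles x P" using x0 by (simp add: poles_def)
      have "- (int r * poles x P) \<le> ord P q" using q(1,3) P by (auto simp: L_iff)
      moreover have "int M * 1 \<le> int M * poles x P" using p1 by (intro mult_left_mono) auto
      moreover have "0 \<le> C P" using C by simp
      ultimately show ?thesis using DM[OF P] by (simp add: Dm_def m_def algebra_simps)
    qed
    \<comment> \<open>Multiplication by \<open>q\<close> turns integrality into the bound
      \<open>- ord P q\<close>. The extra zero demanded at \<open>Q\<close> excludes nonzero
      constants, so that a function meeting the bound must vanish.\<close>
    define E where "E = (\<lambda>P. - ord P q - (if P = Q then 1 else 0))"
    have E: "fin E" unfolding E_def by (rule fin_diff) (simp_all add: q(1))
    have fDm: "fin Dm" unfolding Dm_def by (rule fin_add) (simp_all add: C(1))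
    have EDm: "E P \<le> Dm P" if "P \<in> Pts" for P
      using Dm[OF that] D(2)[rule_format, of P] by (auto simp: E_def)
    define J where "J = {..<n} <+> ({..m} \<times> I)"
    define v where "v = (\<lambda>j P. case j of Inl i \<Rightarrow> q * b i P | Inr (l, \<iota>) \<Rightarrow> x ^ l * z \<iota>)"
    have J: "finite J" using I by (simp add: J_def)
    have "card J \<le> card (Idx Dm E)"
    proof (rule indep_card_le[OF subsp_adele finite_Idx[OF E fDm] J adele_spanned[OF E fDm EDm]])
      fix j assume j: "j \<in> J"
      show "v j \<in> adele Dm"
      proof (cases j)
        case (Inl i)
        then have "i < n" using j by (auto simp: J_def)
        have "q * b i P \<in> ge P (- Dm P)" if "P \<in> Pts" for P
        proof (rule ge_mult')
          show "q \<in> ge P (ord P q)" by (simp add: ge_iff)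
          show "b i P \<in> ge P (- D P)" using D(3) \<open>i < n\<close> that by (simp add: adele_def)
        qed (use Dm[OF that] that in auto)
        then show ?thesis by (simp add: Inl v_def adele_def)
      next
        case (Inr p)
        then obtain l \<iota> where "j = Inr (l, \<iota>)" "(l, \<iota>) \<in> {..m} \<times> I" using j by (cases p) (auto simp: J_def)
        then show ?thesis using z(2) by (fastforce simp: v_def Dm_def L_const_iff)
      qed
    next
      show "indep (adele E) J v"
        unfolding indep_def
      proof (intro allI impI, elim conjE)
        fix a assume a: "\<forall>j\<in>J. a j \<in> K" "(\<lambda>P. \<Sum>j\<in>J. a j * v j P) \<in> adele E"
        define u where "u P = (\<Sum>i<n. a (Inl i) * b i P)" for P
        define f where "f = (\<Sum>p\<in>{..m} \<times> I. a (Inr p) * (case p of (l, \<iota>) \<Rightarrow> x ^ l * z \<iota>))"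
        \<comment> \<open>Dividing the relation by \<open>q\<close> shows that the combination
          \<open>u\<close> of the \<open>b i\<close> equals the function \<open>- f / q\<close> up
          to an integral adele, hence lies in \<open>W1\<close>.\<close>
        have sum: "(\<Sum>j\<in>J. a j * v j P) = (u P + f / q) * q" for P
        proof -
          have "(\<Sum>j\<in>J. a j * v j P) = q * u P + f"
            unfolding J_def using I(1)
            by (simp add: sum.Plus v_def u_def f_def sum_distrib_left mult_ac)
          then show ?thesis using q(1) by (simp add: distrib_right mult.commute[of q])
        qed
        have uf: "u P + f / q \<in> ge P (if P = Q then 1 else 0)" if "P \<in> Pts" for P
        proof -
          have "(u P + f / q) * q \<in> ge P (- E P)" using a(2) that unfolding sum adele_def by blast
          then show ?thesis using that q(1) by (simp add: ge_mult_iff E_def)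
        qed
        then have uf0: "u P - (- (f / q)) \<in> ge P 0" if "P \<in> Pts" for P
          using ge_mono[OF uf[OF that], of 0] by simp
        have "u \<in> W1" unfolding W1_def using uf0 by blast
        then have "(\<lambda>P. \<Sum>i<n. a (Inl i) * b i P) \<in> W1" by (simp add: u_def[abs_def])
        then have a0: "\<forall>i<n. a (Inl i) = 0"
          using indepD[OF b(2), of "\<lambda>i. a (Inl i)"] a(1) by (auto simp: J_def)
        then have "u P = 0" for P by (simp add: u_def)
        then have "f / q \<in> L (\<lambda>P. - (if P = Q then 1 else 0))" using uf by (simp add: L_def)
        then have "f / q = 0" by (intro L_negative[of "\<lambda>P. - (if P = Q then 1 else 0)" Q]) (auto simp: Q)
        then have "f = 0" using q(1) by simp
        then have "\<forall>p\<in>{..m} \<times> I. a (Inr p) = 0"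
          using lin_indepD[OF z(1)[rule_format, of m], of "\<lambda>p. a (Inr p)"] a(1)
          unfolding J_def f_def by blast
        then show "\<forall>j\<in>J. a j = 0" using a0 unfolding J_def by blast
      qed
    qed
    then have "int (card J) \<le> degD Dm - degD E" using card_Idx[OF E fDm EDm] by simp
    also have "degD Dm = int m * degD (zeros x) + degD C"
      unfolding Dm_def using C(1) degD_zeros_eq_poles[OF x0] by (simp add: degD_add degD_scale)
    also have "degD E = - int (deg Q)"
      unfolding E_def using q(1) Q by (simp add: degD_diff degD_uminus degD_principal degD_single)
    also have "int (card J) = int n + (int m + 1) * degD (zeros x)"
      unfolding J_def using I by (simp add: card_Plus card_cartesian_product algebra_simps)
    finally have "int n \<le> degD C + int (deg Q) - degD (zeros x)" by (simp add: algebra_simps)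
    moreover have "0 \<le> degD (zeros x)" by (rule degD_nonneg) (simp add: zeros_def)
    ultimately show ?thesis by simp
  qed
  then show ?thesis by blast
qed

corollary H1_basis:
  "\<exists>(n::nat) b. (\<forall>i<n. b i \<in> adeles) \<and> indep W1 {..<n} b \<and> spanned W1 {..<n} b adeles"
proof -
  obtain N :: nat where "\<forall>n b. (\<forall>i<n. b i \<in> adeles) \<longrightarrow> indep W1 {..<n} b \<longrightarrow> n \<le> N"
    using H1_finite by blast
  then have bound: "\<And>(n::nat) b. (\<And>i. i < n \<Longrightarrow> b i \<in> adeles) \<Longrightarrow> indep W1 {..<n} b \<Longrightarrow> n \<le> N" by blast
  show ?thesis by (rule finite_codim_basis[OF subsp_W1 bound])
qed

end

section \<open>Riemann's inequality\<close>

locale genus_places = places +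
  fixes t :: nat and hb :: "nat \<Rightarrow> 'b \<Rightarrow> 'a"
  assumes deg_Q: "deg Q = 1"
    and hb: "spanned W1 {..<t} hb adeles"
begin

text \<open>The \<open>deg D\<close> basis adeles of \<open>adele D\<close> modulo
  \<open>adele (\<lambda>_. 0)\<close> are expanded in the \<open>t\<close> classes
  \<open>hb i\<close>. Combinations in which the \<open>hb\<close> part cancels are diagonal
  functions up to integral adeles, and these functions lie in \<open>L D\<close>.\<close>

lemma riemann:
  assumes D: "fin D" "\<And>P. P \<in> Pts \<Longrightarrow> 0 \<le> D P"
  shows "\<exists>w. (\<forall>k<nat (degD D + 1 - int t). w k \<in> L D) \<and> lin_indep {..<nat (degD D + 1 - int t)} w"
proof (cases "int t \<le> degD D")
  case False
  then show ?thesis by (simp add: lin_indep_def)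
next
  case True
  \<comment> \<open>The \<open>t\<close> linear conditions leave \<open>deg D - t\<close> functions;
    the constant \<open>1\<close> adds one more.\<close>
  define r where "r = nat (degD D - int t)"
  have n: "nat (degD D + 1 - int t) = Suc r" using True by (simp add: r_def)
  define J where "J = Idx D (\<lambda>_. 0)"
  have J: "finite J" "int (card J) = degD D"
    unfolding J_def using finite_Idx[of "\<lambda>_. 0" D] card_Idx[of "\<lambda>_. 0" D] D by simp_all
  have eD: "efun \<iota> \<in> adele D" if "\<iota> \<in> J" for \<iota> using that efun_adele unfolding J_def by blast
  have "adele D \<subseteq> adeles"
  proof
    fix s assume s: "s \<in> adele D"
    have "{P \<in> Pts. s P \<notin> ge P 0} \<subseteq> {P \<in> Pts. D P \<noteq> 0}" using s by (auto simp: adele_def)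
    then show "s \<in> adeles" using D(1) finite_subset unfolding adeles_def fin_def by blast
  qed
  then have "\<forall>\<iota>\<in>J. \<exists>a. (\<forall>i<t. a i \<in> K) \<and> (\<lambda>P. efun \<iota> P - (\<Sum>i<t. a i * hb i P)) \<in> W1"
    using hb eD unfolding spanned_def by blast
  from bchoice[OF this] obtain a where
    a: "\<forall>\<iota>\<in>J. (\<forall>i<t. a \<iota> i \<in> K) \<and> (\<lambda>P. efun \<iota> P - (\<Sum>i<t. a \<iota> i * hb i P)) \<in> W1" ..
  then have "\<forall>\<iota>\<in>J. \<exists>f. \<forall>P\<in>Pts. efun \<iota> P - (\<Sum>i<t. a \<iota> i * hb i P) - f \<in> ge P 0"
    unfolding W1_def by blast
  from bchoice[OF this] obtain f where
    f: "\<forall>\<iota>\<in>J. \<forall>P\<in>Pts. efun \<iota> P - (\<Sum>i<t. a \<iota> i * hb i P) - f \<iota> \<in> ge P 0" ..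
  obtain x where x: "\<forall>k<r. (\<forall>\<iota>\<in>J. x k \<iota> \<in> K) \<and> (\<forall>i\<in>{..<t}. (\<Sum>\<iota>\<in>J. a \<iota> i * x k \<iota>) = 0)"
    "\<forall>c. (\<forall>\<iota>\<in>J. (\<Sum>k<r. c k * x k \<iota>) = 0) \<longrightarrow> (\<forall>k<r. c k = 0)"
  proof -
    have "card {..<t} + r \<le> card J" using J True by (simp add: r_def)
    from independent_solutions[OF _ J(1) this, of "\<lambda>i \<iota>. a \<iota> i"] a that show thesis by auto
  qed
  define h where "h k = (\<Sum>\<iota>\<in>J. x k \<iota> * f \<iota>)" for k
  define g where "g k P = (\<Sum>\<iota>\<in>J. x k \<iota> * efun \<iota> P)" for k P
  have gh: "g k P - h k \<in> ge P 0" if k: "k < r" and P: "P \<in> Pts" for k P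
  proof -
    have "(\<Sum>\<iota>\<in>J. x k \<iota> * (\<Sum>i<t. a \<iota> i * hb i P)) = (\<Sum>i<t. (\<Sum>\<iota>\<in>J. a \<iota> i * x k \<iota>) * hb i P)"
      unfolding sum_distrib_left sum_distrib_right by (subst sum.swap) (simp add: mult_ac)
    also have "\<dots> = 0" using x(1) k by simp
    finally have "g k P - h k = (\<Sum>\<iota>\<in>J. x k \<iota> * (efun \<iota> P - (\<Sum>i<t. a \<iota> i * hb i P) - f \<iota>))"
      by (simp add: g_def h_def right_diff_distrib sum_subtractf)
    also have "\<dots> \<in> ge P 0" by (intro ge_sum ge_smult P) (use x(1) k f P in auto)
    finally show ?thesis .
  qed
  have hL: "h k \<in> L D" if k: "k < r" for k
    unfolding L_def
  proof (intro CollectI ballI)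
    fix P assume P: "P \<in> Pts"
    have "g k P \<in> ge P (- D P)" unfolding g_def
      by (intro ge_sum ge_smult P) (use x(1) k eD P in \<open>auto simp: adele_def\<close>)
    moreover have "g k P - h k \<in> ge P (- D P)" using gh[OF k P] D(2)[OF P] ge_mono by fastforce
    ultimately have "g k P - (g k P - h k) \<in> ge P (- D P)" by (rule ge_diff[OF P])
    then show "h k \<in> ge P (- D P)" unfolding diff_diff_eq2 add_diff_cancel_left' .
  qed
  define w where "w = (\<lambda>k. case k of 0 \<Rightarrow> 1 | Suc k \<Rightarrow> h k)"
  have "w k \<in> L D" if "k < Suc r" for k
    using that hL D(2) by (auto simp: w_def L_iff split: nat.splits)
  moreover have "lin_indep {..<Suc r} w"
    unfolding lin_indep_def
  proof (intro allI impI, elim conjE)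
    fix c assume c: "\<forall>k\<in>{..<Suc r}. c k \<in> K" "(\<Sum>k<Suc r. c k * w k) = 0"
    have "c 0 + (\<Sum>k<r. c (Suc k) * h k) = 0"
      using c(2) unfolding sum.lessThan_Suc_shift by (simp add: w_def)
    then have hc: "(\<Sum>k<r. c (Suc k) * h k) = - c 0" by (simp add: eq_neg_iff_add_eq_0 add.commute)
    \<comment> \<open>If a combination of the \<open>h k\<close> is constant, the same combination
      of the \<open>g k\<close> is integral, and \<open>efun\<close> is independent modulo integral
      adeles. This gives independence modulo constants.\<close>
    have "(\<lambda>P. \<Sum>\<iota>\<in>J. (\<Sum>k<r. c (Suc k) * x k \<iota>) * efun \<iota> P) \<in> adele (\<lambda>_. 0)"
      unfolding adele_def
    proof (intro CollectI ballI)
      fix P assume P: "P \<in> Pts"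
      have c0: "- c 0 \<in> ge P 0" by (intro ge_uminus ge_K P) (use c(1) in auto)
      have "(\<Sum>\<iota>\<in>J. (\<Sum>k<r. c (Suc k) * x k \<iota>) * efun \<iota> P) = (\<Sum>k<r. c (Suc k) * g k P)"
        unfolding g_def sum_distrib_left sum_distrib_right by (subst sum.swap) (simp add: mult_ac)
      also have "\<dots> = (\<Sum>k<r. c (Suc k) * (g k P - h k)) + - c 0"
        unfolding hc[symmetric] by (simp add: right_diff_distrib sum_subtractf)
      also have "\<dots> \<in> ge P (- 0)"
        unfolding minus_zero
        by (intro ge_add[OF P] ge_sum[OF P] ge_smult[OF P] gh c0) (use c(1) P in auto)
      finally show "(\<Sum>\<iota>\<in>J. (\<Sum>k<r. c (Suc k) * x k \<iota>) * efun \<iota> P) \<in> ge P (- 0)" .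
    qed
    moreover have "indep (adele (\<lambda>_. 0)) J efun"
      unfolding J_def by (rule adele_indep) (use D in simp_all)
    moreover have "\<forall>\<iota>\<in>J. (\<Sum>k<r. c (Suc k) * x k \<iota>) \<in> K"
      using c(1) x(1) by (intro ballI K_sum K_mult) auto
    ultimately have "\<forall>\<iota>\<in>J. (\<Sum>k<r. c (Suc k) * x k \<iota>) = 0"
      using indepD[of "adele (\<lambda>_. 0)" J efun "\<lambda>\<iota>. \<Sum>k<r. c (Suc k) * x k \<iota>"] by blast
    then have "\<forall>k<r. c (Suc k) = 0" using spec[OF x(2), of "\<lambda>k. c (Suc k)"] by blast
    moreover from this hc have "c 0 = 0" by simp
    ultimately show "\<forall>k\<in>{..<Suc r}. c k = 0" by (auto simp: less_Suc_eq_0_disj)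
  qed
  ultimately show ?thesis unfolding n by (intro exI[of _ w]) simp
qed

text \<open>For a divisor with negative coefficients, \<open>riemann\<close> is applied to its
  positive part \<open>A\<close>. Membership in \<open>L D\<close> then costs
  \<open>degD A - degD D\<close> linear conditions, fewer than the dimension available.\<close>

lemma riemann_nonzero:
  assumes D: "fin D" "int t \<le> degD D"
  shows "\<exists>f. f \<noteq> 0 \<and> f \<in> L D"
proof -
  define A where "A = (\<lambda>P. max (D P) 0)"
  have A: "fin A" "\<And>P. 0 \<le> A P" "\<And>P. D P \<le> A P" unfolding A_def using D(1) by (auto intro!: fin_max)
  define n where "n = nat (degD A + 1 - int t)"
  obtain w where w: "\<forall>k<n. w k \<in> L A" "lin_indep {..<n} w"
    using riemann[of A] A unfolding n_def by blast
  have "degD D \<le> degD A" using degD_mono D(1) A by blast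
  then have "card (Idx A D) < card {..<n}"
    using card_Idx[OF D(1) A(1) A(3)] D(2) by (simp add: n_def)
  from dependence[OF subsp_adele finite_Idx[OF D(1) A(1)] _ this adele_spanned[OF D(1) A(1) A(3)],
      of "\<lambda>k _. w k"] w(1)
  obtain x where x: "\<forall>k\<in>{..<n}. x k \<in> K" "\<exists>k\<in>{..<n}. x k \<noteq> 0" "(\<Sum>k<n. x k * w k) \<in> L D"
    by (auto simp: L_const_iff)
  then have "(\<Sum>k<n. x k * w k) \<noteq> 0" using w(2) unfolding lin_indep_def by blast
  then show ?thesis using x(3) by blast
qed

end

section \<open>Subrings of a field and their ideals\<close>

lemma Fr_simps [simp]:
  "carrier Fr = UNIV" "monoid.mult Fr = (*)" "monoid.one Fr = 1" "ring.zero Fr = 0" "ring.add Fr = (+)"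
  by (simp_all add: ring_of_type_algebra_def)

lemma field_Fr: "field (Fr :: 'f::field ring)" by (rule field_from_type_algebra)

lemma ring_Fr: "ring (Fr :: 'f::field ring)" by (rule ring_from_type_algebra)

lemma a_inv_Fr [simp]: "a_inv Fr (a :: 'f::field) = - a"
proof -
  interpret field "Fr :: 'f ring" by (rule field_Fr)
  have "a_inv Fr a + a = 0" using l_neg[of a] by simp
  then show ?thesis by (simp add: eq_neg_iff_add_eq_0)
qed

locale subring_set =
  fixes A :: "'f::field set"
  assumes A_0 [simp]: "0 \<in> A" and A_1 [simp]: "1 \<in> A"
    and A_add [simp]: "a \<in> A \<Longrightarrow> b \<in> A \<Longrightarrow> a + b \<in> A"
    and A_uminus [simp]: "a \<in> A \<Longrightarrow> - a \<in> A"
    and A_mult [simp]: "a \<in> A \<Longrightarrow> b \<in> A \<Longrightarrow> a * b \<in> A"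
begin

lemma A_diff [simp]: "a \<in> A \<Longrightarrow> b \<in> A \<Longrightarrow> a - b \<in> A"
  using A_add[of a "- b"] by simp

lemma A_power [simp]: "a \<in> A \<Longrightarrow> a ^ n \<in> A"
  by (induction n) auto

lemma A_sum [simp]: "(\<And>j. j \<in> J \<Longrightarrow> a j \<in> A) \<Longrightarrow> sum a J \<in> A"
  by (induction J rule: infinite_finite_induct) auto

lemma A_prod [simp]: "(\<And>j. j \<in> J \<Longrightarrow> a j \<in> A) \<Longrightarrow> prod a J \<in> A"
  by (induction J rule: infinite_finite_induct) auto

end

lemma subring_set_iff: "subring_set (A :: 'f::field set) \<longleftrightarrow> subring A Fr"
proof
  assume "subring_set A"
  then interpret subring_set A .
  show "subring A Fr" by (rule ring.subringI[OF ring_Fr]) auto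
next
  assume "subring A Fr"
  from subringE[OF this] show "subring_set A" by unfold_locales auto
qed

text \<open>Closure under negation follows by multiplying with \<open>- 1 \<in> A\<close>.\<close>

definition is_ideal :: "'f::field set \<Rightarrow> 'f set \<Rightarrow> bool"
  where "is_ideal A I \<longleftrightarrow> I \<subseteq> A \<and> 0 \<in> I \<and> (\<forall>a\<in>I. \<forall>b\<in>I. a + b \<in> I) \<and> (\<forall>a\<in>A. \<forall>b\<in>I. a * b \<in> I)"

definition is_prime :: "'f::field set \<Rightarrow> 'f set \<Rightarrow> bool"
  where "is_prime A p \<longleftrightarrow> is_ideal A p \<and> 1 \<notin> p \<and> (\<forall>a\<in>A. \<forall>b\<in>A. a * b \<in> p \<longrightarrow> a \<in> p \<or> b \<in> p)"

lemma is_ideal_sum: "is_ideal A I \<Longrightarrow> (\<And>j. j \<in> J \<Longrightarrow> f j \<in> I) \<Longrightarrow> sum f J \<in> I"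
  by (induction J rule: infinite_finite_induct) (auto simp: is_ideal_def)

context subring_set
begin

lemma is_ideal_uminus: "is_ideal A I \<Longrightarrow> a \<in> I \<Longrightarrow> - a \<in> I"
  using A_uminus[OF A_1] unfolding is_ideal_def by (metis mult_minus1)

lemma is_ideal_diff: "is_ideal A I \<Longrightarrow> a \<in> I \<Longrightarrow> b \<in> I \<Longrightarrow> a - b \<in> I"
  using is_ideal_uminus[of I b] unfolding is_ideal_def by (metis add_uminus_conv_diff)

lemma cring_sub: "cring (sub A)"
proof -
  interpret F: field "Fr :: 'f ring" by (rule field_Fr)
  have "subring A Fr" using subring_set_axioms subring_set_iff by blast
  then show ?thesis using F.subring_is_domain by (simp add: domain_def)
qed

lemma a_inv_sub: assumes "a \<in> A" shows "a_inv (sub A) a = - a"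
proof -
  interpret R: cring "sub A" by (rule cring_sub)
  have "a_inv (sub A) a + a = 0" "a_inv (sub A) a \<in> A"
    using R.l_neg[of a] R.a_inv_closed[of a] assms by simp_all
  then show ?thesis by (simp add: eq_neg_iff_add_eq_0)
qed

lemma is_ideal_iff: "is_ideal A I \<longleftrightarrow> ideal I (sub A)"
proof
  assume I: "is_ideal A I"
  have r: "a * x \<in> I" if "a \<in> I" "x \<in> A" for a x
    using I that unfolding is_ideal_def by (metis mult.commute)
  interpret R: cring "sub A" by (rule cring_sub)
  show "ideal I (sub A)"
  proof (rule idealI)
    show "ring (sub A)" by (rule R.ring_axioms)
    show "subgroup I (add_monoid (sub A))"
    proof (rule R.add.subgroupI)
      show "I \<noteq> {}" using I by (auto simp: is_ideal_def)
      show "a_inv (sub A) a \<in> I" if "a \<in> I" for a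
      proof -
        have "a \<in> A" using that I by (auto simp: is_ideal_def)
        then show ?thesis using a_inv_sub[of a] is_ideal_uminus[OF I that] by simp
      qed
    qed (use I in \<open>auto simp: is_ideal_def\<close>)
  qed (use I r in \<open>auto simp: is_ideal_def\<close>)
next
  assume "ideal I (sub A)"
  then interpret I: ideal I "sub A" .
  show "is_ideal A I"
    unfolding is_ideal_def
    using I.a_subset additive_subgroup.zero_closed[OF I.is_additive_subgroup]
      additive_subgroup.a_closed[OF I.is_additive_subgroup] I.I_l_closed by auto
qed

lemma is_prime_iff: "is_prime A p \<longleftrightarrow> primeideal p (sub A)"
proof
  assume p: "is_prime A p"
  then have "ideal p (sub A)" unfolding is_ideal_iff[symmetric] by (simp add: is_prime_def)
  then show "primeideal p (sub A)"
    by (rule primeidealI[OF _ cring_sub]) (use p in \<open>auto simp: is_prime_def\<close>)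
next
  assume "primeideal p (sub A)"
  then interpret p: primeideal p "sub A" .
  have "1 \<notin> p" using p.I_notcarr p.one_imp_carrier by auto
  then show "is_prime A p"
    unfolding is_prime_def is_ideal_iff using p.ideal_axioms p.I_prime by auto
qed

lemma units_iff: "u \<in> Units (sub A) \<longleftrightarrow> u \<in> A \<and> u \<noteq> 0 \<and> inverse u \<in> A"
proof -
  have "u \<noteq> 0 \<and> inverse u \<in> A" if "b \<in> A" "b * u = 1" for b
    using that by (metis mult_zero_right zero_neq_one inverse_unique mult.commute)
  moreover have "inverse u * u = 1" if "u \<noteq> 0" using that by simp
  ultimately show ?thesis unfolding Units_def by (auto intro!: bexI[of _ "inverse u"])
qed

lemma non_units_iff: "a \<in> non_units A \<longleftrightarrow> a \<in> A \<and> (a = 0 \<or> inverse a \<notin> A)"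
  by (auto simp: non_units_def units_iff)

text \<open>Zorn's lemma gives an ideal maximal among those avoiding \<open>1\<close>, and such an
  ideal is prime.\<close>

lemma proper_ideal_subset_prime:
  assumes I: "is_ideal A I" "1 \<notin> I"
  shows "\<exists>p. is_prime A p \<and> I \<subseteq> p"
proof -
  define S where "S = {J. is_ideal A J \<and> I \<subseteq> J \<and> 1 \<notin> J}"
  have "\<exists>M\<in>S. \<forall>J\<in>S. M \<subseteq> J \<longrightarrow> J = M"
  proof (rule subset_Zorn_nonempty)
    show "S \<noteq> {}" using I by (auto simp: S_def)
    fix C assume C: "C \<noteq> {}" "subset.chain S C"
    have CS: "\<And>J. J \<in> C \<Longrightarrow> J \<in> S" and ch: "\<And>J J'. J \<in> C \<Longrightarrow> J' \<in> C \<Longrightarrow> J \<subseteq> J' \<or> J' \<subseteq> J"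
      using C(2) by (auto simp: subset_chain_def)
    have "is_ideal A (\<Union>C)"
      unfolding is_ideal_def
    proof (intro conjI ballI)
      show "\<Union>C \<subseteq> A" using CS unfolding S_def is_ideal_def by blast
      show "0 \<in> \<Union>C" using CS C(1) unfolding S_def is_ideal_def by blast
      fix a b assume "a \<in> \<Union>C" "b \<in> \<Union>C"
      then obtain J J' where "J \<in> C" "J' \<in> C" "a \<in> J" "b \<in> J'" by blast
      then obtain J'' where "J'' \<in> C" "a \<in> J''" "b \<in> J''" using ch[of J J'] by blast
      then show "a + b \<in> \<Union>C" using CS[of J''] unfolding S_def is_ideal_def by blast
    next
      fix a b assume "a \<in> A" "b \<in> \<Union>C"
      then show "a * b \<in> \<Union>C" using CS unfolding S_def is_ideal_def by blast
    qed
    moreover have "I \<subseteq> \<Union>C" "1 \<notin> \<Union>C" using CS C(1) unfolding S_def by blast+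
    ultimately show "\<Union>C \<in> S" by (simp add: S_def)
  qed
  then obtain M where MS: "M \<in> S" and maxS: "\<forall>J\<in>S. M \<subseteq> J \<longrightarrow> J = M" by blast
  then have M: "is_ideal A M" "I \<subseteq> M" "1 \<notin> M" by (simp_all add: S_def)
  have max: "J = M" if "is_ideal A J" "M \<subseteq> J" "1 \<notin> J" for J
    using maxS[rule_format, of J] that M(2) by (simp add: S_def)
  have "a \<in> M \<or> b \<in> M" if ab: "a \<in> A" "b \<in> A" "a * b \<in> M" for a b
  proof (rule ccontr)
    assume n: "\<not> (a \<in> M \<or> b \<in> M)"
    \<comment> \<open>The ideal generated by \<open>M\<close> and \<open>a\<close>. By maximality it
      contains \<open>1\<close>, and multiplying an expression for \<open>1\<close> by
      \<open>b\<close> puts \<open>b\<close> into \<open>M\<close>.\<close>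
    define J where "J = {x + r * a |x r. x \<in> M \<and> r \<in> A}"
    have MA: "M \<subseteq> A" and M0: "0 \<in> M" using M(1) by (auto simp: is_ideal_def)
    have "is_ideal A J"
      unfolding is_ideal_def
    proof (intro conjI ballI)
      show "J \<subseteq> A" using MA ab by (auto simp: J_def)
      have "0 = 0 + 0 * a" by simp
      then show "0 \<in> J" unfolding J_def using M0 A_0 by blast
      fix x y assume "x \<in> J" "y \<in> J"
      then obtain m r m' r' where "x = m + r * a" "y = m' + r' * a" "m \<in> M" "r \<in> A" "m' \<in> M" "r' \<in> A"
        by (auto simp: J_def)
      moreover have "(m + r * a) + (m' + r' * a) = (m + m') + (r + r') * a" by (simp add: algebra_simps)
      moreover have "m + m' \<in> M" using calculation M(1) by (simp add: is_ideal_def)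
      ultimately show "x + y \<in> J" unfolding J_def by (blast intro: A_add)
    next
      fix x y assume x: "x \<in> A" and "y \<in> J"
      then obtain m r where "y = m + r * a" "m \<in> M" "r \<in> A" by (auto simp: J_def)
      moreover have "x * (m + r * a) = x * m + (x * r) * a" by (simp add: algebra_simps)
      moreover have "x * m \<in> M" using calculation x M(1) by (simp add: is_ideal_def)
      ultimately show "x * y \<in> J" unfolding J_def using x by (blast intro: A_mult)
    qed
    moreover have "M \<subseteq> J"
    proof
      fix m assume "m \<in> M"
      moreover have "m = m + 0 * a" by simp
      ultimately show "m \<in> J" unfolding J_def using A_0 by blast
    qed
    moreover have "a \<in> J"
    proof -
      have "a = 0 + 1 * a" by simp
      then show ?thesis unfolding J_def using A_1 M0 by blast
    qed
    ultimately have "1 \<in> J" using max[of J] n by blast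
    then obtain m r where mr: "1 = m + r * a" "m \<in> M" "r \<in> A" unfolding J_def by blast
    have "b = b * m + r * (a * b)" using mr(1) by (metis mult.assoc mult.commute mult.left_neutral distrib_right)
    moreover have "b * m \<in> M" "r * (a * b) \<in> M" using M(1) ab mr by (auto simp: is_ideal_def)
    ultimately have "b \<in> M" using M(1) unfolding is_ideal_def by metis
    then show False using n by simp
  qed
  then show ?thesis using M unfolding is_prime_def by blast
qed

lemma PIdl_iff: "a \<in> A \<Longrightarrow> PIdl\<^bsub>sub A\<^esub> a = {r * a |r. r \<in> A}"
  by (auto simp: cgenideal_def)

end

section \<open>Discrete valuation rings\<close>

locale dvr = subring_set A for A :: "'f::field set" +
  fixes \<pi> :: 'f
  assumes noeth: "noetherian_ring (sub A)"
    and pi: "\<pi> \<in> A" "\<pi> \<noteq> 0" "non_units A = {r * \<pi> |r. r \<in> A}"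
    and frac: "\<And>f. \<exists>a\<in>A. \<exists>b\<in>A - {0}. f = a / b"
begin

lemma pi_nonunit: "inverse \<pi> \<notin> A"
proof -
  have "1 * \<pi> \<in> non_units A" unfolding pi(3) using A_1 by blast
  then show ?thesis using pi(2) by (simp add: non_units_iff)
qed

text \<open>If no quotient \<open>f / \<pi> ^ n\<close> were a unit, all of them would lie in
  \<open>A\<close> and generate an increasing chain of ideals. Where the chain stops,
  \<open>\<pi>\<close> would be invertible.\<close>

lemma exists_power:
  assumes f: "f \<in> A" "f \<noteq> 0"
  shows "\<exists>n::nat. f / \<pi> ^ n \<in> Units (sub A)"
proof (rule ccontr)
  assume neg: "\<not> ?thesis"
  define g where "g n = f / \<pi> ^ n" for n
  have gA: "g n \<in> A" for n
  proof (induction n)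
    case (Suc n)
    have "g n \<notin> Units (sub A)" using neg by (simp add: g_def)
    then have "g n \<in> non_units A" using Suc by (simp add: non_units_def)
    then obtain r where "r \<in> A" "g n = r * \<pi>" unfolding pi(3) by blast
    then show ?case using pi(2) by (simp add: g_def field_simps)
  qed (use f in \<open>simp add: g_def\<close>)
  define I where "I n = {r * g n |r. r \<in> A}" for n
  have gstep: "g n = \<pi> * g (Suc n)" for n using pi(2) by (simp add: g_def)
  have sub: "I n \<subseteq> I (Suc n)" for n
  proof
    fix x assume "x \<in> I n"
    then obtain r where "r \<in> A" "x = r * g n" by (auto simp: I_def)
    then have "x = (r * \<pi>) * g (Suc n)" "r * \<pi> \<in> A"
      using gstep[of n] pi(1) by (simp_all add: mult.assoc)
    then show "x \<in> I (Suc n)" unfolding I_def by blast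
  qed
  have mono: "I m \<subseteq> I n" if "m \<le> n" for m n using that sub by (rule lift_Suc_mono_le[rotated])
  have "ideal (I n) (sub A)" for n
  proof -
    interpret R: cring "sub A" by (rule cring_sub)
    have "ideal (PIdl\<^bsub>sub A\<^esub> (g n)) (sub A)" using R.cgenideal_ideal gA by simp
    then show ?thesis using PIdl_iff[OF gA] by (simp add: I_def)
  qed
  then have "subset.chain {J. ideal J (sub A)} (range I)"
    unfolding subset_chain_def using mono nat_le_linear by blast
  then have "\<Union>(range I) \<in> range I" using noetherian_ring.ideal_chain_is_trivial[OF noeth] by blast
  then obtain n where "\<Union>(range I) = I n" by blast
  moreover have "g (Suc n) \<in> I (Suc n)" unfolding I_def using A_1 by (auto intro!: exI[of _ 1])
  ultimately have "g (Suc n) \<in> I n" by blast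
  then obtain r where r: "r \<in> A" "g (Suc n) = r * g n" by (auto simp: I_def)
  have "g (Suc n) \<noteq> 0" using f pi(2) by (simp add: g_def)
  have "(r * \<pi>) * g (Suc n) = g (Suc n)" using r(2) gstep[of n] by (simp add: mult.assoc)
  then have "r * \<pi> = 1" using \<open>g (Suc n) \<noteq> 0\<close> by simp
  then have "inverse \<pi> = r" using pi(2) by (simp add: field_simps)
  then show False using r(1) pi_nonunit by simp
qed

lemma units_mult: "u \<in> Units (sub A) \<Longrightarrow> w \<in> Units (sub A) \<Longrightarrow> u * w \<in> Units (sub A)"
  by (auto simp: units_iff)

lemma units_divide: "u \<in> Units (sub A) \<Longrightarrow> w \<in> Units (sub A) \<Longrightarrow> u / w \<in> Units (sub A)"
  by (auto simp: units_iff divide_inverse)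

lemma exists_decomposition:
  assumes "f \<noteq> 0" shows "\<exists>u\<in>Units (sub A). \<exists>n. f = u * \<pi> powi n"
proof -
  obtain a b where ab: "a \<in> A" "b \<in> A" "b \<noteq> 0" "f = a / b" using frac[of f] by blast
  then have "a \<noteq> 0" using assms by auto
  obtain m n where u: "a / \<pi> ^ m \<in> Units (sub A)" "b / \<pi> ^ n \<in> Units (sub A)"
    using exists_power ab \<open>a \<noteq> 0\<close> by metis
  have "f = (a / \<pi> ^ m) / (b / \<pi> ^ n) * \<pi> powi (int m - int n)"
    using ab pi(2) by (simp add: power_int_diff)
  then show ?thesis using units_divide[OF u] by blast
qed

lemma power_in_A_iff: "u \<in> Units (sub A) \<Longrightarrow> u * \<pi> powi n \<in> A \<longleftrightarrow> 0 \<le> n"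
proof
  assume u: "u \<in> Units (sub A)" and un: "u * \<pi> powi n \<in> A"
  have "inverse u * (u * \<pi> powi n) \<in> A" by (rule A_mult[OF _ un]) (use u in \<open>simp add: units_iff\<close>)
  moreover have "inverse u * (u * \<pi> powi n) = \<pi> powi n" using u by (simp add: units_iff)
  ultimately have n: "\<pi> powi n \<in> A" by (simp only:)
  show "0 \<le> n"
  proof (rule ccontr)
    assume "\<not> 0 \<le> n"
    \<comment> \<open>The exponents \<open>n\<close> and \<open>- n - 1\<close> add up to
      \<open>- 1\<close>, and for negative \<open>n\<close> the second is a natural number.\<close>
    then have "\<pi> powi n * \<pi> ^ nat (- n - 1) = \<pi> powi (n + (- n - 1))"
      using pi(2) by (subst power_int_add) (auto simp: power_int_def)
    also have "\<dots> = inverse \<pi>" by simp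
    finally have "inverse \<pi> = \<pi> powi n * \<pi> ^ nat (- n - 1)" by simp
    also have "\<dots> \<in> A" using n pi(1) by simp
    finally show False using pi_nonunit by simp
  qed
next
  assume "u \<in> Units (sub A)" "0 \<le> n"
  then show "u * \<pi> powi n \<in> A" using pi(1) by (simp add: units_iff power_int_def)
qed

lemma decomposition_unique:
  assumes "u \<in> Units (sub A)" "w \<in> Units (sub A)" "u * \<pi> powi m = w * \<pi> powi n" shows "m = n"
proof -
  have eq: "\<pi> powi (m - n) = w / u" "\<pi> powi (n - m) = u / w"
    using assms pi(2) by (auto simp: power_int_diff units_iff field_simps)
  have one: "1 \<in> Units (sub A)" by (simp add: units_iff)
  have "w / u \<in> A" "u / w \<in> A" using units_divide assms by (auto simp: units_iff)
  then show "m = n" using power_in_A_iff[OF one, of "m - n"] power_in_A_iff[OF one, of "n - m"]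
    by (simp add: eq)
qed

definition val :: "'f \<Rightarrow> int" where "val f = (THE n. \<exists>u\<in>Units (sub A). f = u * \<pi> powi n)"

lemma val_eqI: "u \<in> Units (sub A) \<Longrightarrow> f = u * \<pi> powi n \<Longrightarrow> val f = n"
  unfolding val_def
proof (rule the_equality)
  assume u: "u \<in> Units (sub A)" "f = u * \<pi> powi n"
  then show "\<exists>u\<in>Units (sub A). f = u * \<pi> powi n" by blast
  fix m assume "\<exists>u\<in>Units (sub A). f = u * \<pi> powi m"
  then obtain w where "w \<in> Units (sub A)" "f = w * \<pi> powi m" by blast
  then show "m = n" using decomposition_unique[of w u m n] u by simp
qed

lemma val_decomp: assumes "f \<noteq> 0" shows "\<exists>u\<in>Units (sub A). f = u * \<pi> powi (val f)"
proof -
  obtain u n where u: "u \<in> Units (sub A)" "f = u * \<pi> powi n"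
    using exists_decomposition[OF assms] by blast
  then show ?thesis unfolding val_eqI[OF u] by blast
qed

lemma val_mult: assumes "f \<noteq> 0" "g \<noteq> 0" shows "val (f * g) = val f + val g"
proof -
  obtain u w where u: "u \<in> Units (sub A)" "f = u * \<pi> powi (val f)" "w \<in> Units (sub A)" "g = w * \<pi> powi (val g)"
    using val_decomp[OF assms(1)] val_decomp[OF assms(2)] by blast
  have "f * g = (u * w) * \<pi> powi (val f + val g)"
    using pi(2) by (subst u(2), subst u(4)) (simp add: power_int_add)
  then show ?thesis using val_eqI units_mult u by blast
qed

lemma val_nonneg_iff: assumes "f \<noteq> 0" shows "0 \<le> val f \<longleftrightarrow> f \<in> A"
proof -
  obtain u where u: "u \<in> Units (sub A)" and f: "f = u * \<pi> powi (val f)"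
    using val_decomp[OF assms] by blast
  show ?thesis by (subst (2) f) (simp add: power_in_A_iff[OF u])
qed

lemma val_units: "u \<in> Units (sub A) \<Longrightarrow> val u = 0"
  by (rule val_eqI) auto

lemma val_pi: "val \<pi> = 1"
  by (rule val_eqI[of 1]) (auto simp: units_iff)

text \<open>Factoring out the element of smaller value leaves \<open>1 + g / f\<close>, which lies
  in \<open>A\<close>.\<close>

lemma val_add: assumes "f \<noteq> 0" "g \<noteq> 0" "f + g \<noteq> 0" shows "min (val f) (val g) \<le> val (f + g)"
proof -
  have *: "val f \<le> val (f + g)" if "f \<noteq> 0" "g \<noteq> 0" "f + g \<noteq> 0" "val f \<le> val g" for f g
  proof -
    have "val g = val f + val (g / f)" using val_mult[of f "g / f"] that by simp
    then have "g / f \<in> A" using val_nonneg_iff[of "g / f"] that by simp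
    then have "1 + g / f \<in> A" by simp
    moreover have "f + g = f * (1 + g / f)" using that by (simp add: field_simps)
    moreover have "1 + g / f \<noteq> 0" using calculation that by auto
    ultimately show ?thesis using val_mult[of f "1 + g / f"] val_nonneg_iff[of "1 + g / f"] that by simp
  qed
  show ?thesis using *[of f g] *[of g f] assms by (cases "val f \<le> val g") (auto simp: add.commute)
qed

lemma non_units_val: "f \<in> non_units A \<longleftrightarrow> f = 0 \<or> 1 \<le> val f"
proof (cases "f = 0")
  case False
  have "val (inverse f) = - val f"
    using val_mult[of f "inverse f"] False val_units[of 1] by (simp add: units_iff)
  then have "inverse f \<in> A \<longleftrightarrow> val f \<le> 0" using val_nonneg_iff[of "inverse f"] False by simp
  then show ?thesis using val_nonneg_iff[OF False] False by (auto simp: non_units_iff)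
qed (simp add: non_units_iff)

text \<open>Two generators of the maximal ideal differ by a unit. This makes the definite
  description in \<open>ord_at\<close>, which allows every uniformizer, single-valued.\<close>

lemma val_eq_other_uniformizer:
  assumes p: "p \<in> A" "non_units A = PIdl\<^bsub>sub A\<^esub> p" and u: "u \<in> Units (sub A)" "f = u * p powi n"
  shows "val f = n"
proof -
  have eq: "{r * p |r. r \<in> A} = {r * \<pi> |r. r \<in> A}" using p PIdl_iff pi(3) by simp
  have "1 * p \<in> {r * p |r. r \<in> A}" "1 * \<pi> \<in> {r * \<pi> |r. r \<in> A}" using A_1 by blast+
  then have "p \<in> {r * \<pi> |r. r \<in> A}" "\<pi> \<in> {r * p |r. r \<in> A}" unfolding eq by simp_all
  then obtain r s where rs: "r \<in> A" "p = r * \<pi>" "s \<in> A" "\<pi> = s * p" by blast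
  then have "\<pi> = (s * r) * \<pi>" by (simp add: mult.assoc)
  then have "s * r = 1" using pi(2) by simp
  then have r: "r \<in> Units (sub A)" using rs by (auto simp: units_iff inverse_unique mult.commute)
  have p0: "p \<noteq> 0" using rs pi(2) by auto
  have "val (p powi n) = n"
  proof (rule val_eqI)
    show "r powi n \<in> Units (sub A)" using r by (auto simp: units_iff power_int_def power_inverse[symmetric])
    show "p powi n = r powi n * \<pi> powi n" unfolding rs(2) by (simp add: power_int_mult_distrib)
  qed
  then show ?thesis using u p0 val_mult[of u "p powi n"] val_units[OF u(1)] by (simp add: units_iff)
qed

end

section \<open>Curves\<close>

lemma generate_topology_prime_down:
  assumes "generate_topology_on {{p \<in> prime_spectrum A. a \<notin> p} |a. a \<in> A} G"
    and "q \<in> G" "p \<subseteq> q" "p \<in> prime_spectrum A"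
  shows "p \<in> G"
  using assms by (induction rule: generate_topology_on.induct) blast+

text \<open>The sets where \<open>a\<close> is nonzero are given as a subbasis, but they are closed
  under intersection because \<open>a * b\<close> lies outside a prime exactly when both factors do.
  So they form a basis.\<close>

lemma (in subring_set) generate_topology_prime_basic:
  assumes "generate_topology_on {{p \<in> prime_spectrum A. a \<notin> p} |a. a \<in> A} G" and "p \<in> G"
  shows "\<exists>a\<in>A. a \<notin> p \<and> {q \<in> prime_spectrum A. a \<notin> q} \<subseteq> G"
  using assms
proof (induction rule: generate_topology_on.induct)
  case (Int G H)
  then obtain a b where ab: "a \<in> A" "b \<in> A" "a \<notin> p" "b \<notin> p"
    "{q \<in> prime_spectrum A. a \<notin> q} \<subseteq> G" "{q \<in> prime_spectrum A. b \<notin> q} \<subseteq> H" by blast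
  have "p \<in> prime_spectrum A"
  proof -
    have "G \<subseteq> prime_spectrum A" using Int(1) by (induction rule: generate_topology_on.induct) blast+
    then show ?thesis using Int.prems by blast
  qed
  then have p: "is_prime A p" by (simp add: prime_spectrum_def is_prime_iff)
  have "a * b \<notin> p" using p ab unfolding is_prime_def by blast
  moreover have "a \<notin> q \<and> b \<notin> q" if q: "q \<in> prime_spectrum A" "a * b \<notin> q" for q
  proof -
    have I: "is_ideal A q" using q by (simp add: prime_spectrum_def is_prime_iff[symmetric] is_prime_def)
    then have "b * a \<in> q" if "a \<in> q" using ab that by (simp add: is_ideal_def)
    moreover have "a * b \<in> q" if "b \<in> q" using I ab that by (simp add: is_ideal_def)
    ultimately show ?thesis using q by (auto simp: mult.commute)
  qed
  ultimately show ?case using ab A_mult[OF ab(1,2)] by blast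
qed blast+

lemma closure_pointD: "z \<in> TT closure_of {x} \<Longrightarrow> openin TT G \<Longrightarrow> z \<in> G \<Longrightarrow> x \<in> G"
  by (simp add: in_closure_of)

lemma closure_pointI:
  "z \<in> topspace TT \<Longrightarrow> (\<And>G. openin TT G \<Longrightarrow> z \<in> G \<Longrightarrow> x \<in> G) \<Longrightarrow> z \<in> TT closure_of {x}"
  by (simp add: in_closure_of)

text \<open>Every nonempty relatively open subset of the closure of \<open>x\<close> contains
  \<open>x\<close>.\<close>

lemma closure_point_irreducible:
  assumes "x \<in> topspace TT"
  shows "irreducible_space (subtopology TT (TT closure_of {x}))"
proof -
  have x: "x \<in> TT closure_of {x}" by (rule closure_pointI[OF assms])
  have "x \<in> V" if VV: "openin (subtopology TT (TT closure_of {x})) V" "V \<noteq> {}" for V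
  proof -
    from VV(1) have "\<exists>G. openin TT G \<and> V = G \<inter> TT closure_of {x}"
      unfolding openin_subtopology .
    then obtain G where G: "openin TT G" "V = G \<inter> TT closure_of {x}" by (elim exE conjE)
    obtain z where "z \<in> V" using VV(2) by blast
    then have "z \<in> G" "z \<in> TT closure_of {x}" using G(2) by simp_all
    then have "x \<in> G" using closure_pointD G(1) by metis
    then show ?thesis using G(2) x by simp
  qed
  moreover have "topspace (subtopology TT (TT closure_of {x})) \<noteq> {}" using x assms by auto
  ultimately show ?thesis unfolding irreducible_space_def by blast
qed

lemma (in subring_set) prime_contract:
  assumes sub: "A \<subseteq> S" and p: "is_prime S p" shows "is_prime A (p \<inter> A)"
proof -
  have 1: "0 \<in> p" "1 \<notin> p" "\<And>a b. a \<in> p \<Longrightarrow> b \<in> p \<Longrightarrow> a + b \<in> p" "\<And>a b. a \<in> S \<Longrightarrow> b \<in> p \<Longrightarrow> a * b \<in> p"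
    "\<And>a b. a \<in> S \<Longrightarrow> b \<in> S \<Longrightarrow> a * b \<in> p \<Longrightarrow> a \<in> p \<or> b \<in> p"
    using p unfolding is_prime_def is_ideal_def by auto
  show ?thesis
    unfolding is_prime_def is_ideal_def
  proof (intro conjI ballI impI)
    show "a \<in> p \<inter> A \<or> b \<in> p \<inter> A" if "a \<in> A" "b \<in> A" "a * b \<in> p \<inter> A" for a b
      using 1(5)[of a b] that sub by auto
  qed (use 1(1-4) sub in auto)
qed

section \<open>Affine open sets and stalks of the curve\<close>

locale curve =
  fixes K :: "'f::field set" and C :: "('p, 'f) scheme_data" and Q :: 'p
    and n :: nat and c :: "nat \<Rightarrow> 'f"
  assumes regular_curve: "regular_projective_curve K C"
    and rational: "rational_point K C Q"
    and immersion: "closed_immersion_in_projective_space K C n c"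
begin

abbreviation "pts \<equiv> topspace (space C)"
abbreviation "St \<equiv> stalk C"
abbreviation "Mx \<equiv> max_ideal C"

lemma curve_props:
  "irreducible_space (space C)" "x \<in> pts \<Longrightarrow> \<exists>U. x \<in> U \<and> affine_open C U"
  "subfield K Fr" "x \<in> pts \<Longrightarrow> K \<subseteq> St x" "x \<in> pts \<Longrightarrow> regular_local_ring (St x)"
  "topological_dim (space C) = 1"
  using regular_curve
  by (auto simp: regular_projective_curve_def integral_scheme_def projective_over_def scheme_over_def
      regular_scheme_def)

lemma K_subring: "subring_set K"
  using subfieldE(1)[OF curve_props(3)] by (simp add: subring_set_iff)

sublocale subfield_set K
proof -
  interpret R: subring_set K by (rule K_subring)
  have U: "Units (sub K) = K - {0}" using subfield.subfield_Units[OF curve_props(3)] by simp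
  have "inverse a \<in> K" if "a \<in> K" for a
  proof (cases "a = 0")
    case False
    then have "a \<in> Units (sub K)" using U that by blast
    then show ?thesis by (simp add: R.units_iff)
  qed simp
  then show "subfield_set K" by unfold_locales simp_all
qed

lemma stalk_subring: "x \<in> pts \<Longrightarrow> subring_set (St x)"
  using curve_props(5) by (simp add: regular_local_ring_def subring_set_iff)

lemma Mx_iff: "x \<in> pts \<Longrightarrow> a \<in> Mx x \<longleftrightarrow> a \<in> St x \<and> (a = 0 \<or> inverse a \<notin> St x)"
  unfolding max_ideal_def by (rule subring_set.non_units_iff[OF stalk_subring])

lemma Mx_ideal: assumes "x \<in> pts" shows "is_ideal (St x) (Mx x)" "1 \<notin> Mx x"
proof -
  have "maximalideal (Mx x) (sub (St x))"
    using curve_props(5)[OF assms] by (simp add: regular_local_ring_def max_ideal_def)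
  then show "is_ideal (St x) (Mx x)"
    by (simp add: subring_set.is_ideal_iff[OF stalk_subring[OF assms]] maximalideal_def)
  show "1 \<notin> Mx x" using subring_set.A_1[OF stalk_subring[OF assms]] by (simp add: Mx_iff[OF assms])
qed

lemma aff_open: assumes "affine_open C U" shows "openin (space C) U" "U \<noteq> {}" "U \<subseteq> pts"
  using assms openin_subset[of "space C" U] by (auto simp: affine_open_def Let_def)

lemma aff_subring: "affine_open C U \<Longrightarrow> subring_set (sections C U)"
  by (simp add: affine_open_def Let_def subring_set_iff)

lemma aff_frac:
  assumes "affine_open C U"
  shows "\<exists>a\<in>sections C U. \<exists>b\<in>sections C U. b \<noteq> 0 \<and> f = a / b"
proof -
  have "\<forall>f. \<exists>a\<in>sections C U. \<exists>b\<in>sections C U - {0}. f = a / b"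
    using assms unfolding affine_open_def Let_def by blast
  then show ?thesis by blast
qed

lemma aff_stalk:
  assumes "affine_open C U" "x \<in> U"
  shows "St x = {a / b |a b. a \<in> sections C U \<and> b \<in> sections C U \<and> b \<notin> Mx x}"
  using assms by (simp add: affine_open_def Let_def)

lemma sections_stalk: "a \<in> sections C U \<Longrightarrow> x \<in> U \<Longrightarrow> a \<in> St x"
  by (simp add: sections_def)

lemma topspace_Spec:
  assumes "subring_set A" shows "topspace (Spec A) = prime_spectrum A"
proof -
  interpret subring_set A by fact
  have "\<And>p. p \<in> prime_spectrum A \<Longrightarrow> 1 \<notin> p"
    by (simp add: prime_spectrum_def is_prime_iff[symmetric] is_prime_def)
  then have "prime_spectrum A = {p \<in> prime_spectrum A. 1 \<notin> p}" by blast
  then have "prime_spectrum A \<in> {{p \<in> prime_spectrum A. a \<notin> p} |a. a \<in> A}" using A_1 by blast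
  then show ?thesis unfolding Spec_def topology_generated_by_topspace by blast
qed

lemma aff_homeo:
  assumes "affine_open C U"
  shows "homeomorphic_map (subtopology (space C) U) (Spec (sections C U)) (\<lambda>x. Mx x \<inter> sections C U)"
    and "topspace (subtopology (space C) U) = U"
  using assms aff_open[OF assms] by (auto simp: affine_open_def Let_def)

lemma aff_inj: assumes "affine_open C U" shows "inj_on (\<lambda>x. Mx x \<inter> sections C U) U"
  using homeomorphic_imp_injective_map[OF aff_homeo(1)[OF assms]] aff_homeo(2)[OF assms] by simp

lemma aff_image:
  assumes "affine_open C U" shows "(\<lambda>x. Mx x \<inter> sections C U) ` U = prime_spectrum (sections C U)"
  using homeomorphic_imp_surjective_map[OF aff_homeo(1)[OF assms]] aff_homeo(2)[OF assms]
    topspace_Spec[OF aff_subring[OF assms]] by simp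

lemma prime_spectrum_iff: "subring_set A \<Longrightarrow> p \<in> prime_spectrum A \<longleftrightarrow> is_prime A p"
  by (simp add: prime_spectrum_def subring_set.is_prime_iff)

lemma aff_prime:
  assumes "affine_open C U" "x \<in> U" shows "is_prime (sections C U) (Mx x \<inter> sections C U)"
  using aff_image[OF assms(1)] assms(2) prime_spectrum_iff[OF aff_subring[OF assms(1)]] by blast

lemma aff_surj:
  assumes "affine_open C U" "is_prime (sections C U) p"
  shows "\<exists>x\<in>U. Mx x \<inter> sections C U = p"
proof -
  have "p \<in> (\<lambda>x. Mx x \<inter> sections C U) ` U"
    unfolding aff_image[OF assms(1)] using assms(2) prime_spectrum_iff[OF aff_subring[OF assms(1)]] by simp
  then show ?thesis by blast
qed

lemma aff_basic:
  assumes U: "affine_open C U" and a: "a \<in> sections C U"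
  shows "openin (space C) {x \<in> U. a \<notin> Mx x}"
proof -
  let ?A = "sections C U"
  let ?G = "{p \<in> prime_spectrum ?A. a \<notin> p}"
  have "openin (Spec ?A) ?G"
    unfolding Spec_def by (rule topology_generated_by_Basis) (use a in blast)
  then have "openin (subtopology (space C) U) {x \<in> U. Mx x \<inter> ?A \<in> ?G}"
    using openin_continuous_map_preimage[OF homeomorphic_imp_continuous_map[OF aff_homeo(1)[OF U]]]
      aff_homeo(2)[OF U] by fastforce
  moreover have "{x \<in> U. Mx x \<inter> ?A \<in> ?G} = {x \<in> U. a \<notin> Mx x}"
    using aff_prime[OF U] prime_spectrum_iff[OF aff_subring[OF U]] a by auto
  ultimately show ?thesis using openin_open_subtopology[OF aff_open(1)[OF U]] by simp
qed

lemma aff_image_open: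
  assumes U: "affine_open C U" and V: "openin (space C) V"
  shows "generate_topology_on {{p \<in> prime_spectrum (sections C U). a \<notin> p} |a. a \<in> sections C U}
    ((\<lambda>x. Mx x \<inter> sections C U) ` (V \<inter> U))"
proof -
  have "openin (subtopology (space C) U) (V \<inter> U)"
    using V by (auto simp: openin_subtopology)
  then have "openin (Spec (sections C U)) ((\<lambda>x. Mx x \<inter> sections C U) ` (V \<inter> U))"
    using homeomorphic_imp_open_map[OF aff_homeo(1)[OF U]] unfolding open_map_def by blast
  then show ?thesis unfolding Spec_def by (rule openin_topology_generated_by)
qed

text \<open>Open sets are stable under generization, and inside an affine open set generization is
  inclusion of the corresponding primes.\<close>

lemma aff_special:
  assumes U: "affine_open C U" and V: "openin (space C) V" and y: "y \<in> V" "y \<in> U" and x: "x \<in> U"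
    and sub: "Mx x \<inter> sections C U \<subseteq> Mx y"
  shows "x \<in> V"
proof -
  let ?f = "\<lambda>x. Mx x \<inter> sections C U"
  have "?f x \<in> ?f ` (V \<inter> U)"
  proof (rule generate_topology_prime_down[OF aff_image_open[OF U V]])
    show "?f y \<in> ?f ` (V \<inter> U)" using y by blast
    show "?f x \<subseteq> ?f y" using sub by blast
    show "?f x \<in> prime_spectrum (sections C U)" using aff_image[OF U] x by blast
  qed
  then obtain z where "z \<in> V" "z \<in> U" "?f x = ?f z" by blast
  then show ?thesis using inj_onD[OF aff_inj[OF U], of x z] x by simp
qed

lemma aff_nbhd:
  assumes U: "affine_open C U" and V: "openin (space C) V" and x: "x \<in> V" "x \<in> U"
  shows "\<exists>a\<in>sections C U. a \<notin> Mx x \<and> {y \<in> U. a \<notin> Mx y} \<subseteq> V"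
proof -
  let ?A = "sections C U"
  let ?f = "\<lambda>x. Mx x \<inter> ?A"
  interpret A: subring_set ?A by (rule aff_subring[OF U])
  have "?f x \<in> ?f ` (V \<inter> U)" using x by blast
  from A.generate_topology_prime_basic[OF aff_image_open[OF U V] this]
  obtain a where a: "a \<in> ?A" "a \<notin> ?f x" "{q \<in> prime_spectrum ?A. a \<notin> q} \<subseteq> ?f ` (V \<inter> U)" by blast
  have "y \<in> V" if y: "y \<in> U" "a \<notin> Mx y" for y
  proof -
    have "?f y \<in> ?f ` (V \<inter> U)" using a y aff_image[OF U] by blast
    then obtain z where "z \<in> V" "z \<in> U" "?f y = ?f z" by blast
    then show ?thesis using inj_onD[OF aff_inj[OF U], of y z] y by simp
  qed
  then show ?thesis using a by blast
qed

subsection \<open>Dimension one\<close>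

lemma chain_length_le_1:
  assumes "\<forall>i\<le>m. closedin (space C) (Z i) \<and> irreducible_space (subtopology (space C) (Z i))"
    "\<forall>i<m. Z i \<subset> Z (Suc i)"
  shows "m \<le> 1"
proof -
  have "enat m \<le> topological_dim (space C)"
    unfolding topological_dim_def by (rule Sup_upper) (use assms in blast)
  then show ?thesis using curve_props(6) by (simp add: one_enat_def)
qed

lemma exists_chain:
  "\<exists>Z :: nat \<Rightarrow> 'p set. (\<forall>i\<le>1. closedin (space C) (Z i) \<and> irreducible_space (subtopology (space C) (Z i)))
    \<and> Z 0 \<subset> Z 1"
proof (rule ccontr)
  assume neg: "\<not> ?thesis"
  have "topological_dim (space C) \<le> 0"
    unfolding topological_dim_def
  proof (rule Sup_least, clarify)
    fix m and Z :: "nat \<Rightarrow> 'p set"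
    assume Z: "\<forall>i\<le>m. closedin (space C) (Z i) \<and> irreducible_space (subtopology (space C) (Z i))"
      "\<forall>i<m. Z i \<subset> Z (Suc i)"
    have "m = 0"
    proof (rule ccontr)
      assume "m \<noteq> 0"
      then have "(\<forall>i\<le>1. closedin (space C) (Z i) \<and> irreducible_space (subtopology (space C) (Z i)))
        \<and> Z 0 \<subset> Z 1" using Z by auto
      then show False using neg by blast
    qed
    then show "enat m \<le> 0" by (simp add: zero_enat_def)
  qed
  then show False using curve_props(6) by simp
qed

text \<open>The closures of the corresponding points are formed in the whole of \<open>C\<close> and
  not in \<open>U\<close>, so that three nested primes of one chart contradict the dimension of the
  curve.\<close>

lemma no_prime_chain:
  assumes U: "affine_open C U"
    and p: "is_prime (sections C U) p0" "is_prime (sections C U) p1" "is_prime (sections C U) p2"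
    and less: "p0 \<subset> p1" "p1 \<subset> p2"
  shows False
proof -
  obtain x0 x1 x2 where x: "x0 \<in> U" "x1 \<in> U" "x2 \<in> U" "Mx x0 \<inter> sections C U = p0"
    "Mx x1 \<inter> sections C U = p1" "Mx x2 \<inter> sections C U = p2"
    using aff_surj[OF U] p by meson
  define cl where "cl x = space C closure_of {x}" for x
  have Upts: "U \<subseteq> pts" using aff_open[OF U] by simp
  have strict: "cl y \<subset> cl x" if xy: "x \<in> U" "y \<in> U" "Mx x \<inter> sections C U \<subset> Mx y \<inter> sections C U" for x y
  proof -
    have "x \<in> V" if "openin (space C) V" "y \<in> V" for V
      using aff_special[OF U that xy(2) xy(1)] xy(3) by blast
    then have "y \<in> cl x"
      unfolding cl_def by (intro closure_pointI subsetD[OF Upts xy(2)])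
    then have "{y} \<subseteq> cl x" by simp
    then have sub: "cl y \<subseteq> cl x" unfolding cl_def by (metis closure_of_minimal closedin_closure_of)
    obtain a where a: "a \<in> sections C U" "a \<in> Mx y" "a \<notin> Mx x" using xy(3) by blast
    have "x \<notin> cl y"
    proof
      assume "x \<in> cl y"
      then have "y \<in> {z \<in> U. a \<notin> Mx z}"
        unfolding cl_def using aff_basic[OF U a(1)] a(3) xy(1) by (rule_tac closure_pointD) simp_all
      then show False using a(2) by blast
    qed
    moreover have "x \<in> cl x" unfolding cl_def by (intro closure_pointI subsetD[OF Upts xy(1)])
    ultimately show ?thesis using sub by blast
  qed
  \<comment> \<open>The order is reversed: the largest prime has the smallest closure.\<close>
  define Z where "Z = (\<lambda>i::nat. if i = 0 then cl x2 else if i = 1 then cl x1 else cl x0)"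
  have cl: "closedin (space C) (cl x) \<and> irreducible_space (subtopology (space C) (cl x))" if "x \<in> U" for x
    unfolding cl_def by (intro conjI closedin_closure_of closure_point_irreducible subsetD[OF Upts that])
  have "cl x2 \<subset> cl x1" "cl x1 \<subset> cl x0" using strict x less by simp_all
  then have "\<forall>i<2. Z i \<subset> Z (Suc i)" by (simp add: Z_def less_2_cases_iff)
  moreover have "\<forall>i\<le>2. closedin (space C) (Z i) \<and> irreducible_space (subtopology (space C) (Z i))"
    using cl x by (simp add: Z_def)
  ultimately show False using chain_length_le_1[of 2 Z] by simp
qed

lemma zero_prime: "subring_set A \<Longrightarrow> is_prime A {0}"
  by (simp add: is_prime_def is_ideal_def subring_set.A_0)

lemma zero_in_prime: "is_prime A p \<Longrightarrow> 0 \<in> p" by (simp add: is_prime_def is_ideal_def)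

lemma nonzero_prime_maximal:
  assumes U: "affine_open C U" and "is_prime (sections C U) p" "is_prime (sections C U) q"
    and "p \<noteq> {0}" "p \<subseteq> q"
  shows "p = q"
  using no_prime_chain[OF U zero_prime[OF aff_subring[OF U]] assms(2,3)] assms zero_in_prime by blast

text \<open>Primes of the stalk contract to primes of the ring of an affine neighbourhood.
  Strictness survives because a numerator differs from its fraction by a unit of the stalk.\<close>

lemma krull_dim_stalk: assumes x: "x \<in> pts" shows "krull_dim (St x) \<le> 1"
  unfolding krull_dim_def
proof (rule Sup_least, clarify)
  fix m and p :: "nat \<Rightarrow> 'f set"
  assume p: "\<forall>i\<le>m. p i \<in> prime_spectrum (St x)" "\<forall>i<m. p i \<subset> p (Suc i)"
  obtain U where U: "x \<in> U" "affine_open C U" using curve_props(2)[OF x] by blast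
  let ?A = "sections C U"
  interpret A: subring_set ?A by (rule aff_subring[OF U(2)])
  interpret S: subring_set "St x" by (rule stalk_subring[OF x])
  have AS: "?A \<subseteq> St x" using sections_stalk U by blast
  have pr: "is_prime (St x) (p i)" if "i \<le> m" for i
    using p(1) that prime_spectrum_iff[OF stalk_subring[OF x]] by blast
  have con: "is_prime ?A (p i \<inter> ?A)" if "i \<le> m" for i
    by (rule A.prime_contract[OF AS pr[OF that]])
  have strict: "p i \<inter> ?A \<subset> p (Suc i) \<inter> ?A" if i: "i < m" for i
  proof -
    obtain z where z: "z \<in> p (Suc i)" "z \<notin> p i" using p(2) i by blast
    have I: "is_ideal (St x) (p (Suc i))" "is_ideal (St x) (p i)"
      using pr[of i] pr[of "Suc i"] i by (simp_all add: is_prime_def)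
    have "z \<in> St x" using z I by (auto simp: is_ideal_def)
    then obtain a b where ab: "a \<in> ?A" "b \<in> ?A" "b \<notin> Mx x" "z = a / b"
      using aff_stalk[OF U(2,1)] by blast
    have b: "b \<noteq> 0" "inverse b \<in> St x" using ab AS Mx_iff[OF x] by auto
    have eq: "a = b * z" using ab b by simp
    have "b * z \<in> p (Suc i)" using I(1) z(1) subsetD[OF AS ab(2)] by (simp add: is_ideal_def)
    then have "a \<in> p (Suc i)" by (simp only: eq)
    moreover have "a \<notin> p i"
    proof
      assume "a \<in> p i"
      then have "inverse b * a \<in> p i" using I(2) b by (simp add: is_ideal_def)
      then show False using z ab by (simp add: divide_inverse mult.commute)
    qed
    moreover have "p i \<subset> p (Suc i)" using p(2) i by blast
    ultimately show ?thesis using ab by blast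
  qed
  have "m \<le> 1"
  proof (rule ccontr)
    assume m: "\<not> m \<le> 1"
    then show False
      using no_prime_chain[OF U(2) con[of 0] con[of 1] con[of 2]] strict[of 0] strict[of 1]
      by (simp add: numeral_2_eq_2)
  qed
  then show "enat m \<le> 1" by (simp add: one_enat_def)
qed

text \<open>In dimension at most one, regularity leaves at most one generator for the maximal
  ideal.\<close>

lemma stalk_principal:
  assumes x: "x \<in> pts"
  shows "Mx x = {0} \<or> (\<exists>\<pi>\<in>St x. \<pi> \<noteq> 0 \<and> Mx x = {r * \<pi> |r. r \<in> St x})"
proof -
  interpret S: subring_set "St x" by (rule stalk_subring[OF x])
  interpret R: cring "sub (St x)" by (rule S.cring_sub)
  obtain G where G: "finite G" "G \<subseteq> St x" "enat (card G) = krull_dim (St x)"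
    "Mx x = Idl\<^bsub>sub (St x)\<^esub> G"
    using curve_props(5)[OF x] by (auto simp: regular_local_ring_def max_ideal_def)
  have z: "ideal {0} (sub (St x))" using R.zeroideal by simp
  have "card G \<le> 1" using G(3) krull_dim_stalk[OF x] by (simp flip: G(3) add: one_enat_def)
  then consider "G = {}" | \<pi> where "G = {\<pi>}"
    using G(1) by (metis card_1_singletonE card_eq_0_iff le_0_eq le_SucE One_nat_def)
  then show ?thesis
  proof cases
    case 1
    then have "Mx x \<subseteq> {0}" unfolding G(4) using R.genideal_minimal[OF z, of "{}"] by simp
    then show ?thesis using Mx_ideal[OF x] by (auto simp: is_ideal_def)
  next
    case 2
    then have \<pi>: "\<pi> \<in> St x" using G by simp
    have "Mx x = PIdl\<^bsub>sub (St x)\<^esub> \<pi>" unfolding G(4) 2 using R.cgenideal_eq_genideal[of \<pi>] \<pi> by simp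
    then have M: "Mx x = {r * \<pi> |r. r \<in> St x}" using S.PIdl_iff[OF \<pi>] by simp
    show ?thesis
    proof (cases "\<pi> = 0")
      case True
      then have "Mx x \<subseteq> {0}" using M by auto
      then have "Mx x = {0}" using Mx_ideal(1)[OF x] by (auto simp: is_ideal_def)
      then show ?thesis by simp
    qed (use M \<pi> in blast)
  qed
qed

lemma generic_stalk: assumes x: "x \<in> pts" "Mx x = {0}" shows "St x = UNIV"
proof -
  obtain U where U: "x \<in> U" "affine_open C U" using curve_props(2)[OF x(1)] by blast
  have "f \<in> St x" for f using aff_frac[OF U(2), of f] aff_stalk[OF U(2,1)] x(2) by blast
  then show ?thesis by blast
qed

lemma stalk_frac:
  assumes x: "x \<in> pts" shows "\<exists>a\<in>St x. \<exists>b\<in>St x - {0}. f = a / b"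
proof -
  obtain U where U: "x \<in> U" "affine_open C U" using curve_props(2)[OF x(1)] by blast
  then show ?thesis using aff_frac[OF U(2), of f] sections_stalk[OF _ U(1)] by blast
qed

lemma Mx_sections_nonzero:
  assumes U: "affine_open C U" "x \<in> U" and M: "Mx x \<noteq> {0}"
  shows "Mx x \<inter> sections C U \<noteq> {0}"
proof -
  have x: "x \<in> pts" using aff_open[OF U(1)] U(2) by blast
  have I: "is_ideal (St x) (Mx x)" by (rule Mx_ideal[OF x])
  then obtain z where z: "z \<in> Mx x" "z \<noteq> 0" using M by (auto simp: is_ideal_def)
  then have "z \<in> St x" using I by (auto simp: is_ideal_def)
  then obtain a b where ab: "a \<in> sections C U" "b \<in> sections C U" "b \<notin> Mx x" "z = a / b"
    unfolding aff_stalk[OF U] by blast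
  have "b \<in> St x" using ab sections_stalk U by blast
  then have "b * z \<in> Mx x" using I z by (simp add: is_ideal_def)
  moreover have "b \<noteq> 0" using ab I by (auto simp: is_ideal_def)
  ultimately show ?thesis using ab z by auto
qed

text \<open>A point with zero maximal ideal lies in every nonempty open set; were it closed it would
  be the only point, against dimension one. Conversely, the prime of a point with nonzero maximal
  ideal is maximal in every chart, so any other point has a neighbourhood that avoids it.\<close>

lemma closed_point_iff: "x \<in> closed_points C \<longleftrightarrow> x \<in> pts \<and> Mx x \<noteq> {0}"
proof (intro iffI conjI)
  assume c: "x \<in> closed_points C"
  then show x: "x \<in> pts" by (simp add: closed_points_def)
  show "Mx x \<noteq> {0}"
  proof
    assume M: "Mx x = {0}"
    obtain U where U: "x \<in> U" "affine_open C U" using curve_props(2)[OF x] by blast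
    have inV: "x \<in> V" if V: "openin (space C) V" "V \<noteq> {}" for V
    proof -
      obtain y where y: "y \<in> V" "y \<in> U"
        using curve_props(1) V aff_open[OF U(2)] unfolding irreducible_space_def by blast
      have "y \<in> pts" using y aff_open[OF U(2)] by blast
      then show ?thesis
        using aff_special[OF U(2) V(1) y U(1)] M Mx_ideal(1)[of y] by (auto simp: is_ideal_def)
    qed
    have "closedin (space C) {x}" using c by (simp add: closed_points_def)
    then have "openin (space C) (pts - {x})" by (simp add: closedin_def)
    then have eq: "pts = {x}" using inV[of "pts - {x}"] x by blast
    obtain Z :: "nat \<Rightarrow> 'p set" where Z:
      "\<forall>i\<le>1. closedin (space C) (Z i) \<and> irreducible_space (subtopology (space C) (Z i))" "Z 0 \<subset> Z 1"
      using exists_chain by blast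
    have Z0: "Z 0 \<noteq> {}" using Z(1)[rule_format, of 0] by (auto simp: irreducible_space_def)
    have "closedin (space C) (Z 1)" using Z(1) by simp
    then have "Z 1 \<subseteq> {x}" using closedin_subset eq by metis
    then have "Z 0 \<subset> {x}" using psubset_subset_trans[OF Z(2)] by blast
    then show False using Z0 by blast
  qed
next
  assume x: "x \<in> pts \<and> Mx x \<noteq> {0}"
  have "openin (space C) (pts - {x})"
    unfolding openin_subopen[of "space C" "pts - {x}"]
  proof
    fix y assume y: "y \<in> pts - {x}"
    obtain U where U: "y \<in> U" "affine_open C U" using curve_props(2) y by blast
    show "\<exists>V. openin (space C) V \<and> y \<in> V \<and> V \<subseteq> pts - {x}"
    proof (cases "x \<in> U")
      case False
      then show ?thesis using U aff_open[OF U(2)] by blast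
    next
      case True
      have "\<not> Mx x \<inter> sections C U \<subseteq> Mx y \<inter> sections C U"
      proof
        assume "Mx x \<inter> sections C U \<subseteq> Mx y \<inter> sections C U"
        then have "Mx x \<inter> sections C U = Mx y \<inter> sections C U"
          using nonzero_prime_maximal[OF U(2) aff_prime[OF U(2) True] aff_prime[OF U(2,1)]]
            Mx_sections_nonzero[OF U(2) True] x by blast
        then show False using inj_onD[OF aff_inj[OF U(2)], of x y] True U(1) y by blast
      qed
      then obtain a where a: "a \<in> sections C U" "a \<in> Mx x" "a \<notin> Mx y" by blast
      then show ?thesis
        using aff_basic[OF U(2) a(1)] U aff_open[OF U(2)] by (intro exI[of _ "{x \<in> U. a \<notin> Mx x}"]) blast
    qed
  qed
  then show "x \<in> closed_points C" using x by (simp add: closed_points_def closedin_def)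
qed

lemma closed_in_pts: "P \<in> closed_points C \<Longrightarrow> P \<in> pts"
  by (simp add: closed_points_def)

lemma closed_dvr:
  assumes P: "P \<in> closed_points C" shows "\<exists>\<pi>. dvr (St P) \<pi>"
proof -
  have x: "P \<in> pts" "Mx P \<noteq> {0}" using P closed_point_iff by auto
  then obtain \<pi> where \<pi>: "\<pi> \<in> St P" "\<pi> \<noteq> 0" "Mx P = {r * \<pi> |r. r \<in> St P}"
    using stalk_principal[OF x(1)] by blast
  have "dvr (St P) \<pi>"
    by (intro dvr.intro dvr_axioms.intro stalk_subring stalk_frac x(1))
      (use \<pi> curve_props(5)[OF x(1)] in \<open>auto simp: regular_local_ring_def max_ideal_def\<close>)
  then show ?thesis ..
qed

lemma ord_at_eq_val:
  assumes P: "P \<in> closed_points C" and d: "dvr (St P) \<pi>" and f: "f \<noteq> 0"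
  shows "ord_at C P f = dvr.val (St P) \<pi> f"
proof -
  interpret D: dvr "St P" \<pi> by fact
  have piM: "max_ideal C P = PIdl\<^bsub>sub (St P)\<^esub> \<pi>"
    unfolding max_ideal_def using D.pi D.PIdl_iff by simp
  show ?thesis
    unfolding ord_at_def
  proof (rule the_equality)
    show "\<exists>\<pi>\<in>St P. \<exists>u\<in>Units (sub (St P)). max_ideal C P = PIdl\<^bsub>sub (St P)\<^esub> \<pi> \<and> f = u * \<pi> powi D.val f"
      using D.val_decomp[OF f] piM D.pi(1) by blast
    fix m assume "\<exists>\<pi>\<in>St P. \<exists>u\<in>Units (sub (St P)). max_ideal C P = PIdl\<^bsub>sub (St P)\<^esub> \<pi> \<and> f = u * \<pi> powi m"
    then obtain p u where "p \<in> St P" "u \<in> Units (sub (St P))" "max_ideal C P = PIdl\<^bsub>sub (St P)\<^esub> p"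
      "f = u * p powi m" by blast
    then show "m = D.val f" using D.val_eq_other_uniformizer[of p u f m] by (simp add: max_ideal_def)
  qed
qed

context
  fixes P assumes P: "P \<in> closed_points C"
begin

lemma
  shows ord_at_mult: "f \<noteq> 0 \<Longrightarrow> g \<noteq> 0 \<Longrightarrow> ord_at C P (f * g) = ord_at C P f + ord_at C P g"
    and ord_at_add: "f \<noteq> 0 \<Longrightarrow> g \<noteq> 0 \<Longrightarrow> f + g \<noteq> 0 \<Longrightarrow> min (ord_at C P f) (ord_at C P g) \<le> ord_at C P (f + g)"
    and ord_at_uniformizer: "\<exists>\<pi>. \<pi> \<noteq> 0 \<and> ord_at C P \<pi> = 1"
    and ord_at_nonneg: "f \<noteq> 0 \<Longrightarrow> 0 \<le> ord_at C P f \<longleftrightarrow> f \<in> St P"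
    and ord_at_pos: "f \<noteq> 0 \<Longrightarrow> 1 \<le> ord_at C P f \<longleftrightarrow> f \<in> Mx P"
proof -
  obtain \<pi> where d: "dvr (St P) \<pi>" using closed_dvr[OF P] by blast
  interpret D: dvr "St P" \<pi> by fact
  note eq = ord_at_eq_val[OF P d]
  show "f \<noteq> 0 \<Longrightarrow> g \<noteq> 0 \<Longrightarrow> ord_at C P (f * g) = ord_at C P f + ord_at C P g" by (simp add: eq D.val_mult)
  show "f \<noteq> 0 \<Longrightarrow> g \<noteq> 0 \<Longrightarrow> f + g \<noteq> 0 \<Longrightarrow> min (ord_at C P f) (ord_at C P g) \<le> ord_at C P (f + g)"
    using D.val_add by (simp add: eq)
  show "\<exists>\<pi>. \<pi> \<noteq> 0 \<and> ord_at C P \<pi> = 1" using D.pi(2) eq[OF D.pi(2)] D.val_pi by (intro exI[of _ \<pi>]) simp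
  show "f \<noteq> 0 \<Longrightarrow> 0 \<le> ord_at C P f \<longleftrightarrow> f \<in> St P" by (simp add: eq D.val_nonneg_iff)
  show "f \<noteq> 0 \<Longrightarrow> 1 \<le> ord_at C P f \<longleftrightarrow> f \<in> Mx P" by (simp add: eq max_ideal_def D.non_units_val)
qed

lemma val_ge_0: "val_ge (ord_at C) P 0 = St P"
proof (rule Set.set_eqI)
  fix f show "f \<in> val_ge (ord_at C) P 0 \<longleftrightarrow> f \<in> St P"
    using ord_at_nonneg[of f] subring_set.A_0[OF stalk_subring[OF closed_in_pts[OF P]]]
    by (cases "f = 0") (simp_all add: val_ge_def)
qed

lemma val_ge_1: "val_ge (ord_at C) P 1 = Mx P"
proof (rule Set.set_eqI)
  fix f show "f \<in> val_ge (ord_at C) P 1 \<longleftrightarrow> f \<in> Mx P"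
    using ord_at_pos[of f] Mx_ideal(1)[OF closed_in_pts[OF P]]
    by (cases "f = 0") (simp_all add: val_ge_def is_ideal_def)
qed

end

lemma ord_at_K:
  assumes P: "P \<in> closed_points C" and k: "k \<in> K" "k \<noteq> 0" shows "ord_at C P k = 0"
proof -
  have "k \<in> St P" "inverse k \<in> St P" using curve_props(4)[OF closed_in_pts[OF P]] k K_inverse by auto
  then have "0 \<le> ord_at C P k" "\<not> 1 \<le> ord_at C P k"
    using ord_at_nonneg[OF P] ord_at_pos[OF P] Mx_iff[OF closed_in_pts[OF P]] k by auto
  then show ?thesis by simp
qed

end

subsection \<open>Homogeneous forms\<close>

text \<open>These are the values in the field, not formal monomials. Only spans are taken, so
  coincidences among the values are harmless.\<close>

definition mons :: "(nat \<Rightarrow> 'f::field) \<Rightarrow> nat \<Rightarrow> nat \<Rightarrow> 'f set"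
  where "mons b n N = {\<Prod>j\<le>n. b j ^ \<alpha> j |\<alpha>. (\<Sum>j\<le>n. \<alpha> j) = N}"

lemma monsI: "(\<Sum>j\<le>n. \<alpha> j) = N \<Longrightarrow> (\<Prod>j\<le>n. b j ^ \<alpha> j) \<in> mons b n N"
  unfolding mons_def by blast

lemma mons_mult: assumes "x \<in> mons b n N" "y \<in> mons b n M" shows "x * y \<in> mons b n (N + M)"
proof -
  obtain \<alpha> \<beta> where "x = (\<Prod>j\<le>n. b j ^ \<alpha> j)" "(\<Sum>j\<le>n. \<alpha> j) = N"
    "y = (\<Prod>j\<le>n. b j ^ \<beta> j)" "(\<Sum>j\<le>n. \<beta> j) = M" using assms unfolding mons_def by blast
  then show ?thesis using monsI[of "\<lambda>j. \<alpha> j + \<beta> j" n "N + M" b]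
    by (simp add: power_add prod.distrib sum.distrib)
qed

lemma mons_0: "mons b n 0 = {1}"
proof -
  have "(\<Prod>j\<le>n. b j ^ (0::nat)) \<in> mons b n 0" by (rule monsI) simp
  moreover have "m = 1" if "m \<in> mons b n 0" for m using that unfolding mons_def by auto
  ultimately show ?thesis by auto
qed

lemma mons_power: assumes "i \<le> n" shows "b i ^ k \<in> mons b n k"
proof -
  have "(\<Prod>j\<le>n. b j ^ (if j = i then k else 0)) = (\<Prod>j\<le>n. if j = i then b i ^ k else 1)"
    by (intro prod.cong) auto
  also have "\<dots> = b i ^ k" using assms by simp
  finally show ?thesis using monsI[of "\<lambda>j. if j = i then k else 0" n k b] assms by simp
qed

lemma reduce_exponent:
  fixes b :: "nat \<Rightarrow> 'f::field"
  assumes i: "i \<le> n" "M \<le> \<alpha> i"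
  shows "\<exists>\<beta>. (\<Sum>j\<le>n. \<alpha> j) = M + (\<Sum>j\<le>n. \<beta> j) \<and> (\<Prod>j\<le>n. b j ^ \<alpha> j) = b i ^ M * (\<Prod>j\<le>n. b j ^ \<beta> j)"
proof -
  define \<beta> where "\<beta> = \<alpha>(i := \<alpha> i - M)"
  have \<beta>: "\<beta> i = \<alpha> i - M" "j \<noteq> i \<Longrightarrow> \<beta> j = \<alpha> j" for j by (simp_all add: \<beta>_def)
  have ii: "i \<in> {..n}" using i by simp
  have "(\<Sum>j\<le>n. \<alpha> j) = \<alpha> i + sum \<alpha> ({..n} - {i})" by (rule sum.remove[OF _ ii]) simp
  moreover have "(\<Sum>j\<le>n. \<beta> j) = \<beta> i + sum \<beta> ({..n} - {i})" by (rule sum.remove[OF _ ii]) simp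
  moreover have "sum \<beta> ({..n} - {i}) = sum \<alpha> ({..n} - {i})" by (rule sum.cong) (auto simp: \<beta>(2))
  ultimately have 1: "(\<Sum>j\<le>n. \<alpha> j) = M + (\<Sum>j\<le>n. \<beta> j)" using \<beta>(1) i by simp
  have "(\<Prod>j\<le>n. b j ^ \<alpha> j) = b i ^ \<alpha> i * (\<Prod>j\<in>{..n} - {i}. b j ^ \<alpha> j)" by (rule prod.remove[OF _ ii]) simp
  moreover have "(\<Prod>j\<le>n. b j ^ \<beta> j) = b i ^ \<beta> i * (\<Prod>j\<in>{..n} - {i}. b j ^ \<beta> j)"
    by (rule prod.remove[OF _ ii]) simp
  moreover have "(\<Prod>j\<in>{..n} - {i}. b j ^ \<beta> j) = (\<Prod>j\<in>{..n} - {i}. b j ^ \<alpha> j)"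
    by (rule prod.cong) (auto simp: \<beta>(2))
  moreover have "b i ^ \<alpha> i = b i ^ M * b i ^ \<beta> i" using \<beta>(1) i by (simp add: power_add[symmetric])
  ultimately have "(\<Prod>j\<le>n. b j ^ \<alpha> j) = b i ^ M * (\<Prod>j\<le>n. b j ^ \<beta> j)" by (simp add: mult.assoc)
  then show ?thesis using 1 by blast
qed

text \<open>If all \<open>n + 1\<close> exponents were below \<open>M\<close>, the degree would be
  below \<open>Suc n * M\<close>.\<close>

lemma mons_split:
  assumes "m \<in> mons b n N" "Suc n * M \<le> N"
  shows "\<exists>i\<le>n. \<exists>m'\<in>mons b n (N - M). m = b i ^ M * m'"
proof -
  obtain \<alpha> where \<alpha>: "m = (\<Prod>j\<le>n. b j ^ \<alpha> j)" "(\<Sum>j\<le>n. \<alpha> j) = N"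
    using assms(1) unfolding mons_def by blast
  have "\<exists>i\<le>n. M \<le> \<alpha> i"
  proof (rule ccontr)
    assume "\<not> ?thesis"
    then have "(\<Sum>j\<le>n. \<alpha> j) < (\<Sum>j\<le>n. M)" by (intro sum_strict_mono) auto
    then show False using \<alpha>(2) assms(2) by simp
  qed
  then obtain i where i: "i \<le> n" "M \<le> \<alpha> i" by blast
  obtain \<beta> where \<beta>: "(\<Sum>j\<le>n. \<alpha> j) = M + (\<Sum>j\<le>n. \<beta> j)"
    "(\<Prod>j\<le>n. b j ^ \<alpha> j) = b i ^ M * (\<Prod>j\<le>n. b j ^ \<beta> j)"
    using reduce_exponent[where b = b and \<alpha> = \<alpha>, OF i] by blast
  have "m = b i ^ M * (\<Prod>j\<le>n. b j ^ \<beta> j)" using \<alpha>(1) \<beta>(2) by simp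
  moreover have "(\<Prod>j\<le>n. b j ^ \<beta> j) \<in> mons b n (N - M)" using monsI[of \<beta> n "N - M" b] \<alpha>(2) \<beta>(1) by simp
  ultimately show ?thesis using i(1) by blast
qed

lemma finite_mons: "finite (mons b n N)"
proof (induction N)
  case 0
  then show ?case by (simp add: mons_0)
next
  case (Suc N)
  have "mons b n (Suc N) \<subseteq> (\<Union>i\<in>{..n}. (*) (b i) ` mons b n N)"
  proof
    fix m assume "m \<in> mons b n (Suc N)"
    then obtain \<alpha> where \<alpha>: "m = (\<Prod>j\<le>n. b j ^ \<alpha> j)" "(\<Sum>j\<le>n. \<alpha> j) = Suc N"
      unfolding mons_def by blast
    then obtain i where i: "i \<le> n" "\<alpha> i \<noteq> 0" by (metis atMost_iff sum.neutral nat.distinct(1))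
    obtain \<beta> where \<beta>: "(\<Sum>j\<le>n. \<alpha> j) = 1 + (\<Sum>j\<le>n. \<beta> j)"
      "(\<Prod>j\<le>n. b j ^ \<alpha> j) = b i ^ 1 * (\<Prod>j\<le>n. b j ^ \<beta> j)"
      using reduce_exponent[OF i(1), of 1 \<alpha>] i(2) by (metis Suc_leI neq0_conv One_nat_def)
    have "m = b i * (\<Prod>j\<le>n. b j ^ \<beta> j)" using \<alpha>(1) \<beta>(2) by simp
    moreover have "(\<Prod>j\<le>n. b j ^ \<beta> j) \<in> mons b n N" using monsI[of \<beta> n N b] \<alpha>(2) \<beta>(1) by simp
    ultimately show "m \<in> (\<Union>i\<in>{..n}. (*) (b i) ` mons b n N)" using i(1) by blast
  qed
  then show ?case using Suc by (meson finite_UN_I finite_atMost finite_imageI finite_subset)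
qed

context subfield_set
begin

definition ksub :: "'f set \<Rightarrow> bool"
  where "ksub Z \<longleftrightarrow> 0 \<in> Z \<and> (\<forall>a\<in>Z. \<forall>b\<in>Z. a + b \<in> Z) \<and> (\<forall>k\<in>K. \<forall>a\<in>Z. k * a \<in> Z)"

definition kspan :: "'f set \<Rightarrow> 'f set"
  where "kspan S = {\<Sum>m\<in>S. k m * m |k. \<forall>m\<in>S. k m \<in> K}"

lemma kspan_subset: assumes "ksub Z" "S \<subseteq> Z" shows "kspan S \<subseteq> Z"
proof
  fix x assume "x \<in> kspan S"
  then obtain k where k: "x = (\<Sum>m\<in>S. k m * m)" "\<forall>m\<in>S. k m \<in> K" by (auto simp: kspan_def)
  have "(\<Sum>m\<in>T. k m * m) \<in> Z" if "T \<subseteq> S" for T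
    using that by (induction T rule: infinite_finite_induct) (use assms k in \<open>auto simp: ksub_def\<close>)
  then show "x \<in> Z" using k by blast
qed

lemma ksub_kspan: "ksub (kspan S)"
  unfolding ksub_def
proof (intro conjI ballI)
  show "0 \<in> kspan S" unfolding kspan_def by (auto intro!: exI[of _ "\<lambda>_. 0"])
  fix a b assume "a \<in> kspan S" "b \<in> kspan S"
  then obtain k l where "a = (\<Sum>m\<in>S. k m * m)" "\<forall>m\<in>S. k m \<in> K" "b = (\<Sum>m\<in>S. l m * m)" "\<forall>m\<in>S. l m \<in> K"
    by (auto simp: kspan_def)
  then show "a + b \<in> kspan S" unfolding kspan_def
    by (auto simp: sum.distrib[symmetric] distrib_right intro!: exI[of _ "\<lambda>m. k m + l m"])
next
  fix c a assume "c \<in> K" "a \<in> kspan S"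
  then obtain k where "a = (\<Sum>m\<in>S. k m * m)" "\<forall>m\<in>S. k m \<in> K" by (auto simp: kspan_def)
  then show "c * a \<in> kspan S" unfolding kspan_def using \<open>c \<in> K\<close>
    by (auto simp: sum_distrib_left mult.assoc intro!: exI[of _ "\<lambda>m. c * k m"])
qed

lemma kspan_add: "a \<in> kspan S \<Longrightarrow> b \<in> kspan S \<Longrightarrow> a + b \<in> kspan S"
  using ksub_kspan[of S] by (simp add: ksub_def)

lemma kspan_smult: "c \<in> K \<Longrightarrow> a \<in> kspan S \<Longrightarrow> c * a \<in> kspan S"
  using ksub_kspan[of S] by (simp add: ksub_def)

lemma kspan_0: "0 \<in> kspan S"
  using ksub_kspan[of S] by (simp add: ksub_def)

lemma kspan_base: assumes "finite S" "m \<in> S" shows "m \<in> kspan S"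
proof -
  have "(\<Sum>m'\<in>S. (if m' = m then 1 else 0) * m') = (\<Sum>m'\<in>S. if m' = m then m else 0)"
    by (intro sum.cong) auto
  also have "\<dots> = m" using assms by simp
  finally show ?thesis unfolding kspan_def by (auto intro!: exI[of _ "\<lambda>m'. if m' = m then 1 else 0"])
qed

abbreviation "forms b n N \<equiv> kspan (mons b n N)"

lemma forms_mult:
  assumes x: "x \<in> forms b n N" and y: "y \<in> forms b n M" shows "x * y \<in> forms b n (N + M)"
proof -
  have base: "m * m' \<in> forms b n (N + M)" if "m \<in> mons b n N" "m' \<in> mons b n M" for m m'
    by (intro kspan_base finite_mons mons_mult that)
  have 1: "m * y \<in> forms b n (N + M)" if m: "m \<in> mons b n N" for m
  proof -
    have "ksub {z. m * z \<in> forms b n (N + M)}"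
      unfolding ksub_def by (auto simp: distrib_left kspan_0 kspan_add mult.left_commute kspan_smult)
    then show ?thesis using kspan_subset[of "{z. m * z \<in> forms b n (N + M)}" "mons b n M"] base[OF m] y by blast
  qed
  have "ksub {z. z * y \<in> forms b n (N + M)}"
    unfolding ksub_def by (auto simp: distrib_right kspan_0 kspan_add mult.assoc kspan_smult)
  then show ?thesis using kspan_subset[of "{z. z * y \<in> forms b n (N + M)}" "mons b n N"] 1 x by blast
qed

lemma forms_power: "i \<le> n \<Longrightarrow> b i ^ k \<in> forms b n k"
  by (intro kspan_base finite_mons mons_power)

lemma forms_const: "k \<in> K \<Longrightarrow> k \<in> forms b n 0"
  using kspan_smult[of k 1 "mons b n 0"] kspan_base[of "mons b n 0" 1] by (simp add: mons_0)

text \<open>The polynomial ring maps onto the coordinate ring of a chart; clearing denominators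
  turns a section into a form.\<close>

lemma section_form:
  assumes z: "z \<in> generate_ring Fr (K \<union> {c j / c i |j. j \<le> n})" and i: "i \<le> n"
    and b: "b i \<noteq> 0" "\<And>j. j \<le> n \<Longrightarrow> b j / b i = c j / c i"
  shows "\<exists>N. z * b i ^ N \<in> forms b n N"
  using z
proof (induction rule: generate_ring.induct)
  case one
  then show ?case using forms_const[OF K_1] by (intro exI[of _ 0]) simp
next
  case (incl h)
  then consider "h \<in> K" | j where "j \<le> n" "h = c j / c i" by blast
  then show ?case
  proof cases
    case 1
    then show ?thesis using forms_const by (intro exI[of _ 0]) simp
  next
    case 2
    then have "h * b i = b j" using b(2)[of j] b(1) by (simp add: field_simps)
    then show ?thesis using forms_power[OF 2(1), of b 1] by (intro exI[of _ 1]) simp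
  qed
next
  case (a_inv h)
  then obtain N where "h * b i ^ N \<in> forms b n N" by blast
  from kspan_smult[OF K_uminus[OF K_1] this] show ?case by (intro exI[of _ N]) simp
next
  case (eng_add h1 h2)
  then obtain N1 N2 where N: "h1 * b i ^ N1 \<in> forms b n N1" "h2 * b i ^ N2 \<in> forms b n N2" by blast
  have "h1 * b i ^ N1 * b i ^ N2 + b i ^ N1 * (h2 * b i ^ N2) \<in> forms b n (N1 + N2)"
    by (intro kspan_add forms_mult forms_power N i)
  then show ?case by (intro exI[of _ "N1 + N2"]) (simp add: algebra_simps power_add)
next
  case (eng_mult h1 h2)
  then obtain N1 N2 where N: "h1 * b i ^ N1 \<in> forms b n N1" "h2 * b i ^ N2 \<in> forms b n N2" by blast
  have "(h1 * b i ^ N1) * (h2 * b i ^ N2) \<in> forms b n (N1 + N2)"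
    by (intro forms_mult N)
  then show ?case by (intro exI[of _ "N1 + N2"]) (simp add: algebra_simps power_add)
qed

text \<open>A regular function on a projective scheme acts on the forms of large degree: by the pigeonhole
  principle every monomial contains a high power of some coordinate.\<close>

lemma forms_stable:
  assumes R: "subring_set R" and W: "is_ideal R W" and KR: "K \<subseteq> R"
    and b: "\<And>j. j \<le> n \<Longrightarrow> b j \<in> R" and y: "y \<in> R"
    and loc: "\<And>i. i \<le> n \<Longrightarrow> \<exists>N. \<exists>h\<in>forms b n N. y * b i ^ N - h \<in> W"
  shows "\<exists>N0. \<forall>N\<ge>N0. \<forall>h\<in>forms b n N. \<exists>h'\<in>forms b n N. y * h - h' \<in> W"
proof -
  interpret R: subring_set R by fact
  have "\<forall>i\<in>{..n}. \<exists>N. \<exists>h\<in>forms b n N. y * b i ^ N - h \<in> W" using loc by simp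
  from bchoice[OF this] obtain e where e: "\<forall>i\<in>{..n}. \<exists>h\<in>forms b n (e i). y * b i ^ e i - h \<in> W" ..
  define M where "M = (\<Sum>i\<le>n. e i)"
  have eM: "e i \<le> M" if "i \<le> n" for i unfolding M_def by (rule member_le_sum) (use that in auto)
  have monsR: "mons b n N \<subseteq> R" for N unfolding mons_def by (auto intro!: R.A_prod R.A_power b)
  have W_mult: "a * w \<in> W" "w * a \<in> W" if "a \<in> R" "w \<in> W" for a w
    using W that by (auto simp: is_ideal_def mult.commute)
  have "\<exists>h'\<in>forms b n N. y * h - h' \<in> W" if N: "Suc n * M \<le> N" and h: "h \<in> forms b n N" for N h
  proof -
    define Z where "Z = {h. \<exists>h'\<in>forms b n N. y * h - h' \<in> W}"
    have "ksub Z"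
      unfolding ksub_def
    proof (intro conjI ballI)
      show "0 \<in> Z" unfolding Z_def using kspan_0 W by (auto simp: is_ideal_def intro!: bexI[of _ 0])
      fix a a' assume "a \<in> Z" "a' \<in> Z"
      then obtain h h' where h: "h \<in> forms b n N" "h' \<in> forms b n N" "y * a - h \<in> W" "y * a' - h' \<in> W"
        by (auto simp: Z_def)
      have "(y * a - h) + (y * a' - h') \<in> W" using h W by (simp add: is_ideal_def)
      moreover have "(y * a - h) + (y * a' - h') = y * (a + a') - (h + h')" by (simp add: algebra_simps)
      ultimately show "a + a' \<in> Z" unfolding Z_def using kspan_add h by auto
    next
      fix k a assume k: "k \<in> K" "a \<in> Z"
      then obtain h where h: "h \<in> forms b n N" "y * a - h \<in> W" by (auto simp: Z_def)
      have "k * (y * a - h) \<in> W" using h W_mult k KR by blast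
      moreover have "k * (y * a - h) = y * (k * a) - k * h" by (simp add: algebra_simps)
      ultimately show "k * a \<in> Z" unfolding Z_def using kspan_smult[OF k(1)] h by auto
    qed
    moreover have "mons b n N \<subseteq> Z"
    proof
      fix m assume m: "m \<in> mons b n N"
      obtain i m' where i: "i \<le> n" "m' \<in> mons b n (N - M)" "m = b i ^ M * m'"
        using mons_split[OF m N] by blast
      obtain h where h: "h \<in> forms b n (e i)" "y * b i ^ e i - h \<in> W" using e i by auto
      define h' where "h' = h * b i ^ (M - e i) * m'"
      have MN: "M \<le> N" using N by simp
      have "h' \<in> forms b n (e i + (M - e i) + (N - M))"
        unfolding h'_def by (intro forms_mult forms_power h i kspan_base finite_mons)
      then have h'N: "h' \<in> forms b n N" using eM[OF i(1)] MN by simp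
      have "b i ^ M = b i ^ e i * b i ^ (M - e i)" using eM[OF i(1)] by (simp add: power_add[symmetric])
      then have "y * m - h' = (b i ^ (M - e i) * m') * (y * b i ^ e i - h)"
        unfolding i(3) h'_def by (simp add: algebra_simps)
      moreover have "b i ^ (M - e i) * m' \<in> R"
        by (intro R.A_mult R.A_power b i(1) subsetD[OF monsR i(2)])
      ultimately have "y * m - h' \<in> W" using W_mult h by simp
      then show "m \<in> Z" unfolding Z_def using h'N by blast
    qed
    ultimately show ?thesis using kspan_subset h unfolding Z_def by blast
  qed
  then show ?thesis by blast
qed

end

section \<open>Forms acting on residue fields and on global functions\<close>

context curve
begin

abbreviation "chart_ring i \<equiv> sections C (chart C n c i)"

lemma chart_affine: "i \<le> n \<Longrightarrow> c i \<noteq> 0 \<Longrightarrow> affine_open C (chart C n c i)"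
  and chart_ring: "i \<le> n \<Longrightarrow> c i \<noteq> 0 \<Longrightarrow> chart_ring i = generate_ring Fr (K \<union> {c j / c i |j. j \<le> n})"
  and chart_cover: "x \<in> pts \<Longrightarrow> \<exists>i\<le>n. c i \<noteq> 0 \<and> x \<in> chart C n c i"
  using immersion unfolding closed_immersion_in_projective_space_def by auto

lemma chart_pts: "x \<in> chart C n c i \<Longrightarrow> x \<in> pts" by (simp add: chart_def)

lemma K_sections: "U \<subseteq> pts \<Longrightarrow> K \<subseteq> sections C U"
  using curve_props(4) by (fastforce simp: sections_def)

text \<open>The prime of a closed point is maximal in the coordinate ring, so a denominator
  \<open>s\<close> that is nonzero at \<open>P\<close> has an inverse modulo this prime already
  among the sections.\<close>

lemma sections_onto_residue:
  assumes U: "affine_open C U" "P \<in> U" and P: "P \<in> closed_points C" and z: "z \<in> St P"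
  shows "\<exists>a\<in>sections C U. z - a \<in> Mx P"
proof -
  let ?A = "sections C U"
  interpret A: subring_set ?A by (rule aff_subring[OF U(1)])
  have x: "P \<in> pts" "Mx P \<noteq> {0}" using P closed_point_iff by auto
  interpret S: subring_set "St P" by (rule stalk_subring[OF x(1)])
  let ?p = "Mx P \<inter> ?A"
  have p: "is_prime ?A ?p" by (rule aff_prime[OF U])
  then have pI: "is_ideal ?A ?p" by (simp add: is_prime_def)
  obtain a s where as: "a \<in> ?A" "s \<in> ?A" "s \<notin> Mx P" "z = a / s" using aff_stalk[OF U] z by blast
  \<comment> \<open>If the ideal generated by the prime and \<open>s\<close> were proper, it would
    lie in a prime strictly above a nonzero prime.\<close>
  define J where "J = {m + r * s |m r. m \<in> ?p \<and> r \<in> ?A}"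
  have J: "is_ideal ?A J"
    unfolding is_ideal_def
  proof (intro conjI ballI)
    show "J \<subseteq> ?A" using as by (auto simp: J_def)
    have "0 = 0 + 0 * s" by simp
    then show "0 \<in> J" unfolding J_def using pI A.A_0 by (fastforce simp: is_ideal_def)
    fix x y assume "x \<in> J" "y \<in> J"
    then obtain m r m' r' where xy: "x = m + r * s" "y = m' + r' * s" "m \<in> ?p" "r \<in> ?A" "m' \<in> ?p" "r' \<in> ?A"
      by (auto simp: J_def)
    have "x + y = (m + m') + (r + r') * s" unfolding xy by (simp add: algebra_simps)
    moreover have "m + m' \<in> ?p" using pI xy unfolding is_ideal_def by blast
    ultimately show "x + y \<in> J" unfolding J_def using xy A.A_add by blast
  next
    fix x y assume x: "x \<in> ?A" and "y \<in> J"
    then obtain m r where y: "y = m + r * s" "m \<in> ?p" "r \<in> ?A" by (auto simp: J_def)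
    have "x * y = x * m + (x * r) * s" unfolding y by (simp add: algebra_simps)
    moreover have "x * m \<in> ?p" using pI x y unfolding is_ideal_def by blast
    ultimately show "x * y \<in> J" unfolding J_def using x y A.A_mult by blast
  qed
  have "1 \<in> J"
  proof (rule ccontr)
    assume "1 \<notin> J"
    then obtain q where q: "is_prime ?A q" "J \<subseteq> q" using A.proper_ideal_subset_prime[OF J] by blast
    have "?p \<subseteq> J"
    proof
      fix m assume "m \<in> ?p"
      moreover have "m = m + 0 * s" by simp
      ultimately show "m \<in> J" unfolding J_def using A.A_0 by blast
    qed
    then have "?p = q"
      using nonzero_prime_maximal[OF U(1) p q(1)] Mx_sections_nonzero[OF U x(2)] q(2) by blast
    moreover have "s \<in> J"
    proof -
      have "s = 0 + 1 * s" by simp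
      then show ?thesis unfolding J_def using A.A_1 zero_in_prime[OF p] by blast
    qed
    ultimately show False using q as by blast
  qed
  then obtain m r where mr: "1 = m + r * s" "m \<in> ?p" "r \<in> ?A" by (auto simp: J_def)
  have s: "s \<noteq> 0" using as(3) Mx_ideal(1)[OF x(1)] by (auto simp: is_ideal_def)
  have "z - a * r = z * (1 - r * s)" using as(4) s by (simp add: field_simps)
  also have "1 - r * s = m" using mr(1) by (simp add: diff_eq_eq)
  also have "z * m \<in> Mx P" using Mx_ideal(1)[OF x(1)] z mr(2) by (auto simp: is_ideal_def)
  finally show ?thesis using as mr by (intro bexI[of _ "a * r"]) auto
qed

text \<open>The residue field of a closed point is the set of values of the forms of some large degree.\<close>

lemma residue_field_finite:
  assumes P: "P \<in> closed_points C"
  shows "\<exists>S. finite S \<and> S \<subseteq> St P \<and> (\<forall>z\<in>St P. \<exists>h\<in>kspan S. z - h \<in> Mx P)"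
proof -
  have x: "P \<in> pts" using closed_in_pts[OF P] .
  interpret S: subring_set "St P" by (rule stalk_subring[OF x])
  have M: "is_ideal (St P) (Mx P)" by (rule Mx_ideal[OF x])
  obtain i0 where i0: "i0 \<le> n" "c i0 \<noteq> 0" "P \<in> chart C n c i0" using chart_cover[OF x] by blast
  define b where "b = (\<lambda>j. c j / c i0)"
  have b: "b j \<in> St P" if "j \<le> n" for j using i0(3) that by (simp add: b_def chart_def)
  have bi0: "b i0 = 1" using i0 by (simp add: b_def)
  \<comment> \<open>A coordinate that vanishes at \<open>P\<close> satisfies the condition with the
    zero form. If it does not vanish, \<open>P\<close> lies in the corresponding chart, whose
    sections reach the whole residue field.\<close>
  have loc: "\<exists>N. \<exists>h\<in>forms b n N. y * b i ^ N - h \<in> Mx P" if y: "y \<in> St P" and i: "i \<le> n" for y i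
  proof (cases "b i \<in> Mx P")
    case True
    then have "y * b i ^ 1 - 0 \<in> Mx P" using M y by (simp add: is_ideal_def)
    then show ?thesis using kspan_0 by blast
  next
    case False
    then have inv: "b i \<noteq> 0" "inverse (b i) \<in> St P" using b[OF i] Mx_iff[OF x] by auto
    then have ci: "c i \<noteq> 0" by (auto simp: b_def)
    have ratio: "b j / b i = c j / c i" for j using ci i0(2) by (simp add: b_def)
    have "c j / c i \<in> St P" if "j \<le> n" for j
      using S.A_mult[OF b[OF that] inv(2)] ratio[of j] by (simp add: divide_inverse)
    then have Pi: "P \<in> chart C n c i" using x by (simp add: chart_def)
    obtain a where a: "a \<in> chart_ring i" "y - a \<in> Mx P"
      using sections_onto_residue[OF chart_affine[OF i ci] Pi P y] by blast
    obtain N where N: "a * b i ^ N \<in> forms b n N"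
      using section_form[OF a(1)[unfolded chart_ring[OF i ci]] i inv(1) ratio] by blast
    have "b i ^ N * (y - a) \<in> Mx P" using M a(2) b[OF i] by (simp add: is_ideal_def)
    then have "y * b i ^ N - a * b i ^ N \<in> Mx P" by (simp add: algebra_simps)
    then show ?thesis using N by blast
  qed
  have stab: "\<exists>N0. \<forall>N\<ge>N0. \<forall>h\<in>forms b n N. \<exists>h'\<in>forms b n N. y * h - h' \<in> Mx P" if y: "y \<in> St P" for y
    by (rule forms_stable[OF stalk_subring[OF x] M curve_props(4)[OF x] b y loc[OF y]])
  have "\<forall>j\<in>{..n}. \<exists>N0. \<forall>N\<ge>N0. \<forall>h\<in>forms b n N. \<exists>h'\<in>forms b n N. b j * h - h' \<in> Mx P"
    using stab b by simp
  from bchoice[OF this] obtain N0 where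
    N0: "\<forall>j\<in>{..n}. \<forall>N\<ge>N0 j. \<forall>h\<in>forms b n N. \<exists>h'\<in>forms b n N. b j * h - h' \<in> Mx P" ..
  define N where "N = (\<Sum>j\<le>n. N0 j)"
  have N: "\<exists>h'\<in>forms b n N. b j * h - h' \<in> Mx P" if "j \<le> n" "h \<in> forms b n N" for j h
  proof -
    have "N0 j \<le> N" unfolding N_def by (rule member_le_sum) (use that in auto)
    then show ?thesis using N0 that by auto
  qed
  \<comment> \<open>\<open>Z\<close> contains \<open>1\<close> and is stable under the chart ring,
    because multiplication by a coordinate preserves degree \<open>N\<close> modulo the maximal
    ideal. Hence the forms of this one degree represent every residue.\<close>
  define Z where "Z = {z. \<exists>h\<in>forms b n N. z - h \<in> Mx P}"
  have monsS: "mons b n N \<subseteq> St P" unfolding mons_def by (auto intro!: S.A_prod S.A_power b)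
  have formsS: "forms b n N \<subseteq> St P"
    by (rule kspan_subset[OF _ monsS]) (use curve_props(4)[OF x] in \<open>auto simp: ksub_def\<close>)
  have MS: "Mx P \<subseteq> St P" using M by (simp add: is_ideal_def)
  have Zadd: "z + z' \<in> Z" if zz: "z \<in> Z" "z' \<in> Z" for z z'
  proof -
    obtain h h' where h: "h \<in> forms b n N" "h' \<in> forms b n N" "z - h \<in> Mx P" "z' - h' \<in> Mx P"
      using zz by (auto simp: Z_def)
    have "(z - h) + (z' - h') \<in> Mx P" using h M by (simp add: is_ideal_def)
    moreover have "(z - h) + (z' - h') = (z + z') - (h + h')" by (simp add: algebra_simps)
    ultimately show ?thesis unfolding Z_def using kspan_add h by auto
  qed
  have Zk: "k * z \<in> Z" if kz: "k \<in> K" "z \<in> Z" for k z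
  proof -
    obtain h where h: "h \<in> forms b n N" "z - h \<in> Mx P" using kz by (auto simp: Z_def)
    have "k * (z - h) \<in> Mx P" using h M kz curve_props(4)[OF x] by (auto simp: is_ideal_def)
    then have "k * z - k * h \<in> Mx P" by (simp add: algebra_simps)
    then show ?thesis unfolding Z_def using kspan_smult[OF kz(1)] h by auto
  qed
  have Zb: "b j * z \<in> Z" if j: "j \<le> n" and z: "z \<in> Z" for j z
  proof -
    obtain h where h: "h \<in> forms b n N" "z - h \<in> Mx P" using z by (auto simp: Z_def)
    obtain h' where h': "h' \<in> forms b n N" "b j * h - h' \<in> Mx P" using N[OF j h(1)] by blast
    have "b j * (z - h) + (b j * h - h') \<in> Mx P" using h h' M b[OF j] by (simp add: is_ideal_def)
    then have "b j * z - h' \<in> Mx P" by (simp add: algebra_simps)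
    then show ?thesis unfolding Z_def using h' by blast
  qed
  have gen: "\<forall>z\<in>Z. a * z \<in> Z" if "a \<in> generate_ring Fr (K \<union> {c j / c i0 |j. j \<le> n})" for a
    using that
  proof (induction rule: generate_ring.induct)
    case (incl h)
    then show ?case using Zk Zb by (auto simp: b_def)
  next
    case (a_inv h)
    show ?case
    proof
      fix z assume "z \<in> Z"
      then have "(-1) * (h * z) \<in> Z" using a_inv Zk[OF K_uminus[OF K_1]] by blast
      then show "a_inv Fr h * z \<in> Z" by simp
    qed
  next
    case (eng_add h1 h2)
    then show ?case using Zadd by (simp add: distrib_right)
  next
    case (eng_mult h1 h2)
    then show ?case by (simp add: mult.assoc)
  qed simp
  have "0 \<in> Mx P" using M by (simp add: is_ideal_def)
  moreover have "1 \<in> forms b n N" using forms_power[OF i0(1), of b N] by (simp add: bi0)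
  ultimately have one: "1 \<in> Z" unfolding Z_def by (auto intro!: bexI[of _ 1])
  have "\<exists>h\<in>forms b n N. z - h \<in> Mx P" if z: "z \<in> St P" for z
  proof -
    obtain a where a: "a \<in> chart_ring i0" "z - a \<in> Mx P"
      using sections_onto_residue[OF chart_affine[OF i0(1,2)] i0(3) P z] by blast
    have "a * 1 \<in> Z" using gen a(1) one unfolding chart_ring[OF i0(1,2)] by blast
    then obtain h where h: "h \<in> forms b n N" "a - h \<in> Mx P" by (auto simp: Z_def)
    have "(z - a) + (a - h) \<in> Mx P" using a(2) h(2) M unfolding is_ideal_def by blast
    then show ?thesis using h(1) by auto
  qed
  then show ?thesis using finite_mons monsS by blast
qed

lemma Q_closed: "Q \<in> closed_points C" using rational by (simp add: rational_point_def)

lemma residue_class_eq_iff: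
  assumes P: "P \<in> closed_points C" and "f \<in> St P" "g \<in> St P"
  shows "residue_class C P f = residue_class C P g \<longleftrightarrow> f - g \<in> Mx P"
proof -
  have x: "P \<in> pts" using closed_in_pts[OF P] .
  interpret S: subring_set "St P" by (rule stalk_subring[OF x])
  have M: "is_ideal (St P) (Mx P)" by (rule Mx_ideal[OF x])
  have cl: "residue_class C P f = {m + f |m. m \<in> Mx P}" for f
    by (auto simp: residue_class_def a_r_coset_def r_coset_def)
  show ?thesis
  proof
    assume "residue_class C P f = residue_class C P g"
    moreover have "0 + f \<in> residue_class C P f" unfolding cl using M by (force simp: is_ideal_def)
    ultimately obtain m where "f = m + g" "m \<in> Mx P" by (auto simp: cl)
    then show "f - g \<in> Mx P" by simp
  next
    have *: "residue_class C P f \<subseteq> residue_class C P g" if "f - g \<in> Mx P" for f g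
    proof
      fix y assume "y \<in> residue_class C P f"
      then obtain m where m: "y = m + f" "m \<in> Mx P" by (auto simp: cl)
      have "m + (f - g) \<in> Mx P" using m that M by (simp add: is_ideal_def)
      moreover have "y = (m + (f - g)) + g" using m by simp
      ultimately show "y \<in> residue_class C P g" unfolding cl by blast
    qed
    assume fg: "f - g \<in> Mx P"
    then have "g - f \<in> Mx P" using S.is_ideal_uminus[OF M fg] by simp
    then show "residue_class C P f = residue_class C P g" using * fg by blast
  qed
qed

lemma carrier_residue_field: "carrier (residue_field C P) = residue_class C P ` St P"
  by (auto simp: residue_field_def FactRing_def A_RCOSETS_def RCOSETS_def residue_class_def a_r_coset_def)

text \<open>After subtraction of its value at the rational point the function vanishes at
  \<open>Q\<close>. Multiplication by it preserves the finite-dimensional space of forms of some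
  large degree, so its powers are dependent over \<open>K\<close>, and the lowest coefficient of a
  relation would be a nonzero constant vanishing at \<open>Q\<close>.\<close>

lemma global_sections_const:
  assumes f: "\<And>P. P \<in> closed_points C \<Longrightarrow> f \<in> St P" shows "f \<in> K"
proof -
  have Qx: "Q \<in> pts" using closed_in_pts[OF Q_closed] .
  interpret S: subring_set "St Q" by (rule stalk_subring[OF Qx])
  have M: "is_ideal (St Q) (Mx Q)" by (rule Mx_ideal[OF Qx])
  have "residue_class C Q f \<in> residue_class C Q ` K"
    using rational f[OF Q_closed] unfolding rational_point_def carrier_residue_field by blast
  then obtain k where k: "k \<in> K" "residue_class C Q f = residue_class C Q k" by blast
  define y where "y = f - k"
  have yQ: "y \<in> Mx Q"
    using residue_class_eq_iff[OF Q_closed f[OF Q_closed]] k curve_props(4)[OF Qx] by (auto simp: y_def)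
  have all: "y \<in> St x" if x: "x \<in> pts" for x
  proof (cases "x \<in> closed_points C")
    case True
    then show ?thesis using f[OF True] k curve_props(4)[OF x] subring_set.A_diff[OF stalk_subring[OF x]]
      by (auto simp: y_def)
  next
    case False
    then show ?thesis using closed_point_iff[of x] x generic_stalk by auto
  qed
  have "y = 0"
  proof (rule ccontr)
    assume y0: "y \<noteq> 0"
    obtain i0 where i0: "i0 \<le> n" "c i0 \<noteq> 0" using chart_cover[OF Qx] by blast
    \<comment> \<open>With the whole field as ring and the zero ideal, the congruences in
      \<open>forms_stable\<close> become equalities.\<close>
    have U: "subring_set (UNIV :: 'f set)" by unfold_locales auto
    have W: "is_ideal (UNIV :: 'f set) {0}" by (simp add: is_ideal_def)
    have loc: "\<exists>N. \<exists>h\<in>forms c n N. y * c i ^ N - h \<in> {0}" if i: "i \<le> n" for i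
    proof (cases "c i = 0")
      case True
      then have "y * c i ^ 1 - 0 \<in> {0}" by simp
      then show ?thesis using kspan_0 by blast
    next
      case False
      have "y \<in> chart_ring i" using all chart_pts by (auto simp: sections_def)
      then obtain N where "y * c i ^ N \<in> forms c n N"
        using section_form[of y c i n c] i False unfolding chart_ring[OF i False] by blast
      then show ?thesis by force
    qed
    obtain N0 where N0: "\<forall>N\<ge>N0. \<forall>h\<in>forms c n N. \<exists>h'\<in>forms c n N. y * h - h' \<in> {0}"
      using forms_stable[OF U W _ _ _ loc] by auto
    then have N0: "y * h \<in> forms c n N0" if "h \<in> forms c n N0" for h using that by auto
    define s where "s = c i0 ^ N0"
    have s: "s \<noteq> 0" "s \<in> forms c n N0" using i0 forms_power by (auto simp: s_def)
    have pow: "y ^ k * s \<in> forms c n N0" for k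
      by (induction k) (use s N0 in \<open>auto simp: mult.assoc\<close>)
    define S where "S = mons c n N0"
    have finS: "finite S" by (simp add: S_def finite_mons)
    have sp: "spanned {\<lambda>_::unit. 0} S (\<lambda>m _. m) {v. v () \<in> forms c n N0}"
      unfolding spanned_def
    proof
      fix v :: "unit \<Rightarrow> 'f" assume "v \<in> {v. v () \<in> forms c n N0}"
      then obtain a where "\<forall>m\<in>S. a m \<in> K" "v () = (\<Sum>m\<in>S. a m * m)" by (auto simp: kspan_def S_def)
      then show "\<exists>a. (\<forall>i\<in>S. a i \<in> K) \<and> (\<lambda>x. v x - (\<Sum>i\<in>S. a i * i)) \<in> {\<lambda>_. 0}"
        by (intro exI[of _ a]) (auto simp: fun_eq_iff)
    qed
    have "subsp {\<lambda>_::unit. 0}" by (auto simp: subsp_def)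
    from dependence[OF this finS _ _ sp, of "{..card S}" "\<lambda>k _. y ^ k * s"] pow
    obtain a where a: "\<forall>k\<in>{..card S}. a k \<in> K" "\<exists>k\<in>{..card S}. a k \<noteq> 0"
      "(\<Sum>k\<le>card S. a k * (y ^ k * s)) = 0"
      by (auto simp: fun_eq_iff)
    have "(\<Sum>k\<le>card S. a k * y ^ k) * s = 0" using a(3) by (simp add: sum_distrib_right mult.assoc)
    then have sum0: "(\<Sum>k\<le>card S. a k * y ^ k) = 0" using s by simp
    define nz where "nz k \<longleftrightarrow> k \<le> card S \<and> a k \<noteq> 0" for k
    define l where "l = (LEAST k. nz k)"
    obtain k0 where "nz k0" using a(2) by (auto simp: nz_def)
    then have l: "nz l" "\<And>k. k < l \<Longrightarrow> \<not> nz k"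
      using LeastI[of nz k0] not_less_Least[of _ nz] unfolding l_def by blast+
    have lS: "l \<le> card S" using l(1) by (simp add: nz_def)
    have "(\<Sum>k\<le>card S. a k * y ^ k) = (\<Sum>k\<in>{l..card S}. a k * y ^ k)"
      by (rule sum.mono_neutral_right) (use l(2) in \<open>auto simp: nz_def\<close>)
    also have "\<dots> = y ^ l * (\<Sum>k\<in>{l..card S}. a k * y ^ (k - l))"
      unfolding sum_distrib_left by (intro sum.cong) (auto simp: power_add[symmetric] mult.left_commute)
    finally have "(\<Sum>k\<in>{l..card S}. a k * y ^ (k - l)) = 0" using sum0 y0 by simp
    moreover have "{l..card S} = insert l {Suc l..card S}" using lS by auto
    ultimately have al: "a l = - (\<Sum>k\<in>{Suc l..card S}. a k * y ^ (k - l))"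
      by (simp add: eq_neg_iff_add_eq_0)
    \<comment> \<open>Every term above the lowest one contains the factor \<open>y\<close>, which
      vanishes at \<open>Q\<close>.\<close>
    have "a k * y ^ (k - l) \<in> Mx Q" if "k \<in> {Suc l..card S}" for k
    proof -
      have "y ^ (k - l) = y ^ (k - l - 1) * y" using that by (simp flip: power_Suc2 add: Suc_diff_Suc)
      moreover have "a k * y ^ (k - l - 1) \<in> St Q"
        using a(1) that curve_props(4)[OF Qx] all[OF Qx] by auto
      ultimately show ?thesis using M yQ by (simp add: is_ideal_def mult.assoc[symmetric])
    qed
    then have "a l \<in> Mx Q" unfolding al by (intro S.is_ideal_uminus[OF M] is_ideal_sum[OF M])
    moreover have "a l \<noteq> 0" "a l \<in> K" using l(1) a(1) by (auto simp: nz_def)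
    ultimately show False using ord_at_K[OF Q_closed, of "a l"] ord_at_pos[OF Q_closed, of "a l"] by simp
  qed
  then show ?thesis using k by (simp add: y_def)
qed

end

context curve
begin

subsection \<open>Residue fields\<close>

context
  fixes P assumes P: "P \<in> closed_points C"
begin

lemma residue_field_field: "field (residue_field C P)"
  and residue_class_hom: "ring_hom_ring (sub (St P)) (residue_field C P) (residue_class C P)"
proof -
  have x: "P \<in> pts" using closed_in_pts[OF P] .
  interpret S: subring_set "St P" by (rule stalk_subring[OF x])
  interpret M: maximalideal "Mx P" "sub (St P)"
    using curve_props(5)[OF x] by (simp add: regular_local_ring_def max_ideal_def)
  show "field (residue_field C P)"
    unfolding residue_field_def by (rule M.quotient_is_field[OF S.cring_sub])
  show "ring_hom_ring (sub (St P)) (residue_field C P) (residue_class C P)"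
    unfolding residue_field_def residue_class_def[abs_def] by (rule M.rcos_ring_hom_ring)
qed

lemma residue_class_simps:
  shows "f \<in> St P \<Longrightarrow> g \<in> St P \<Longrightarrow> residue_class C P (f + g) = residue_class C P f \<oplus>\<^bsub>residue_field C P\<^esub> residue_class C P g"
    and "f \<in> St P \<Longrightarrow> g \<in> St P \<Longrightarrow> residue_class C P (f * g) = residue_class C P f \<otimes>\<^bsub>residue_field C P\<^esub> residue_class C P g"
    and "residue_class C P 0 = \<zero>\<^bsub>residue_field C P\<^esub>" "residue_class C P 1 = \<one>\<^bsub>residue_field C P\<^esub>"
    and "f \<in> St P \<Longrightarrow> residue_class C P f \<in> carrier (residue_field C P)"
proof -
  interpret h: ring_hom_ring "sub (St P)" "residue_field C P" "residue_class C P" by (rule residue_class_hom)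
  show "f \<in> St P \<Longrightarrow> g \<in> St P \<Longrightarrow> residue_class C P (f + g) = residue_class C P f \<oplus>\<^bsub>residue_field C P\<^esub> residue_class C P g"
    "f \<in> St P \<Longrightarrow> g \<in> St P \<Longrightarrow> residue_class C P (f * g) = residue_class C P f \<otimes>\<^bsub>residue_field C P\<^esub> residue_class C P g"
    using h.hom_add[of f g] h.hom_mult[of f g] by simp_all
  show "residue_class C P 0 = \<zero>\<^bsub>residue_field C P\<^esub>" "residue_class C P 1 = \<one>\<^bsub>residue_field C P\<^esub>"
    using h.hom_zero h.hom_one by simp_all
  show "f \<in> St P \<Longrightarrow> residue_class C P f \<in> carrier (residue_field C P)" using h.hom_closed[of f] by simp
qed

lemma residue_subfield: "subfield (residue_class C P ` K) (residue_field C P)"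
proof -
  interpret h: ring_hom_ring "sub (St P)" "residue_field C P" "residue_class C P" by (rule residue_class_hom)
  interpret E: field "residue_field C P" by (rule residue_field_field)
  have "field (sub K)" using ring.subfield_iff(2)[OF ring_Fr curve_props(3)] .
  then have "subfield K (sub (St P))"
    using curve_props(4)[OF closed_in_pts[OF P]] by (intro h.R.subfield_iff(1)) simp_all
  then show ?thesis by (rule h.img_is_subfield(2)) simp
qed

lemma exists_residue_basis:
  "\<exists>(r::nat) u. (\<forall>i<r. u i \<in> St P) \<and>
     (\<forall>f\<in>St P. \<exists>a. (\<forall>i<r. a i \<in> K) \<and> f - (\<Sum>i<r. a i * u i) \<in> Mx P) \<and>
     (\<forall>a. (\<forall>i<r. a i \<in> K) \<and> (\<Sum>i<r. a i * u i) \<in> Mx P \<longrightarrow> (\<forall>i<r. a i = 0))"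
proof -
  have x: "P \<in> pts" using closed_in_pts[OF P] .
  interpret S: subring_set "St P" by (rule stalk_subring[OF x])
  have M: "is_ideal (St P) (Mx P)" by (rule Mx_ideal[OF x])
  obtain S where S: "finite S" "S \<subseteq> St P" "\<forall>z\<in>St P. \<exists>h\<in>kspan S. z - h \<in> Mx P"
    using residue_field_finite[OF P] by blast
  define W where "W = {v::unit \<Rightarrow> 'f. v () \<in> Mx P}"
  define V where "V = {v::unit \<Rightarrow> 'f. v () \<in> St P}"
  have W: "subsp W" using M curve_props(4)[OF x] by (auto simp: subsp_def W_def is_ideal_def)
  have sp: "spanned W S (\<lambda>m _. m) V"
    unfolding spanned_def
  proof
    fix v assume "v \<in> V"
    then obtain h where "h \<in> kspan S" "v () - h \<in> Mx P" using S(3) by (auto simp: V_def)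
    then obtain a where "\<forall>m\<in>S. a m \<in> K" "v () - (\<Sum>m\<in>S. a m * m) \<in> Mx P" by (auto simp: kspan_def)
    then show "\<exists>a. (\<forall>i\<in>S. a i \<in> K) \<and> (\<lambda>x. v x - (\<Sum>i\<in>S. a i * i)) \<in> W"
      by (intro exI[of _ a]) (simp add: W_def)
  qed
  have bound: "n \<le> card S" if "\<And>i. i < n \<Longrightarrow> b i \<in> V" "indep W {..<n} b" for n and b :: "nat \<Rightarrow> unit \<Rightarrow> 'f"
    using indep_card_le[OF W S(1) _ sp, of "{..<n}" b] that by simp
  have "\<exists>(r::nat) b. (\<forall>i<r. b i \<in> V) \<and> indep W {..<r} b \<and> spanned W {..<r} b V"
    by (rule finite_codim_basis[OF W bound])
  then obtain r :: nat and b where b: "\<forall>i<r. b i \<in> V" "indep W {..<r} b" "spanned W {..<r} b V"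
    by (elim exE conjE)
  show ?thesis
  proof (rule exI[of _ r], rule exI[of _ "\<lambda>i. b i ()"], intro conjI ballI allI impI)
    show "b i () \<in> St P" if "i < r" for i using b(1) that by (simp add: V_def)
    show "\<exists>a. (\<forall>i<r. a i \<in> K) \<and> f - (\<Sum>i<r. a i * b i ()) \<in> Mx P" if "f \<in> St P" for f
    proof -
      have "(\<lambda>_. f) \<in> V" using that by (simp add: V_def)
      then show ?thesis using b(3) unfolding spanned_def W_def by fastforce
    qed
    show "a i = 0" if a: "(\<forall>i<r. a i \<in> K) \<and> (\<Sum>i<r. a i * b i ()) \<in> Mx P" and i: "i < r" for a i
    proof -
      have "(\<lambda>x. \<Sum>i<r. a i * b i x) \<in> W" using a by (simp add: W_def)
      then show ?thesis using b(2) a i unfolding indep_def by blast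
    qed
  qed
qed

text \<open>Translates a basis described by lifts into the inductive notion of dimension: each
  further basis vector is a line extension of the span of its predecessors.\<close>

lemma residue_dimension:
  assumes u: "\<forall>i<r. u i \<in> St P"
    and ind: "\<forall>a. (\<forall>i<r. a i \<in> K) \<and> (\<Sum>i<r. a i * u i) \<in> Mx P \<longrightarrow> (\<forall>i<r. a i = 0)"
    and m: "m \<le> r"
  shows "ring.dimension (residue_field C P) m (residue_class C P ` K)
    {residue_class C P (\<Sum>i<m. a i * u i) |a. \<forall>i<m. a i \<in> K}"
  using m
proof (induction m)
  case 0
  interpret E: field "residue_field C P" by (rule residue_field_field)
  show ?case using E.zero_dim[of "residue_class C P ` K"] residue_class_simps(3) by simp
next
  case (Suc m)
  interpret E: field "residue_field C P" by (rule residue_field_field)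
  have x: "P \<in> pts" using closed_in_pts[OF P] .
  interpret S: subring_set "St P" by (rule stalk_subring[OF x])
  note KS = subsetD[OF curve_props(4)[OF x]]
  let ?E = "{residue_class C P (\<Sum>i<m. a i * u i) |a. \<forall>i<m. a i \<in> K}"
  have sumS: "(\<Sum>i<m. a i * u i) \<in> St P" if "\<forall>i<m. a i \<in> K" for a
    using that u Suc.prems KS by (intro S.A_sum S.A_mult) auto
  have um: "u m \<in> St P" using u Suc.prems by simp
  have notin: "residue_class C P (u m) \<notin> ?E"
  proof
    assume "residue_class C P (u m) \<in> ?E"
    then obtain a where a: "\<forall>i<m. a i \<in> K" "residue_class C P (u m) = residue_class C P (\<Sum>i<m. a i * u i)" by blast
    then have M: "u m - (\<Sum>i<m. a i * u i) \<in> Mx P" using residue_class_eq_iff[OF P um sumS[OF a(1)]] by simp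
    define b where "b i = (if i < m then - a i else if i = m then 1 else 0)" for i
    have "(\<Sum>i<r. b i * u i) = (\<Sum>i<Suc m. b i * u i)"
      by (rule sum.mono_neutral_right) (use Suc.prems in \<open>auto simp: b_def\<close>)
    also have "\<dots> = u m - (\<Sum>i<m. a i * u i)" by (simp add: b_def sum_negf)
    finally have "(\<Sum>i<r. b i * u i) \<in> Mx P" using M by simp
    moreover have "\<forall>i<r. b i \<in> K" using a by (simp add: b_def)
    ultimately have "b m = 0" using ind Suc.prems by (metis Suc_le_lessD)
    then show False by (simp add: b_def)
  qed
  have "{residue_class C P (\<Sum>i<Suc m. a i * u i) |a. \<forall>i<Suc m. a i \<in> K}
      = E.line_extension (residue_class C P ` K) (residue_class C P (u m)) ?E"
  proof (rule Set.set_eqI, unfold E.line_extension_mem_iff, rule iffI)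
    fix z assume "z \<in> {residue_class C P (\<Sum>i<Suc m. a i * u i) |a. \<forall>i<Suc m. a i \<in> K}"
    then obtain a where a: "\<forall>i<Suc m. a i \<in> K" "z = residue_class C P (\<Sum>i<Suc m. a i * u i)" by blast
    have "z = residue_class C P (a m) \<otimes>\<^bsub>residue_field C P\<^esub> residue_class C P (u m)
        \<oplus>\<^bsub>residue_field C P\<^esub> residue_class C P (\<Sum>i<m. a i * u i)"
      using a sumS[of a] um KS by (simp add: residue_class_simps add.commute)
    then show "\<exists>k\<in>residue_class C P ` K. \<exists>v\<in>?E. z = k \<otimes>\<^bsub>residue_field C P\<^esub> residue_class C P (u m)
        \<oplus>\<^bsub>residue_field C P\<^esub> v"
      using a(1) by (intro bexI[of _ "residue_class C P (a m)"] bexI[of _ "residue_class C P (\<Sum>i<m. a i * u i)"]) auto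
  next
    fix z assume "\<exists>k\<in>residue_class C P ` K. \<exists>v\<in>?E. z = k \<otimes>\<^bsub>residue_field C P\<^esub> residue_class C P (u m)
        \<oplus>\<^bsub>residue_field C P\<^esub> v"
    then obtain k a where a: "k \<in> K" "\<forall>i<m. a i \<in> K" "z = residue_class C P k \<otimes>\<^bsub>residue_field C P\<^esub> residue_class C P (u m)
        \<oplus>\<^bsub>residue_field C P\<^esub> residue_class C P (\<Sum>i<m. a i * u i)" by blast
    have "z = residue_class C P (k * u m + (\<Sum>i<m. a i * u i))"
      using a sumS[of a] um KS by (simp add: residue_class_simps)
    also have "k * u m + (\<Sum>i<m. a i * u i) = (\<Sum>i<Suc m. (a(m := k)) i * u i)" by (simp add: add.commute)
    finally show "z \<in> {residue_class C P (\<Sum>i<Suc m. a i * u i) |a. \<forall>i<Suc m. a i \<in> K}"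
      using a by (intro CollectI exI[of _ "a(m := k)"]) auto
  qed
  then show ?case
    using E.Suc_dim[OF residue_class_simps(5)[OF um] notin Suc.IH] Suc.prems by simp
qed

lemma point_degree_basis:
  "\<exists>u. (\<forall>i<point_degree K C P. u i \<in> St P) \<and>
     (\<forall>f\<in>St P. \<exists>a. (\<forall>i<point_degree K C P. a i \<in> K) \<and> f - (\<Sum>i<point_degree K C P. a i * u i) \<in> Mx P) \<and>
     (\<forall>a. (\<forall>i<point_degree K C P. a i \<in> K) \<and> (\<Sum>i<point_degree K C P. a i * u i) \<in> Mx P \<longrightarrow>
       (\<forall>i<point_degree K C P. a i = 0))"
proof -
  obtain r :: nat and u where u: "\<forall>i<r. u i \<in> St P"
    "\<forall>f\<in>St P. \<exists>a. (\<forall>i<r. a i \<in> K) \<and> f - (\<Sum>i<r. a i * u i) \<in> Mx P"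
    "\<forall>a. (\<forall>i<r. a i \<in> K) \<and> (\<Sum>i<r. a i * u i) \<in> Mx P \<longrightarrow> (\<forall>i<r. a i = 0)"
    using exists_residue_basis by blast
  interpret E: field "residue_field C P" by (rule residue_field_field)
  have x: "P \<in> pts" using closed_in_pts[OF P] .
  interpret S: subring_set "St P" by (rule stalk_subring[OF x])
  have sumS: "(\<Sum>i<r. a i * u i) \<in> St P" if "\<forall>i<r. a i \<in> K" for a
    using that u(1) subsetD[OF curve_props(4)[OF x]] by (intro S.A_sum S.A_mult) auto
  have "{residue_class C P (\<Sum>i<r. a i * u i) |a. \<forall>i<r. a i \<in> K} = carrier (residue_field C P)"
  proof (rule Set.set_eqI, rule iffI)
    fix z assume "z \<in> {residue_class C P (\<Sum>i<r. a i * u i) |a. \<forall>i<r. a i \<in> K}"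
    then show "z \<in> carrier (residue_field C P)" using sumS residue_class_simps(5) by blast
  next
    fix z assume "z \<in> carrier (residue_field C P)"
    then obtain f where f: "f \<in> St P" "z = residue_class C P f" unfolding carrier_residue_field by blast
    then obtain a where a: "\<forall>i<r. a i \<in> K" "f - (\<Sum>i<r. a i * u i) \<in> Mx P" using u(2) by blast
    then have "z = residue_class C P (\<Sum>i<r. a i * u i)"
      using residue_class_eq_iff[OF P f(1) sumS[OF a(1)]] f(2) by simp
    then show "z \<in> {residue_class C P (\<Sum>i<r. a i * u i) |a. \<forall>i<r. a i \<in> K}" using a(1) by blast
  qed
  then have "E.dimension r (residue_class C P ` K) (carrier (residue_field C P))"
    using residue_dimension[OF u(1,3), of r] by simp
  then have "point_degree K C P = r"
    unfolding point_degree_def using E.dimI[OF residue_subfield] by (simp add: over_def)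
  then show ?thesis using u by blast
qed

end

lemma point_degree_Q: "point_degree K C Q = 1"
proof -
  interpret E: field "residue_field C Q" by (rule residue_field_field[OF Q_closed])
  have "carrier (residue_field C Q) = residue_class C Q ` K" using rational by (simp add: rational_point_def)
  then show ?thesis
    unfolding point_degree_def
    using E.dimI[OF residue_subfield[OF Q_closed] E.dimension_one[OF residue_subfield[OF Q_closed]]]
    by (simp add: over_def)
qed

subsection \<open>Finiteness of zeros\<close>

text \<open>The induction shows more, namely that every element of the chart ring maps
  \<open>Z\<close> into itself; this passes through products, and evaluation at \<open>1\<close>
  gives the inclusion.\<close>

lemma chart_ring_subset:
  assumes i: "i \<le> n" "c i \<noteq> 0"
    and Z: "\<And>k z. k \<in> K \<Longrightarrow> z \<in> Z \<Longrightarrow> k * z \<in> Z" "\<And>z z'. z \<in> Z \<Longrightarrow> z' \<in> Z \<Longrightarrow> z + z' \<in> Z"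
      "\<And>j z. j \<le> n \<Longrightarrow> z \<in> Z \<Longrightarrow> c j / c i * z \<in> Z" "1 \<in> Z"
  shows "chart_ring i \<subseteq> Z"
proof
  fix a assume "a \<in> chart_ring i"
  then have "a \<in> generate_ring Fr (K \<union> {c j / c i |j. j \<le> n})" by (simp only: chart_ring[OF i])
  then have "\<forall>z\<in>Z. a * z \<in> Z"
  proof (induction rule: generate_ring.induct)
    case (incl h)
    then show ?case using Z by auto
  next
    case (a_inv h)
    show ?case
    proof
      fix z assume "z \<in> Z"
      then have "(-1) * (h * z) \<in> Z" using a_inv Z(1)[OF K_uminus[OF K_1]] by blast
      then show "a_inv Fr h * z \<in> Z" by simp
    qed
  next
    case (eng_add h1 h2)
    then show ?case using Z(2) by (simp add: distrib_right)
  next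
    case (eng_mult h1 h2)
    then show ?case by (simp add: mult.assoc)
  qed simp
  then show "a \<in> Z" using Z(4) by force
qed

text \<open>Since \<open>k(P)\<close> is finite over \<open>k\<close>, the multiplication table of a basis provides finitely many
  elements that cut out \<open>P\<close> in a chart.\<close>

lemma point_finitely_cut_out:
  assumes i: "i \<le> n" "c i \<noteq> 0" and P: "P \<in> closed_points C" "P \<in> chart C n c i"
  shows "\<exists>G. finite G \<and> G \<subseteq> Mx P \<inter> chart_ring i \<and>
    (\<forall>R\<in>chart C n c i. G \<subseteq> Mx R \<longrightarrow> R = P)"
proof -
  let ?A = "chart_ring i"
  let ?U = "chart C n c i"
  note U = chart_affine[OF i]
  interpret A: subring_set ?A by (rule aff_subring[OF U])
  have x: "P \<in> pts" "Mx P \<noteq> {0}" using P closed_point_iff by auto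
  interpret S: subring_set "St P" by (rule stalk_subring[OF x(1)])
  have M: "is_ideal (St P) (Mx P)" by (rule Mx_ideal[OF x(1)])
  let ?p = "Mx P \<inter> ?A"
  have p: "is_prime ?A ?p" by (rule aff_prime[OF U P(2)])
  have KA: "K \<subseteq> ?A" using K_sections[OF aff_open(3)[OF U]] .
  define r where "r = point_degree K C P"
  obtain u where u: "\<forall>l<r. u l \<in> St P"
    "\<forall>f\<in>St P. \<exists>a. (\<forall>l<r. a l \<in> K) \<and> f - (\<Sum>l<r. a l * u l) \<in> Mx P"
    "\<forall>a. (\<forall>l<r. a l \<in> K) \<and> (\<Sum>l<r. a l * u l) \<in> Mx P \<longrightarrow> (\<forall>l<r. a l = 0)"
    using point_degree_basis[OF P(1)] unfolding r_def by blast
  have "\<forall>l\<in>{..<r}. \<exists>s. s \<in> ?A \<and> u l - s \<in> Mx P" using sections_onto_residue[OF U P(2,1)] u(1) by blast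
  from bchoice[OF this] obtain s where s: "\<And>l. l < r \<Longrightarrow> s l \<in> ?A" "\<And>l. l < r \<Longrightarrow> u l - s l \<in> Mx P" by auto
  have diff: "(\<Sum>l<r. a l * u l) - (\<Sum>l<r. a l * s l) \<in> Mx P" if "\<forall>l<r. a l \<in> K" for a
  proof -
    have "(\<Sum>l<r. a l * (u l - s l)) \<in> Mx P"
    proof (rule is_ideal_sum[OF M])
      fix l assume "l \<in> {..<r}"
      then have "u l - s l \<in> Mx P" "a l \<in> St P" using s that subsetD[OF curve_props(4)[OF x(1)]] by auto
      then show "a l * (u l - s l) \<in> Mx P" using M by (simp add: is_ideal_def)
    qed
    then show ?thesis by (simp add: sum_subtractf right_diff_distrib)
  qed
  have span: "\<exists>a. (\<forall>l<r. a l \<in> K) \<and> f - (\<Sum>l<r. a l * s l) \<in> Mx P" if f: "f \<in> ?A" for f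
  proof -
    obtain a where a: "\<forall>l<r. a l \<in> K" "f - (\<Sum>l<r. a l * u l) \<in> Mx P" using u(2) sections_stalk[OF f P(2)] by blast
    have "(f - (\<Sum>l<r. a l * u l)) + ((\<Sum>l<r. a l * u l) - (\<Sum>l<r. a l * s l)) \<in> Mx P"
      using a(2) diff[OF a(1)] M unfolding is_ideal_def by blast
    then show ?thesis using a(1) by auto
  qed
  have indp: "\<forall>l<r. a l = 0" if a: "\<forall>l<r. a l \<in> K" "(\<Sum>l<r. a l * s l) \<in> Mx P" for a
  proof -
    have "((\<Sum>l<r. a l * u l) - (\<Sum>l<r. a l * s l)) + (\<Sum>l<r. a l * s l) \<in> Mx P"
      using a(2) diff[OF a(1)] M unfolding is_ideal_def by blast
    then show ?thesis using u(3) a(1) by simp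
  qed
  have sumA: "(\<Sum>l<r. a l * s l) \<in> ?A" if "\<forall>l<r. a l \<in> K" for a
    using that s(1) KA by (intro A.A_sum A.A_mult) auto
  have xA: "c j / c i \<in> ?A" if "j \<le> n" for j
    unfolding chart_ring[OF i] by (rule generate_ring.incl) (use that in blast)
  \<comment> \<open>Expanding \<open>1\<close> and all products of a coordinate with a basis element
    modulo \<open>P\<close> records the multiplication table; the defects of these expansions form
    \<open>G\<close>.\<close>
  define F where "F = insert 1 ((\<lambda>(j, l). c j / c i * s l) ` ({..n} \<times> {..<r}))"
  have F: "finite F" "F \<subseteq> ?A"
    unfolding F_def using A.A_mult[OF xA s(1)] by (auto simp del: times_divide_eq_left)
  have "\<forall>f\<in>F. \<exists>a. (\<forall>l<r. a l \<in> K) \<and> f - (\<Sum>l<r. a l * s l) \<in> Mx P" using span F by blast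
  from bchoice[OF this] obtain a where
    a: "\<And>f. f \<in> F \<Longrightarrow> \<forall>l<r. a f l \<in> K" "\<And>f. f \<in> F \<Longrightarrow> f - (\<Sum>l<r. a f l * s l) \<in> Mx P" by auto
  define G where "G = (\<lambda>f. f - (\<Sum>l<r. a f l * s l)) ` F"
  have Gp: "G \<subseteq> ?p"
  proof
    fix g assume "g \<in> G"
    then obtain f where f: "f \<in> F" "g = f - (\<Sum>l<r. a f l * s l)" by (auto simp: G_def)
    then show "g \<in> ?p" using a(2)[OF f(1)] A.A_diff[OF subsetD[OF F(2) f(1)] sumA[OF a(1)[OF f(1)]]] by simp
  qed
  have "R = P" if R: "R \<in> ?U" and GR: "G \<subseteq> Mx R" for R
  proof -
    let ?q = "Mx R \<inter> ?A"
    have q: "is_prime ?A ?q" by (rule aff_prime[OF U R])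
    define I where "I = ?p \<inter> ?q"
    have I: "is_ideal ?A I" using p q by (auto simp: I_def is_prime_def is_ideal_def)
    have GI: "G \<subseteq> I" using Gp GR by (auto simp: I_def)
    \<comment> \<open>If \<open>G\<close> also vanishes at \<open>R\<close>, the table holds modulo
      the intersection \<open>I\<close> of the two primes. Then the \<open>s l\<close> span the
      whole coordinate ring modulo \<open>I\<close>.\<close>
    define Z where "Z = {z. \<exists>a. (\<forall>l<r. a l \<in> K) \<and> z - (\<Sum>l<r. a l * s l) \<in> I}"
    have FZ: "F \<subseteq> Z"
    proof
      fix f assume f: "f \<in> F"
      then have "f - (\<Sum>l<r. a f l * s l) \<in> I" using GI by (auto simp: G_def)
      then show "f \<in> Z" unfolding Z_def using a(1)[OF f] by blast
    qed
    have Zadd: "z + z' \<in> Z" if zz: "z \<in> Z" "z' \<in> Z" for z z'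
    proof -
      obtain b b' where b: "\<forall>l<r. b l \<in> K" "z - (\<Sum>l<r. b l * s l) \<in> I"
        "\<forall>l<r. b' l \<in> K" "z' - (\<Sum>l<r. b' l * s l) \<in> I" using zz by (auto simp: Z_def)
      have "(z - (\<Sum>l<r. b l * s l)) + (z' - (\<Sum>l<r. b' l * s l)) \<in> I" using I b by (simp add: is_ideal_def)
      then have "z + z' - (\<Sum>l<r. (b l + b' l) * s l) \<in> I" by (simp add: sum.distrib distrib_right algebra_simps)
      then show ?thesis unfolding Z_def using b by (intro CollectI exI[of _ "\<lambda>l. b l + b' l"]) auto
    qed
    have Zk: "k * z \<in> Z" if kz: "k \<in> K" "z \<in> Z" for k z
    proof -
      obtain b where b: "\<forall>l<r. b l \<in> K" "z - (\<Sum>l<r. b l * s l) \<in> I" using kz by (auto simp: Z_def)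
      have "k * (z - (\<Sum>l<r. b l * s l)) \<in> I" using I b kz(1) KA by (auto simp: is_ideal_def)
      then have "k * z - (\<Sum>l<r. (k * b l) * s l) \<in> I"
        by (simp add: right_diff_distrib sum_distrib_left mult.assoc)
      then show ?thesis unfolding Z_def using b kz(1) by (intro CollectI exI[of _ "\<lambda>l. k * b l"]) auto
    qed
    have Zsum: "sum f J \<in> Z" if "\<And>l. l \<in> J \<Longrightarrow> f l \<in> Z" "finite J" for f and J :: "nat set"
    proof -
      have Z0: "0 \<in> Z" using Zk[of 0 1] FZ by (auto simp: F_def)
      show ?thesis using that(2,1) by (induction J rule: finite_induct) (auto intro: Zadd Z0)
    qed
    have ZI: "z \<in> Z" if "z \<in> I" for z
      unfolding Z_def using that by (intro CollectI exI[of _ "\<lambda>_. 0"]) simp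
    have Zx: "c j / c i * z \<in> Z" if j: "j \<le> n" and z: "z \<in> Z" for j z
    proof -
      obtain b where b: "\<forall>l<r. b l \<in> K" "z - (\<Sum>l<r. b l * s l) \<in> I" using z by (auto simp: Z_def)
      have 1: "c j / c i * (z - (\<Sum>l<r. b l * s l)) \<in> I" using I b(2) xA[OF j] unfolding is_ideal_def by blast
      have 2: "(\<Sum>l<r. b l * (c j / c i * s l)) \<in> Z"
      proof (rule Zsum)
        fix l assume l: "l \<in> {..<r}"
        then have "c j / c i * s l \<in> Z" using j subsetD[OF FZ] by (auto simp: F_def)
        then show "b l * (c j / c i * s l) \<in> Z" using Zk[of "b l" "c j / c i * s l"] b(1) l by simp
      qed simp
      have "c j / c i * z = c j / c i * (z - (\<Sum>l<r. b l * s l)) + (\<Sum>l<r. b l * (c j / c i * s l))"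
        by (simp add: right_diff_distrib sum_distrib_left mult.left_commute del: times_divide_eq_left)
      then show ?thesis using Zadd[OF ZI[OF 1] 2] by (simp only:)
    qed
    have AZ: "?A \<subseteq> Z" by (rule chart_ring_subset[OF i Zk Zadd Zx]) (use FZ in \<open>auto simp: F_def\<close>)
    \<comment> \<open>An element of \<open>?p\<close> is a combination of the \<open>s l\<close>
      modulo \<open>I\<close>; that combination lies in \<open>?p\<close> as well, so its
      coefficients vanish and the element lies in \<open>I\<close>.\<close>
    have "?p \<subseteq> ?q"
    proof
      fix z assume z: "z \<in> ?p"
      then obtain b where b: "\<forall>l<r. b l \<in> K" "z - (\<Sum>l<r. b l * s l) \<in> I" using AZ by (auto simp: Z_def)
      have "z - (z - (\<Sum>l<r. b l * s l)) \<in> Mx P" 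
        by (rule S.is_ideal_diff[OF M]) (use z b(2) in \<open>simp_all add: I_def\<close>)
      then have "\<forall>l<r. b l = 0" using indp[OF b(1)] by simp
      then show "z \<in> ?q" using b(2) by (simp add: I_def)
    qed
    then have "?p = ?q" using nonzero_prime_maximal[OF U p q Mx_sections_nonzero[OF U P(2) x(2)]] by blast
    then show ?thesis using inj_onD[OF aff_inj[OF U], of R P] R P(2) by simp
  qed
  then show ?thesis using F(1) Gp by (intro exI[of _ G]) (auto simp: G_def)
qed

text \<open>A quasi-compactness argument with ideals: the functions that vanish at all but finitely
  many zeros of \<open>a\<close> form an ideal \<open>J\<close>. Near each zero \<open>P\<close> an
  element of \<open>J\<close> is nonzero at \<open>P\<close>, so \<open>J\<close> lies in no prime
  and contains \<open>1\<close>.\<close>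

lemma finite_zeros:
  assumes i: "i \<le> n" "c i \<noteq> 0" and a: "a \<in> chart_ring i" "a \<noteq> 0"
  shows "finite {x \<in> chart C n c i. a \<in> Mx x}"
proof -
  let ?A = "chart_ring i"
  let ?U = "chart C n c i"
  note U = chart_affine[OF i]
  interpret A: subring_set ?A by (rule aff_subring[OF U])
  define V where "V = {x \<in> ?U. a \<in> Mx x}"
  have Vcl: "P \<in> closed_points C" if "P \<in> V" for P
    using that a chart_pts closed_point_iff by (auto simp: V_def)
  have I: "is_ideal ?A (Mx x \<inter> ?A)" if "x \<in> ?U" for x using aff_prime[OF U that] by (simp add: is_prime_def)
  define J where "J = {z \<in> ?A. finite {x \<in> V. z \<notin> Mx x}}"
  have J: "is_ideal ?A J"
    unfolding is_ideal_def
  proof (intro conjI ballI)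
    show "J \<subseteq> ?A" by (auto simp: J_def)
    have "{x \<in> V. 0 \<notin> Mx x} = {}" using I by (auto simp: V_def is_ideal_def)
    then have "finite {x \<in> V. 0 \<notin> Mx x}" by (simp only: finite.emptyI)
    then show "0 \<in> J" by (simp add: J_def)
  next
    fix y z assume yz: "y \<in> J" "z \<in> J"
    have "{x \<in> V. y + z \<notin> Mx x} \<subseteq> {x \<in> V. y \<notin> Mx x} \<union> {x \<in> V. z \<notin> Mx x}"
      using I yz by (fastforce simp: V_def J_def is_ideal_def)
    then show "y + z \<in> J" using yz unfolding J_def by (auto intro: finite_subset)
  next
    fix y z assume yz: "y \<in> ?A" "z \<in> J"
    have "{x \<in> V. y * z \<notin> Mx x} \<subseteq> {x \<in> V. z \<notin> Mx x}"
      using I yz by (fastforce simp: V_def J_def is_ideal_def)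
    then show "y * z \<in> J" using yz unfolding J_def by (auto intro: finite_subset)
  qed
  have aJ: "a \<in> J" using a by (simp add: J_def V_def)
  have isolate: "\<exists>g\<in>J. g \<notin> Mx P" if PV: "P \<in> V" for P
  proof -
    have PU: "P \<in> ?U" and aP: "a \<in> Mx P" using PV by (auto simp: V_def)
    note P = Vcl[OF PV]
    have x: "P \<in> pts" using closed_in_pts[OF P] .
    obtain G where G: "finite G" "G \<subseteq> Mx P \<inter> ?A" "\<forall>R\<in>?U. G \<subseteq> Mx R \<longrightarrow> R = P"
      using point_finitely_cut_out[OF i P PU] by blast
    \<comment> \<open>For \<open>\<gamma>\<close> vanishing at \<open>P\<close>, the order of
      \<open>a\<close> is high enough an exponent to make \<open>\<gamma> ^ e / a\<close> regular at
      \<open>P\<close>. Its denominator \<open>g\<close> satisfies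
      \<open>g * \<gamma> ^ e = b * a\<close>, so \<open>g\<close> vanishes at every zero of
      \<open>a\<close> where \<open>\<gamma>\<close> does not.\<close>
    define e where "e = nat (ord_at C P a)"
    have "\<exists>g\<in>?A. g \<notin> Mx P \<and> (\<forall>R\<in>V. \<gamma> \<notin> Mx R \<longrightarrow> g \<in> Mx R)" if \<gamma>: "\<gamma> \<in> G" for \<gamma>
    proof -
      have \<gamma>P: "\<gamma> \<in> Mx P" "\<gamma> \<in> ?A" using G(2) \<gamma> by auto
      have "\<gamma> ^ e / a \<in> St P"
      proof (cases "\<gamma> ^ e = 0")
        case True
        show ?thesis unfolding True using subring_set.A_0[OF stalk_subring[OF x]] by simp
      next
        case False
        have opow: "ord_at C P (\<gamma> ^ k) = int k * ord_at C P \<gamma>" if "\<gamma> \<noteq> 0" for k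
        proof (induction k)
          case 0
          show ?case using ord_at_K[OF P K_1] by simp
        next
          case (Suc k)
          then show ?case using ord_at_mult[OF P that, of "\<gamma> ^ k"] that by (simp add: algebra_simps)
        qed
        have "e \<noteq> 0" using ord_at_pos[OF P a(2)] aP by (simp add: e_def)
        then have \<gamma>0: "\<gamma> \<noteq> 0" using False by (metis zero_power neq0_conv)
        have "1 \<le> ord_at C P \<gamma>" using ord_at_pos[OF P \<gamma>0] \<gamma>P by simp
        then have "int e * 1 \<le> ord_at C P (\<gamma> ^ e)" unfolding opow[OF \<gamma>0] by (intro mult_left_mono) auto
        moreover have "ord_at C P (\<gamma> ^ e) = ord_at C P (\<gamma> ^ e / a) + ord_at C P a"
          using ord_at_mult[OF P, of "\<gamma> ^ e / a" a] False a(2) by simp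
        ultimately have "0 \<le> ord_at C P (\<gamma> ^ e / a)" by (simp add: e_def split: if_splits)
        then show ?thesis using ord_at_nonneg[OF P, of "\<gamma> ^ e / a"] False a(2) by simp
      qed
      then obtain b g where bg: "b \<in> ?A" "g \<in> ?A" "g \<notin> Mx P" "\<gamma> ^ e / a = b / g"
        using aff_stalk[OF U PU] by blast
      have g0: "g \<noteq> 0" using bg(3) Mx_ideal(1)[OF x] by (auto simp: is_ideal_def)
      have eq: "g * \<gamma> ^ e = b * a" using bg(4) g0 a(2) by (simp add: field_simps)
      have "g \<in> Mx R" if R: "R \<in> V" "\<gamma> \<notin> Mx R" for R
      proof -
        have RU: "R \<in> ?U" "a \<in> Mx R" using R by (auto simp: V_def)
        have q: "is_prime ?A (Mx R \<inter> ?A)" by (rule aff_prime[OF U RU(1)])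
        have "b * a \<in> Mx R \<inter> ?A" using I[OF RU(1)] bg(1) a(1) RU(2) by (simp add: is_ideal_def)
        then have gR: "g * \<gamma> ^ e \<in> Mx R \<inter> ?A" by (simp only: eq)
        have "\<gamma> ^ k \<notin> Mx R" for k
        proof (induction k)
          case 0
          show ?case using Mx_ideal(2)[OF chart_pts[OF RU(1)]] by simp
        next
          case (Suc k)
          have "\<gamma> * \<gamma> ^ k \<notin> Mx R \<inter> ?A"
            using q Suc R(2) \<gamma>P(2) A.A_power[OF \<gamma>P(2)] unfolding is_prime_def by blast
          then show ?case using A.A_mult[OF \<gamma>P(2) A.A_power[OF \<gamma>P(2)]] by simp
        qed
        then show ?thesis using q gR bg(2) A.A_power[OF \<gamma>P(2), of e] unfolding is_prime_def by blast
      qed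
      then show ?thesis using bg by blast
    qed
    then have "\<forall>\<gamma>\<in>G. \<exists>g. g \<in> ?A \<and> g \<notin> Mx P \<and> (\<forall>R\<in>V. \<gamma> \<notin> Mx R \<longrightarrow> g \<in> Mx R)" by blast
    from bchoice[OF this] obtain g where
      g: "\<And>\<gamma>. \<gamma> \<in> G \<Longrightarrow> g \<gamma> \<in> ?A" "\<And>\<gamma>. \<gamma> \<in> G \<Longrightarrow> g \<gamma> \<notin> Mx P"
        "\<And>\<gamma> R. \<gamma> \<in> G \<Longrightarrow> R \<in> V \<Longrightarrow> \<gamma> \<notin> Mx R \<Longrightarrow> g \<gamma> \<in> Mx R" by blast
    have q: "is_prime ?A (Mx P \<inter> ?A)" by (rule aff_prime[OF U PU])
    have prodA: "prod g H \<in> ?A" if "H \<subseteq> G" for H using that g(1) by (intro A.A_prod) auto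
    have "prod g H \<notin> Mx P" if "H \<subseteq> G" for H
      using finite_subset[OF that G(1)] that
    proof (induction H rule: finite_induct)
      case empty
      then show ?case using Mx_ideal(2)[OF x] by simp
    next
      case (insert h H)
      have "g h * prod g H \<notin> Mx P \<inter> ?A"
        using q insert g(1,2)[of h] prodA[of H] unfolding is_prime_def by blast
      then show ?case using insert A.A_mult[OF g(1)[of h] prodA[of H]] by simp
    qed
    then have out: "prod g G \<notin> Mx P" by simp
    \<comment> \<open>Since \<open>G\<close> cuts out \<open>P\<close>, some
      \<open>\<gamma> \<in> G\<close> is nonzero at \<open>R\<close>, and the factor belonging to it
      vanishes there.\<close>
    have "prod g G \<in> Mx R" if R: "R \<in> V" "R \<noteq> P" for R
    proof -
      have RU: "R \<in> ?U" using R by (simp add: V_def)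
      then obtain \<gamma> where \<gamma>: "\<gamma> \<in> G" "\<gamma> \<notin> Mx R" using G(3) R by blast
      have "prod g G = prod g (G - {\<gamma>}) * g \<gamma>" using prod.remove[OF G(1) \<gamma>(1), of g] by (simp add: mult.commute)
      moreover have "g \<gamma> \<in> Mx R \<inter> ?A" using g(1,3) \<gamma> R by blast
      ultimately show ?thesis using I[OF RU] prodA[of "G - {\<gamma>}"] by (auto simp: is_ideal_def)
    qed
    then have "{y \<in> V. prod g G \<notin> Mx y} \<subseteq> {P}" by blast
    then have "prod g G \<in> J" unfolding J_def using prodA[of G] by (auto intro: finite_subset)
    then show ?thesis using out by blast
  qed
  have "1 \<in> J"
  proof (rule ccontr)
    assume "1 \<notin> J"
    then obtain q where q: "is_prime ?A q" "J \<subseteq> q" using A.proper_ideal_subset_prime[OF J] by blast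
    obtain x where x: "x \<in> ?U" "Mx x \<inter> ?A = q" using aff_surj[OF U q(1)] by blast
    then have "x \<in> V" using aJ q(2) by (auto simp: V_def)
    then obtain g where "g \<in> J" "g \<notin> Mx x" using isolate by blast
    then show False using q(2) x(2) by blast
  qed
  then have "finite {x \<in> V. 1 \<notin> Mx x}" by (simp add: J_def)
  moreover have "{x \<in> V. 1 \<notin> Mx x} = V" using Mx_ideal(2) chart_pts by (auto simp: V_def)
  ultimately show ?thesis by (simp add: V_def)
qed

lemma finite_poles_zeros:
  assumes f: "f \<noteq> 0" shows "finite {P \<in> closed_points C. ord_at C P f \<noteq> 0}"
proof -
  have fin: "finite {P \<in> closed_points C. P \<in> chart C n c i \<and> ord_at C P f \<noteq> 0}" if i: "i \<le> n" "c i \<noteq> 0" for i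
  proof -
    note U = chart_affine[OF i]
    obtain a b where ab: "a \<in> chart_ring i" "b \<in> chart_ring i" "b \<noteq> 0" "f = a / b" using aff_frac[OF U] by blast
    have a0: "a \<noteq> 0" using ab f by auto
    have "ord_at C P f = 0" if P: "P \<in> closed_points C" "P \<in> chart C n c i" "a \<notin> Mx P" "b \<notin> Mx P" for P
    proof -
      have z: "ord_at C P g = 0" if "g \<in> chart_ring i" "g \<noteq> 0" "g \<notin> Mx P" for g
        using ord_at_nonneg[OF P(1) that(2)] ord_at_pos[OF P(1) that(2)] sections_stalk[OF that(1) P(2)] that(3) by simp
      have "ord_at C P a = ord_at C P f + ord_at C P b" using ord_at_mult[OF P(1) f ab(3)] ab by simp
      then show ?thesis using z[OF ab(1) a0 P(3)] z[OF ab(2,3) P(4)] by simp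
    qed
    then have "{P \<in> closed_points C. P \<in> chart C n c i \<and> ord_at C P f \<noteq> 0}
        \<subseteq> {x \<in> chart C n c i. a \<in> Mx x} \<union> {x \<in> chart C n c i. b \<in> Mx x}" by blast
    then show ?thesis using finite_zeros[OF i ab(1) a0] finite_zeros[OF i ab(2,3)] by (auto intro: finite_subset)
  qed
  have "{P \<in> closed_points C. ord_at C P f \<noteq> 0}
      \<subseteq> (\<Union>i\<in>{i. i \<le> n \<and> c i \<noteq> 0}. {P \<in> closed_points C. P \<in> chart C n c i \<and> ord_at C P f \<noteq> 0})"
    using chart_cover closed_in_pts by blast
  moreover have "finite (\<Union>i\<in>{i. i \<le> n \<and> c i \<noteq> 0}. {P \<in> closed_points C. P \<in> chart C n c i \<and> ord_at C P f \<noteq> 0})"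
    using fin by (intro finite_UN_I) auto
  ultimately show ?thesis by (rule finite_subset)
qed

text \<open>Inclusion of stalks puts \<open>R\<close> into every chart around \<open>P\<close>.
  Non-units of the larger ring are non-units of the smaller one, so the primes in that chart are
  nested and hence equal.\<close>

lemma stalk_incomparable:
  assumes P: "P \<in> closed_points C" and R: "R \<in> closed_points C" and sub: "St P \<subseteq> St R" shows "P = R"
proof -
  obtain i where i: "i \<le> n" "c i \<noteq> 0" "P \<in> chart C n c i" using chart_cover closed_in_pts[OF P] by blast
  have Ri: "R \<in> chart C n c i" using i sub closed_in_pts[OF R] by (auto simp: chart_def)
  note U = chart_affine[OF i(1,2)]
  have "Mx R \<inter> chart_ring i \<subseteq> Mx P \<inter> chart_ring i"
  proof
    fix z assume z: "z \<in> Mx R \<inter> chart_ring i"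
    then have "z = 0 \<or> inverse z \<notin> St P" "z \<in> St P"
      using Mx_iff[OF closed_in_pts[OF R]] sub sections_stalk i(3) by blast+
    then show "z \<in> Mx P \<inter> chart_ring i" using Mx_iff[OF closed_in_pts[OF P]] z by blast
  qed
  then have "Mx R \<inter> chart_ring i = Mx P \<inter> chart_ring i"
    using nonzero_prime_maximal[OF U aff_prime[OF U Ri] aff_prime[OF U i(3)]]
      Mx_sections_nonzero[OF U Ri] R closed_point_iff by blast
  then show ?thesis using inj_onD[OF aff_inj[OF U], of R P] Ri i(3) by simp
qed

sublocale places K "closed_points C" "ord_at C" "point_degree K C" Q
proof
  show "\<exists>z. z \<noteq> 0 \<and> 0 \<le> ord_at C P z \<and> ord_at C R z < 0"
    if PR: "P \<in> closed_points C" "R \<in> closed_points C" "P \<noteq> R" for P R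
  proof -
    obtain z where z: "z \<in> St P" "z \<notin> St R" using stalk_incomparable PR by blast
    then have "z \<noteq> 0" using subring_set.A_0[OF stalk_subring[OF closed_in_pts[OF PR(2)]]] by blast
    then show ?thesis
      using ord_at_nonneg[OF PR(1), of z] ord_at_nonneg[OF PR(2), of z] z by (intro exI[of _ z]) auto
  qed
  show "f \<in> K" if "f \<noteq> 0" "\<And>P. P \<in> closed_points C \<Longrightarrow> 0 \<le> ord_at C P f" for f
    using global_sections_const[of f] ord_at_nonneg that by blast
  show "\<exists>u. (\<forall>i<point_degree K C P. u i \<in> val_ge (ord_at C) P 0) \<and>
     (\<forall>f\<in>val_ge (ord_at C) P 0. \<exists>a. (\<forall>i<point_degree K C P. a i \<in> K) \<and>
        f - (\<Sum>i<point_degree K C P. a i * u i) \<in> val_ge (ord_at C) P 1) \<and>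
     (\<forall>a. (\<forall>i<point_degree K C P. a i \<in> K) \<and> (\<Sum>i<point_degree K C P. a i * u i) \<in> val_ge (ord_at C) P 1 \<longrightarrow>
        (\<forall>i<point_degree K C P. a i = 0))" if "P \<in> closed_points C" for P
    unfolding val_ge_0[OF that] val_ge_1[OF that] by (rule point_degree_basis[OF that])
qed (use ord_at_mult ord_at_add ord_at_K ord_at_uniformizer finite_poles_zeros Q_closed in blast)+

end

subsection \<open>The genus as a codimension in the adeles\<close>

lemma ex1_unique: "\<exists>!x. P x \<Longrightarrow> P a \<Longrightarrow> P b \<Longrightarrow> a = b"
  by blast

context curve
begin

text \<open>In each of the finitely many charts the open set contains the nonvanishing locus of a
  nonzero function, which omits finitely many points.\<close>

lemma open_cofinite:
  assumes V: "openin (space C) V" "V \<noteq> {}"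
  shows "finite {P \<in> closed_points C. P \<notin> V}"
proof -
  have fin: "finite {P \<in> closed_points C. P \<in> chart C n c i \<and> P \<notin> V}" if i: "i \<le> n" "c i \<noteq> 0" for i
  proof -
    note U = chart_affine[OF i]
    obtain x where x: "x \<in> V" "x \<in> chart C n c i"
      using curve_props(1) V aff_open[OF U] unfolding irreducible_space_def by blast
    obtain a where a: "a \<in> chart_ring i" "a \<notin> Mx x" "{y \<in> chart C n c i. a \<notin> Mx y} \<subseteq> V"
      using aff_nbhd[OF U V(1) x] by blast
    have "a \<noteq> 0" using a(2) Mx_ideal(1)[OF chart_pts[OF x(2)]] by (auto simp: is_ideal_def)
    then have "finite {y \<in> chart C n c i. a \<in> Mx y}" by (rule finite_zeros[OF i a(1)])
    then show ?thesis by (rule finite_subset[rotated]) (use a(3) in blast)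
  qed
  have "{P \<in> closed_points C. P \<notin> V}
      \<subseteq> (\<Union>i\<in>{i. i \<le> n \<and> c i \<noteq> 0}. {P \<in> closed_points C. P \<in> chart C n c i \<and> P \<notin> V})"
    using chart_cover closed_in_pts by blast
  moreover have "finite (\<Union>i\<in>{i. i \<le> n \<and> c i \<noteq> 0}. {P \<in> closed_points C. P \<in> chart C n c i \<and> P \<notin> V})"
    using fin by (intro finite_UN_I) auto
  ultimately show ?thesis by (rule finite_subset)
qed

lemma nonclosed_stalk: "x \<in> pts \<Longrightarrow> x \<notin> closed_points C \<Longrightarrow> St x = UNIV"
  using closed_point_iff[of x] generic_stalk[of x] by blast

lemma finite_poles: "finite {P \<in> closed_points C. f \<notin> St P}"
proof (cases "f = 0")
  case True
  then have "{P \<in> closed_points C. f \<notin> St P} = {}"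
    using subring_set.A_0[OF stalk_subring[OF closed_in_pts]] by blast
  then show ?thesis by (simp only: finite.emptyI)
next
  case False
  have "{P \<in> closed_points C. f \<notin> St P} \<subseteq> {P \<in> closed_points C. ord_at C P f \<noteq> 0}"
    using ord_at_nonneg[OF _ False] by force
  then show ?thesis by (rule finite_subset[OF _ finite_poles_zeros[OF False]])
qed

lemma adeles_iff: "s \<in> adeles \<longleftrightarrow> finite {P \<in> closed_points C. s P \<notin> St P}"
proof -
  have "{P \<in> closed_points C. s P \<notin> val_ge (ord_at C) P 0} = {P \<in> closed_points C. s P \<notin> St P}"
    using val_ge_0 by blast
  then show ?thesis by (simp only: adeles_def mem_Collect_eq)
qed

text \<open>A section differs from one function only inside the stalks over a cofinite set, and that
  function has finitely many poles. Conversely, the finitely many bad points other than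
  \<open>x\<close> can be removed from a neighbourhood of \<open>x\<close>.\<close>

lemma quotient_sections_eq: "quotient_sections C = adeles"
proof (rule Set.set_eqI, rule iffI)
  fix s assume "s \<in> quotient_sections C"
  then obtain U f where U: "openin (space C) U" "Q \<in> U" "\<forall>y\<in>U. s y - f \<in> St y"
    using closed_in_pts[OF Q_closed] unfolding quotient_sections_def by blast
  have sum: "s P \<in> St P" if P: "P \<in> closed_points C" "P \<in> U" "f \<in> St P" for P
  proof -
    have "(s P - f) + f \<in> St P"
      using subring_set.A_add[OF stalk_subring[OF closed_in_pts[OF P(1)]]] U(3) P(2,3) by blast
    then show ?thesis by simp
  qed
  have "{P \<in> closed_points C. s P \<notin> St P} \<subseteq> {P \<in> closed_points C. P \<notin> U} \<union> {P \<in> closed_points C. f \<notin> St P}"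
    using sum by blast
  moreover have "finite ({P \<in> closed_points C. P \<notin> U} \<union> {P \<in> closed_points C. f \<notin> St P})"
    using open_cofinite[OF U(1)] U(2) finite_poles by blast
  ultimately show "s \<in> adeles" unfolding adeles_iff by (rule finite_subset)
next
  fix s assume "s \<in> adeles"
  then have fin: "finite {P \<in> closed_points C. s P \<notin> St P}" by (simp only: adeles_iff)
  show "s \<in> quotient_sections C"
    unfolding quotient_sections_def
  proof (rule CollectI, rule ballI)
    fix x assume x: "x \<in> pts"
    define f where "f = (if s x \<in> St x then 0 else s x)"
    define B where "B = ({P \<in> closed_points C. s P \<notin> St P} \<union> {P \<in> closed_points C. f \<notin> St P}) - {x}"
    have B: "finite B" "B \<subseteq> closed_points C" using fin finite_poles by (auto simp: B_def)
    have "closedin (space C) (\<Union>P\<in>B. {P})"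
      using B by (intro closedin_Union) (auto simp: closed_points_def)
    then have "openin (space C) (pts - B)" by (simp add: closedin_def)
    moreover have "x \<in> pts - B" using x by (simp add: B_def)
    moreover have "\<forall>y\<in>pts - B. s y - f \<in> St y"
    proof
      fix y assume y: "y \<in> pts - B"
      interpret S: subring_set "St y" by (rule stalk_subring) (use y in blast)
      show "s y - f \<in> St y"
      proof (cases "y = x")
        case True
        then show ?thesis using S.A_0 by (auto simp: f_def)
      next
        case False
        show ?thesis
        proof (cases "y \<in> closed_points C")
          case True
          then have "s y \<in> St y" "f \<in> St y" using y False by (auto simp: B_def)
          then show ?thesis by (rule S.A_diff)
        next
          case False
          then show ?thesis using nonclosed_stalk[of y] y by blast
        qed
      qed
    qed
    ultimately show "\<exists>U f. openin (space C) U \<and> x \<in> U \<and> (\<forall>y\<in>U. s y - f \<in> St y)" by blast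
  qed
qed

lemma constant_quotient_sections_eq: "constant_quotient_sections C = W1"
proof -
  have "(\<forall>y\<in>pts. s y - f \<in> St y) \<longleftrightarrow> (\<forall>P\<in>closed_points C. s P - f \<in> val_ge (ord_at C) P 0)" for s f
    using val_ge_0 closed_in_pts nonclosed_stalk by blast
  then show ?thesis unfolding constant_quotient_sections_def W1_def by simp
qed

lemma zero_adeles: "(\<lambda>_. 0) \<in> adeles"
proof -
  have "{P \<in> closed_points C. 0 \<notin> St P} = {}"
    using subring_set.A_0[OF stalk_subring[OF closed_in_pts]] by blast
  then show ?thesis unfolding adeles_iff by (simp only: finite.emptyI)
qed

text \<open>Unique expansions with coefficients in \<open>K\<close> amount to a family that spans
  and is independent, and two such families have the same length.\<close>

lemma h1_eq:
  assumes b: "\<forall>i<m. b i \<in> adeles" "indep W1 {..<m} b" "spanned W1 {..<m} b adeles"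
  shows "h1 K C = m"
  unfolding h1_def quotient_dim_def quotient_sections_eq constant_quotient_sections_eq
proof (rule the_equality)
  show "\<exists>b. (\<forall>i<m. b i \<in> adeles) \<and>
    (\<forall>v\<in>adeles. \<exists>!a. a \<in> {..<m} \<rightarrow>\<^sub>E K \<and> (\<lambda>x. v x - (\<Sum>i<m. a i * b i x)) \<in> W1)"
  proof (rule exI[of _ b], intro conjI ballI b(1))
    fix v assume "v \<in> adeles"
    then obtain a0 where a0: "\<forall>i\<in>{..<m}. a0 i \<in> K" "(\<lambda>x. v x - (\<Sum>i<m. a0 i * b i x)) \<in> W1"
      using b(3) unfolding spanned_def by blast
    show "\<exists>!a. a \<in> {..<m} \<rightarrow>\<^sub>E K \<and> (\<lambda>x. v x - (\<Sum>i<m. a i * b i x)) \<in> W1"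
    proof (rule ex1I[of _ "restrict a0 {..<m}"])
      show "restrict a0 {..<m} \<in> {..<m} \<rightarrow>\<^sub>E K \<and> (\<lambda>x. v x - (\<Sum>i<m. restrict a0 {..<m} i * b i x)) \<in> W1"
        using a0 by auto
      fix a assume a: "a \<in> {..<m} \<rightarrow>\<^sub>E K \<and> (\<lambda>x. v x - (\<Sum>i<m. a i * b i x)) \<in> W1"
      have aK: "a i \<in> K" if "i < m" for i using a that by (auto simp: PiE_iff)
      have "(\<lambda>x. (v x - (\<Sum>i<m. a i * b i x)) - (v x - (\<Sum>i<m. a0 i * b i x))) \<in> W1"
        using subsp_diff[OF subsp_W1] a a0(2) by blast
      moreover have "(\<lambda>x. (v x - (\<Sum>i<m. a i * b i x)) - (v x - (\<Sum>i<m. a0 i * b i x)))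
          = (\<lambda>x. \<Sum>i<m. (a0 i - a i) * b i x)"
        by (simp add: fun_eq_iff sum_subtractf left_diff_distrib)
      ultimately have "(\<lambda>x. \<Sum>i<m. (a0 i - a i) * b i x) \<in> W1" by (simp only:)
      then have "a0 i - a i = 0" if "i < m" for i
        using indepD[OF b(2), of "\<lambda>i. a0 i - a i" i] a0(1) aK that by auto
      then show "a = restrict a0 {..<m}" using a by (intro extensionalityI[of _ "{..<m}"]) (auto simp: PiE_def)
    qed
  qed
next
  fix m' :: nat assume "\<exists>b :: nat \<Rightarrow> 'p \<Rightarrow> 'f. (\<forall>i<m'. b i \<in> adeles) \<and>
    (\<forall>v\<in>adeles. \<exists>!a. a \<in> {..<m'} \<rightarrow>\<^sub>E K \<and> (\<lambda>x. v x - (\<Sum>i<m'. a i * b i x)) \<in> W1)"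
  then obtain b' where b': "(\<forall>i<m'. b' i \<in> adeles) \<and>
    (\<forall>v\<in>adeles. \<exists>!a. a \<in> {..<m'} \<rightarrow>\<^sub>E K \<and> (\<lambda>x. v x - (\<Sum>i<m'. a i * b' i x)) \<in> W1)" ..
  note b'1 = conjunct1[OF b'] and b'2 = bspec[OF conjunct2[OF b']]
  have span: "spanned W1 {..<m'} b' adeles"
    unfolding spanned_def
  proof
    fix v assume v: "v \<in> adeles"
    obtain a where a: "a \<in> {..<m'} \<rightarrow>\<^sub>E K \<and> (\<lambda>x. v x - (\<Sum>i<m'. a i * b' i x)) \<in> W1"
      using ex1_implies_ex[OF b'2[OF v]] ..
    show "\<exists>a. (\<forall>i\<in>{..<m'}. a i \<in> K) \<and> (\<lambda>x. v x - (\<Sum>i<m'. a i * b' i x)) \<in> W1"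
      by (rule exI[of _ a], intro conjI conjunct2[OF a]) (use conjunct1[OF a] in \<open>auto simp: PiE_iff\<close>)
  qed
  have ind: "indep W1 {..<m'} b'"
    unfolding indep_def
  proof (intro allI impI)
    \<comment> \<open>Independence is the uniqueness of the expansion of the zero adele; the
      coefficients are restricted because uniqueness is stated for extensional functions.\<close>
    fix a assume a: "(\<forall>j\<in>{..<m'}. a j \<in> K) \<and> (\<lambda>y. \<Sum>j<m'. a j * b' j y) \<in> W1"
    have "(\<lambda>x. (-1) * (\<Sum>i<m'. a i * b' i x)) \<in> W1"
      by (rule subsp_smult[OF subsp_W1 _ conjunct2[OF a]]) simp
    then have 1: "(\<lambda>x. 0 - (\<Sum>i<m'. restrict a {..<m'} i * b' i x)) \<in> W1" by simp
    have "(\<lambda>_. 0) \<in> W1" using subsp_W1 by (simp add: subsp_def)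
    then have 2: "(\<lambda>x. 0 - (\<Sum>i<m'. restrict (\<lambda>_. 0) {..<m'} i * b' i x)) \<in> W1" by simp
    have 3: "restrict a {..<m'} \<in> {..<m'} \<rightarrow>\<^sub>E K" "restrict (\<lambda>_. 0) {..<m'} \<in> {..<m'} \<rightarrow>\<^sub>E K" using a by auto
    have eq: "restrict a {..<m'} = restrict (\<lambda>_. 0) {..<m'}"
      by (rule ex1_unique[where P = "\<lambda>a. a \<in> {..<m'} \<rightarrow>\<^sub>E K \<and> (\<lambda>x. 0 - (\<Sum>i<m'. a i * b' i x)) \<in> W1"],
          rule b'2[OF zero_adeles], rule conjI[OF 3(1) 1], rule conjI[OF 3(2) 2])
    show "\<forall>j\<in>{..<m'}. a j = 0"
    proof
      fix j assume "j \<in> {..<m'}"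
      then show "a j = 0" using fun_cong[OF eq, of j] by simp
    qed
  qed
  have "m' \<le> m" using indep_card_le[OF subsp_W1 _ _ b(3), of "{..<m'}" b'] b'1 ind by simp
  moreover have "m \<le> m'" using indep_card_le[OF subsp_W1 _ _ span, of "{..<m}" b] b(1,2) by simp
  ultimately show "m' = m" by simp
qed

lemma h0_eq: "h0 K C = 1"
proof -
  interpret F: field "Fr :: 'f ring" by (rule field_Fr)
  have "sections C pts = K"
    using global_sections_const K_sections[of pts] closed_in_pts by (auto simp: sections_def)
  then show ?thesis
    unfolding h0_def using F.dimI[OF curve_props(3) F.dimension_one[OF curve_props(3)]] by (simp add: over_def)
qed

text \<open>The rational point forces \<open>h0 = 1\<close>, so the arithmetic genus is the
  dimension of the adelic \<open>H^1\<close>.\<close>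

theorem genus_basis: "\<exists>t hb. arithmetic_genus K C = int t \<and> spanned W1 {..<t} hb adeles"
proof -
  obtain m :: nat and b where b: "\<forall>i<m. b i \<in> adeles" "indep W1 {..<m} b" "spanned W1 {..<m} b adeles"
    using H1_basis by (elim exE conjE)
  then show ?thesis using h1_eq[OF b] h0_eq by (intro exI[of _ m] exI[of _ b]) (simp add: arithmetic_genus_def)
qed

end

section \<open>Tame symbols\<close>

lemma neg_one_powi: "(-1 :: 'f::field) powi m = (if even m then 1 else - 1)"
  by (cases m rule: int_cases2) (auto simp: power_int_minus)

context places
begin

text \<open>The tame symbol before reduction modulo the maximal ideal, a unit at
  \<open>P\<close>.\<close>

definition tau :: "'p \<Rightarrow> 'f \<Rightarrow> 'f \<Rightarrow> 'f"
  where "tau P f g = (-1) powi (ord P f * ord P g) * (f powi ord P g / g powi ord P f)"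

lemma tau_nonzero: "f \<noteq> 0 \<Longrightarrow> g \<noteq> 0 \<Longrightarrow> tau P f g \<noteq> 0"
  by (simp add: tau_def)

lemma ord_tau: assumes "P \<in> Pts" "f \<noteq> 0" "g \<noteq> 0" shows "ord P (tau P f g) = 0"
  using assms by (simp add: tau_def ord_mult ord_divide ord_powi ord_uminus_1)

lemma tau_mult_left:
  assumes "P \<in> Pts" "f \<noteq> 0" "f' \<noteq> 0" "g \<noteq> 0" shows "tau P (f * f') g = tau P f g * tau P f' g"
  using assms by (simp add: tau_def ord_mult power_int_mult_distrib power_int_add distrib_right)

lemma tau_mult_right:
  assumes "P \<in> Pts" "f \<noteq> 0" "g \<noteq> 0" "g' \<noteq> 0" shows "tau P f (g * g') = tau P f g * tau P f g'"
  using assms by (simp add: tau_def ord_mult power_int_mult_distrib power_int_add distrib_left)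

lemma tau_trivial: "ord P f = 0 \<Longrightarrow> ord P g = 0 \<Longrightarrow> tau P f g = 1"
  by (simp add: tau_def)

lemma one_unit_mult:
  assumes "P \<in> Pts" "u - 1 \<in> ge P 1" "w - 1 \<in> ge P 1" shows "u * w - 1 \<in> ge P 1"
proof -
  have "1 + (w - 1) \<in> ge P 0" by (intro ge_add[OF assms(1)] ge_mono[OF assms(3)]) (use assms(1) in \<open>auto simp: ge_iff\<close>)
  then have "w \<in> ge P 0" by simp
  then have "(u - 1) * w + (w - 1) \<in> ge P 1" using assms ge_mult'[of P "u - 1" 1 w 0 1] by (intro ge_add) auto
  then show ?thesis by (simp add: algebra_simps)
qed

lemma one_unit_ord:
  assumes "P \<in> Pts" "u - 1 \<in> ge P 1" shows "u \<noteq> 0" "ord P u = 0"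
  using ord_add_eq[of P 1 "u - 1"] assms by (auto simp: ge_iff)

lemma one_unit_powi:
  assumes P: "P \<in> Pts" and u: "u - 1 \<in> ge P 1" shows "u powi n - 1 \<in> ge P 1"
proof -
  have pow: "w ^ k - 1 \<in> ge P 1" if "w - 1 \<in> ge P 1" for w k
    by (induction k) (use one_unit_mult[OF P that] in auto)
  have "inverse u - 1 = (1 - u) * inverse u" using one_unit_ord[OF P u] by (simp add: algebra_simps)
  also have "1 - u \<in> ge P 1" using ge_uminus[OF P u] by simp
  then have "(1 - u) * inverse u \<in> ge P 1"
    using one_unit_ord[OF P u] P ge_mult'[of P "1 - u" 1 "inverse u" 0 1] by (simp add: ge_iff ord_inverse)
  finally have "inverse u - 1 \<in> ge P 1" .
  then show ?thesis using pow u by (cases n rule: int_cases2) (auto simp: power_int_minus power_inverse[symmetric])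
qed

text \<open>In every case the value is a power of a unit congruent to \<open>1\<close>: of
  \<open>1 - a\<close> if \<open>a\<close> has a zero, of \<open>a / (a - 1)\<close> if it has a
  pole, and of \<open>a\<close> if \<open>1 - a\<close> has a zero. If neither \<open>a\<close> nor
  \<open>1 - a\<close> has a zero or pole, it is \<open>1\<close>.\<close>

lemma tau_steinberg:
  assumes P: "P \<in> Pts" and a: "a \<noteq> 0" "a \<noteq> 1" shows "tau P a (1 - a) - 1 \<in> ge P 1"
proof -
  have b: "1 - a \<noteq> 0" using a by simp
  consider "ord P a > 0" | "ord P a < 0" | "ord P a = 0" by linarith
  then show ?thesis
  proof cases
    case 1
    have "ord P (1 + (- a)) = ord P 1" using ord_add_eq[of P 1 "- a"] P a 1 by auto
    then have "ord P (1 - a) = 0" using P by simp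
    then have "tau P a (1 - a) = (1 - a) powi (- ord P a)"
      by (simp add: tau_def power_int_minus divide_inverse)
    moreover have "(1 - a) - 1 \<in> ge P 1" using 1 P by (simp add: ge_iff)
    ultimately show ?thesis using one_unit_powi[OF P] by metis
  next
    case 2
    have "ord P (- a + 1) = ord P (- a)" using ord_add_eq[of P "- a" 1] P a 2 by auto
    then have k: "ord P (1 - a) = ord P a" using P by simp
    have "tau P a (1 - a) = (-1) powi ord P a * (a powi ord P a / (1 - a) powi ord P a)"
      by (simp add: tau_def k neg_one_powi)
    also have "\<dots> = (a / (a - 1)) powi ord P a"
      by (simp add: power_int_divide_distrib[symmetric] power_int_mult_distrib[symmetric])
        (metis minus_diff_eq minus_divide_right)
    finally have "tau P a (1 - a) = (a / (a - 1)) powi ord P a" .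
    moreover have "a / (a - 1) - 1 \<in> ge P 1"
    proof -
      have "a / (a - 1) - 1 = inverse (a - 1)" using a by (simp add: field_simps)
      moreover have "ord P (a - 1) = ord P (1 - a)" using ord_uminus[OF P, of "1 - a"] by simp
      ultimately show ?thesis using 2 k P a by (simp add: ge_iff ord_inverse)
    qed
    ultimately show ?thesis using one_unit_powi[OF P] by metis
  next
    case 3
    then have tau: "tau P a (1 - a) = a powi ord P (1 - a)" by (simp add: tau_def)
    have "1 - a \<in> ge P 0" by (rule ge_diff[OF P]) (use 3 P in \<open>auto simp: ge_iff\<close>)
    then consider "ord P (1 - a) = 0" | "ord P (1 - a) \<ge> 1" using b by (force simp: ge_iff)
    then show ?thesis
    proof cases
      case 1
      then show ?thesis unfolding tau by simp
    next
      case 2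
      then have "- (1 - a) \<in> ge P 1" using ge_uminus[OF P, of "1 - a" 1] b by (simp add: ge_iff)
      then have "a - 1 \<in> ge P 1" by simp
      then show ?thesis unfolding tau by (rule one_unit_powi[OF P])
    qed
  qed
qed

end

section \<open>The filtration by degree\<close>

lemma (in group) finprod_in_subgroup:
  assumes "comm_group G" "subgroup H G" "finite I" "\<And>i. i \<in> I \<Longrightarrow> f i \<in> H"
  shows "finprod G f I \<in> H"
proof -
  interpret comm_group G by fact
  show ?thesis using assms(3,4)
  proof (induction I rule: finite_induct)
    case (insert i I)
    have "f \<in> I \<rightarrow> carrier G" "f i \<in> carrier G" using insert.prems subgroup.subset[OF assms(2)] by auto
    then show ?case using insert subgroup.m_closed[OF assms(2)] by simp
  qed (simp add: subgroup.one_closed[OF assms(2)])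
qed

text \<open>\<open>G\<close> stands for \<open>K_2(F)\<close>, \<open>U P\<close> for the
  multiplicative group of the residue field and \<open>cl P\<close> for the residue class. Of
  \<open>K_2\<close> only the bilinear symbol, the Steinberg relation, generation by symbols and the
  tame homomorphisms are retained.\<close>

locale tame_places = genus_places K Pts ord deg Q t hb
  for K :: "'f::field set" and Pts :: "'p set" and ord and deg and Q and t and hb +
  fixes G :: "'g monoid" and sym :: "'f \<Rightarrow> 'f \<Rightarrow> 'g" and U :: "'p \<Rightarrow> 'u monoid"
    and cl :: "'p \<Rightarrow> 'f \<Rightarrow> 'u" and T :: "'g \<Rightarrow> 'p \<Rightarrow> 'u"
  assumes G: "comm_group G"
    and sym_closed: "f \<noteq> 0 \<Longrightarrow> g \<noteq> 0 \<Longrightarrow> sym f g \<in> carrier G"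
    and sym_mult_left: "f \<noteq> 0 \<Longrightarrow> f' \<noteq> 0 \<Longrightarrow> g \<noteq> 0 \<Longrightarrow> sym (f * f') g = sym f g \<otimes>\<^bsub>G\<^esub> sym f' g"
    and sym_mult_right: "f \<noteq> 0 \<Longrightarrow> g \<noteq> 0 \<Longrightarrow> g' \<noteq> 0 \<Longrightarrow> sym f (g * g') = sym f g \<otimes>\<^bsub>G\<^esub> sym f g'"
    and sym_steinberg: "a \<noteq> 0 \<Longrightarrow> a \<noteq> 1 \<Longrightarrow> sym a (1 - a) = \<one>\<^bsub>G\<^esub>"
    and sym_generate: "carrier G = generate G {sym f g |f g. f \<noteq> 0 \<and> g \<noteq> 0}"
    and U: "P \<in> Pts \<Longrightarrow> comm_group (U P)"
    and cl_surj: "P \<in> Pts \<Longrightarrow> u \<in> carrier (U P) \<Longrightarrow> \<exists>f. f \<noteq> 0 \<and> ord P f = 0 \<and> cl P f = u"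
    and cl_eq: "P \<in> Pts \<Longrightarrow> f \<in> ge P 0 \<Longrightarrow> g \<in> ge P 0 \<Longrightarrow> cl P f = cl P g \<longleftrightarrow> f - g \<in> ge P 1"
    and cl_1: "P \<in> Pts \<Longrightarrow> cl P 1 = \<one>\<^bsub>U P\<^esub>"
    and T_hom: "P \<in> Pts \<Longrightarrow> (\<lambda>\<xi>. T \<xi> P) \<in> hom G (U P)"
    and T_sym: "P \<in> Pts \<Longrightarrow> f \<noteq> 0 \<Longrightarrow> g \<noteq> 0 \<Longrightarrow> T (sym f g) P = cl P (tau P f g)"
begin

sublocale G: comm_group G by (rule G)

lemma sym_1_left: assumes "g \<noteq> 0" shows "sym 1 g = \<one>\<^bsub>G\<^esub>"
  using sym_mult_left[of 1 1 g] sym_closed[of 1 g] assms by (simp add: G.r_cancel_one)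

lemma sym_1_right: assumes "f \<noteq> 0" shows "sym f 1 = \<one>\<^bsub>G\<^esub>"
  using sym_mult_right[of f 1 1] sym_closed[of f 1] assms by (simp add: G.r_cancel_one)

lemma sym_inverse_left: assumes "f \<noteq> 0" "g \<noteq> 0" shows "sym (inverse f) g = inv\<^bsub>G\<^esub> sym f g"
  using sym_mult_left[of "inverse f" f g] sym_1_left[of g] assms
  by (intro G.inv_equality[symmetric]) (auto simp: sym_closed)

lemma sym_inverse_right: assumes "f \<noteq> 0" "g \<noteq> 0" shows "sym f (inverse g) = inv\<^bsub>G\<^esub> sym f g"
  using sym_mult_right[of f "inverse g" g] sym_1_right[of f] assms
  by (intro G.inv_equality[symmetric]) (auto simp: sym_closed)

text \<open>Both \<open>{f, 1 - f}\<close> and \<open>{1 / f, 1 - 1 / f}\<close> are Steinberg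
  symbols, and \<open>- f\<close> is the quotient of \<open>1 - f\<close> by
  \<open>1 - 1 / f\<close>. At \<open>f = 1\<close> this quotient is undefined, and the symbol is
  trivial for another reason.\<close>

lemma sym_uminus: assumes "f \<noteq> 0" shows "sym f (- f) = \<one>\<^bsub>G\<^esub>"
proof (cases "f = 1")
  case True
  then show ?thesis using sym_1_left[of "-1"] by simp
next
  case False
  have 1: "1 - inverse f \<noteq> 0" "1 - f \<noteq> 0" using False assms by (auto simp: field_simps)
  have "sym (inverse f) (1 - inverse f) = \<one>\<^bsub>G\<^esub>" using sym_steinberg[of "inverse f"] assms False by auto
  then have 2: "inv\<^bsub>G\<^esub> sym f (1 - inverse f) = \<one>\<^bsub>G\<^esub>" using sym_inverse_left[of f "1 - inverse f"] assms 1 by simp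
  have "- f = (1 - f) * inverse (1 - inverse f)" using assms False 1 by (simp add: field_simps)
  then have "sym f (- f) = sym f (1 - f) \<otimes>\<^bsub>G\<^esub> sym f (inverse (1 - inverse f))"
    using sym_mult_right[of f "1 - f" "inverse (1 - inverse f)"] assms 1 by simp
  also have "\<dots> = \<one>\<^bsub>G\<^esub>" using sym_steinberg[of f] sym_inverse_right[of f "1 - inverse f"] assms False 1 2 by simp
  finally show ?thesis .
qed

lemma sym_self: assumes "f \<noteq> 0" shows "sym f f = sym f (-1)"
  using sym_mult_right[of f "- f" "-1"] sym_uminus[OF assms] sym_closed[of f "-1"] assms by simp

text \<open>Expand the trivial symbol \<open>{f g, - f g}\<close> in its first entry and then in its
  second.\<close>

lemma sym_antisym: assumes "f \<noteq> 0" "g \<noteq> 0" shows "sym g f = inv\<^bsub>G\<^esub> sym f g"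
proof -
  have "\<one>\<^bsub>G\<^esub> = sym (f * g) (- (f * g))" using sym_uminus[of "f * g"] assms by simp
  also have "\<dots> = sym f (- (f * g)) \<otimes>\<^bsub>G\<^esub> sym g (- (f * g))" using assms by (intro sym_mult_left) auto
  also have "sym f (- (f * g)) = sym f g"
    using sym_mult_right[of f "- f" g] sym_uminus[OF assms(1)] sym_closed[OF assms] assms by simp
  also have "sym g (- (f * g)) = sym g f"
    using sym_mult_right[of g f "- g"] sym_uminus[OF assms(2)] sym_closed[OF assms(2,1)] assms by simp
  finally have "sym g f \<otimes>\<^bsub>G\<^esub> sym f g = \<one>\<^bsub>G\<^esub>"
    using sym_closed[OF assms] sym_closed[OF assms(2,1)] by (simp add: G.m_comm)
  then show ?thesis using sym_closed[OF assms] sym_closed[OF assms(2,1)] by (metis G.inv_equality)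
qed

subsection \<open>Functions supported in bounded degree\<close>

definition Gd :: "int \<Rightarrow> 'f set"
  where "Gd d = {f. f \<noteq> 0 \<and> (\<forall>P\<in>Pts. ord P f \<noteq> 0 \<longrightarrow> int (deg P) \<le> d)}"

definition Fil :: "int \<Rightarrow> 'g set"
  where "Fil d = generate G {sym f g |f g. f \<in> Gd d \<and> g \<in> Gd d}"

lemma Gd_nonzero: "f \<in> Gd d \<Longrightarrow> f \<noteq> 0" by (simp add: Gd_def)

lemma Gd_mult: "f \<in> Gd d \<Longrightarrow> g \<in> Gd d \<Longrightarrow> f * g \<in> Gd d"
  unfolding Gd_def by (auto simp: ord_mult)

lemma Gd_inverse: "f \<in> Gd d \<Longrightarrow> inverse f \<in> Gd d"
  unfolding Gd_def by (auto simp: ord_inverse)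

lemma Gd_divide: "f \<in> Gd d \<Longrightarrow> g \<in> Gd d \<Longrightarrow> f / g \<in> Gd d"
  unfolding divide_inverse by (intro Gd_mult Gd_inverse)

lemma Gd_1: "1 \<in> Gd d" by (simp add: Gd_def)

lemma Gd_uminus_1: "-1 \<in> Gd d" by (simp add: Gd_def)

lemma Gd_mono: "f \<in> Gd d \<Longrightarrow> d \<le> e \<Longrightarrow> f \<in> Gd e" by (force simp: Gd_def)

lemma Gd_ord: "f \<in> Gd d \<Longrightarrow> P \<in> Pts \<Longrightarrow> d < int (deg P) \<Longrightarrow> ord P f = 0" by (force simp: Gd_def)

lemma Fil_gens: "{sym f g |f g. f \<in> Gd d \<and> g \<in> Gd d} \<subseteq> carrier G"
  using sym_closed Gd_nonzero by blast

lemma Fil_subgroup: "subgroup (Fil d) G"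
  unfolding Fil_def by (rule G.generate_is_subgroup[OF Fil_gens])

lemma Fil_carrier: "\<xi> \<in> Fil d \<Longrightarrow> \<xi> \<in> carrier G"
  using subgroup.subset[OF Fil_subgroup] by blast

lemma Fil_sym: "f \<in> Gd d \<Longrightarrow> g \<in> Gd d \<Longrightarrow> sym f g \<in> Fil d"
  unfolding Fil_def by (rule generate.incl) blast

lemma Fil_mult: "x \<in> Fil d \<Longrightarrow> y \<in> Fil d \<Longrightarrow> x \<otimes>\<^bsub>G\<^esub> y \<in> Fil d"
  using subgroup.m_closed[OF Fil_subgroup] .

lemma Fil_inv: "x \<in> Fil d \<Longrightarrow> inv\<^bsub>G\<^esub> x \<in> Fil d"
  using subgroup.m_inv_closed[OF Fil_subgroup] .

lemma Fil_one: "\<one>\<^bsub>G\<^esub> \<in> Fil d"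
  using subgroup.one_closed[OF Fil_subgroup] .

lemma Fil_mono: assumes "d \<le> e" shows "Fil d \<subseteq> Fil e"
  unfolding Fil_def[of d]
  by (rule G.generate_subgroup_incl[OF _ Fil_subgroup]) (use Fil_sym Gd_mono assms in blast)

lemma group_hom_T: assumes "P \<in> Pts" shows "group_hom G (U P) (\<lambda>\<xi>. T \<xi> P)"
  by (rule group_hom.intro[OF G.is_group comm_group.axioms(2)[OF U[OF assms]]])
    (simp add: group_hom_axioms_def T_hom assms)

lemma T_kernel: assumes "P \<in> Pts" shows "subgroup {\<xi> \<in> carrier G. T \<xi> P = \<one>\<^bsub>U P\<^esub>} G"
  using group_hom.subgroup_kernel[OF group_hom_T[OF assms]] by (simp add: kernel_def)

lemma Fil_T:
  assumes P: "P \<in> Pts" "d < int (deg P)" and \<xi>: "\<xi> \<in> Fil d" shows "T \<xi> P = \<one>\<^bsub>U P\<^esub>"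
proof -
  have "Fil d \<subseteq> {\<xi> \<in> carrier G. T \<xi> P = \<one>\<^bsub>U P\<^esub>}"
    unfolding Fil_def
  proof (rule G.generate_subgroup_incl[OF _ T_kernel[OF P(1)]], clarify)
    fix f g assume fg: "f \<in> Gd d" "g \<in> Gd d"
    have "ord P f = 0" "ord P g = 0" using Gd_ord fg P by auto
    then show "sym f g \<in> carrier G \<and> T (sym f g) P = \<one>\<^bsub>U P\<^esub>"
      using T_sym[OF P(1)] fg Gd_nonzero sym_closed tau_trivial cl_1[OF P(1)] by simp
  qed
  then show ?thesis using \<xi> by blast
qed

text \<open>The divisor of \<open>k\<close> plus \<open>D\<close> is effective of degree
  \<open>degD D\<close>, so each of its points has degree at most \<open>m\<close>. Zeros and poles
  of \<open>k\<close> outside the support of \<open>D\<close> are among these points.\<close>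

lemma L_Gd:
  assumes k: "k \<noteq> 0" "k \<in> L D" and D: "fin D" "degD D \<le> m" "\<And>R. R \<in> Pts \<Longrightarrow> D R \<noteq> 0 \<Longrightarrow> int (deg R) \<le> m"
  shows "k \<in> Gd m"
  unfolding Gd_def
proof (intro CollectI conjI ballI impI k(1))
  fix R assume R: "R \<in> Pts" "ord R k \<noteq> 0"
  show "int (deg R) \<le> m"
  proof (cases "D R = 0")
    case False
    then show ?thesis using D(3) R by blast
  next
    case True
    let ?E = "\<lambda>P. ord P k + D P"
    have E: "0 \<le> ?E P" if "P \<in> Pts" for P using k that by (force simp: L_iff)
    have "?E R * int (deg R) \<le> degD ?E" by (rule degD_ge_term) (use k D R E in auto)
    also have "\<dots> = degD D" using degD_add[of "\<lambda>P. ord P k" D] degD_principal[OF k(1)] k D by simp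
    finally have *: "?E R * int (deg R) \<le> m" using D(2) by simp
    have "1 * int (deg R) \<le> ?E R * int (deg R)"
      by (rule mult_right_mono) (use E[OF R(1)] R True in auto)
    then show ?thesis using * by simp
  qed
qed

definition OD :: "int \<Rightarrow> 'p \<Rightarrow> int" where "OD a = (\<lambda>P. if P = Q then a else 0)"

lemma fin_OD [simp]: "fin (OD a)" by (simp add: OD_def)

lemma degD_OD [simp]: "degD (OD a) = a" using degD_single[OF Q, of a] deg_Q by (simp add: OD_def)

text \<open>Since \<open>1 - y / x = F * (k / x)\<close>, the Steinberg relation for
  \<open>y / x\<close> trades the entry \<open>F\<close> for \<open>k / x\<close>, whose support has
  low degree.\<close>

lemma steinberg_reduce:
  assumes nz: "x \<noteq> 0" "y \<noteq> 0" "k \<noteq> 0" "F \<noteq> 0" and eq: "x - y = F * k"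
    and gd: "y / x \<in> Gd m" "k / x \<in> Gd m"
  shows "sym F (y / x) \<in> Fil m"
proof -
  have "1 - y / x = F * (k / x)" using nz eq by (simp add: field_simps)
  moreover have "y / x \<noteq> 1" using nz eq by auto
  ultimately have "sym (y / x) (F * (k / x)) = \<one>\<^bsub>G\<^esub>" using sym_steinberg[of "y / x"] nz by simp
  then have "sym (y / x) F \<otimes>\<^bsub>G\<^esub> sym (y / x) (k / x) = \<one>\<^bsub>G\<^esub>"
    using sym_mult_right[of "y / x" F "k / x"] nz by simp
  then have "sym (y / x) F = inv\<^bsub>G\<^esub> sym (y / x) (k / x)"
    using nz by (intro G.inv_equality[symmetric]) (auto simp: sym_closed)
  then have "sym F (y / x) = sym (y / x) (k / x)"
    using sym_antisym[of "y / x" F] nz sym_closed[of "y / x" "k / x"] by simp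
  then show ?thesis using Fil_sym gd by simp
qed

end

locale tame_degree = tame_places K Pts ord deg Q t hb G sym U cl T
  for K :: "'f::field set" and Pts :: "'p set" and ord deg Q t hb
    and G :: "'g monoid" and sym and U :: "'p \<Rightarrow> 'u monoid" and cl T +
  fixes d :: int
  assumes d: "3 * int t + 1 \<le> d"
begin

lemma d_pos: "1 \<le> d" "int t \<le> d - 1" "2 * int t \<le> d - 1" using d by linarith+

text \<open>The exclusion of \<open>Q\<close>, a point of degree one, has an effect only when
  \<open>d = 1\<close>.\<close>

definition S :: "'p set" where "S = {P \<in> Pts. int (deg P) = d \<and> P \<noteq> Q}"

lemma S_D: "P \<in> S \<Longrightarrow> P \<in> Pts" "P \<in> S \<Longrightarrow> int (deg P) = d" "P \<in> S \<Longrightarrow> P \<noteq> Q"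
  by (simp_all add: S_def)

text \<open>The pole order \<open>d + t\<close> makes the degree of \<open>(d + t) Q - P\<close>
  equal to \<open>t\<close>, just enough for \<open>riemann_nonzero\<close>. The remaining zeros
  form an effective divisor \<open>E\<close> of degree \<open>t\<close>; its points have degree
  below \<open>d\<close>.\<close>

lemma exists_uniformizing_function:
  assumes P: "P \<in> S"
  shows "\<exists>f E. f \<noteq> 0 \<and> fin E \<and> (\<forall>R\<in>Pts. 0 \<le> E R) \<and> degD E = int t \<and>
    (\<forall>R\<in>Pts. ord R f = (if R = P then 1 else 0) + E R - OD (d + int t) R)"
proof -
  let ?D = "\<lambda>R. OD (d + int t) R - (if R = P then 1 else 0)"
  have D: "fin ?D" "degD ?D = int t"
    using S_D[OF P] by (simp_all add: degD_diff degD_single)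
  then obtain f where f: "f \<noteq> 0" "f \<in> L ?D" using riemann_nonzero[of ?D] by auto
  define E where "E = (\<lambda>R. ord R f + ?D R)"
  have "fin E" unfolding E_def by (rule fin_add) (use f D in auto)
  moreover have "\<forall>R\<in>Pts. 0 \<le> E R" using f by (force simp: L_iff E_def)
  moreover have "degD E = int t"
    unfolding E_def using degD_add[of "\<lambda>R. ord R f" ?D] f D degD_principal[of f] by simp
  moreover have "\<forall>R\<in>Pts. ord R f = (if R = P then 1 else 0) + E R - OD (d + int t) R"
    by (simp add: E_def)
  ultimately show ?thesis using f(1) by blast
qed

text \<open>A fixed choice of the uniformizing function; \<open>pE P\<close> is then the rest of its
  zero divisor.\<close>

definition pf :: "'p \<Rightarrow> 'f"
  where "pf P = (SOME f. \<exists>E. f \<noteq> 0 \<and> fin E \<and> (\<forall>R\<in>Pts. 0 \<le> E R) \<and> degD E = int t \<and>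
    (\<forall>R\<in>Pts. ord R f = (if R = P then 1 else 0) + E R - OD (d + int t) R))"

definition pE :: "'p \<Rightarrow> 'p \<Rightarrow> int"
  where "pE P = (SOME E. pf P \<noteq> 0 \<and> fin E \<and> (\<forall>R\<in>Pts. 0 \<le> E R) \<and> degD E = int t \<and>
    (\<forall>R\<in>Pts. ord R (pf P) = (if R = P then 1 else 0) + E R - OD (d + int t) R))"

lemma pf:
  assumes P: "P \<in> S"
  shows "pf P \<noteq> 0" "fin (pE P)" "\<And>R. R \<in> Pts \<Longrightarrow> 0 \<le> pE P R" "degD (pE P) = int t"
    "\<And>R. R \<in> Pts \<Longrightarrow> ord R (pf P) = (if R = P then 1 else 0) + pE P R - OD (d + int t) R"
  using someI_ex[OF someI_ex[OF exists_uniformizing_function[OF P], folded pf_def], folded pE_def] by blast+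

lemma eff_deg_le:
  assumes B: "fin B" "\<And>R. R \<in> Pts \<Longrightarrow> 0 \<le> B R" "degD B = int t" and R: "R \<in> Pts" "B R \<noteq> 0"
  shows "int (deg R) \<le> int t"
proof -
  have "1 * int (deg R) \<le> B R * int (deg R)" by (rule mult_right_mono) (use B(2)[OF R(1)] R(2) in auto)
  also have "\<dots> \<le> degD B" by (rule degD_ge_term[OF B(1,2) R(1)])
  finally show ?thesis using B(3) by simp
qed

lemma eff_S: assumes "fin B" "\<And>R. R \<in> Pts \<Longrightarrow> 0 \<le> B R" "degD B = int t" "P \<in> S" shows "B P = 0"
  using eff_deg_le[OF assms(1-3), of P] S_D[OF assms(4)] d_pos by fastforce

lemma pE_S: "P \<in> S \<Longrightarrow> R \<in> S \<Longrightarrow> pE P R = 0"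
  using eff_S[OF pf(2,3,4)] .

lemma pE_deg: "P \<in> S \<Longrightarrow> R \<in> Pts \<Longrightarrow> pE P R \<noteq> 0 \<Longrightarrow> int (deg R) \<le> d - 1"
  using eff_deg_le[OF pf(2,3,4)] d_pos by fastforce

lemma ord_pf_S: assumes "P \<in> S" "R \<in> S" shows "ord R (pf P) = (if R = P then 1 else 0)"
  using pf(5)[OF assms(1) S_D(1)[OF assms(2)]] pE_S[OF assms] S_D(3)[OF assms(2)] by (simp add: OD_def)

lemma pf_Gd: assumes P: "P \<in> S" shows "pf P \<in> Gd d"
  unfolding Gd_def
proof (intro CollectI conjI ballI impI pf(1)[OF P])
  fix R assume R: "R \<in> Pts" "ord R (pf P) \<noteq> 0"
  show "int (deg R) \<le> d"
  proof (cases "R = P \<or> R = Q")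
    case True
    then show ?thesis using S_D[OF P] deg_Q d_pos by auto
  next
    case False
    then have "pE P R \<noteq> 0" using pf(5)[OF P R(1)] R(2) by (simp add: OD_def split: if_splits)
    then show ?thesis using pE_deg[OF P R(1)] by simp
  qed
qed

lemma OD_deg: "0 \<le> a \<Longrightarrow> a \<le> d - 1 \<Longrightarrow> R \<in> Pts \<Longrightarrow> OD a R \<noteq> 0 \<Longrightarrow> int (deg R) \<le> d - 1"
  by (auto simp: OD_def deg_Q split: if_splits)

lemma V_Gd:
  assumes "v \<in> L (OD a)" "v \<noteq> 0" "a \<le> d - 1" shows "v \<in> Gd (d - 1)"
proof (rule L_Gd[OF assms(2,1)])
  have "0 \<le> a" using L_degD_nonneg[OF assms(2,1)] by simp
  then show "int (deg R) \<le> d - 1" if "R \<in> Pts" "OD a R \<noteq> 0" for R using OD_deg assms(3) that by blast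
qed (use assms in auto)

lemma V_ord_S: assumes "v \<in> L (OD a)" "v \<noteq> 0" "a \<le> d - 1" "P \<in> S" shows "ord P v = 0"
  using Gd_ord[OF V_Gd[OF assms(1-3)] S_D(1)[OF assms(4)]] S_D(2)[OF assms(4)] by simp

lemma V_small: assumes "v \<in> L (OD a)" "a \<le> d - 1" "P \<in> S" "v \<in> ge P 1" shows "v = 0"
  using V_ord_S[OF assms(1) _ assms(2,3)] assms(4) by (force simp: ge_iff)

text \<open>The zero of \<open>w\<close> at \<open>P\<close> pays for the zero of
  \<open>pf P\<close> there. At all other points the bound moves by the rest of the divisor of
  \<open>pf P\<close>, which has degree \<open>- d\<close>.\<close>

lemma L_divide_pf:
  assumes P: "P \<in> S" and w: "w \<in> L A" "w \<in> ge P 1" "A P = 0"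
  shows "w / pf P \<in> L (\<lambda>R. A R + pE P R - OD (d + int t) R)"
proof (cases "w = 0")
  case False
  have "- (A R + pE P R - OD (d + int t) R) \<le> ord R (w / pf P)" if R: "R \<in> Pts" for R
  proof -
    have o: "ord R (w / pf P) = ord R w - ord R (pf P)" using False R pf(1)[OF P] by (simp add: ord_divide)
    show ?thesis
    proof (cases "R = P")
      case True
      then show ?thesis
        using o w(2,3) False ord_pf_S[OF P P] pE_S[OF P P] S_D(3)[OF P] by (simp add: ge_iff OD_def)
    next
      case False2: False
      then show ?thesis using o w(1) False R pf(5)[OF P R] by (force simp: L_iff)
    qed
  qed
  then show ?thesis using False pf(1)[OF P] by (simp add: L_iff)
qed simp

text \<open>Two pairs of functions with few poles whose products agree at \<open>P\<close> are
  interchangeable in the second entry. Products on both sides are allowed because two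
  multiplications by \<open>pf\<close>-symbols of quotients have to be compared in
  \<open>rep_mult\<close>.\<close>

lemma cross_ratio_in_Fil:
  assumes P: "P \<in> S" and v: "v1 \<in> L (OD (d - 1))" "v2 \<in> L (OD (d - 1))" "v3 \<in> L (OD (d - 1))" "v4 \<in> L (OD (d - 1))"
    and nz: "v1 \<noteq> 0" "v2 \<noteq> 0" "v3 \<noteq> 0" "v4 \<noteq> 0" and eq: "v1 * v2 - v3 * v4 \<in> ge P 1"
  shows "sym (pf P) (v1 * v2 / (v3 * v4)) \<in> Fil (d - 1)"
proof (cases "v1 * v2 = v3 * v4")
  case True
  then have "v1 * v2 / (v3 * v4) = 1" using nz by simp
  then show ?thesis using sym_1_right[OF pf(1)[OF P]] Fil_one by simp
next
  case False
  have PP: "P \<in> Pts" using S_D(1)[OF P] .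
  have gd: "v1 \<in> Gd (d - 1)" "v2 \<in> Gd (d - 1)" "v3 \<in> Gd (d - 1)" "v4 \<in> Gd (d - 1)"
    using V_Gd v nz by auto
  define w where "w = v3 * v4 - v1 * v2"
  have w0: "w \<noteq> 0" using False by (simp add: w_def)
  have "w = - (v1 * v2 - v3 * v4)" by (simp add: w_def)
  then have w1: "w \<in> ge P 1" using ge_uminus[OF PP eq] by simp
  let ?A = "\<lambda>R. OD (d - 1) R + OD (d - 1) R"
  have wL: "w \<in> L ?A" unfolding w_def by (intro L_diff L_mult v)
  define k where "k = w / pf P"
  have k0: "k \<noteq> 0" using w0 pf(1)[OF P] by (simp add: k_def)
  let ?D = "\<lambda>R. ?A R + pE P R - OD (d + int t) R"
  have kL: "k \<in> L ?D" unfolding k_def by (rule L_divide_pf[OF P wL w1]) (use S_D[OF P] in \<open>simp add: OD_def\<close>)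
  have fA: "fin ?A" by (intro fin_add fin_OD)
  have fD: "fin ?D" by (intro fin_diff fin_add fin_OD pf(2)[OF P])
  have dA: "degD ?A = 2 * (d - 1)" using degD_add[OF fin_OD fin_OD, of "d - 1" "d - 1"] by simp
  have "degD ?D = degD (\<lambda>R. ?A R + pE P R) - degD (OD (d + int t))"
    by (rule degD_diff[OF fin_add[OF fA pf(2)[OF P]] fin_OD])
  also have "degD (\<lambda>R. ?A R + pE P R) = 2 * (d - 1) + int t"
    using degD_add[OF fA pf(2)[OF P]] dA pf(4)[OF P] by simp
  \<comment> \<open>The count is \<open>2 (d - 1) + t - (d + t) = d - 2\<close>.\<close>
  finally have deg: "degD ?D = d - 2" by simp
  \<comment> \<open>A nonzero \<open>k\<close> needs a bound of nonnegative degree. So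
    \<open>d\<close> is at least \<open>2\<close>, and the point \<open>Q\<close> of degree one
    counts as low.\<close>
  then have d2: "2 \<le> d" using L_degD_nonneg[OF k0 kL fD] by simp
  have kG: "k \<in> Gd (d - 1)"
  proof (rule L_Gd[OF k0 kL fD])
    fix R assume R: "R \<in> Pts" "?D R \<noteq> 0"
    show "int (deg R) \<le> d - 1"
    proof (cases "R = Q")
      case True
      then show ?thesis using deg_Q d2 by simp
    next
      case False
      then show ?thesis using R pE_deg[OF P R(1)] by (simp add: OD_def)
    qed
  qed (use deg in simp)
  show ?thesis
  proof (rule steinberg_reduce)
    show "v3 * v4 - v1 * v2 = pf P * k" using pf(1)[OF P] by (simp add: k_def w_def)
    show "v1 * v2 / (v3 * v4) \<in> Gd (d - 1)" "k / (v3 * v4) \<in> Gd (d - 1)" by (intro Gd_divide Gd_mult gd kG)+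
  qed (use nz k0 pf(1)[OF P] in auto)
qed

subsection \<open>Representing residues by functions of small degree\<close>

text \<open>Simultaneous conditions at \<open>P\<close> are indexed by the finite type
  \<open>'x\<close>: \<open>bool\<close> for two congruences, \<open>unit\<close> for one. Each
  costs \<open>deg P\<close> dimensions.\<close>

lemma residue_spanned:
  assumes "P \<in> S"
  shows "spanned {s::'x \<Rightarrow> 'f. \<forall>i. s i \<in> ge P 1} ({..<deg P} \<times> (UNIV :: 'x::finite set))
    (\<lambda>(i, c) c'. if c' = c then res_basis P i else 0) {s. \<forall>i. s i \<in> ge P 0}"
  unfolding spanned_def
proof
  fix s :: "'x \<Rightarrow> 'f" assume "s \<in> {s. \<forall>i. s i \<in> ge P 0}"
  then have "\<forall>c. \<exists>a. (\<forall>i<deg P. a i \<in> K) \<and> s c - (\<Sum>i<deg P. a i * res_basis P i) \<in> ge P 1"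
    using res_basis(2)[OF S_D(1)[OF assms]] by blast
  from choice[OF this] obtain a where
    a: "\<forall>c. (\<forall>i<deg P. a c i \<in> K) \<and> s c - (\<Sum>i<deg P. a c i * res_basis P i) \<in> ge P 1" ..
  define b where "b = (\<lambda>(i, c). a c i)"
  have "(\<Sum>p\<in>{..<deg P} \<times> UNIV. b p * (case p of (i, c) \<Rightarrow> \<lambda>c'. if c' = c then res_basis P i else 0) c')
      = (\<Sum>i<deg P. a c' i * res_basis P i)" for c'
  proof -
    have "(\<Sum>p\<in>{..<deg P} \<times> UNIV. b p * (case p of (i, c) \<Rightarrow> \<lambda>c'. if c' = c then res_basis P i else 0) c')
      = (\<Sum>i<deg P. \<Sum>c\<in>UNIV. if c = c' then a c i * res_basis P i else 0)"
      unfolding sum.cartesian_product by (intro sum.cong) (auto simp: b_def)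
    then show ?thesis by simp
  qed
  then show "\<exists>b. (\<forall>p\<in>{..<deg P} \<times> UNIV. b p \<in> K) \<and>
      (\<lambda>c'. s c' - (\<Sum>p\<in>{..<deg P} \<times> UNIV. b p * (case p of (i, c) \<Rightarrow> \<lambda>c'. if c' = c then res_basis P i else 0) c'))
        \<in> {s. \<forall>i. s i \<in> ge P 1}"
    using a by (intro exI[of _ b]) (auto simp: b_def)
qed

lemma residue_subsp: assumes "P \<in> S" shows "subsp {s::'x \<Rightarrow> 'f. \<forall>i. s i \<in> ge P 1}"
  using S_D(1)[OF assms] by (auto simp: subsp_def intro: ge_add ge_smult)

lemma V_basis:
  assumes "int t \<le> a + 1" "0 \<le> a"
  shows "\<exists>w. (\<forall>k<nat (a + 1 - int t). w k \<in> L (OD a)) \<and> lin_indep {..<nat (a + 1 - int t)} w"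
proof -
  have "\<And>P. P \<in> Pts \<Longrightarrow> 0 \<le> OD a P" using assms(2) by (simp add: OD_def)
  then show ?thesis using riemann[of "OD a"] assms by simp
qed

lemma L_comb: "(\<And>j. j \<in> J \<Longrightarrow> x j \<in> K) \<Longrightarrow> (\<And>j. j \<in> J \<Longrightarrow> w j \<in> L D) \<Longrightarrow> (\<Sum>j\<in>J. x j * w j) \<in> L D"
  by (intro L_sum L_smult)

lemma V_ge_0: assumes "v \<in> L (OD a)" "P \<in> S" shows "v \<in> ge P 0"
  using assms S_D[OF assms(2)] by (auto simp: L_def OD_def dest!: bspec[of _ _ P])

lemma two_representations:
  assumes P: "P \<in> S" and u: "u1 \<noteq> 0" "ord P u1 = 0" "u2 \<noteq> 0" "ord P u2 = 0"
  shows "\<exists>g h j. g \<in> L (OD (d - 1)) \<and> h \<in> L (OD (d - 1)) \<and> j \<in> L (OD (d - 1)) \<and> g \<noteq> 0 \<and> h \<noteq> 0 \<and> j \<noteq> 0 \<and>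
    g - u1 * h \<in> ge P 1 \<and> h - u2 * j \<in> ge P 1"
proof -
  have PP: "P \<in> Pts" using S_D(1)[OF P] .
  define n where "n = nat (d - int t)"
  obtain w where w: "\<forall>k<n. w k \<in> L (OD (d - 1))" "lin_indep {..<n} w"
    using V_basis[of "d - 1"] d_pos by (auto simp: n_def)
  \<comment> \<open>The three summands carry the unknowns \<open>g\<close>, \<open>h\<close>,
    \<open>j\<close>. The component \<open>True\<close> is \<open>g - u1 * h\<close>, the component
    \<open>False\<close> is \<open>h - u2 * j\<close>.\<close>
  define v :: "nat + nat + nat \<Rightarrow> bool \<Rightarrow> 'f" where
    "v = (\<lambda>p c. case p of Inl k \<Rightarrow> if c then w k else 0
       | Inr (Inl k) \<Rightarrow> if c then - (u1 * w k) else w k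
       | Inr (Inr k) \<Rightarrow> if c then 0 else - (u2 * w k))"
  define J where "J = {..<n} <+> ({..<n} <+> {..<n})"
  have J: "finite J" "card J = 3 * n" by (simp_all add: J_def card_Plus)
  have w0: "w k \<in> ge P 0" if "k < n" for k using V_ge_0 w(1) that P by blast
  have u0: "u1 \<in> ge P 0" "u2 \<in> ge P 0" using u by (auto simp: ge_iff)
  have uw: "u1 * w k \<in> ge P 0" "u2 * w k \<in> ge P 0" if "k < n" for k
    using ge_mult[OF PP u0(1) w0[OF that]] ge_mult[OF PP u0(2) w0[OF that]] by auto
  have vV: "v p \<in> {s. \<forall>i. s i \<in> ge P 0}" if "p \<in> J" for p
    using that w0 uw ge_uminus[OF PP] by (auto simp: J_def v_def)
  \<comment> \<open>Two congruences impose \<open>2 d\<close> conditions on \<open>3 (d - t)\<close>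
    unknowns.\<close>
  have "card ({..<deg P} \<times> (UNIV :: bool set)) < card J"
    using S_D(2)[OF P] d J by (simp add: card_cartesian_product n_def)
  from dependence[OF residue_subsp[OF P] _ J(1) this residue_spanned[OF P], where v = v] vV
  obtain x where x: "\<forall>p\<in>J. x p \<in> K" "\<exists>p\<in>J. x p \<noteq> 0" "\<forall>c. (\<Sum>p\<in>J. x p * v p c) \<in> ge P 1" by auto
  define g where "g = (\<Sum>k<n. x (Inl k) * w k)"
  define h where "h = (\<Sum>k<n. x (Inr (Inl k)) * w k)"
  define j where "j = (\<Sum>k<n. x (Inr (Inr k)) * w k)"
  have L: "g \<in> L (OD (d - 1))" "h \<in> L (OD (d - 1))" "j \<in> L (OD (d - 1))"
    unfolding g_def h_def j_def by (intro L_comb; use x(1) w(1) in \<open>auto simp: J_def\<close>)+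
  have "(\<Sum>p\<in>J. x p * v p True) = g - u1 * h" "(\<Sum>p\<in>J. x p * v p False) = h - u2 * j"
    by (simp_all add: J_def sum.Plus v_def g_def h_def j_def sum_distrib_left sum_negf mult.left_commute)
  then have eq: "g - u1 * h \<in> ge P 1" "h - u2 * j \<in> ge P 1" using x(3) by metis+
  \<comment> \<open>A function of this size that vanishes at \<open>P\<close> is zero. If one of
    \<open>g\<close>, \<open>h\<close>, \<open>j\<close> were zero, the congruences would therefore
    annihilate the other two, and with them the whole relation.\<close>
  have small: "z = 0" if "z \<in> L (OD (d - 1))" "z \<in> ge P 1" for z using V_small[OF that(1) _ P that(2)] by simp
  have cancel: "y \<in> ge P 1" if "u * y \<in> ge P 1" "u \<noteq> 0" "ord P u = 0" for u y
    using that PP ge_mult_iff[of P u y 1] by (simp add: mult.commute)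
  have gh: "g = 0 \<Longrightarrow> h = 0"
    using eq(1) small[OF L(2)] cancel[of u1 h] u ge_uminus[OF PP, of "- (u1 * h)" 1] by auto
  have hj: "h = 0 \<Longrightarrow> j = 0"
    using eq(2) small[OF L(3)] cancel[of u2 j] u ge_uminus[OF PP, of "- (u2 * j)" 1] by auto
  have hg: "h = 0 \<Longrightarrow> g = 0" using eq(1) small[OF L(1)] by auto
  have jh: "j = 0 \<Longrightarrow> h = 0" using eq(2) small[OF L(2)] by auto
  have "\<not> (g = 0 \<and> h = 0 \<and> j = 0)"
  proof
    assume z: "g = 0 \<and> h = 0 \<and> j = 0"
    have "x (Inl k) = 0" "x (Inr (Inl k)) = 0" "x (Inr (Inr k)) = 0" if "k < n" for k
      using lin_indepD[OF w(2), of "\<lambda>k. x (Inl k)" k] lin_indepD[OF w(2), of "\<lambda>k. x (Inr (Inl k))" k]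
        lin_indepD[OF w(2), of "\<lambda>k. x (Inr (Inr k))" k] z x(1) that
      by (auto simp: g_def h_def j_def J_def)
    then show False using x(2) by (auto simp: J_def)
  qed
  then have "g \<noteq> 0" "h \<noteq> 0" "j \<noteq> 0" using gh hj hg jh by blast+
  then show ?thesis using L eq by blast
qed

text \<open>The unknowns number \<open>(t + 1) + (d - t)\<close>, one more than the \<open>d\<close>
  conditions at \<open>P\<close>. The pole bound \<open>2 t\<close> for \<open>h\<close> is the
  smallest for which \<open>V_basis\<close> supplies \<open>t + 1\<close> functions; keeping
  \<open>h\<close> so small makes the later degree counts close.\<close>

lemma small_representation:
  assumes P: "P \<in> S" and u: "u \<noteq> 0" "ord P u = 0"
  shows "\<exists>h v. h \<in> L (OD (2 * int t)) \<and> v \<in> L (OD (d - 1)) \<and> h \<noteq> 0 \<and> v \<noteq> 0 \<and> u * h - v \<in> ge P 1"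
proof -
  have PP: "P \<in> Pts" using S_D(1)[OF P] .
  define n where "n = nat (d - int t)"
  define m where "m = nat (int t + 1)"
  obtain w where w: "\<forall>k<n. w k \<in> L (OD (d - 1))" "lin_indep {..<n} w"
    using V_basis[of "d - 1"] d_pos by (auto simp: n_def)
  obtain w' where w': "\<forall>k<m. w' k \<in> L (OD (2 * int t))" "lin_indep {..<m} w'"
    using V_basis[of "2 * int t"] by (auto simp: m_def algebra_simps)
  define v :: "nat + nat \<Rightarrow> unit \<Rightarrow> 'f" where
    "v = (\<lambda>p c. case p of Inl k \<Rightarrow> u * w' k | Inr k \<Rightarrow> - w k)"
  define J where "J = {..<m} <+> {..<n}"
  have J: "finite J" "card J = m + n" by (simp_all add: J_def card_Plus)
  have u0: "u \<in> ge P 0" using u by (auto simp: ge_iff)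
  have "u * w' k \<in> ge P 0" if "k < m" for k
    using ge_mult[OF PP u0 V_ge_0[OF _ P, of "w' k"]] w'(1) that by auto
  moreover have "- w k \<in> ge P 0" if "k < n" for k
    using ge_uminus[OF PP V_ge_0[OF _ P, of "w k"]] w(1) that by blast
  ultimately have vV: "v p \<in> {s. \<forall>i. s i \<in> ge P 0}" if "p \<in> J" for p
    using that by (auto simp: J_def v_def)
  have "card ({..<deg P} \<times> (UNIV :: unit set)) < card J"
    using S_D(2)[OF P] d J by (simp add: card_cartesian_product n_def m_def)
  from dependence[OF residue_subsp[OF P] _ J(1) this residue_spanned[OF P], where v = v] vV
  obtain x where x: "\<forall>p\<in>J. x p \<in> K" "\<exists>p\<in>J. x p \<noteq> 0" "(\<Sum>p\<in>J. x p * v p ()) \<in> ge P 1" by auto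
  define h where "h = (\<Sum>k<m. x (Inl k) * w' k)"
  define y where "y = (\<Sum>k<n. x (Inr k) * w k)"
  have L: "h \<in> L (OD (2 * int t))" "y \<in> L (OD (d - 1))"
    unfolding h_def y_def by (intro L_comb; use x(1) w(1) w'(1) in \<open>auto simp: J_def\<close>)+
  have "(\<Sum>p\<in>J. x p * v p ()) = u * h - y"
    by (simp add: J_def sum.Plus v_def h_def y_def sum_distrib_left sum_negf mult.left_commute)
  then have eq: "u * h - y \<in> ge P 1" using x(3) by metis
  have "y \<noteq> 0 \<or> h \<noteq> 0"
  proof (rule ccontr)
    assume z: "\<not> ?thesis"
    have "x (Inl k) = 0" if "k < m" for k
      using lin_indepD[OF w'(2), of "\<lambda>k. x (Inl k)" k] z x(1) that by (auto simp: h_def J_def)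
    moreover have "x (Inr k) = 0" if "k < n" for k
      using lin_indepD[OF w(2), of "\<lambda>k. x (Inr k)" k] z x(1) that by (auto simp: y_def J_def)
    ultimately show False using x(2) by (auto simp: J_def)
  qed
  moreover have "h = 0 \<Longrightarrow> y = 0"
    using eq V_small[OF L(2) _ P] ge_uminus[OF PP, of "- y" 1] by auto
  moreover have "h = 0" if "y = 0"
  proof -
    have "h * u \<in> ge P 1" using eq that by (simp add: mult.commute)
    then have "h \<in> ge P 1" using ge_mult_iff[OF PP u(1)] u(2) by simp
    then show ?thesis using V_small[OF L(1) _ P] d_pos by simp
  qed
  ultimately show ?thesis using L eq by blast
qed

end

section \<open>Symbols with a uniformizing function, modulo lower degree\<close>

context tame_degree
begin

text \<open>The \<open>c\<close> that can be replaced by a quotient \<open>v / w\<close> of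
  functions with poles only at \<open>Q\<close>, without changing \<open>{pf P, c}\<close> modulo
  \<open>Fil (d - 1)\<close>.\<close>

definition rep :: "'p \<Rightarrow> 'f set"
  where "rep P = {c. c \<noteq> 0 \<and> (\<exists>v w. v \<in> L (OD (d - 1)) \<and> w \<in> L (OD (d - 1)) \<and> v \<noteq> 0 \<and> w \<noteq> 0 \<and>
    sym (pf P) (c * w / v) \<in> Fil (d - 1))}"

lemma sym_pf_closed: "P \<in> S \<Longrightarrow> g \<noteq> 0 \<Longrightarrow> sym (pf P) g \<in> carrier G"
  using sym_closed pf(1) by blast

lemma sym_pf_Fil_mult:
  assumes P: "P \<in> S" and "g \<noteq> 0" "g' \<noteq> 0" "sym (pf P) g \<in> Fil m" "sym (pf P) g' \<in> Fil m"
  shows "sym (pf P) (g * g') \<in> Fil m"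
  using sym_mult_right[OF pf(1)[OF P] assms(2,3)] Fil_mult assms by simp

lemma sym_pf_Fil_inverse:
  assumes P: "P \<in> S" and "g \<noteq> 0" "sym (pf P) g \<in> Fil m"
  shows "sym (pf P) (inverse g) \<in> Fil m"
  using sym_inverse_right[OF pf(1)[OF P] assms(2)] Fil_inv assms by simp

text \<open>The two quotients \<open>v1 / w1\<close> and \<open>v2 / w2\<close> are replaced by
  \<open>g / h\<close> and \<open>h / j\<close>, which have the same values at \<open>P\<close>; in
  the product \<open>h\<close> cancels.\<close>

lemma rep_mult:
  assumes P: "P \<in> S" and a: "a \<in> rep P" and b: "b \<in> rep P" shows "a * b \<in> rep P"
proof -
  let ?V = "L (OD (d - 1))"
  obtain v1 w1 where 1: "v1 \<in> ?V" "w1 \<in> ?V" "v1 \<noteq> 0" "w1 \<noteq> 0" "sym (pf P) (a * w1 / v1) \<in> Fil (d - 1)" "a \<noteq> 0"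
    using a by (auto simp: rep_def)
  obtain v2 w2 where 2: "v2 \<in> ?V" "w2 \<in> ?V" "v2 \<noteq> 0" "w2 \<noteq> 0" "sym (pf P) (b * w2 / v2) \<in> Fil (d - 1)" "b \<noteq> 0"
    using b by (auto simp: rep_def)
  have PP: "P \<in> Pts" using S_D(1)[OF P] .
  have o: "ord P v1 = 0" "ord P w1 = 0" "ord P v2 = 0" "ord P w2 = 0"
    using V_ord_S[OF _ _ _ P] 1 2 by auto
  obtain g h j where g: "g \<in> ?V" "h \<in> ?V" "j \<in> ?V" "g \<noteq> 0" "h \<noteq> 0" "j \<noteq> 0"
    "g - (v1 / w1) * h \<in> ge P 1" "h - (v2 / w2) * j \<in> ge P 1"
    using two_representations[OF P, of "v1 / w1" "v2 / w2"] 1 2 o PP by (auto simp: ord_divide)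
  \<comment> \<open>Clears the denominator, so that the congruence takes the shape demanded by
    \<open>cross_ratio_in_Fil\<close>.\<close>
  have e: "v * h - g * w \<in> ge P 1" if "g - (v / w) * h \<in> ge P 1" "w \<noteq> 0" "ord P w = 0" for g v w h
  proof -
    have "w * (g - (v / w) * h) \<in> ge P 1"
      using ge_mult'[OF PP, of w 0 "g - (v / w) * h" 1 1] that by (simp add: ge_iff)
    then have "- (w * (g - (v / w) * h)) \<in> ge P 1" by (rule ge_uminus[OF PP])
    then show ?thesis using that(2) by (simp add: algebra_simps)
  qed
  have "sym (pf P) (v1 * h / (g * w1)) \<in> Fil (d - 1)" "sym (pf P) (v2 * j / (h * w2)) \<in> Fil (d - 1)"
    using cross_ratio_in_Fil[OF P 1(1) g(2) g(1) 1(2)] cross_ratio_in_Fil[OF P 2(1) g(3) g(2) 2(2)]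
      e[OF g(7)] e[OF g(8)] 1 2 g o by auto
  then have "sym (pf P) ((v1 * h / (g * w1)) * (a * w1 / v1) * ((v2 * j / (h * w2)) * (b * w2 / v2))) \<in> Fil (d - 1)"
    by (intro sym_pf_Fil_mult[OF P]) (use 1 2 g in auto)
  moreover have "(v1 * h / (g * w1)) * (a * w1 / v1) * ((v2 * j / (h * w2)) * (b * w2 / v2)) = a * b * j / g"
    using 1 2 g by (simp add: field_simps)
  ultimately have "sym (pf P) (a * b * j / g) \<in> Fil (d - 1)" by simp
  then show ?thesis using 1(6) 2(6) g unfolding rep_def
    by (intro CollectI conjI exI[of _ g] exI[of _ j]) simp_all
qed

lemma rep_inverse:
  assumes P: "P \<in> S" and a: "a \<in> rep P" shows "inverse a \<in> rep P"
proof -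
  obtain v w where 1: "v \<in> L (OD (d - 1))" "w \<in> L (OD (d - 1))" "v \<noteq> 0" "w \<noteq> 0"
      "sym (pf P) (a * w / v) \<in> Fil (d - 1)" "a \<noteq> 0"
    using a by (auto simp: rep_def)
  then have "sym (pf P) (inverse (a * w / v)) \<in> Fil (d - 1)" by (intro sym_pf_Fil_inverse[OF P]) auto
  moreover have "inverse (a * w / v) = inverse a * v / w" using 1 by (simp add: field_simps)
  ultimately show ?thesis using 1 by (auto simp: rep_def)
qed

lemma one_V: "1 \<in> L (OD (d - 1))"
  using d_pos by (simp add: L_iff OD_def)

text \<open>At \<open>P\<close> the function is congruent to a quotient \<open>v / h\<close> with
  \<open>h\<close> in \<open>L (OD (2 * int t))\<close>. The bounding divisor of
  \<open>g * h - v\<close> then has degree \<open>(d - 1) + t + 2 t\<close>, and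
  \<open>steinberg_reduce\<close> applies to the quotient by \<open>pf P\<close>.\<close>

lemma rep_small:
  assumes P: "P \<in> S" and g: "g \<in> Gd (d - 1)" and B: "fin B" "\<And>R. R \<in> Pts \<Longrightarrow> 0 \<le> B R" "degD B = int t"
    and gL: "g \<in> L (\<lambda>R. OD (d - 1) R + B R)"
  shows "g \<in> rep P"
proof -
  have PP: "P \<in> Pts" using S_D(1)[OF P] .
  have g0: "g \<noteq> 0" "ord P g = 0" using g Gd_ord[OF g PP] S_D(2)[OF P] by (auto simp: Gd_nonzero)
  obtain h v where h: "h \<in> L (OD (2 * int t))" "v \<in> L (OD (d - 1))" "h \<noteq> 0" "v \<noteq> 0" "g * h - v \<in> ge P 1"
    using small_representation[OF P g0] by blast
  have hV: "h \<in> L (OD (d - 1))" by (rule L_mono[OF h(1)]) (use d_pos in \<open>simp add: OD_def\<close>)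
  have "sym (pf P) (v / (g * h)) \<in> Fil (d - 1)"
  proof (cases "g * h = v")
    case True
    then show ?thesis using h sym_1_right[OF pf(1)[OF P]] Fil_one by simp
  next
    case False
    define k where "k = (g * h - v) / pf P"
    have k0: "k \<noteq> 0" using False pf(1)[OF P] by (simp add: k_def)
    let ?A = "\<lambda>R. (OD (d - 1) R + B R) + OD (2 * int t) R"
    let ?D = "\<lambda>R. ?A R + pE P R - OD (d + int t) R"
    have "v \<in> L ?A" by (rule L_mono[OF h(2)]) (use B(2) in \<open>simp add: OD_def\<close>)
    then have wL: "g * h - v \<in> L ?A" by (intro L_diff L_mult gL h)
    have "?A P = 0" using S_D(3)[OF P] eff_S[OF B P] by (simp add: OD_def)
    then have kL: "k \<in> L ?D" unfolding k_def by (rule L_divide_pf[OF P wL h(5)])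
    have fA: "fin ?A" by (intro fin_add fin_OD B)
    have fD: "fin ?D" by (intro fin_diff fin_add fA fin_OD pf(2)[OF P] B)
    have dA: "degD ?A = d - 1 + 3 * int t"
      using degD_add[OF fin_add[OF fin_OD B(1)] fin_OD, of "d - 1" "2 * int t"] degD_add[OF fin_OD B(1), of "d - 1"] B(3) by simp
    have "degD ?D = degD ?A + int t - (d + int t)"
      using degD_diff[OF fin_add[OF fA pf(2)[OF P]] fin_OD, of "d + int t"] degD_add[OF fA pf(2)[OF P]] pf(4)[OF P] by simp
    \<comment> \<open>Division by \<open>pf P\<close> takes away \<open>d\<close>. Nonnegativity of
      what remains, needed for \<open>k\<close> to be nonzero, forces \<open>t \<ge> 1\<close> and
      thereby \<open>d \<ge> 2\<close>.\<close>
    then have deg: "degD ?D = 3 * int t - 1" using dA by simp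
    then have d2: "2 \<le> d" using L_degD_nonneg[OF k0 kL fD] d by simp
    have kG: "k \<in> Gd (d - 1)"
    proof (rule L_Gd[OF k0 kL fD])
      fix R assume R: "R \<in> Pts" "?D R \<noteq> 0"
      show "int (deg R) \<le> d - 1"
      proof (cases "R = Q")
        case True
        then show ?thesis using deg_Q d2 by simp
      next
        case False
        then have "B R \<noteq> 0 \<or> pE P R \<noteq> 0" using R by (auto simp: OD_def)
        then show ?thesis using pE_deg[OF P R(1)] eff_deg_le[OF B R(1)] d_pos by fastforce
      qed
    qed (use deg d in simp)
    have hG: "h \<in> Gd (d - 1)" "v \<in> Gd (d - 1)" using V_Gd[OF hV] V_Gd[OF h(2)] h by auto
    show ?thesis
    proof (rule steinberg_reduce)
      show "g * h - v = pf P * k" using pf(1)[OF P] by (simp add: k_def)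
      show "v / (g * h) \<in> Gd (d - 1)" "k / (g * h) \<in> Gd (d - 1)" by (intro Gd_divide Gd_mult g hG kG)+
    qed (use h g0 k0 pf(1)[OF P] in auto)
  qed
  then have "sym (pf P) (inverse (v / (g * h))) \<in> Fil (d - 1)" using h g0 by (intro sym_pf_Fil_inverse[OF P]) auto
  then have "sym (pf P) (g * h / v) \<in> Fil (d - 1)" by simp
  then show ?thesis using h hV g0 by (auto simp: rep_def)
qed

text \<open>Reducing a divisor step by step to a divisor of the form \<open>B - t Q\<close> with \<open>B\<close> effective
  of degree \<open>t\<close> shows that functions with few poles generate.\<close>

lemma small_functions_generate:
  assumes mult: "\<And>a b. a \<in> \<Gamma> \<Longrightarrow> b \<in> \<Gamma> \<Longrightarrow> a * b \<in> \<Gamma>" and inv: "\<And>a. a \<in> \<Gamma> \<Longrightarrow> inverse a \<in> \<Gamma>"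
    and small: "\<And>g B. g \<in> Gd (d - 1) \<Longrightarrow> fin B \<Longrightarrow> (\<And>R. R \<in> Pts \<Longrightarrow> 0 \<le> B R) \<Longrightarrow> degD B = int t \<Longrightarrow>
      g \<in> L (\<lambda>R. OD (d - 1) R + B R) \<Longrightarrow> g \<in> \<Gamma>"
    and D: "fin D" "degD D = 0" "\<And>R. R \<in> Pts \<Longrightarrow> D R \<noteq> 0 \<Longrightarrow> int (deg R) \<le> d - 1"
    and f: "f \<noteq> 0" "f \<in> L (\<lambda>R. D R + OD (int t) R)"
  shows "f \<in> \<Gamma>"
  using D f
proof (induction "\<Sum>R\<in>{R \<in> Pts. D R \<noteq> 0 \<and> R \<noteq> Q}. nat \<bar>D R\<bar>" arbitrary: D f)
  case 0
  have "finite {R \<in> Pts. D R \<noteq> 0 \<and> R \<noteq> Q}"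
    by (rule finite_subset[OF _ 0(2)[unfolded fin_def]]) blast
  then have D0: "D R = 0" if "R \<in> Pts" "R \<noteq> Q" for R using 0(1) that by force
  have "degD D = degD (OD (D Q))" by (rule degD_cong) (use D0 in \<open>auto simp: OD_def\<close>)
  then have DQ: "D Q = 0" using 0(3) by simp
  then have fL: "f \<in> L (OD (int t))" using 0(6) D0 by (auto simp: L_def OD_def)
  show ?case
  proof (rule small[of f "OD (int t)"])
    show "f \<in> Gd (d - 1)" by (rule V_Gd[OF fL 0(5)]) (use d_pos in simp)
    show "f \<in> L (\<lambda>R. OD (d - 1) R + OD (int t) R)"
      by (rule L_mono[OF fL]) (use d_pos in \<open>simp add: OD_def\<close>)
    show "fin (OD (int t))" "degD (OD (int t)) = int t" by simp_all
    show "0 \<le> OD (int t) R" for R by (simp add: OD_def)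
  qed
next
  case (Suc m)
  have finS: "finite {R \<in> Pts. D R \<noteq> 0 \<and> R \<noteq> Q}"
    by (rule finite_subset[OF _ Suc(3)[unfolded fin_def]]) blast
  have "{R \<in> Pts. D R \<noteq> 0 \<and> R \<noteq> Q} \<noteq> {}"
  proof
    assume e: "{R \<in> Pts. D R \<noteq> 0 \<and> R \<noteq> Q} = {}"
    show False using Suc(2) unfolding e by simp
  qed
  then obtain R where R: "R \<in> Pts" "D R \<noteq> 0" "R \<noteq> Q" by blast
  define \<epsilon> where "\<epsilon> = sgn (D R)"
  define e where "e = int (deg R)"
  have ed: "e \<le> d - 1" using Suc(5)[OF R(1,2)] by (simp add: e_def)
  have d2: "2 \<le> d" using ed deg_pos[OF R(1)] by (simp add: e_def)
  \<comment> \<open>One unit at \<open>R\<close> is moved towards zero, and a multiple of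
    \<open>Q\<close> restores degree zero. The sum of absolute values away from \<open>Q\<close>, on
    which the induction runs, drops by one.\<close>
  define D' where "D' = (\<lambda>x. D x - (if x = R then \<epsilon> else 0) + OD (\<epsilon> * e) x)"
  have D': "fin D'" unfolding D'_def by (intro fin_add fin_diff Suc(3) fin_single fin_OD)
  have degD': "degD D' = 0"
    unfolding D'_def using degD_add[OF fin_diff[OF Suc(3) fin_single] fin_OD] degD_diff[OF Suc(3) fin_single]
      degD_single[OF R(1)] Suc(4) by (simp add: e_def)
  have suppD': "int (deg x) \<le> d - 1" if "x \<in> Pts" "D' x \<noteq> 0" for x
    using that Suc(5)[of x] Suc(5)[OF R(1,2)] deg_Q d2 by (auto simp: D'_def OD_def split: if_splits)
  have absR: "nat \<bar>D R\<bar> = Suc (nat \<bar>D' R\<bar>)"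
    using R(2,3) by (simp add: D'_def OD_def \<epsilon>_def sgn_if) arith
  have "(\<Sum>x\<in>{x \<in> Pts. D x \<noteq> 0 \<and> x \<noteq> Q}. nat \<bar>D x\<bar>) = Suc (\<Sum>x\<in>{x \<in> Pts. D x \<noteq> 0 \<and> x \<noteq> Q}. nat \<bar>D' x\<bar>)"
  proof -
    have RS: "R \<in> {x \<in> Pts. D x \<noteq> 0 \<and> x \<noteq> Q}" using R by blast
    have "(\<Sum>x\<in>{x \<in> Pts. D x \<noteq> 0 \<and> x \<noteq> Q} - {R}. nat \<bar>D x\<bar>) = (\<Sum>x\<in>{x \<in> Pts. D x \<noteq> 0 \<and> x \<noteq> Q} - {R}. nat \<bar>D' x\<bar>)"
      by (intro sum.cong) (auto simp: D'_def OD_def)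
    then show ?thesis unfolding sum.remove[OF finS RS] absR by (simp only: add_Suc)
  qed
  also have "(\<Sum>x\<in>{x \<in> Pts. D x \<noteq> 0 \<and> x \<noteq> Q}. nat \<bar>D' x\<bar>) = (\<Sum>x\<in>{x \<in> Pts. D' x \<noteq> 0 \<and> x \<noteq> Q}. nat \<bar>D' x\<bar>)"
    by (rule sum.mono_neutral_right[OF finS]) (use R in \<open>auto simp: D'_def OD_def split: if_splits\<close>)
  finally have m: "m = (\<Sum>x\<in>{x \<in> Pts. D' x \<noteq> 0 \<and> x \<noteq> Q}. nat \<bar>D' x\<bar>)" using Suc(2) by simp
  have DT: "fin (\<lambda>x. D x + OD (int t) x)" "fin (\<lambda>x. D' x + OD (int t) x)" by (intro fin_add Suc(3) D' fin_OD)+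
  have degT: "degD (\<lambda>x. D x + OD (int t) x) = int t" "degD (\<lambda>x. D' x + OD (int t) x) = int t"
    using degD_add[OF Suc(3) fin_OD] degD_add[OF D' fin_OD] Suc(4) degD' by simp_all
  obtain f' where f': "f' \<noteq> 0" "f' \<in> L (\<lambda>x. D' x + OD (int t) x)"
    using riemann_nonzero[OF DT(2)] degT(2) by auto
  have f'\<Gamma>: "f' \<in> \<Gamma>" using Suc(1)[OF m D' degD' suppD' f'] by blast
  define B where "B = (\<lambda>x. ord x f + (D x + OD (int t) x))"
  define B' where "B' = (\<lambda>x. ord x f' + (D' x + OD (int t) x))"
  have B: "fin B" "\<And>x. x \<in> Pts \<Longrightarrow> 0 \<le> B x" "degD B = int t"
    unfolding B_def
    using fin_add[OF fin_ord[OF Suc(6)] DT(1)] Suc(6,7)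
      degD_add[OF fin_ord[OF Suc(6)] DT(1)] degT(1) degD_principal[OF Suc(6)] by (force simp: L_iff)+
  have B': "fin B'" "\<And>x. x \<in> Pts \<Longrightarrow> 0 \<le> B' x" "degD B' = int t"
    unfolding B'_def
    using fin_add[OF fin_ord[OF f'(1)] DT(2)] f'
      degD_add[OF fin_ord[OF f'(1)] DT(2)] degT(2) degD_principal[OF f'(1)] by (force simp: L_iff)+
  have ordf: "ord x f = B x - D x - OD (int t) x" "ord x f' = B' x - D' x - OD (int t) x" for x
    by (simp_all add: B_def B'_def)
  have gd: "h \<in> Gd (d - 1)" if hE: "h \<noteq> 0" "fin E" "\<And>x. x \<in> Pts \<Longrightarrow> 0 \<le> E x" "degD E = int t"
    "\<And>x. ord x h = E x - F x - OD (int t) x" "\<And>x. x \<in> Pts \<Longrightarrow> F x \<noteq> 0 \<Longrightarrow> int (deg x) \<le> d - 1" for h E F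
    unfolding Gd_def
  proof (intro CollectI conjI ballI impI hE(1))
    fix x assume x: "x \<in> Pts" "ord x h \<noteq> 0"
    consider "x = Q" | "E x \<noteq> 0" | "F x \<noteq> 0" | "x \<noteq> Q" "E x = 0" "F x = 0" by blast
    then show "int (deg x) \<le> d - 1"
    proof cases
      case 1
      then show ?thesis using deg_Q d2 by simp
    next
      case 2
      then show ?thesis using eff_deg_le[OF hE(2-4) x(1)] d_pos by simp
    next
      case 3
      then show ?thesis by (rule hE(6)[OF x(1)])
    next
      case 4
      then show ?thesis using x(2) hE(5)[of x] by (simp add: OD_def)
    qed
  qed
  have fG: "f \<in> Gd (d - 1)" by (rule gd[OF Suc(6) B ordf(1) Suc(5)])
  have f'G: "f' \<in> Gd (d - 1)" by (rule gd[OF f'(1) B' ordf(2) suppD'])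
  have e0: "0 \<le> e" by (simp add: e_def)
  \<comment> \<open>The sign of \<open>D R\<close> decides which of \<open>f' / f\<close> and
    \<open>f / f'\<close> has its additional pole at \<open>Q\<close>; its order there is
    \<open>e \<le> d - 1\<close>, as \<open>small\<close> requires, and the remaining poles are
    bounded by an effective divisor of degree \<open>t\<close>.\<close>
  show ?case
  proof (cases "D R > 0")
    case True
    then have \<epsilon>: "\<epsilon> = 1" by (simp add: \<epsilon>_def)
    have "f' / f \<in> \<Gamma>"
    proof (rule small[OF Gd_divide[OF f'G fG] B])
      have "- (OD (d - 1) x + B x) \<le> ord x (f' / f)" if x: "x \<in> Pts" for x
        using ordf[of x] B'(2)[OF x] ed e0 \<epsilon> ord_divide[OF x f'(1) Suc(6)] R(3)
        by (auto simp: D'_def OD_def split: if_splits)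
      then show "f' / f \<in> L (\<lambda>x. OD (d - 1) x + B x)" using f'(1) Suc(6) by (simp add: L_iff)
    qed
    then have "f' * inverse (f' / f) \<in> \<Gamma>" by (intro mult inv f'\<Gamma>)
    then show ?thesis using f'(1) Suc(6) by simp
  next
    case False
    then have \<epsilon>: "\<epsilon> = - 1" using R(2) by (simp add: \<epsilon>_def)
    have "f / f' \<in> \<Gamma>"
    proof (rule small[OF Gd_divide[OF fG f'G] B'])
      have "- (OD (d - 1) x + B' x) \<le> ord x (f / f')" if x: "x \<in> Pts" for x
        using ordf[of x] B(2)[OF x] ed e0 \<epsilon> ord_divide[OF x Suc(6) f'(1)] R(3)
        by (auto simp: D'_def OD_def split: if_splits)
      then show "f / f' \<in> L (\<lambda>x. OD (d - 1) x + B' x)" using f'(1) Suc(6) by (simp add: L_iff)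
    qed
    then have "f' * (f / f') \<in> \<Gamma>" by (intro mult f'\<Gamma>)
    then show ?thesis using f'(1) by simp
  qed
qed

text \<open>With minus the divisor of \<open>g\<close> as \<open>D\<close>, the function
  \<open>g\<close> itself meets the bound in \<open>small_functions_generate\<close>, so nothing
  beyond the closure properties of \<open>rep P\<close> has to be checked.\<close>

lemma Gd_rep: assumes P: "P \<in> S" and g: "g \<in> Gd (d - 1)" shows "g \<in> rep P"
proof -
  have g0: "g \<noteq> 0" using Gd_nonzero[OF g] .
  show ?thesis
  proof (rule small_functions_generate[where D = "\<lambda>R. - ord R g"])
    show "fin (\<lambda>R. - ord R g)" "degD (\<lambda>R. - ord R g) = 0"
      using g0 by (simp_all add: degD_uminus degD_principal)
    show "int (deg R) \<le> d - 1" if "R \<in> Pts" "- ord R g \<noteq> 0" for R using g that by (auto simp: Gd_def)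
    show "g \<in> L (\<lambda>R. - ord R g + OD (int t) R)" using g0 by (simp add: L_iff OD_def)
  qed (use rep_mult[OF P] rep_inverse[OF P] rep_small[OF P] g0 in blast)+
qed

subsection \<open>The graded pieces\<close>

lemma T_pf:
  assumes P: "P \<in> S" and c: "c \<in> Gd (d - 1)" and R: "R \<in> S"
  shows "T (sym (pf P) c) R = (if R = P then cl P (inverse c) else \<one>\<^bsub>U R\<^esub>)"
proof -
  have RP: "R \<in> Pts" using S_D(1)[OF R] .
  have o: "ord R c = 0" using Gd_ord[OF c RP] S_D(2)[OF R] by simp
  have "tau R (pf P) c = (if R = P then inverse c else 1)"
    using o ord_pf_S[OF P R] by (simp add: tau_def divide_inverse)
  then show ?thesis using T_sym[OF RP pf(1)[OF P] Gd_nonzero[OF c]] cl_1[OF RP] by auto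
qed

text \<open>Membership in \<open>rep P\<close> trades \<open>c\<close> for a quotient
  \<open>v / w\<close>. Symbols in \<open>Fil (d - 1)\<close> are trivial at \<open>P\<close>, so
  \<open>v / w\<close> is \<open>1\<close> at \<open>P\<close> just as \<open>c\<close> is, and then
  \<open>v\<close> and \<open>w\<close> are interchangeable.\<close>

lemma kernel_at_point:
  assumes P: "P \<in> S" and c: "c \<in> Gd (d - 1)" and triv: "T (sym (pf P) c) P = \<one>\<^bsub>U P\<^esub>"
  shows "sym (pf P) c \<in> Fil (d - 1)"
proof -
  have PP: "P \<in> Pts" using S_D(1)[OF P] .
  have c0: "c \<noteq> 0" using Gd_nonzero[OF c] .
  obtain v w where vw: "v \<in> L (OD (d - 1))" "w \<in> L (OD (d - 1))" "v \<noteq> 0" "w \<noteq> 0"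
    "sym (pf P) (c * w / v) \<in> Fil (d - 1)" using Gd_rep[OF P c] by (auto simp: rep_def)
  have gd: "v \<in> Gd (d - 1)" "w \<in> Gd (d - 1)" using V_Gd vw by auto
  have unit: "u \<in> ge P 0" "ord P u = 0" if "u \<in> Gd (d - 1)" for u
    using Gd_ord[OF that PP] S_D(2)[OF P] by (auto simp: ge_iff)
  have inv1: "inverse u - 1 \<in> ge P 1" if "u \<in> Gd (d - 1)" "T (sym (pf P) u) P = \<one>\<^bsub>U P\<^esub>" for u
    using T_pf[OF P that(1) P] that(2) cl_1[OF PP] cl_eq[OF PP unit(1)[OF Gd_inverse[OF that(1)]] unit(1)[OF Gd_1]]
    by simp
  have "T (sym (pf P) (c * w / v)) P = \<one>\<^bsub>U P\<^esub>"
    using Fil_T[OF PP _ vw(5)] S_D(2)[OF P] by simp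
  then have 1: "inverse (c * w / v) - 1 \<in> ge P 1" by (rule inv1[OF Gd_divide[OF Gd_mult[OF c gd(2)] gd(1)]])
  have 2: "inverse c - 1 \<in> ge P 1" using inv1[OF c triv] .
  have "inverse (c * w / v) * c - 1 \<in> ge P 1"
    using one_unit_mult[OF PP 1 one_unit_powi[OF PP 2, of "-1"]] by (simp add: power_int_minus)
  moreover have "inverse (c * w / v) * c = v / w" using c0 vw by (simp add: field_simps)
  ultimately have "v / w - 1 \<in> ge P 1" by simp
  then have "w * (v / w - 1) \<in> ge P 1"
    using ge_mult'[OF PP unit(1)[OF gd(2)], of "v / w - 1" 1 1] by simp
  \<comment> \<open>The constant \<open>1\<close> fills the second place in both products of
    \<open>cross_ratio_in_Fil\<close>.\<close>
  then have "v * 1 - w * 1 \<in> ge P 1" using vw(4) by (simp add: algebra_simps)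
  then have "sym (pf P) (v * 1 / (w * 1)) \<in> Fil (d - 1)"
    by (intro cross_ratio_in_Fil[OF P] vw one_V) simp_all
  then have "sym (pf P) ((c * w / v) * (v / w)) \<in> Fil (d - 1)"
    using sym_pf_Fil_mult[OF P _ _ vw(5), of "v / w"] vw c0 by simp
  then show ?thesis using vw by simp
qed

text \<open>Introduced because its elements have a normal form with one symbol for each point of
  \<open>S\<close>; that it contains \<open>Fil d\<close> is the content of the next lemmas.\<close>

definition N :: "'g set"
  where "N = generate G (Fil (d - 1) \<union> {sym (pf P) g |P g. P \<in> S \<and> g \<in> Gd (d - 1)})"

lemma N_gens: "Fil (d - 1) \<union> {sym (pf P) g |P g. P \<in> S \<and> g \<in> Gd (d - 1)} \<subseteq> carrier G"
  using Fil_carrier sym_pf_closed Gd_nonzero by blast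

lemma N_subgroup: "subgroup N G"
  unfolding N_def by (rule G.generate_is_subgroup[OF N_gens])

lemma N_Fil: "\<xi> \<in> Fil (d - 1) \<Longrightarrow> \<xi> \<in> N"
  unfolding N_def by (rule generate.incl) blast

lemma N_pf: "P \<in> S \<Longrightarrow> g \<in> Gd (d - 1) \<Longrightarrow> sym (pf P) g \<in> N"
  unfolding N_def by (rule generate.incl) blast

lemma N_mult: "x \<in> N \<Longrightarrow> y \<in> N \<Longrightarrow> x \<otimes>\<^bsub>G\<^esub> y \<in> N"
  using subgroup.m_closed[OF N_subgroup] .

lemma N_inv: "x \<in> N \<Longrightarrow> inv\<^bsub>G\<^esub> x \<in> N"
  using subgroup.m_inv_closed[OF N_subgroup] .

lemma N_antisym: "f \<noteq> 0 \<Longrightarrow> g \<noteq> 0 \<Longrightarrow> sym f g \<in> N \<Longrightarrow> sym g f \<in> N"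
  by (subst sym_antisym[of f g]) (auto intro: N_inv)

text \<open>The function \<open>pf P'\<close> is written at \<open>P\<close> as a quotient
  \<open>v / h\<close> of small functions, which gives \<open>1 - a / ?g = ?F * b / ?g\<close> with
  \<open>a\<close> and \<open>b\<close> supported in low degree. Expanding this Steinberg relation
  expresses the symbol of the two uniformizing functions through symbols already in
  \<open>N\<close>. On the diagonal, \<open>{f, f} = {f, - 1}\<close>.\<close>

lemma N_pf_pf: assumes P: "P \<in> S" and P': "P' \<in> S" shows "sym (pf P') (pf P) \<in> N"
proof (cases "P' = P")
  case True
  then show ?thesis using sym_self[OF pf(1)[OF P]] N_pf[OF P Gd_uminus_1] by simp
next
  case False
  let ?g = "pf P'" and ?F = "pf P"
  have PP: "P \<in> Pts" "P' \<in> Pts" using S_D(1) P P' by auto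
  have nz: "?g \<noteq> 0" "?F \<noteq> 0" using pf(1) P P' by auto
  have og: "ord P ?g = 0" using ord_pf_S[OF P' P] False by simp
  obtain h v where h: "h \<in> L (OD (2 * int t))" "v \<in> L (OD (d - 1))" "h \<noteq> 0" "v \<noteq> 0" "?g * h - v \<in> ge P 1"
    using small_representation[OF P nz(1) og] by blast
  have hG: "h \<in> Gd (d - 1)" "v \<in> Gd (d - 1)" using V_Gd h d_pos by auto
  \<comment> \<open>The two sides are distinguished at \<open>P'\<close>, where only the left one
    vanishes.\<close>
  have "ord P' (?g * h) = 1" "ord P' v = 0"
    using ord_mult[OF PP(2) nz(1) h(3)] ord_pf_S[OF P' P'] V_ord_S[OF h(1,3) _ P'] V_ord_S[OF h(2,4) _ P'] d_pos
    by simp_all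
  then have ne: "?g * h \<noteq> v" by auto
  define k where "k = (?g * h - v) / ?F"
  have k0: "k \<noteq> 0" using ne nz by (simp add: k_def)
  have gL: "?g \<in> L (OD (d + int t))"
  proof -
    have "- OD (d + int t) R \<le> ord R ?g" if "R \<in> Pts" for R using pf(5)[OF P' that] pf(3)[OF P' that] by simp
    then show ?thesis using nz by (simp add: L_iff)
  qed
  let ?A = "\<lambda>R. OD (d + int t) R + OD (2 * int t) R"
  have "v \<in> L ?A" by (rule L_mono[OF h(2)]) (simp add: OD_def)
  then have wL: "?g * h - v \<in> L ?A" by (intro L_diff L_mult gL h)
  have "?A P = 0" using S_D(3)[OF P] by (simp add: OD_def)
  then have "k \<in> L (\<lambda>R. ?A R + pE P R - OD (d + int t) R)" unfolding k_def by (rule L_divide_pf[OF P wL h(5)])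
  \<comment> \<open>The pole of \<open>pf P'\<close> at \<open>Q\<close> is cancelled by the equal
    pole of \<open>pf P\<close>, which leaves a divisor of degree
    \<open>3 t \<le> d - 1\<close>.\<close>
  then have kL: "k \<in> L (\<lambda>R. OD (2 * int t) R + pE P R)" by (rule L_mono) simp
  have fD: "fin (\<lambda>R. OD (2 * int t) R + pE P R)" by (intro fin_add fin_OD pf(2)[OF P])
  have deg: "degD (\<lambda>R. OD (2 * int t) R + pE P R) = 3 * int t"
    using degD_add[OF fin_OD pf(2)[OF P]] pf(4)[OF P] by simp
  have kG: "k \<in> Gd (d - 1)"
  proof (rule L_Gd[OF k0 kL fD])
    fix R assume R: "R \<in> Pts" "OD (2 * int t) R + pE P R \<noteq> 0"
    then consider "OD (2 * int t) R \<noteq> 0" | "pE P R \<noteq> 0" by force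
    then show "int (deg R) \<le> d - 1"
      using OD_deg[of "2 * int t" R] pE_deg[OF P R(1)] R(1) d_pos by cases auto
  qed (use deg d in simp)
  define a where "a = v / h"
  define b where "b = k / h"
  have ab: "a \<in> Gd (d - 1)" "b \<in> Gd (d - 1)" unfolding a_def b_def by (intro Gd_divide hG kG)+
  have ab0: "a \<noteq> 0" "b \<noteq> 0" using ab Gd_nonzero by auto
  have "1 - a / ?g = ?F * b / ?g"
    using nz h by (simp add: a_def b_def k_def field_simps)
  moreover have "a / ?g \<noteq> 1" using ne h nz by (auto simp: a_def field_simps)
  ultimately have st: "sym (a / ?g) (?F * b / ?g) = \<one>\<^bsub>G\<^esub>"
    using sym_steinberg[of "a / ?g"] nz ab0 by simp
  have left: "sym (a / ?g) y = sym a y \<otimes>\<^bsub>G\<^esub> inv\<^bsub>G\<^esub> sym ?g y" if "y \<noteq> 0" for y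
    using sym_mult_left[of a "inverse ?g" y] sym_inverse_left[of ?g y] nz ab0 that by (simp add: divide_inverse)
  have right: "sym x (?F * b / ?g) = sym x ?F \<otimes>\<^bsub>G\<^esub> (sym x b \<otimes>\<^bsub>G\<^esub> inv\<^bsub>G\<^esub> sym x ?g)" if "x \<noteq> 0" for x
    using sym_mult_right[of x ?F "b * inverse ?g"] sym_mult_right[of x b "inverse ?g"] sym_inverse_right[of x ?g]
      nz ab0 that by (simp add: divide_inverse mult.assoc)
  let ?u = "sym a (?F * b / ?g)"
  have cl: "sym x y \<in> carrier G" if "x \<in> {a, ?g}" "y \<in> {?F, b, ?g, ?F * b / ?g}" for x y
    using that sym_closed nz ab0 by auto
  have "?u \<otimes>\<^bsub>G\<^esub> inv\<^bsub>G\<^esub> sym ?g (?F * b / ?g) = \<one>\<^bsub>G\<^esub>"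
    using st left[of "?F * b / ?g"] nz ab0 by simp
  then have "?u \<otimes>\<^bsub>G\<^esub> inv\<^bsub>G\<^esub> sym ?g (?F * b / ?g) \<otimes>\<^bsub>G\<^esub> sym ?g (?F * b / ?g) = \<one>\<^bsub>G\<^esub> \<otimes>\<^bsub>G\<^esub> sym ?g (?F * b / ?g)"
    by simp
  then have "sym ?g (?F * b / ?g) = ?u"
    using cl[of a "?F * b / ?g"] cl[of ?g "?F * b / ?g"] by (simp add: G.m_assoc)
  \<comment> \<open>In the expanded relation every symbol other than that of \<open>?g\<close> and
    \<open>?F\<close> has an entry in \<open>Gd (d - 1)\<close> or is the diagonal symbol of
    \<open>?g\<close>.\<close>
  then have *: "sym ?g ?F \<otimes>\<^bsub>G\<^esub> (sym ?g b \<otimes>\<^bsub>G\<^esub> inv\<^bsub>G\<^esub> sym ?g ?g) = ?u" using right nz by simp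
  have uN: "?u \<in> N"
    unfolding right[OF ab0(1)]
    by (intro N_mult N_inv N_Fil[OF Fil_sym] ab N_antisym[OF _ _ N_pf[OF P]] N_antisym[OF _ _ N_pf[OF P']] nz ab0)
  have yN: "sym ?g b \<otimes>\<^bsub>G\<^esub> inv\<^bsub>G\<^esub> sym ?g ?g \<in> N"
    unfolding sym_self[OF nz(1)] by (intro N_mult N_inv N_pf P' ab Gd_uminus_1)
  have yc: "sym ?g b \<otimes>\<^bsub>G\<^esub> inv\<^bsub>G\<^esub> sym ?g ?g \<in> carrier G" using yN subgroup.subset[OF N_subgroup] by blast
  let ?y = "sym ?g b \<otimes>\<^bsub>G\<^esub> inv\<^bsub>G\<^esub> sym ?g ?g"
  have "sym ?g ?F = sym ?g ?F \<otimes>\<^bsub>G\<^esub> (?y \<otimes>\<^bsub>G\<^esub> inv\<^bsub>G\<^esub> ?y)"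
    using yc cl[of ?g ?F] by (simp only: G.r_inv G.r_one insertI1 insertI2 simp_thms)
  also have "\<dots> = (sym ?g ?F \<otimes>\<^bsub>G\<^esub> ?y) \<otimes>\<^bsub>G\<^esub> inv\<^bsub>G\<^esub> ?y"
    by (rule G.m_assoc[symmetric]) (use yc cl[of ?g ?F] in \<open>blast intro: G.inv_closed\<close>)+
  also have "\<dots> = ?u \<otimes>\<^bsub>G\<^esub> inv\<^bsub>G\<^esub> ?y" by (simp only: *)
  finally show ?thesis using N_mult[OF uN N_inv[OF yN]] by simp
qed

text \<open>Dividing by a power of \<open>pf P\<close> removes one point of \<open>S\<close> from
  the support and touches no other point of \<open>S\<close>.\<close>

lemma Gd_generated:
  assumes mult: "\<And>a b. a \<in> \<Gamma> \<Longrightarrow> b \<in> \<Gamma> \<Longrightarrow> a * b \<in> \<Gamma>" and inv: "\<And>a. a \<in> \<Gamma> \<Longrightarrow> inverse a \<in> \<Gamma>"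
    and low: "Gd (d - 1) \<subseteq> \<Gamma>" and pfs: "\<And>P. P \<in> S \<Longrightarrow> pf P \<in> \<Gamma>"
    and f: "f \<in> Gd d"
  shows "f \<in> \<Gamma>"
  using f
proof (induction "card {P \<in> S. ord P f \<noteq> 0}" arbitrary: f)
  case 0
  have f0: "f \<noteq> 0" using Gd_nonzero[OF 0(2)] .
  have fS: "finite {P \<in> S. ord P f \<noteq> 0}"
    by (rule finite_subset[OF _ finite_support[OF f0]]) (auto simp: S_def)
  then have none: "ord P f = 0" if "P \<in> S" for P using 0(1) that by auto
  have "f \<in> Gd (d - 1)"
    unfolding Gd_def
  proof (intro CollectI conjI ballI impI f0)
    fix P assume P: "P \<in> Pts" "ord P f \<noteq> 0"
    show "int (deg P) \<le> d - 1"
    proof (rule ccontr)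
      assume "\<not> ?thesis"
      then have dP: "int (deg P) = d" using 0(2) P by (force simp: Gd_def)
      \<comment> \<open>For \<open>d = 1\<close> the point \<open>Q\<close> has degree
        \<open>d\<close> without belonging to \<open>S\<close>. A function supported at
        \<open>Q\<close> alone has a divisor of degree zero, hence no zero or pole there.\<close>
      then have PQ: "P = Q" using none P by (auto simp: S_def)
      then have d1: "d = 1" using dP deg_Q by simp
      have other: "ord R f = 0" if R: "R \<in> Pts" "R \<noteq> Q" for R
      proof (rule ccontr)
        assume o: "ord R f \<noteq> 0"
        then have "int (deg R) \<le> 1" using 0(2) R d1 by (auto simp: Gd_def)
        then have "int (deg R) = d" using deg_pos[OF R(1)] d1 by simp
        then have "R \<in> S" using R unfolding S_def by blast
        then show False using none o by blast
      qed
      have "degD (\<lambda>R. ord R f) = degD (OD (ord Q f))"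
        by (rule degD_cong) (use other in \<open>auto simp: OD_def\<close>)
      then show False using degD_principal[OF f0] P PQ by simp
    qed
  qed
  then show ?case using low by blast
next
  case (Suc m)
  have f0: "f \<noteq> 0" using Gd_nonzero[OF Suc(3)] .
  have fS: "finite {P \<in> S. ord P f \<noteq> 0}"
    by (rule finite_subset[OF _ finite_support[OF f0]]) (auto simp: S_def)
  obtain P where P: "P \<in> S" "ord P f \<noteq> 0" using Suc(2) by (metis (mono_tags, lifting) card.empty empty_Collect_eq nat.distinct(1))
  define p where "p = pf P powi ord P f"
  have PP: "P \<in> Pts" using S_D(1)[OF P(1)] .
  have pow: "y powi n \<in> \<Gamma>'" if "\<And>a b. a \<in> \<Gamma>' \<Longrightarrow> b \<in> \<Gamma>' \<Longrightarrow> a * b \<in> \<Gamma>'" "\<And>a. a \<in> \<Gamma>' \<Longrightarrow> inverse a \<in> \<Gamma>'"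
    "1 \<in> \<Gamma>'" "y \<in> \<Gamma>'" for y n and \<Gamma>' :: "'f set"
  proof -
    have "y ^ k \<in> \<Gamma>'" for k by (induction k) (use that in auto)
    then show ?thesis using that(2) by (cases n rule: int_cases2) (auto simp: power_int_minus)
  qed
  have pG: "p \<in> Gd d" unfolding p_def by (rule pow[OF Gd_mult Gd_inverse Gd_1 pf_Gd[OF P(1)]])
  have "1 \<in> \<Gamma>" using low Gd_1 by blast
  have p\<Gamma>: "p \<in> \<Gamma>" unfolding p_def by (rule pow[OF mult inv \<open>1 \<in> \<Gamma>\<close> pfs[OF P(1)]])
  have ordp: "ord R (f / p) = ord R f - (if R = P then ord P f else 0)" if R: "R \<in> S" for R
    using ord_divide[OF S_D(1)[OF R] f0 Gd_nonzero[OF pG]] ord_powi[OF S_D(1)[OF R] pf(1)[OF P(1)]] ord_pf_S[OF P(1) R]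
    by (simp add: p_def)
  have "{R \<in> S. ord R (f / p) \<noteq> 0} = {R \<in> S. ord R f \<noteq> 0} - {P}"
    using ordp by (auto split: if_splits)
  then have "card {R \<in> S. ord R (f / p) \<noteq> 0} = m" using Suc(2) fS P by simp
  then have "f / p \<in> \<Gamma>" using Suc(1)[of "f / p"] Gd_divide[OF Suc(3) pG] by blast
  then have "f / p * p \<in> \<Gamma>" by (rule mult[OF _ p\<Gamma>])
  then show ?case using Gd_nonzero[OF pG] by simp
qed

text \<open>For a fixed first entry, the second entries whose symbol lies in \<open>N\<close> form a
  group, so generators suffice. Antisymmetry exchanges the entries, and the first entry is enlarged
  from low functions to uniformizing functions and then to all of \<open>Gd d\<close>.\<close>

lemma Fil_subset_N: "Fil d \<subseteq> N"
proof -
  have N1: "\<one>\<^bsub>G\<^esub> \<in> N" using subgroup.one_closed[OF N_subgroup] .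
  have right: "sym f g \<in> N"
    if f: "f \<noteq> 0" and base: "\<And>h. h \<in> Gd (d - 1) \<Longrightarrow> sym f h \<in> N" "\<And>P. P \<in> S \<Longrightarrow> sym f (pf P) \<in> N"
      and g: "g \<in> Gd d" for f g
  proof -
    have "g \<in> {g. g \<noteq> 0 \<and> sym f g \<in> N}"
      by (rule Gd_generated[OF _ _ _ _ g])
        (use f base pf(1) in \<open>auto simp: sym_mult_right sym_inverse_right N_mult N_inv dest: Gd_nonzero\<close>)
    then show ?thesis by simp
  qed
  have 1: "sym f g \<in> N" if f: "f \<in> Gd (d - 1)" and g: "g \<in> Gd d" for f g
  proof (rule right[OF Gd_nonzero[OF f] _ _ g])
    show "sym f h \<in> N" if "h \<in> Gd (d - 1)" for h by (rule N_Fil[OF Fil_sym[OF f that]])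
    show "sym f (pf P) \<in> N" if "P \<in> S" for P
      by (rule N_antisym[OF pf(1)[OF that] Gd_nonzero[OF f] N_pf[OF that f]])
  qed
  have 2: "sym (pf P) g \<in> N" if P: "P \<in> S" and g: "g \<in> Gd d" for P g
    by (rule right[OF pf(1)[OF P] N_pf[OF P] N_pf_pf[OF _ P] g])
  have "sym f g \<in> N" if f: "f \<in> Gd d" and g: "g \<in> Gd d" for f g
  proof (rule right[OF Gd_nonzero[OF f] _ _ g])
    show "sym f h \<in> N" if "h \<in> Gd (d - 1)" for h
      by (rule N_antisym[OF Gd_nonzero[OF that] Gd_nonzero[OF f] 1[OF that f]])
    show "sym f (pf P) \<in> N" if "P \<in> S" for P
      by (rule N_antisym[OF pf(1)[OF that] Gd_nonzero[OF f] 2[OF that f]])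
  qed
  then show ?thesis
    unfolding Fil_def by (intro G.generate_subgroup_incl[OF _ N_subgroup]) blast
qed

text \<open>Symbols with the same \<open>pf P\<close> merge because the second entry is
  multiplicative. The convention \<open>c P = 1\<close> outside \<open>I\<close> lets two elements
  be brought to a common index set.\<close>

lemma N_normal_form:
  assumes "\<xi> \<in> N"
  shows "\<exists>I c \<eta>. finite I \<and> I \<subseteq> S \<and> (\<forall>P. c P \<in> Gd (d - 1)) \<and> (\<forall>P. P \<notin> I \<longrightarrow> c P = 1) \<and> \<eta> \<in> Fil (d - 1) \<and>
    \<xi> = \<eta> \<otimes>\<^bsub>G\<^esub> finprod G (\<lambda>P. sym (pf P) (c P)) I"
proof -
  define NF where "NF \<xi> \<longleftrightarrow> (\<exists>I c \<eta>. finite I \<and> I \<subseteq> S \<and> (\<forall>P. c P \<in> Gd (d - 1)) \<and> (\<forall>P. P \<notin> I \<longrightarrow> c P = 1) \<and>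
    \<eta> \<in> Fil (d - 1) \<and> \<xi> = \<eta> \<otimes>\<^bsub>G\<^esub> finprod G (\<lambda>P. sym (pf P) (c P)) I)" for \<xi>
  have Fil_NF: "NF \<eta>" if "\<eta> \<in> Fil (d - 1)" for \<eta>
    unfolding NF_def using that Fil_carrier Gd_1
    by (intro exI[of _ "{}"] exI[of _ "\<lambda>_. 1"] exI[of _ \<eta>]) simp
  have pf_NF: "NF (sym (pf P) g)" if P: "P \<in> S" and g: "g \<in> Gd (d - 1)" for P g
    unfolding NF_def using P g sym_pf_closed[OF P Gd_nonzero[OF g]] Gd_1 Fil_one
    by (intro exI[of _ "{P}"] exI[of _ "(\<lambda>_. 1)(P := g)"] exI[of _ "\<one>\<^bsub>G\<^esub>"]) auto
  have mult_NF: "NF (x \<otimes>\<^bsub>G\<^esub> y)" if x: "NF x" and y: "NF y" for x y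
  proof -
    obtain I c \<eta> where 1: "finite I" "I \<subseteq> S" "\<forall>P. c P \<in> Gd (d - 1)" "\<forall>P. P \<notin> I \<longrightarrow> c P = 1" "\<eta> \<in> Fil (d - 1)"
      "x = \<eta> \<otimes>\<^bsub>G\<^esub> finprod G (\<lambda>P. sym (pf P) (c P)) I" using x unfolding NF_def by blast
    obtain I' c' \<eta>' where 2: "finite I'" "I' \<subseteq> S" "\<forall>P. c' P \<in> Gd (d - 1)" "\<forall>P. P \<notin> I' \<longrightarrow> c' P = 1" "\<eta>' \<in> Fil (d - 1)"
      "y = \<eta>' \<otimes>\<^bsub>G\<^esub> finprod G (\<lambda>P. sym (pf P) (c' P)) I'" using y unfolding NF_def by blast
    let ?J = "I \<union> I'"
    have car: "sym (pf P) (e P) \<in> carrier G" if "P \<in> ?J" "\<forall>P. e P \<in> Gd (d - 1)" for P e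
      using that 1(2) 2(2) sym_pf_closed Gd_nonzero by blast
    have ext: "finprod G (\<lambda>P. sym (pf P) (e P)) I0 = finprod G (\<lambda>P. sym (pf P) (e P)) ?J"
      if "I0 \<subseteq> ?J" "\<forall>P. e P \<in> Gd (d - 1)" "\<forall>P. P \<notin> I0 \<longrightarrow> e P = 1" for I0 e
    proof (rule G.finprod_mono_neutral_cong_left)
      show "sym (pf P) (e P) = \<one>\<^bsub>G\<^esub>" if "P \<in> ?J - I0" for P
        using that \<open>\<forall>P. P \<notin> I0 \<longrightarrow> e P = 1\<close> 1(2) 2(2) sym_1_right pf(1) by (metis DiffD1 DiffD2 UnE subsetD)
    qed (use that car 1 2 in auto)
    have c1: "finprod G (\<lambda>P. sym (pf P) (c P)) I = finprod G (\<lambda>P. sym (pf P) (c P)) ?J"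
      by (rule ext) (use 1 in auto)
    have c2: "finprod G (\<lambda>P. sym (pf P) (c' P)) I' = finprod G (\<lambda>P. sym (pf P) (c' P)) ?J"
      by (rule ext) (use 2 in auto)
    have "finprod G (\<lambda>P. sym (pf P) (c P * c' P)) ?J
        = finprod G (\<lambda>P. sym (pf P) (c P) \<otimes>\<^bsub>G\<^esub> sym (pf P) (c' P)) ?J"
    proof (rule G.finprod_cong'[OF refl])
      show "(\<lambda>P. sym (pf P) (c P) \<otimes>\<^bsub>G\<^esub> sym (pf P) (c' P)) \<in> ?J \<rightarrow> carrier G" using car 1 2 by auto
      fix P assume "P \<in> ?J"
      then have "pf P \<noteq> 0" using 1(2) 2(2) pf(1) by blast
      then show "sym (pf P) (c P * c' P) = sym (pf P) (c P) \<otimes>\<^bsub>G\<^esub> sym (pf P) (c' P)"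
        using sym_mult_right 1(3) 2(3) Gd_nonzero by blast
    qed
    also have "\<dots> = finprod G (\<lambda>P. sym (pf P) (c P)) ?J \<otimes>\<^bsub>G\<^esub> finprod G (\<lambda>P. sym (pf P) (c' P)) ?J"
      by (rule G.finprod_multf) (use car 1 2 in auto)
    finally have prod: "finprod G (\<lambda>P. sym (pf P) (c P * c' P)) ?J =
      finprod G (\<lambda>P. sym (pf P) (c P)) ?J \<otimes>\<^bsub>G\<^esub> finprod G (\<lambda>P. sym (pf P) (c' P)) ?J" .
    have fc: "finprod G (\<lambda>P. sym (pf P) (c P)) ?J \<in> carrier G" "finprod G (\<lambda>P. sym (pf P) (c' P)) ?J \<in> carrier G"
      by (intro G.finprod_closed; use car 1 2 in auto)+
    have ec: "\<eta> \<in> carrier G" "\<eta>' \<in> carrier G" using 1 2 Fil_carrier by auto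
    have "x \<otimes>\<^bsub>G\<^esub> y = (\<eta> \<otimes>\<^bsub>G\<^esub> \<eta>') \<otimes>\<^bsub>G\<^esub> finprod G (\<lambda>P. sym (pf P) (c P * c' P)) ?J"
      unfolding prod 1(6) 2(6) c1 c2 using fc ec by (simp add: G.m_ac)
    then show ?thesis
      unfolding NF_def using 1 2 Gd_mult Fil_mult
      by (intro exI[of _ ?J] exI[of _ "\<lambda>P. c P * c' P"] exI[of _ "\<eta> \<otimes>\<^bsub>G\<^esub> \<eta>'"]) auto
  qed
  have "NF \<xi>"
    using assms unfolding N_def
  proof (induction rule: generate.induct)
    case one
    then show ?case by (rule Fil_NF[OF Fil_one])
  next
    case (incl h)
    then show ?case using Fil_NF pf_NF by blast
  next
    case (inv h)
    then consider "h \<in> Fil (d - 1)" | P g where "h = sym (pf P) g" "P \<in> S" "g \<in> Gd (d - 1)" by blast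
    then show ?case
    proof cases
      case 1
      then show ?thesis by (intro Fil_NF Fil_inv)
    next
      case 2
      then have "inv\<^bsub>G\<^esub> h = sym (pf P) (inverse g)"
        using sym_inverse_right[OF pf(1)[OF 2(2)] Gd_nonzero[OF 2(3)]] by simp
      then show ?thesis using pf_NF[OF 2(2) Gd_inverse[OF 2(3)]] by simp
    qed
  next
    case (eng x y)
    then show ?case by (intro mult_NF)
  qed
  then show ?thesis unfolding NF_def .
qed

text \<open>At \<open>R\<close> the tame symbol sees only the factor belonging to \<open>R\<close>,
  since the other uniformizing functions and all low functions are units there. So each factor is in
  the kernel on its own, and \<open>kernel_at_point\<close> applies.\<close>

theorem graded_kernel:
  assumes \<xi>: "\<xi> \<in> Fil d" and triv: "\<And>P. P \<in> S \<Longrightarrow> T \<xi> P = \<one>\<^bsub>U P\<^esub>"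
  shows "\<xi> \<in> Fil (d - 1)"
proof -
  obtain I c \<eta> where nf: "finite I" "I \<subseteq> S" "\<forall>P. c P \<in> Gd (d - 1)" "\<forall>P. P \<notin> I \<longrightarrow> c P = 1" "\<eta> \<in> Fil (d - 1)"
    "\<xi> = \<eta> \<otimes>\<^bsub>G\<^esub> finprod G (\<lambda>P. sym (pf P) (c P)) I"
    using N_normal_form[OF subsetD[OF Fil_subset_N \<xi>]] by blast
  have car: "sym (pf P) (c P) \<in> carrier G" if "P \<in> I" for P
    using that nf sym_pf_closed Gd_nonzero by blast
  have "sym (pf R) (c R) \<in> Fil (d - 1)" if R: "R \<in> I" for R
  proof (rule kernel_at_point)
    show RS: "R \<in> S" using R nf by blast
    show "c R \<in> Gd (d - 1)" using nf by blast
    have RP: "R \<in> Pts" using S_D(1)[OF RS] .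
    interpret h: group_hom G "U R" "\<lambda>\<xi>. T \<xi> R" by (rule group_hom_T[OF RP])
    define A where "A = finprod G (\<lambda>P. sym (pf P) (c P)) (I - {R})"
    have Ac: "A \<in> carrier G" unfolding A_def by (rule G.finprod_closed) (use car in auto)
    have "A \<in> {\<xi> \<in> carrier G. T \<xi> R = \<one>\<^bsub>U R\<^esub>}"
      unfolding A_def
    proof (rule G.finprod_in_subgroup[OF G T_kernel[OF RP]])
      fix P assume P: "P \<in> I - {R}"
      then have "P \<in> S" using nf by blast
      then have "T (sym (pf P) (c P)) R = \<one>\<^bsub>U R\<^esub>" using T_pf[OF _ nf(3)[rule_format] RS, of P] P by auto
      then show "sym (pf P) (c P) \<in> {\<xi> \<in> carrier G. T \<xi> R = \<one>\<^bsub>U R\<^esub>}" using car P by blast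
    qed (use nf in auto)
    then have TA: "T A R = \<one>\<^bsub>U R\<^esub>" by simp
    have T\<eta>: "T \<eta> R = \<one>\<^bsub>U R\<^esub>" using Fil_T[OF RP _ nf(5)] S_D(2)[OF RS] by simp
    have "I = insert R (I - {R})" using R by blast
    then have "finprod G (\<lambda>P. sym (pf P) (c P)) I = sym (pf R) (c R) \<otimes>\<^bsub>G\<^esub> A"
      unfolding A_def using G.finprod_insert[of "I - {R}" R "\<lambda>P. sym (pf P) (c P)"] nf(1) car R by auto
    then have "\<xi> = \<eta> \<otimes>\<^bsub>G\<^esub> (sym (pf R) (c R) \<otimes>\<^bsub>G\<^esub> A)" using nf(6) by simp
    then have "T \<xi> R = T \<eta> R \<otimes>\<^bsub>U R\<^esub> (T (sym (pf R) (c R)) R \<otimes>\<^bsub>U R\<^esub> T A R)"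
      using Ac car[OF R] Fil_carrier[OF nf(5)] by simp
    then show "T (sym (pf R) (c R)) R = \<one>\<^bsub>U R\<^esub>"
      using triv[OF RS] TA T\<eta> h.hom_closed[OF car[OF R]] by simp
  qed
  then have "finprod G (\<lambda>P. sym (pf P) (c P)) I \<in> Fil (d - 1)"
    by (intro G.finprod_in_subgroup[OF G Fil_subgroup nf(1)])
  then show ?thesis unfolding nf(6) by (intro Fil_mult nf(5))
qed

text \<open>Points are added one at a time: a symbol with first entry \<open>pf R\<close> changes
  the value at \<open>R\<close> and no other value on \<open>S\<close>.\<close>

theorem graded_surjective:
  assumes "finite I" "I \<subseteq> S" "\<And>P. P \<in> I \<Longrightarrow> y P \<in> carrier (U P)"
  shows "\<exists>\<xi>\<in>Fil d. \<forall>P\<in>S. T \<xi> P = (if P \<in> I then y P else \<one>\<^bsub>U P\<^esub>)"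
  using assms
proof (induction I rule: finite_induct)
  case empty
  have "T \<one>\<^bsub>G\<^esub> P = \<one>\<^bsub>U P\<^esub>" if "P \<in> S" for P
    using group_hom.hom_one[OF group_hom_T[OF S_D(1)[OF that]]] .
  then show ?case using Fil_one by (intro bexI[of _ "\<one>\<^bsub>G\<^esub>"]) auto
next
  case (insert R I)
  then obtain \<xi> where \<xi>: "\<xi> \<in> Fil d" "\<forall>P\<in>S. T \<xi> P = (if P \<in> I then y P else \<one>\<^bsub>U P\<^esub>)" by auto
  have R: "R \<in> S" "R \<in> Pts" using insert.prems S_D(1) by auto
  obtain u where u: "u \<noteq> 0" "ord R u = 0" "cl R u = y R" using cl_surj[OF R(2), of "y R"] insert.prems by auto
  \<comment> \<open>With second unit \<open>1\<close>, \<open>two_representations\<close> yields a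
    single quotient \<open>g / h\<close> with the value \<open>u\<close> at
    \<open>R\<close>.\<close>
  obtain g h where g: "g \<in> L (OD (d - 1))" "h \<in> L (OD (d - 1))" "g \<noteq> 0" "h \<noteq> 0" "g - u * h \<in> ge R 1"
    using two_representations[OF R(1) u(1,2), of 1] R by auto
  have gd: "g \<in> Gd (d - 1)" "h \<in> Gd (d - 1)" using V_Gd g by auto
  have o: "ord R g = 0" "ord R h = 0" using V_ord_S g R by auto
  \<comment> \<open>Inverted, because the tame symbol of \<open>{pf R, c}\<close> at
    \<open>R\<close> is the class of the inverse of \<open>c\<close>.\<close>
  define c where "c = h / g"
  have cG: "c \<in> Gd (d - 1)" unfolding c_def by (intro Gd_divide gd)
  have "inverse h * (g - u * h) \<in> ge R 1"
    using ge_mult'[OF R(2), of "inverse h" 0 "g - u * h" 1 1] g o R by (simp add: ge_iff ord_inverse)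
  moreover have "inverse h * (g - u * h) = inverse c - u" using g by (simp add: c_def field_simps)
  ultimately have "inverse c - u \<in> ge R 1" by simp
  then have "cl R (inverse c) = y R"
    using cl_eq[OF R(2), of "inverse c" u] u g o R by (simp add: c_def ge_iff ord_divide)
  then have Tc: "T (sym (pf R) c) P = (if P = R then y R else \<one>\<^bsub>U P\<^esub>)" if "P \<in> S" for P
    using T_pf[OF R(1) cG that] by auto
  have sc: "sym (pf R) c \<in> Fil d" using Fil_sym pf_Gd[OF R(1)] Gd_mono[OF cG] by simp
  have "T (\<xi> \<otimes>\<^bsub>G\<^esub> sym (pf R) c) P = (if P \<in> insert R I then y P else \<one>\<^bsub>U P\<^esub>)" if P: "P \<in> S" for P
  proof -
    interpret h: group_hom G "U P" "\<lambda>\<xi>. T \<xi> P" by (rule group_hom_T[OF S_D(1)[OF P]])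
    have "T (\<xi> \<otimes>\<^bsub>G\<^esub> sym (pf R) c) P = T \<xi> P \<otimes>\<^bsub>U P\<^esub> T (sym (pf R) c) P"
      using Fil_carrier \<xi>(1) sc by simp
    moreover have "T \<xi> P = (if P \<in> I then y P else \<one>\<^bsub>U P\<^esub>)" using \<xi>(2) P by blast
    moreover have "P \<in> insert R I \<Longrightarrow> y P \<in> carrier (U P)" using insert.prems by blast
    ultimately show ?thesis
      using Tc[OF P] insert.hyps(2) h.H.l_one[of "y P"] h.H.r_one[of "y P"] h.H.l_one[OF h.H.one_closed]
      by (cases "P = R") auto
  qed
  then show ?case using Fil_mult[OF \<xi>(1) sc] by blast
qed

end

section \<open>From one degree to all degrees\<close>

context tame_places
begin

lemma exhaustive: assumes "\<xi> \<in> carrier G" shows "\<exists>m. \<xi> \<in> Fil m"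
proof -
  have Gd_ex: "\<exists>m. f \<in> Gd m" if f: "f \<noteq> 0" for f
  proof -
    let ?D = "{P \<in> Pts. ord P f \<noteq> 0}"
    have "int (deg P) \<le> (\<Sum>P\<in>?D. int (deg P))" if "P \<in> ?D" for P
      by (rule member_le_sum) (use that finite_support[OF f] in auto)
    then have "f \<in> Gd (\<Sum>P\<in>?D. int (deg P))" using f by (simp add: Gd_def)
    then show ?thesis ..
  qed
  have "\<xi> \<in> generate G {sym f g |f g. f \<noteq> 0 \<and> g \<noteq> 0}" using assms sym_generate by simp
  then show ?thesis
  proof (induction rule: generate.induct)
    case one
    then show ?case using Fil_one by blast
  next
    case (incl h)
    then obtain f g where fg: "h = sym f g" "f \<noteq> 0" "g \<noteq> 0" by blast
    obtain m m' where "f \<in> Gd m" "g \<in> Gd m'" using Gd_ex fg by meson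
    then have "f \<in> Gd (max m m')" "g \<in> Gd (max m m')" using Gd_mono by (meson max.cobounded1 max.cobounded2)+
    then show ?case using Fil_sym fg by blast
  next
    case (inv h)
    then obtain f g where fg: "h = sym f g" "f \<noteq> 0" "g \<noteq> 0" by blast
    obtain m m' where "f \<in> Gd m" "g \<in> Gd m'" using Gd_ex fg by meson
    then have "f \<in> Gd (max m m')" "g \<in> Gd (max m m')" using Gd_mono by (meson max.cobounded1 max.cobounded2)+
    then show ?case using Fil_sym Fil_inv fg by blast
  next
    case (eng x y)
    then obtain m m' where "x \<in> Fil m" "y \<in> Fil m'" by blast
    then have "x \<in> Fil (max m m')" "y \<in> Fil (max m m')"
      using Fil_mono[of m "max m m'"] Fil_mono[of m' "max m m'"] by auto
    then show ?case using Fil_mult by blast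
  qed
qed

lemma tame_degree: "3 * int t + 1 \<le> d \<Longrightarrow> tame_degree K Pts ord deg Q t hb G sym U cl T d"
  by (simp add: tame_degree_def tame_degree_axioms_def tame_places_axioms)

text \<open>The element lies in some step of the filtration, and \<open>graded_kernel\<close> lowers
  this step one degree at a time until \<open>d - 1\<close> is reached.\<close>

theorem total_kernel:
  assumes d: "3 * int t + 1 \<le> d" and \<xi>: "\<xi> \<in> carrier G"
    and triv: "\<And>P. P \<in> Pts \<Longrightarrow> d \<le> int (deg P) \<Longrightarrow> P \<noteq> Q \<Longrightarrow> T \<xi> P = \<one>\<^bsub>U P\<^esub>"
  shows "\<xi> \<in> Fil (d - 1)"
proof -
  obtain m0 where "\<xi> \<in> Fil m0" using exhaustive[OF \<xi>] by blast
  \<comment> \<open>The maximum guarantees a starting degree from which the induction can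
    descend.\<close>
  then have "\<xi> \<in> Fil (max m0 (d - 1))" using Fil_mono[of m0 "max m0 (d - 1)"] by auto
  moreover have "d - 1 \<le> max m0 (d - 1)" by simp
  ultimately obtain m where m: "d - 1 \<le> m" "\<xi> \<in> Fil m" by blast
  have "\<xi> \<in> Fil m \<Longrightarrow> \<xi> \<in> Fil (d - 1)" using m(1)
  proof (induction m rule: int_ge_induct)
    case (step i)
    interpret D: tame_degree K Pts ord deg Q t hb G sym U cl T "i + 1"
      by (rule tame_degree) (use d step.hyps in simp)
    have "\<xi> \<in> Fil (i + 1 - 1)"
      by (rule D.graded_kernel[OF step.prems]) (use triv step.hyps in \<open>auto simp: D.S_def\<close>)
    then show ?case using step.IH by simp
  qed
  then show ?thesis using m(2) by blast
qed

text \<open>The values in the highest degree are matched first. The symbol used for this is trivial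
  in still higher degrees, so only lower degrees need a correction, and these are covered by the
  induction hypothesis.\<close>

theorem total_surjective:
  assumes d: "3 * int t + 1 \<le> d" and y: "\<And>P. P \<in> Pts \<Longrightarrow> y P \<in> carrier (U P)"
    and fin: "finite {P \<in> Pts. y P \<noteq> \<one>\<^bsub>U P\<^esub>}"
    and finT: "\<And>\<xi>. \<xi> \<in> carrier G \<Longrightarrow> finite {P \<in> Pts. T \<xi> P \<noteq> \<one>\<^bsub>U P\<^esub>}"
  shows "\<exists>\<xi>\<in>carrier G. \<forall>P\<in>Pts. d \<le> int (deg P) \<and> P \<noteq> Q \<longrightarrow> T \<xi> P = y P"
proof -
  have main: "\<exists>\<xi>\<in>carrier G. \<forall>P\<in>Pts. d \<le> int (deg P) \<and> P \<noteq> Q \<longrightarrow> T \<xi> P = y P"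
    if "d - 1 \<le> m" "\<And>P. P \<in> Pts \<Longrightarrow> y P \<in> carrier (U P)" "finite {P \<in> Pts. y P \<noteq> \<one>\<^bsub>U P\<^esub>}"
      "\<And>P. P \<in> Pts \<Longrightarrow> m < int (deg P) \<Longrightarrow> P \<noteq> Q \<Longrightarrow> y P = \<one>\<^bsub>U P\<^esub>" for m y
    using that
  proof (induction m arbitrary: y rule: int_ge_induct)
    case base
    have "T \<one>\<^bsub>G\<^esub> P = \<one>\<^bsub>U P\<^esub>" if "P \<in> Pts" for P using group_hom.hom_one[OF group_hom_T[OF that]] .
    then show ?case using base by (intro bexI[of _ "\<one>\<^bsub>G\<^esub>"]) auto
  next
    case (step i)
    interpret D: tame_degree K Pts ord deg Q t hb G sym U cl T "i + 1"
      by (rule tame_degree) (use d step.hyps in simp)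
    define I where "I = {P \<in> D.S. y P \<noteq> \<one>\<^bsub>U P\<^esub>}"
    have I: "finite I" by (rule finite_subset[OF _ step.prems(2)]) (auto simp: I_def D.S_def)
    obtain \<xi> where \<xi>: "\<xi> \<in> Fil (i + 1)" "\<forall>P\<in>D.S. T \<xi> P = (if P \<in> I then y P else \<one>\<^bsub>U P\<^esub>)"
      using D.graded_surjective[OF I, of y] step.prems(1) by (auto simp: I_def D.S_def)
    have \<xi>c: "\<xi> \<in> carrier G" using Fil_carrier \<xi> by blast
    have \<xi>S: "T \<xi> P = y P" if "P \<in> D.S" for P using \<xi>(2) that by (auto simp: I_def)
    \<comment> \<open>The correction still to be realised. On \<open>D.S\<close> it is set to
      \<open>1\<close> outright, since the values there are already right.\<close>
    define z where "z P = (if P \<in> D.S then \<one>\<^bsub>U P\<^esub> else y P \<otimes>\<^bsub>U P\<^esub> inv\<^bsub>U P\<^esub> T \<xi> P)" for P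
    have Tc: "T \<xi> P \<in> carrier (U P)" if "P \<in> Pts" for P
      using group_hom.hom_closed[OF group_hom_T[OF that] \<xi>c] .
    have grp: "group (U P)" if "P \<in> Pts" for P using comm_group.axioms(2)[OF U[OF that]] .
    have "\<exists>\<xi>'\<in>carrier G. \<forall>P\<in>Pts. d \<le> int (deg P) \<and> P \<noteq> Q \<longrightarrow> T \<xi>' P = z P"
    proof (rule step.IH)
      show "z P \<in> carrier (U P)" if P: "P \<in> Pts" for P
      proof -
        interpret group "U P" by (rule grp[OF P])
        show ?thesis using step.prems(1)[OF P] Tc[OF P] by (simp add: z_def)
      qed
      show "finite {P \<in> Pts. z P \<noteq> \<one>\<^bsub>U P\<^esub>}"
      proof (rule finite_subset[OF _ finite_UnI[OF step.prems(2) finT[OF \<xi>c]]], rule subsetI, rule ccontr)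
        fix P assume P: "P \<in> {P \<in> Pts. z P \<noteq> \<one>\<^bsub>U P\<^esub>}" "P \<notin> {P \<in> Pts. y P \<noteq> \<one>\<^bsub>U P\<^esub>} \<union> {P \<in> Pts. T \<xi> P \<noteq> \<one>\<^bsub>U P\<^esub>}"
        then interpret group "U P" by (intro grp) simp
        show False using P by (auto simp: z_def split: if_splits)
      qed
      show "z P = \<one>\<^bsub>U P\<^esub>" if P: "P \<in> Pts" "i < int (deg P)" "P \<noteq> Q" for P
      proof (cases "P \<in> D.S")
        case False
        then have deg: "i + 1 < int (deg P)" using P by (simp add: D.S_def)
        interpret group "U P" by (rule grp[OF P(1)])
        have "T \<xi> P = \<one>\<^bsub>U P\<^esub>" using Fil_T[OF P(1) deg \<xi>(1)] .
        then show ?thesis using step.prems(3)[OF P(1) deg P(3)] False by (simp add: z_def)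
      qed (simp add: z_def)
    qed
    then obtain \<xi>' where \<xi>': "\<xi>' \<in> carrier G" "\<forall>P\<in>Pts. d \<le> int (deg P) \<and> P \<noteq> Q \<longrightarrow> T \<xi>' P = z P" by blast
    have "T (\<xi>' \<otimes>\<^bsub>G\<^esub> \<xi>) P = y P" if P: "P \<in> Pts" "d \<le> int (deg P)" "P \<noteq> Q" for P
    proof -
      interpret h: group_hom G "U P" "\<lambda>\<xi>. T \<xi> P" by (rule group_hom_T[OF P(1)])
      have "T (\<xi>' \<otimes>\<^bsub>G\<^esub> \<xi>) P = z P \<otimes>\<^bsub>U P\<^esub> T \<xi> P" using \<xi>' \<xi>c P by simp
      then show ?thesis using \<xi>S Tc[OF P(1)] step.prems(1)[OF P(1)] by (auto simp: z_def h.H.m_assoc)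
    qed
    then show ?case using \<xi>'(1) \<xi>c by (intro bexI[of _ "\<xi>' \<otimes>\<^bsub>G\<^esub> \<xi>"]) auto
  qed
  let ?D = "{P \<in> Pts. y P \<noteq> \<one>\<^bsub>U P\<^esub>}"
  define m where "m = max (d - 1) (\<Sum>P\<in>?D. int (deg P))"
  have "y P = \<one>\<^bsub>U P\<^esub>" if "P \<in> Pts" "m < int (deg P)" for P
  proof (rule ccontr)
    assume "y P \<noteq> \<one>\<^bsub>U P\<^esub>"
    then have "int (deg P) \<le> (\<Sum>P\<in>?D. int (deg P))"
      by (intro member_le_sum) (use that fin in auto)
    then show False using that by (simp add: m_def)
  qed
  then show ?thesis using main[of m y] y fin by (simp add: m_def)
qed

end

section \<open>The second K-group\<close>

lemma (in comm_group) coset_eq_iff: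
  assumes "subgroup N G" "x \<in> carrier G" "y \<in> carrier G"
  shows "N #> x = N #> y \<longleftrightarrow> x \<otimes> inv y \<in> N"
proof
  assume "N #> x = N #> y"
  then have "x \<in> N #> y" using rcos_self[OF assms(2,1)] by simp
  then show "x \<otimes> inv y \<in> N" using subgroup.rcos_module_imp[OF assms(1) is_group assms(3)] by blast
next
  assume "x \<otimes> inv y \<in> N"
  then have "x \<in> N #> y" using subgroup.rcos_module_rev[OF assms(1) is_group assms(3,2)] by blast
  then show "N #> x = N #> y" using repr_independence[OF _ assms(3,1)] by blast
qed

text \<open>The kernel is a subgroup containing \<open>R\<close>, hence contains everything
  \<open>R\<close> generates, and the homomorphism is constant on cosets.\<close>

lemma hom_factors_through_generated:
  assumes G: "comm_group G" and H: "group H" and h: "h \<in> hom G H"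
    and R: "R \<subseteq> carrier G" "\<And>r. r \<in> R \<Longrightarrow> h r = \<one>\<^bsub>H\<^esub>"
  obtains g where "g \<in> hom (G Mod generate G R) H"
    "\<And>x. x \<in> carrier G \<Longrightarrow> g (generate G R #>\<^bsub>G\<^esub> x) = h x"
proof -
  interpret G: comm_group G by fact
  interpret h: group_hom G H h by (intro group_hom.intro group_hom_axioms.intro G.is_group H h)
  have sub: "subgroup (generate G R) G" by (rule G.generate_is_subgroup[OF R(1)])
  have ker: "h x = \<one>\<^bsub>H\<^esub>" if "x \<in> generate G R" for x
    using that
  proof (induction rule: generate.induct)
    case (inv x)
    then have "x \<in> carrier G" using R(1) by blast
    then show ?case using R(2)[OF inv] by simp
  next
    case (eng x y)
    then have "x \<in> carrier G" "y \<in> carrier G" using G.generate_in_carrier[OF R(1)] by auto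
    then show ?case using eng by simp
  qed (use R in auto)
  have eq: "h x = h y"
    if "x \<in> carrier G" "y \<in> carrier G" "generate G R #>\<^bsub>G\<^esub> x = generate G R #>\<^bsub>G\<^esub> y" for x y
  proof -
    have "h (x \<otimes>\<^bsub>G\<^esub> inv\<^bsub>G\<^esub> y) = \<one>\<^bsub>H\<^esub>" using ker G.coset_eq_iff[OF sub that(1,2)] that(3) by blast
    then have "h x \<otimes>\<^bsub>H\<^esub> inv\<^bsub>H\<^esub> h y = \<one>\<^bsub>H\<^esub>" using that by simp
    then have "h x \<otimes>\<^bsub>H\<^esub> inv\<^bsub>H\<^esub> h y \<otimes>\<^bsub>H\<^esub> h y = \<one>\<^bsub>H\<^esub> \<otimes>\<^bsub>H\<^esub> h y" by simp
    then show ?thesis using that by (simp add: h.H.m_assoc)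
  qed
  show thesis
    by (rule FactGroup_universal[OF h G.subgroup_imp_normal[OF sub] eq]) (use that in auto)
qed

section \<open>A presentation of K_2 and its universal property\<close>

abbreviation FA :: "('f::field \<times> 'f \<Rightarrow>\<^sub>0 int) monoid"
  where "FA \<equiv> free_Abelian_group (carrier Fstar \<times> carrier Fstar)"

lemma Fstar_simps [simp]:
  "carrier Fstar = {x :: 'f::field. x \<noteq> 0}" "monoid.mult Fstar = (*)" "monoid.one Fstar = (1 :: 'f)"
proof -
  have "x \<in> Units Fr \<longleftrightarrow> x \<noteq> 0" for x :: 'f
    by (auto simp: Units_def ring_of_type_algebra_def intro!: exI[of _ "inverse x"])
  then show "carrier Fstar = {x :: 'f. x \<noteq> 0}" by (auto simp: units_of_def)
qed (simp_all add: units_of_def ring_of_type_algebra_def)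

definition tensor_rels :: "('f::field \<times> 'f \<Rightarrow>\<^sub>0 int) set"
  where "tensor_rels = {frag_of (a * a', b) - frag_of (a, b) - frag_of (a', b) |a a' b.
                 a \<noteq> 0 \<and> a' \<noteq> 0 \<and> b \<noteq> 0} \<union>
              {frag_of (a, b * b') - frag_of (a, b) - frag_of (a, b') |a b b'.
                 a \<noteq> 0 \<and> b \<noteq> 0 \<and> b' \<noteq> 0}"

abbreviation FT :: "('f::field \<times> 'f \<Rightarrow>\<^sub>0 int) set monoid"
  where "FT \<equiv> tensor_group Fstar Fstar"

abbreviation TR :: "('f::field \<times> 'f \<Rightarrow>\<^sub>0 int) set"
  where "TR \<equiv> tensor_relations Fstar Fstar"

lemma tensor_relations_eq: "TR = generate FA tensor_rels"
  unfolding tensor_relations_def tensor_rels_def by simp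

lemma comm_group_FA: "comm_group FA" by (rule abelian_free_Abelian_group)

lemma frag_of_FA: "a \<noteq> 0 \<Longrightarrow> b \<noteq> 0 \<Longrightarrow> frag_of (a, b) \<in> carrier FA"
  by simp

lemma FA_diff: assumes "x \<in> carrier FA" "y \<in> carrier FA" shows "x - y \<in> carrier FA"
  using assms keys_diff[of x y] unfolding carrier_free_Abelian_group_iff by blast

lemma tensor_rels_FA: "tensor_rels \<subseteq> carrier FA"
  unfolding tensor_rels_def by (auto intro!: FA_diff frag_of_FA simp del: carrier_free_Abelian_group_iff Fstar_simps)

lemma subgroup_TR: "subgroup (TR) FA"
  unfolding tensor_relations_eq
  by (rule group.generate_is_subgroup[OF comm_group.axioms(2)[OF comm_group_FA] tensor_rels_FA])

lemma comm_group_tensor: "comm_group FT"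
  unfolding tensor_group_def by (rule comm_group.abelian_FactGroup[OF comm_group_FA subgroup_TR])

definition quot1 :: "('f::field \<times> 'f \<Rightarrow>\<^sub>0 int) \<Rightarrow> ('f \<times> 'f \<Rightarrow>\<^sub>0 int) set"
  where "quot1 x = TR #>\<^bsub>FA\<^esub> x"

lemma quot1_hom: "quot1 \<in> hom FA FT"
  unfolding tensor_group_def quot1_def[abs_def]
  by (rule normal.r_coset_hom_Mod[OF comm_group.subgroup_imp_normal[OF comm_group_FA subgroup_TR]])

lemma carrier_tensor: "carrier FT = quot1 ` carrier FA"
  unfolding tensor_group_def quot1_def[abs_def] by (rule carrier_FactGroup)

lemma pure_tensor_eq: "pure_tensor Fstar Fstar a b = quot1 (frag_of (a, b))"
  by (simp add: pure_tensor_def quot1_def)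

definition steinberg_rels :: "('f::field \<times> 'f \<Rightarrow>\<^sub>0 int) set set"
  where "steinberg_rels = {quot1 (frag_of (a, 1 - a)) |a. a \<noteq> 0 \<and> a \<noteq> 1}"

lemma steinberg_rels_carrier: "steinberg_rels \<subseteq> carrier FT"
  unfolding steinberg_rels_def carrier_tensor using frag_of_FA by fastforce

lemma steinberg_relations_eq: "steinberg_relations = generate FT steinberg_rels"
  unfolding steinberg_relations_def steinberg_rels_def pure_tensor_eq ..

lemma subgroup_SR: "subgroup steinberg_relations FT"
  unfolding steinberg_relations_eq
  by (rule group.generate_is_subgroup[OF comm_group.axioms(2)[OF comm_group_tensor] steinberg_rels_carrier])

lemma comm_group_K2: "comm_group (K2 :: ('f::field \<times> 'f \<Rightarrow>\<^sub>0 int) set set monoid)"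
  unfolding K2_def by (rule comm_group.abelian_FactGroup[OF comm_group_tensor subgroup_SR])

definition quot2 :: "('f::field \<times> 'f \<Rightarrow>\<^sub>0 int) set \<Rightarrow> ('f \<times> 'f \<Rightarrow>\<^sub>0 int) set set"
  where "quot2 x = steinberg_relations #>\<^bsub>FT\<^esub> x"

lemma quot2_hom: "quot2 \<in> hom FT K2"
  unfolding K2_def quot2_def[abs_def]
  by (rule normal.r_coset_hom_Mod[OF comm_group.subgroup_imp_normal[OF comm_group_tensor subgroup_SR]])

text \<open>The two quotients in the definition of \<open>K2\<close> are composed into one
  homomorphism from the free abelian group, where relations can be written additively.\<close>

definition quot :: "('f::field \<times> 'f \<Rightarrow>\<^sub>0 int) \<Rightarrow> ('f \<times> 'f \<Rightarrow>\<^sub>0 int) set set"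
  where "quot x = quot2 (quot1 x)"

lemma quot_hom: "quot \<in> hom FA K2"
  using hom_compose[OF quot1_hom quot2_hom] unfolding quot_def[abs_def] comp_def .

lemma group_hom_quot: "group_hom FA K2 quot"
  by (intro group_hom.intro group_hom_axioms.intro comm_group.axioms(2) comm_group_FA comm_group_K2 quot_hom)

lemma carrier_K2: "carrier K2 = quot ` carrier FA"
  unfolding K2_def carrier_FactGroup carrier_tensor quot_def[abs_def] quot2_def by auto

lemma symbol_eq: "symbol f g = quot (frag_of (f, g))"
  by (simp add: symbol_def pure_tensor_eq quot_def quot2_def)

lemma symbol_closed: "f \<noteq> 0 \<Longrightarrow> g \<noteq> 0 \<Longrightarrow> symbol f g \<in> carrier K2"
  unfolding symbol_eq carrier_K2 using frag_of_FA by blast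

lemma quot1_rel:
  assumes "x \<in> tensor_rels" shows "quot1 x = \<one>\<^bsub>FT\<^esub>"
proof -
  interpret FA: comm_group FA by (rule comm_group_FA)
  have "x \<in> TR" unfolding tensor_relations_eq using assms by (rule generate.incl)
  then show ?thesis unfolding quot1_def tensor_group_def one_FactGroup
    using FA.coset_join2[OF _ subgroup_TR] assms tensor_rels_FA by blast
qed

lemma quot_rel_mult:
  assumes "x - y - z \<in> tensor_rels" "x \<in> carrier FA" "y \<in> carrier FA" "z \<in> carrier FA"
  shows "quot x = quot y \<otimes>\<^bsub>K2\<^esub> quot z"
proof -
  interpret q: group_hom FA K2 quot by (rule group_hom_quot)
  interpret q2: group_hom FT K2 quot2
    by (intro group_hom.intro group_hom_axioms.intro comm_group.axioms(2) comm_group_tensor comm_group_K2 quot2_hom)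
  have w: "x - y - z \<in> carrier FA" using assms tensor_rels_FA by blast
  have "quot x = quot ((x - y - z) \<otimes>\<^bsub>FA\<^esub> (y \<otimes>\<^bsub>FA\<^esub> z))"
    by (simp add: algebra_simps)
  also have "\<dots> = quot (x - y - z) \<otimes>\<^bsub>K2\<^esub> (quot y \<otimes>\<^bsub>K2\<^esub> quot z)"
    using w assms by (simp only: q.hom_mult q.G.m_closed)
  also have "quot (x - y - z) = \<one>\<^bsub>K2\<^esub>"
    unfolding quot_def quot1_rel[OF assms(1)] by simp
  also have "\<one>\<^bsub>K2\<^esub> \<otimes>\<^bsub>K2\<^esub> (quot y \<otimes>\<^bsub>K2\<^esub> quot z) = quot y \<otimes>\<^bsub>K2\<^esub> quot z"
    using q.hom_closed[OF assms(3)] q.hom_closed[OF assms(4)] by simp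
  finally show ?thesis .
qed

lemma tensor_rels_left:
  "f \<noteq> 0 \<Longrightarrow> f' \<noteq> 0 \<Longrightarrow> g \<noteq> 0 \<Longrightarrow> frag_of (f * f', g) - frag_of (f, g) - frag_of (f', g) \<in> tensor_rels"
  unfolding tensor_rels_def by blast

lemma tensor_rels_right:
  "f \<noteq> 0 \<Longrightarrow> g \<noteq> 0 \<Longrightarrow> g' \<noteq> 0 \<Longrightarrow> frag_of (f, g * g') - frag_of (f, g) - frag_of (f, g') \<in> tensor_rels"
  unfolding tensor_rels_def by blast

lemma symbol_mult_left:
  "f \<noteq> 0 \<Longrightarrow> f' \<noteq> 0 \<Longrightarrow> g \<noteq> 0 \<Longrightarrow> symbol (f * f') g = symbol f g \<otimes>\<^bsub>K2\<^esub> symbol f' g"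
  unfolding symbol_eq by (rule quot_rel_mult[OF tensor_rels_left]) simp_all

lemma symbol_mult_right:
  "f \<noteq> 0 \<Longrightarrow> g \<noteq> 0 \<Longrightarrow> g' \<noteq> 0 \<Longrightarrow> symbol f (g * g') = symbol f g \<otimes>\<^bsub>K2\<^esub> symbol f g'"
  unfolding symbol_eq by (rule quot_rel_mult[OF tensor_rels_right]) simp_all

lemma symbol_steinberg:
  assumes "a \<noteq> 0" "a \<noteq> 1" shows "symbol a (1 - a) = \<one>\<^bsub>K2\<^esub>"
proof -
  interpret T: comm_group FT by (rule comm_group_tensor)
  have r: "quot1 (frag_of (a, 1 - a)) \<in> steinberg_rels" unfolding steinberg_rels_def using assms by blast
  then have "quot1 (frag_of (a, 1 - a)) \<in> steinberg_relations"
    unfolding steinberg_relations_eq by (rule generate.incl)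
  then show ?thesis
    unfolding symbol_eq quot_def quot2_def K2_def one_FactGroup
    using T.coset_join2[OF _ subgroup_SR] r steinberg_rels_carrier by blast
qed

lemma K2_generated: "carrier K2 = generate K2 {symbol f g |f g. f \<noteq> 0 \<and> (g :: 'f::field) \<noteq> 0}"
proof
  interpret q: group_hom "FA :: ('f \<times> 'f \<Rightarrow>\<^sub>0 int) monoid" K2 quot by (rule group_hom_quot)
  let ?S = "{symbol f g |f g. f \<noteq> 0 \<and> (g :: 'f::field) \<noteq> 0}"
  have S: "?S \<subseteq> carrier K2" using symbol_closed by blast
  show "generate K2 ?S \<subseteq> carrier K2" by (rule q.H.generate_incl[OF S])
  show "carrier K2 \<subseteq> generate K2 ?S"
  proof
    fix \<xi> :: "('f \<times> 'f \<Rightarrow>\<^sub>0 int) set set" assume "\<xi> \<in> carrier K2"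
    then obtain x where x: "x \<in> carrier FA" "\<xi> = quot x" unfolding carrier_K2 by blast
    have "quot x \<in> generate K2 ?S"
    proof (rule free_Abelian_group_induct[of x])
      show "Poly_Mapping.keys x \<subseteq> carrier Fstar \<times> carrier Fstar" using x(1) by simp
      show "quot 0 \<in> generate K2 ?S" using q.hom_one generate.one[of K2 ?S] by simp
    next
      fix x y :: "'f \<times> 'f \<Rightarrow>\<^sub>0 int"
      assume xy: "Poly_Mapping.keys x \<subseteq> carrier Fstar \<times> carrier Fstar"
        "Poly_Mapping.keys y \<subseteq> carrier Fstar \<times> carrier Fstar"
        "quot x \<in> generate K2 ?S" "quot y \<in> generate K2 ?S"
      then have c: "x \<in> carrier FA" "y \<in> carrier FA" by simp_all
      have "x - y = x \<otimes>\<^bsub>FA\<^esub> inv\<^bsub>FA\<^esub> y" using inv_free_Abelian_group[OF xy(2)] by simp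
      then have "quot (x - y) = quot x \<otimes>\<^bsub>K2\<^esub> inv\<^bsub>K2\<^esub> quot y"
        using c by (simp only: q.hom_mult q.G.inv_closed q.hom_inv)
      then show "quot (x - y) \<in> generate K2 ?S"
        using xy(3,4) q.H.generate_m_inv_closed[OF S] by (simp add: generate.eng)
    next
      fix p :: "'f \<times> 'f" assume "p \<in> carrier Fstar \<times> carrier Fstar"
      then have "quot (frag_of p) \<in> ?S" by (cases p) (auto simp: symbol_eq)
      then show "quot (frag_of p) \<in> generate K2 ?S" by (rule generate.incl)
    qed
    then show "\<xi> \<in> generate K2 ?S" using x by simp
  qed
qed

text \<open>A map on pairs extends to the free abelian group; bilinearity lets it pass to the tensor
  product and the Steinberg relation to the second quotient.\<close>

theorem K2_universal:
  fixes \<phi> :: "'f::field \<Rightarrow> 'f \<Rightarrow> 'a"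
  assumes H: "comm_group H"
    and closed: "\<And>f g. f \<noteq> 0 \<Longrightarrow> g \<noteq> 0 \<Longrightarrow> \<phi> f g \<in> carrier H"
    and left: "\<And>f f' g. f \<noteq> 0 \<Longrightarrow> f' \<noteq> 0 \<Longrightarrow> g \<noteq> 0 \<Longrightarrow> \<phi> (f * f') g = \<phi> f g \<otimes>\<^bsub>H\<^esub> \<phi> f' g"
    and right: "\<And>f g g'. f \<noteq> 0 \<Longrightarrow> g \<noteq> 0 \<Longrightarrow> g' \<noteq> 0 \<Longrightarrow> \<phi> f (g * g') = \<phi> f g \<otimes>\<^bsub>H\<^esub> \<phi> f g'"
    and st: "\<And>a. a \<noteq> 0 \<Longrightarrow> a \<noteq> 1 \<Longrightarrow> \<phi> a (1 - a) = \<one>\<^bsub>H\<^esub>"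
  obtains h where "h \<in> hom K2 H" "\<And>f g. f \<noteq> 0 \<Longrightarrow> g \<noteq> 0 \<Longrightarrow> h (symbol f g) = \<phi> f g"
proof -
  interpret H: comm_group H by fact
  have im: "(\<lambda>(f, g). \<phi> f g) ` (carrier Fstar \<times> carrier Fstar) \<subseteq> carrier H" using closed by auto
  obtain h0 where h0: "h0 \<in> hom FA H"
    "\<And>x. x \<in> carrier Fstar \<times> carrier Fstar \<Longrightarrow> h0 (frag_of x) = (\<lambda>(f, g). \<phi> f g) x"
    using H.free_Abelian_group_universal[OF im] by blast
  have h0f: "h0 (frag_of (f, g)) = \<phi> f g" if "f \<noteq> 0" "g \<noteq> 0" for f g using h0(2)[of "(f, g)"] that by simp
  interpret FA: comm_group FA by (rule comm_group_FA)
  interpret h0: group_hom FA H h0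
    by (intro group_hom.intro group_hom_axioms.intro FA.is_group H.is_group h0(1))
  have diff: "h0 (x - y - z) = \<one>\<^bsub>H\<^esub>"
    if "x \<in> carrier FA" "y \<in> carrier FA" "z \<in> carrier FA" "h0 x = h0 y \<otimes>\<^bsub>H\<^esub> h0 z" for x y z
  proof -
    have w: "x - y - z \<in> carrier FA" by (intro FA_diff that)
    have "h0 x = h0 ((x - y - z) \<otimes>\<^bsub>FA\<^esub> (y \<otimes>\<^bsub>FA\<^esub> z))" by (simp add: algebra_simps)
    also have "\<dots> = h0 (x - y - z) \<otimes>\<^bsub>H\<^esub> (h0 y \<otimes>\<^bsub>H\<^esub> h0 z)"
      using w that by (simp only: h0.hom_mult FA.m_closed)
    finally have "h0 (x - y - z) \<otimes>\<^bsub>H\<^esub> (h0 y \<otimes>\<^bsub>H\<^esub> h0 z) = \<one>\<^bsub>H\<^esub> \<otimes>\<^bsub>H\<^esub> (h0 y \<otimes>\<^bsub>H\<^esub> h0 z)"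
      using h0.hom_closed[OF that(2)] h0.hom_closed[OF that(3)] that(4) by simp
    then show ?thesis
      using h0.hom_closed[OF w] h0.hom_closed[OF that(2)] h0.hom_closed[OF that(3)]
      by (simp only: H.r_cancel H.m_closed H.one_closed)
  qed
  have r0: "h0 r = \<one>\<^bsub>H\<^esub>" if "r \<in> tensor_rels" for r
    using that unfolding tensor_rels_def
    by (auto intro!: diff frag_of_FA simp: h0f left right simp del: carrier_free_Abelian_group_iff Fstar_simps)
  obtain h1 where h1: "h1 \<in> hom (FA Mod generate FA tensor_rels) H"
    "\<And>x. x \<in> carrier FA \<Longrightarrow> h1 (generate FA tensor_rels #>\<^bsub>FA\<^esub> x) = h0 x"
    using hom_factors_through_generated[OF comm_group_FA H.is_group h0(1) tensor_rels_FA r0] by blast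
  have h1': "h1 \<in> hom FT H" "\<And>x. x \<in> carrier FA \<Longrightarrow> h1 (quot1 x) = h0 x"
    using h1 by (simp_all add: tensor_group_def tensor_relations_eq quot1_def)
  have s0: "h1 r = \<one>\<^bsub>H\<^esub>" if "r \<in> steinberg_rels" for r
  proof -
    obtain a where "r = quot1 (frag_of (a, 1 - a))" "a \<noteq> 0" "a \<noteq> 1"
      using \<open>r \<in> steinberg_rels\<close> unfolding steinberg_rels_def by blast
    then show ?thesis using h1'(2)[OF frag_of_FA[of a "1 - a"]] h0f[of a "1 - a"] st by simp
  qed
  obtain h2 where h2: "h2 \<in> hom (FT Mod generate FT steinberg_rels) H"
    "\<And>x. x \<in> carrier FT \<Longrightarrow>
      h2 (generate FT steinberg_rels #>\<^bsub>FT\<^esub> x) = h1 x"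
    using hom_factors_through_generated[OF comm_group_tensor H.is_group h1'(1) steinberg_rels_carrier s0] by blast
  show thesis
  proof (rule that)
    show "h2 \<in> hom K2 H" using h2(1) by (simp add: K2_def steinberg_relations_eq)
    show "h2 (symbol f g) = \<phi> f g" if "f \<noteq> 0" "g \<noteq> 0" for f g
    proof -
      have "quot1 (frag_of (f, g)) \<in> carrier FT"
        unfolding carrier_tensor using frag_of_FA that by blast
      then show ?thesis
        using h2(2)[of "quot1 (frag_of (f, g))"] h1'(2)[OF frag_of_FA[OF that]] h0f[OF that]
        by (simp add: symbol_eq quot_def quot2_def steinberg_relations_eq)
    qed
  qed
qed

section \<open>The tame symbol of a curve\<close>

context curve
begin

abbreviation "RU \<equiv> \<lambda>P. units_of (residue_field C P)"

lemma RU_group: assumes P: "P \<in> closed_points C" shows "comm_group (RU P)" "group (RU P)"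
proof -
  interpret E: field "residue_field C P" by (rule residue_field_field[OF P])
  show "comm_group (RU P)" by (rule E.units_comm_group)
  then show "group (RU P)" by (rule comm_group.axioms(2))
qed

lemma RU_simps [simp]:
  "monoid.mult (RU P) = monoid.mult (residue_field C P)" "\<one>\<^bsub>RU P\<^esub> = \<one>\<^bsub>residue_field C P\<^esub>"
  by (simp_all add: units_of_def)

lemma unit_iff:
  assumes P: "P \<in> closed_points C" shows "f \<noteq> 0 \<and> ord_at C P f = 0 \<longleftrightarrow> f \<in> St P \<and> f \<notin> Mx P"
proof (cases "f = 0")
  case True
  then show ?thesis using Mx_ideal(1)[OF closed_in_pts[OF P]] by (simp add: is_ideal_def)
next
  case False
  then show ?thesis using ord_at_nonneg[OF P False] ord_at_pos[OF P False] by auto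
qed

lemma RU_carrier:
  assumes P: "P \<in> closed_points C"
  shows "carrier (RU P) = {residue_class C P f |f. f \<noteq> 0 \<and> ord_at C P f = 0}"
proof -
  interpret E: field "residue_field C P" by (rule residue_field_field[OF P])
  interpret S: subring_set "St P" by (rule stalk_subring[OF closed_in_pts[OF P]])
  have "residue_class C P f = \<zero>\<^bsub>residue_field C P\<^esub> \<longleftrightarrow> f \<in> Mx P" if "f \<in> St P" for f
    using residue_class_eq_iff[OF P that S.A_0] residue_class_simps(3)[OF P] by simp
  then have "carrier (residue_field C P) - {\<zero>\<^bsub>residue_field C P\<^esub>} = {residue_class C P f |f. f \<in> St P \<and> f \<notin> Mx P}"
    unfolding carrier_residue_field by blast
  then show ?thesis unfolding units_of_carrier E.field_Units unit_iff[OF P] .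
qed

lemma RU_class: "P \<in> closed_points C \<Longrightarrow> f \<noteq> 0 \<Longrightarrow> ord_at C P f = 0 \<Longrightarrow> residue_class C P f \<in> carrier (RU P)"
  unfolding RU_carrier by blast

lemma residue_units_carrier:
  assumes "S \<subseteq> closed_points C"
  shows "x \<in> carrier (residue_units C S) \<longleftrightarrow>
    x \<in> extensional S \<and> (\<forall>P\<in>S. x P \<in> carrier (RU P)) \<and> finite {P \<in> S. x P \<noteq> \<one>\<^bsub>residue_field C P\<^esub>}"
proof -
  have "\<And>P. P \<in> S \<Longrightarrow> group (RU P)" using RU_group assms by blast
  from carrier_sum_group[of S RU, OF this] show ?thesis
    unfolding residue_units_def by (simp add: PiE_iff conj_ac)
qed

lemma residue_units_mult:
  "x \<otimes>\<^bsub>residue_units C S\<^esub> y = (\<lambda>P\<in>S. x P \<otimes>\<^bsub>residue_field C P\<^esub> y P)"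
  by (simp add: residue_units_def)

lemma residue_units_one: "\<one>\<^bsub>residue_units C S\<^esub> = (\<lambda>P\<in>S. \<one>\<^bsub>residue_field C P\<^esub>)"
  by (simp add: residue_units_def)

lemma residue_units_eqI:
  assumes "S \<subseteq> closed_points C" "x \<in> carrier (residue_units C S)" "y \<in> carrier (residue_units C S)"
    "\<And>P. P \<in> S \<Longrightarrow> x P = y P"
  shows "x = y"
  using assms by (intro extensionalityI[of x S y]) (simp_all add: residue_units_carrier)

lemma comm_group_residue_units:
  assumes S: "S \<subseteq> closed_points C" shows "comm_group (residue_units C S)"
proof (rule group.group_comm_groupI)
  show "group (residue_units C S)"
    unfolding residue_units_def by (rule sum_group) (use RU_group S in blast)
  fix x y assume xy: "x \<in> carrier (residue_units C S)" "y \<in> carrier (residue_units C S)"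
  have "x P \<otimes>\<^bsub>residue_field C P\<^esub> y P = y P \<otimes>\<^bsub>residue_field C P\<^esub> x P" if P: "P \<in> S" for P
  proof -
    interpret U: comm_group "RU P" by (rule RU_group(1)) (use P S in blast)
    show ?thesis using U.m_comm[of "x P" "y P"] xy P by (simp add: residue_units_carrier[OF S])
  qed
  then show "x \<otimes>\<^bsub>residue_units C S\<^esub> y = y \<otimes>\<^bsub>residue_units C S\<^esub> x"
    unfolding residue_units_mult by (intro restrict_ext)
qed

lemma tame_at_tau: "tame_at C P f g = residue_class C P (tau P f g)"
  by (simp add: tame_at_def tau_def)

lemma tau_unit:
  assumes "P \<in> closed_points C" "f \<noteq> 0" "g \<noteq> 0"
  shows "tau P f g \<noteq> 0" "ord_at C P (tau P f g) = 0" "tau P f g \<in> St P"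
  using tau_nonzero ord_tau[of P f g] unit_iff[OF assms(1), of "tau P f g"] assms by auto

lemma tame_at_closed:
  "f \<noteq> 0 \<Longrightarrow> g \<noteq> 0 \<Longrightarrow> (\<lambda>P\<in>closed_points C. tame_at C P f g) \<in> carrier (residue_units C (closed_points C))"
proof -
  assume fg: "f \<noteq> 0" "g \<noteq> 0"
  have "{P \<in> closed_points C. tame_at C P f g \<noteq> \<one>\<^bsub>residue_field C P\<^esub>}
      \<subseteq> {P \<in> closed_points C. ord_at C P f \<noteq> 0} \<union> {P \<in> closed_points C. ord_at C P g \<noteq> 0}"
    using tau_trivial residue_class_simps(4) by (force simp: tame_at_tau)
  then have "finite {P \<in> closed_points C. tame_at C P f g \<noteq> \<one>\<^bsub>residue_field C P\<^esub>}"
    by (rule finite_subset[OF _ finite_UnI[OF finite_poles_zeros[OF fg(1)] finite_poles_zeros[OF fg(2)]]])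
  moreover have "tame_at C P f g \<in> carrier (RU P)" if "P \<in> closed_points C" for P
    unfolding tame_at_tau by (intro RU_class that tau_unit fg)
  ultimately show ?thesis by (simp add: residue_units_carrier cong: conj_cong)
qed

text \<open>The universal property is applied once, with the direct sum over all closed points as
  target. Divisors have finite support, so a symbol has trivial components at almost all
  points.\<close>

lemma tame_symbol_exists:
  "\<exists>T. T \<in> hom K2 (residue_units C (closed_points C)) \<inter> extensional (carrier K2) \<and>
     (\<forall>f g. f \<noteq> 0 \<longrightarrow> g \<noteq> 0 \<longrightarrow> (\<forall>P\<in>closed_points C. T (symbol f g) P = tame_at C P f g))"
proof -
  let ?\<phi> = "\<lambda>f g. \<lambda>P\<in>closed_points C. tame_at C P f g"
  have mult: "tame_at C P (f * f') g = tame_at C P f g \<otimes>\<^bsub>residue_field C P\<^esub> tame_at C P f' g"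
    "tame_at C P g (f * f') = tame_at C P g f \<otimes>\<^bsub>residue_field C P\<^esub> tame_at C P g f'"
    if P: "P \<in> closed_points C" and "f \<noteq> 0" "f' \<noteq> 0" "g \<noteq> 0" for P f f' g
    unfolding tame_at_tau using that
    by (simp_all add: tau_mult_left tau_mult_right residue_class_simps(2)[OF P] tau_unit(3)[OF P])
  have st: "tame_at C P a (1 - a) = \<one>\<^bsub>residue_field C P\<^esub>" if P: "P \<in> closed_points C" and a: "a \<noteq> 0" "a \<noteq> 1" for P a
  proof -
    interpret S: subring_set "St P" by (rule stalk_subring[OF closed_in_pts[OF P]])
    have "tau P a (1 - a) - 1 \<in> Mx P" using tau_steinberg[OF P a] val_ge_1[OF P] by simp
    then show ?thesis
      using residue_class_eq_iff[OF P tau_unit(3)[OF P] S.A_1] a residue_class_simps(4)[OF P] by (simp add: tame_at_tau)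
  qed
  have "\<exists>h\<in>hom K2 (residue_units C (closed_points C)). \<forall>f g. f \<noteq> 0 \<longrightarrow> g \<noteq> 0 \<longrightarrow> h (symbol f g) = ?\<phi> f g"
  proof (rule K2_universal[of "residue_units C (closed_points C)" ?\<phi>])
    show "comm_group (residue_units C (closed_points C))" by (rule comm_group_residue_units) simp
    show "?\<phi> f g \<in> carrier (residue_units C (closed_points C))" if "f \<noteq> 0" "g \<noteq> 0" for f g
      by (rule tame_at_closed[OF that])
    show "?\<phi> (f * f') g = ?\<phi> f g \<otimes>\<^bsub>residue_units C (closed_points C)\<^esub> ?\<phi> f' g"
      if "f \<noteq> 0" "f' \<noteq> 0" "g \<noteq> 0" for f f' g
      unfolding residue_units_mult using mult that by (intro restrict_ext) simp
    show "?\<phi> f (g * g') = ?\<phi> f g \<otimes>\<^bsub>residue_units C (closed_points C)\<^esub> ?\<phi> f g'"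
      if "f \<noteq> 0" "g \<noteq> 0" "g' \<noteq> 0" for f g g'
      unfolding residue_units_mult using mult that by (intro restrict_ext) simp
    show "?\<phi> a (1 - a) = \<one>\<^bsub>residue_units C (closed_points C)\<^esub>" if "a \<noteq> 0" "a \<noteq> 1" for a
      unfolding residue_units_one using st that by (intro restrict_ext) simp
    fix h assume "h \<in> hom K2 (residue_units C (closed_points C))"
      "\<And>f g. f \<noteq> 0 \<Longrightarrow> g \<noteq> 0 \<Longrightarrow> h (symbol f g) = ?\<phi> f g"
    then show "\<exists>h\<in>hom K2 (residue_units C (closed_points C)). \<forall>f g. f \<noteq> 0 \<longrightarrow> g \<noteq> 0 \<longrightarrow> h (symbol f g) = ?\<phi> f g"
      by blast
  qed
  then obtain h where h: "h \<in> hom K2 (residue_units C (closed_points C))"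
    "\<And>f g. f \<noteq> 0 \<Longrightarrow> g \<noteq> 0 \<Longrightarrow> h (symbol f g) = ?\<phi> f g" by blast
  interpret K2: comm_group K2 by (rule comm_group_K2)
  have "restrict h (carrier K2) \<in> hom K2 (residue_units C (closed_points C))"
    using h(1) by (auto simp: hom_def)
  then show ?thesis using h(2)
    by (intro exI[of _ "restrict h (carrier K2)"]) (simp add: symbol_closed)
qed

lemma homs_agree_on_symbols:
  assumes S: "S \<subseteq> closed_points C"
    and T: "T \<in> hom K2 (residue_units C S)" "T' \<in> hom K2 (residue_units C S)"
    and eq: "\<And>f g :: 'f. f \<noteq> 0 \<Longrightarrow> g \<noteq> 0 \<Longrightarrow> T (symbol f g) = T' (symbol f g)"
    and \<xi>: "\<xi> \<in> carrier K2"
  shows "T \<xi> = T' \<xi>"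
proof -
  interpret K2: comm_group "K2 :: ('f \<times> 'f \<Rightarrow>\<^sub>0 int) set set monoid" by (rule comm_group_K2)
  interpret H: comm_group "residue_units C S" by (rule comm_group_residue_units[OF S])
  interpret T: group_hom K2 "residue_units C S" T
    by (intro group_hom.intro group_hom_axioms.intro K2.is_group H.is_group T)
  interpret T': group_hom K2 "residue_units C S" T'
    by (intro group_hom.intro group_hom_axioms.intro K2.is_group H.is_group T)
  let ?G = "{symbol f g |f g. f \<noteq> 0 \<and> (g :: 'f) \<noteq> 0}"
  have G: "?G \<subseteq> carrier K2" using symbol_closed by blast
  have "\<xi> \<in> generate K2 ?G" using \<xi> K2_generated by blast
  then show ?thesis
  proof (induction rule: generate.induct)
    case one
    show ?case by simp
  next
    case (incl h)
    then show ?case using eq by blast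
  next
    case (inv h)
    then have "h \<in> carrier K2" "T h = T' h" using G eq by blast+
    then show ?case by simp
  next
    case (eng x y)
    have "x \<in> carrier K2" "y \<in> carrier K2" using eng K2.generate_in_carrier[OF G] by blast+
    then show ?case using eng by simp
  qed
qed

text \<open>The definite description has a unique solution: symbols generate \<open>K2\<close>, and
  extensionality fixes the values outside its carrier.\<close>

lemma tame_symbol:
  shows "tame_symbol C \<in> hom K2 (residue_units C (closed_points C))"
    and "f \<noteq> 0 \<Longrightarrow> g \<noteq> 0 \<Longrightarrow> P \<in> closed_points C \<Longrightarrow> tame_symbol C (symbol f g) P = tame_at C P f g"
proof -
  let ?A = "\<lambda>T. T \<in> hom K2 (residue_units C (closed_points C)) \<inter> extensional (carrier K2) \<and>
     (\<forall>f g. f \<noteq> 0 \<longrightarrow> g \<noteq> 0 \<longrightarrow> (\<forall>P\<in>closed_points C. T (symbol f g) P = tame_at C P f g))"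
  have uniq: "T = T'" if T: "?A T" and T': "?A T'" for T T'
  proof -
    have h: "T \<in> hom K2 (residue_units C (closed_points C))" "T' \<in> hom K2 (residue_units C (closed_points C))"
      "T \<in> extensional (carrier K2)" "T' \<in> extensional (carrier K2)" using T T' by auto
    have "T (symbol f g) = T' (symbol f g)" if fg: "f \<noteq> 0" "g \<noteq> 0" for f g
    proof (rule residue_units_eqI[OF order_refl])
      show "T (symbol f g) \<in> carrier (residue_units C (closed_points C))"
        "T' (symbol f g) \<in> carrier (residue_units C (closed_points C))"
        by (rule hom_in_carrier[OF h(1) symbol_closed[OF fg]] hom_in_carrier[OF h(2) symbol_closed[OF fg]])+
      show "T (symbol f g) P = T' (symbol f g) P" if "P \<in> closed_points C" for P
        using T T' fg that by simp
    qed
    then have "T \<xi> = T' \<xi>" if "\<xi> \<in> carrier K2" for \<xi>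
      by (rule homs_agree_on_symbols[OF order_refl h(1,2) _ that])
    then show ?thesis by (rule extensionalityI[OF h(3,4)])
  qed
  obtain T0 where T0: "?A T0" using tame_symbol_exists by blast
  have "?A (tame_symbol C)"
    unfolding tame_symbol_def by (rule theI[where P = ?A, OF T0]) (rule uniq[OF _ T0])
  then show "tame_symbol C \<in> hom K2 (residue_units C (closed_points C))"
    "f \<noteq> 0 \<Longrightarrow> g \<noteq> 0 \<Longrightarrow> P \<in> closed_points C \<Longrightarrow> tame_symbol C (symbol f g) P = tame_at C P f g"
    by blast+
qed

lemma tame_symbol_carrier:
  assumes "\<xi> \<in> carrier K2"
  shows "tame_symbol C \<xi> \<in> extensional (closed_points C)"
    and "P \<in> closed_points C \<Longrightarrow> tame_symbol C \<xi> P \<in> carrier (RU P)"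
    and "finite {P \<in> closed_points C. tame_symbol C \<xi> P \<noteq> \<one>\<^bsub>residue_field C P\<^esub>}"
  using hom_in_carrier[OF tame_symbol(1) assms] by (simp_all add: residue_units_carrier)

lemma tame_part_hom:
  assumes S: "S \<subseteq> closed_points C" shows "tame_part C S \<in> hom K2 (residue_units C S)"
proof (rule homI)
  fix \<xi> :: "('f \<times> 'f \<Rightarrow>\<^sub>0 int) set set" assume \<xi>: "\<xi> \<in> carrier K2"
  have "finite {P \<in> S. tame_symbol C \<xi> P \<noteq> \<one>\<^bsub>residue_field C P\<^esub>}"
    by (rule finite_subset[OF _ tame_symbol_carrier(3)[OF \<xi>]]) (use S in blast)
  moreover have "\<forall>P\<in>S. tame_symbol C \<xi> P \<in> carrier (RU P)" using tame_symbol_carrier(2)[OF \<xi>] S by blast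
  ultimately show "tame_part C S \<xi> \<in> carrier (residue_units C S)"
    by (simp add: residue_units_carrier[OF S] tame_part_def cong: conj_cong)
next
  fix \<xi> \<eta> :: "('f \<times> 'f \<Rightarrow>\<^sub>0 int) set set" assume "\<xi> \<in> carrier K2" "\<eta> \<in> carrier K2"
  then have eq: "tame_symbol C (\<xi> \<otimes>\<^bsub>K2\<^esub> \<eta>) = tame_symbol C \<xi> \<otimes>\<^bsub>residue_units C (closed_points C)\<^esub> tame_symbol C \<eta>"
    using hom_mult[OF tame_symbol(1)] by blast
  show "tame_part C S (\<xi> \<otimes>\<^bsub>K2\<^esub> \<eta>) = tame_part C S \<xi> \<otimes>\<^bsub>residue_units C S\<^esub> tame_part C S \<eta>"
    unfolding tame_part_def residue_units_mult
    by (rule restrict_ext) (use S in \<open>auto simp: eq residue_units_mult\<close>)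
qed

lemma tame_symbol_at_hom:
  assumes P: "P \<in> closed_points C" shows "(\<lambda>\<xi>. tame_symbol C \<xi> P) \<in> hom K2 (RU P)"
  using tame_symbol_carrier(2)[OF _ P] hom_mult[OF tame_symbol(1)] P
  by (intro homI) (simp_all add: residue_units_mult)

lemma extend_by_one_hom:
  assumes S: "S \<subseteq> closed_points C"
  shows "extend_by_one C S \<in> hom (residue_units C S) (residue_units C (closed_points C))"
proof (rule homI)
  fix y assume y: "y \<in> carrier (residue_units C S)"
  then have "finite {P \<in> S. y P \<noteq> \<one>\<^bsub>residue_field C P\<^esub>}" "\<forall>P\<in>S. y P \<in> carrier (RU P)"
    by (simp_all add: residue_units_carrier[OF S])
  moreover have "{P \<in> closed_points C. (if P \<in> S then y P else \<one>\<^bsub>residue_field C P\<^esub>) \<noteq> \<one>\<^bsub>residue_field C P\<^esub>}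
      = {P \<in> S. y P \<noteq> \<one>\<^bsub>residue_field C P\<^esub>}" using S by auto
  moreover have "\<one>\<^bsub>residue_field C P\<^esub> \<in> carrier (RU P)" if "P \<in> closed_points C" for P
    using monoid.one_closed[OF group.is_monoid[OF RU_group(2)[OF that]]] by simp
  ultimately show "extend_by_one C S y \<in> carrier (residue_units C (closed_points C))"
    by (simp add: residue_units_carrier extend_by_one_def cong: conj_cong)
next
  fix x y
  have "\<one>\<^bsub>residue_field C P\<^esub> = \<one>\<^bsub>residue_field C P\<^esub> \<otimes>\<^bsub>residue_field C P\<^esub> \<one>\<^bsub>residue_field C P\<^esub>"
    if "P \<in> closed_points C" for P
  proof -
    interpret U: group "RU P" by (rule RU_group(2)[OF that])
    show ?thesis using U.l_one[OF U.one_closed] by simp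
  qed
  then show "extend_by_one C S (x \<otimes>\<^bsub>residue_units C S\<^esub> y)
      = extend_by_one C S x \<otimes>\<^bsub>residue_units C (closed_points C)\<^esub> extend_by_one C S y"
    unfolding residue_units_mult extend_by_one_def by (intro restrict_ext) simp
qed

end

section \<open>The main theorem\<close>

lemma restrict_eq_iff: "restrict f S = restrict g S \<longleftrightarrow> (\<forall>x\<in>S. f x = g x)"
  by (auto simp: restrict_def fun_eq_iff)

text \<open>The first isomorphism theorem with its value on cosets made explicit, so that the
  isomorphisms are recognisable as induced by the given maps.\<close>

lemma quotient_iso:
  assumes h: "group_hom G H h" and surj: "h ` carrier G = carrier H" and ker: "kernel G H h = N"
  shows "\<exists>\<phi>\<in>iso (G Mod N) H. \<forall>x\<in>carrier G. \<phi> (N #>\<^bsub>G\<^esub> x) = h x"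
proof -
  interpret h: group_hom G H h by fact
  have "the_elem (h ` (N #>\<^bsub>G\<^esub> x)) = h x" if x: "x \<in> carrier G" for x
  proof -
    have "h ` (N #>\<^bsub>G\<^esub> x) \<subseteq> {h x}"
      using x unfolding ker[symmetric] by (auto simp: r_coset_def kernel_def)
    moreover have "h x \<in> h ` (N #>\<^bsub>G\<^esub> x)"
    proof -
      have "\<one>\<^bsub>G\<^esub> \<in> N" unfolding ker[symmetric] by (simp add: kernel_def)
      then have "\<one>\<^bsub>G\<^esub> \<otimes>\<^bsub>G\<^esub> x \<in> N #>\<^bsub>G\<^esub> x" unfolding r_coset_def by blast
      then show ?thesis using x by simp
    qed
    ultimately have "h ` (N #>\<^bsub>G\<^esub> x) = {h x}" by blast
    then show ?thesis by simp
  qed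
  then show ?thesis
    using h.FactGroup_iso_set[OF surj] unfolding ker by (intro bexI[of _ "\<lambda>Y. the_elem (h ` Y)"]) auto
qed

section \<open>The two isomorphisms and the comparison of kernels and cokernels\<close>

context curve
begin

lemma restrict_residue_units:
  assumes S: "S \<subseteq> closed_points C" and w: "w \<in> carrier (residue_units C (closed_points C))"
  shows "restrict w S \<in> carrier (residue_units C S)"
proof -
  have w': "finite {P \<in> closed_points C. w P \<noteq> \<one>\<^bsub>residue_field C P\<^esub>}" "\<forall>P\<in>closed_points C. w P \<in> carrier (RU P)"
    using w by (simp_all add: residue_units_carrier)
  have "finite {P \<in> S. w P \<noteq> \<one>\<^bsub>residue_field C P\<^esub>}"
    by (rule finite_subset[OF _ w'(1)]) (use S in blast)
  moreover have "\<forall>P\<in>S. w P \<in> carrier (RU P)" using w'(2) S by blast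
  ultimately show ?thesis by (simp add: residue_units_carrier[OF S] cong: conj_cong)
qed

abbreviation "Fl \<equiv> K2_filtration K C"
abbreviation "allpts \<equiv> closed_points C"

context
  fixes d :: int
  assumes d: "d \<ge> 3 * arithmetic_genus K C + 1"
begin

text \<open>These transfer the abstract results to the curve. All are proved together because the
  spanning family for the genus is known only to exist, so \<open>tame_places\<close> can be
  interpreted only inside a proof.\<close>

lemma
  shows fil_subgroup: "subgroup (Fl m) K2"
    and fil_mono: "m \<le> m' \<Longrightarrow> Fl m \<subseteq> Fl m'"
    and fil_tame: "\<xi> \<in> Fl m \<Longrightarrow> P \<in> allpts \<Longrightarrow> m < int (point_degree K C P) \<Longrightarrow>
      tame_symbol C \<xi> P = \<one>\<^bsub>residue_field C P\<^esub>"
    and fil_graded_kernel: "\<xi> \<in> Fl d \<Longrightarrow>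
      (\<And>P. P \<in> points_eq K C d - {Q} \<Longrightarrow> tame_symbol C \<xi> P = \<one>\<^bsub>residue_field C P\<^esub>) \<Longrightarrow> \<xi> \<in> Fl (d - 1)"
    and fil_graded_surjective: "finite I \<Longrightarrow> I \<subseteq> points_eq K C d - {Q} \<Longrightarrow> (\<And>P. P \<in> I \<Longrightarrow> y P \<in> carrier (RU P)) \<Longrightarrow>
      \<exists>\<xi>\<in>Fl d. \<forall>P\<in>points_eq K C d - {Q}. tame_symbol C \<xi> P = (if P \<in> I then y P else \<one>\<^bsub>residue_field C P\<^esub>)"
    and fil_total_kernel: "\<xi> \<in> carrier K2 \<Longrightarrow>
      (\<And>P. P \<in> points_ge K C d - {Q} \<Longrightarrow> tame_symbol C \<xi> P = \<one>\<^bsub>residue_field C P\<^esub>) \<Longrightarrow> \<xi> \<in> Fl (d - 1)"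
    and fil_total_surjective: "y \<in> carrier (residue_units C allpts) \<Longrightarrow>
      \<exists>\<xi>\<in>carrier K2. \<forall>P\<in>points_ge K C d - {Q}. tame_symbol C \<xi> P = y P"
proof -
  obtain t hb where t: "arithmetic_genus K C = int t" and hb: "spanned W1 {..<t} hb adeles"
    using genus_basis by blast
  interpret M: tame_places K allpts "ord_at C" "point_degree K C" Q t hb K2 symbol RU "residue_class C" "tame_symbol C"
  proof (intro tame_places.intro genus_places.intro genus_places_axioms.intro tame_places_axioms.intro places_axioms)
    show "residue_class C P f = residue_class C P g \<longleftrightarrow> f - g \<in> val_ge (ord_at C) P 1"
      if "P \<in> allpts" "f \<in> val_ge (ord_at C) P 0" "g \<in> val_ge (ord_at C) P 0" for P f g
      using residue_class_eq_iff[OF that(1)] that val_ge_0[OF that(1)] val_ge_1[OF that(1)] by simp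
    show "\<exists>f. f \<noteq> 0 \<and> ord_at C P f = 0 \<and> residue_class C P f = u" if "P \<in> allpts" "u \<in> carrier (RU P)" for P u
    proof -
      have "u \<in> {residue_class C P f |f. f \<noteq> 0 \<and> ord_at C P f = 0}" using that(2) by (simp only: RU_carrier[OF that(1)])
      then show ?thesis by blast
    qed
    show "residue_class C P 1 = \<one>\<^bsub>RU P\<^esub>" if "P \<in> allpts" for P
      using residue_class_simps(4)[OF that] by simp
    show "tame_symbol C (symbol f g) P = residue_class C P (tau P f g)" if "P \<in> allpts" "f \<noteq> 0" "g \<noteq> 0" for P f g
      using tame_symbol(2)[OF that(2,3,1)] tame_at_tau by simp
    show "carrier K2 = generate K2 {symbol f g |f g. f \<noteq> 0 \<and> (g :: 'f) \<noteq> 0}" by (rule K2_generated)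
  qed (simp_all add: point_degree_Q hb comm_group_K2 symbol_closed symbol_mult_left symbol_mult_right
      symbol_steinberg RU_group(1) RU_class tame_symbol_at_hom)
  \<comment> \<open>Divisor supports contained in \<open>points_le\<close> are the degree condition
    in \<open>Gd\<close>, so both filtrations have the same generators.\<close>
  have Fil: "M.Fil m = Fl m" for m
  proof -
    have "M.Gd m = {f. f \<noteq> 0 \<and> divisor_support C f \<subseteq> points_le K C m}"
      by (auto simp: M.Gd_def divisor_support_def points_le_def)
    then show ?thesis unfolding M.Fil_def K2_filtration_def
      by (intro arg_cong[of _ _ "generate K2"]) auto
  qed
  have d': "3 * int t + 1 \<le> d" using d t by simp
  interpret D: tame_degree K allpts "ord_at C" "point_degree K C" Q t hb K2 symbol RU "residue_class C" "tame_symbol C" d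
    by (rule M.tame_degree[OF d'])
  have S: "D.S = points_eq K C d - {Q}" by (auto simp: D.S_def points_eq_def)
  have ge: "P \<in> points_ge K C d - {Q} \<longleftrightarrow> P \<in> allpts \<and> d \<le> int (point_degree K C P) \<and> P \<noteq> Q" for P
    by (auto simp: points_ge_def)
  show "subgroup (Fl m) K2" using M.Fil_subgroup Fil by metis
  show "m \<le> m' \<Longrightarrow> Fl m \<subseteq> Fl m'" using M.Fil_mono Fil by metis
  show "\<xi> \<in> Fl m \<Longrightarrow> P \<in> allpts \<Longrightarrow> m < int (point_degree K C P) \<Longrightarrow>
      tame_symbol C \<xi> P = \<one>\<^bsub>residue_field C P\<^esub>"
    using M.Fil_T[of P m \<xi>] Fil by simp
  show "\<xi> \<in> Fl d \<Longrightarrow> (\<And>P. P \<in> points_eq K C d - {Q} \<Longrightarrow> tame_symbol C \<xi> P = \<one>\<^bsub>residue_field C P\<^esub>) \<Longrightarrow>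
      \<xi> \<in> Fl (d - 1)"
    using D.graded_kernel[of \<xi>] unfolding S Fil RU_simps by blast
  show "finite I \<Longrightarrow> I \<subseteq> points_eq K C d - {Q} \<Longrightarrow> (\<And>P. P \<in> I \<Longrightarrow> y P \<in> carrier (RU P)) \<Longrightarrow>
      \<exists>\<xi>\<in>Fl d. \<forall>P\<in>points_eq K C d - {Q}. tame_symbol C \<xi> P = (if P \<in> I then y P else \<one>\<^bsub>residue_field C P\<^esub>)"
    using D.graded_surjective[of I y] unfolding S Fil RU_simps by blast
  show "\<xi> \<in> carrier K2 \<Longrightarrow>
      (\<And>P. P \<in> points_ge K C d - {Q} \<Longrightarrow> tame_symbol C \<xi> P = \<one>\<^bsub>residue_field C P\<^esub>) \<Longrightarrow> \<xi> \<in> Fl (d - 1)"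
    using M.total_kernel[OF d', of \<xi>] unfolding ge Fil RU_simps by blast
  show "\<exists>\<xi>\<in>carrier K2. \<forall>P\<in>points_ge K C d - {Q}. tame_symbol C \<xi> P = y P"
    if y: "y \<in> carrier (residue_units C allpts)"
  proof -
    have "\<exists>\<xi>\<in>carrier K2. \<forall>P\<in>allpts. d \<le> int (point_degree K C P) \<and> P \<noteq> Q \<longrightarrow> tame_symbol C \<xi> P = y P"
      by (rule M.total_surjective[OF d'])
        (use y tame_symbol_carrier(3) in \<open>simp_all add: residue_units_carrier\<close>)
    then obtain \<xi> where \<xi>: "\<xi> \<in> carrier K2"
      "\<forall>P\<in>allpts. d \<le> int (point_degree K C P) \<and> P \<noteq> Q \<longrightarrow> tame_symbol C \<xi> P = y P" by (elim bexE)
    have "\<forall>P\<in>points_ge K C d - {Q}. tame_symbol C \<xi> P = y P"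
      using \<xi>(2) by (simp add: points_ge_def)
    then show ?thesis using \<xi>(1) by (rule bexI)
  qed
qed

lemma fil_carrier: "\<xi> \<in> Fl m \<Longrightarrow> \<xi> \<in> carrier K2"
  using subgroup.subset[OF fil_subgroup] by blast

lemma fil_group: "group (K2\<lparr>carrier := Fl m\<rparr>)"
  by (rule subgroup.subgroup_is_group[OF fil_subgroup comm_group.axioms(2)[OF comm_group_K2]])

lemma tame_part_fil_hom:
  assumes "S \<subseteq> allpts" shows "tame_part C S \<in> hom (K2\<lparr>carrier := Fl m\<rparr>) (residue_units C S)"
  using tame_part_hom[OF assms] fil_carrier by (auto simp: hom_def)

lemma tame_part_one_iff:
  "tame_part C S \<xi> = \<one>\<^bsub>residue_units C S\<^esub> \<longleftrightarrow> (\<forall>P\<in>S. tame_symbol C \<xi> P = \<one>\<^bsub>residue_field C P\<^esub>)"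
  unfolding tame_part_def residue_units_one by (rule restrict_eq_iff)

lemma graded_iso:
  "\<exists>\<phi>\<in>iso (K2\<lparr>carrier := Fl d\<rparr> Mod Fl (d - 1)) (residue_units C (points_eq K C d - {Q})).
     \<forall>\<xi>\<in>Fl d. \<phi> (Fl (d - 1) #>\<^bsub>K2\<^esub> \<xi>) = tame_part C (points_eq K C d - {Q}) \<xi>"
proof -
  let ?S = "points_eq K C d - {Q}"
  have S: "?S \<subseteq> allpts" by (auto simp: points_eq_def)
  let ?h = "tame_part C ?S"
  have h: "group_hom (K2\<lparr>carrier := Fl d\<rparr>) (residue_units C ?S) ?h"
    by (intro group_hom.intro group_hom_axioms.intro fil_group tame_part_fil_hom[OF S]
        comm_group.axioms(2)[OF comm_group_residue_units[OF S]])
  have ker: "kernel (K2\<lparr>carrier := Fl d\<rparr>) (residue_units C ?S) ?h = Fl (d - 1)"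
    unfolding kernel_def tame_part_one_iff
  proof (rule Set.set_eqI, rule iffI)
    fix \<xi> assume "\<xi> \<in> {\<xi> \<in> carrier (K2\<lparr>carrier := Fl d\<rparr>). \<forall>P\<in>?S. tame_symbol C \<xi> P = \<one>\<^bsub>residue_field C P\<^esub>}"
    then show "\<xi> \<in> Fl (d - 1)" using fil_graded_kernel[of \<xi>] by simp
  next
    fix \<xi> assume \<xi>: "\<xi> \<in> Fl (d - 1)"
    then have "\<xi> \<in> Fl d" using fil_mono[of "d - 1" d] by auto
    moreover have "\<forall>P\<in>?S. tame_symbol C \<xi> P = \<one>\<^bsub>residue_field C P\<^esub>"
      using fil_tame[OF \<xi>] by (auto simp: points_eq_def)
    ultimately show "\<xi> \<in> {\<xi> \<in> carrier (K2\<lparr>carrier := Fl d\<rparr>). \<forall>P\<in>?S. tame_symbol C \<xi> P = \<one>\<^bsub>residue_field C P\<^esub>}"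
      by simp
  qed
  have surj: "?h ` carrier (K2\<lparr>carrier := Fl d\<rparr>) = carrier (residue_units C ?S)"
  proof (rule equalityI)
    show "?h ` carrier (K2\<lparr>carrier := Fl d\<rparr>) \<subseteq> carrier (residue_units C ?S)"
      using hom_in_carrier[OF tame_part_fil_hom[OF S]] by blast
    show "carrier (residue_units C ?S) \<subseteq> ?h ` carrier (K2\<lparr>carrier := Fl d\<rparr>)"
    proof
      fix y assume y: "y \<in> carrier (residue_units C ?S)"
      define I where "I = {P \<in> ?S. y P \<noteq> \<one>\<^bsub>residue_field C P\<^esub>}"
      have "finite I" "\<And>P. P \<in> I \<Longrightarrow> y P \<in> carrier (RU P)"
        using y unfolding residue_units_carrier[OF S] I_def by blast+
      then obtain \<xi> where \<xi>: "\<xi> \<in> Fl d"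
        "\<forall>P\<in>?S. tame_symbol C \<xi> P = (if P \<in> I then y P else \<one>\<^bsub>residue_field C P\<^esub>)"
        using fil_graded_surjective[of I y] by (auto simp: I_def)
      have "?h \<xi> = y"
      proof (rule residue_units_eqI[OF S _ y])
        show "?h \<xi> \<in> carrier (residue_units C ?S)" by (rule hom_in_carrier[OF tame_part_hom[OF S] fil_carrier[OF \<xi>(1)]])
        show "?h \<xi> P = y P" if "P \<in> ?S" for P using \<xi>(2) that by (auto simp: tame_part_def I_def)
      qed
      then show "y \<in> ?h ` carrier (K2\<lparr>carrier := Fl d\<rparr>)" using \<xi>(1) by force
    qed
  qed
  show ?thesis using quotient_iso[OF h surj ker] by (simp add: r_coset_def)
qed

lemma total_iso:
  "\<exists>\<phi>\<in>iso (K2 Mod Fl (d - 1)) (residue_units C (points_ge K C d - {Q})).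
     \<forall>\<xi>\<in>carrier K2. \<phi> (Fl (d - 1) #>\<^bsub>K2\<^esub> \<xi>) = tame_part C (points_ge K C d - {Q}) \<xi>"
proof -
  let ?S = "points_ge K C d - {Q}"
  have S: "?S \<subseteq> allpts" by (auto simp: points_ge_def)
  let ?h = "tame_part C ?S"
  have h: "group_hom K2 (residue_units C ?S) ?h"
    by (intro group_hom.intro group_hom_axioms.intro comm_group.axioms(2)[OF comm_group_K2] tame_part_hom[OF S]
        comm_group.axioms(2)[OF comm_group_residue_units[OF S]])
  have ker: "kernel K2 (residue_units C ?S) ?h = Fl (d - 1)"
    unfolding kernel_def tame_part_one_iff
  proof (rule Set.set_eqI, rule iffI)
    fix \<xi> assume "\<xi> \<in> {\<xi> \<in> carrier K2. \<forall>P\<in>?S. tame_symbol C \<xi> P = \<one>\<^bsub>residue_field C P\<^esub>}"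
    then show "\<xi> \<in> Fl (d - 1)" using fil_total_kernel[of \<xi>] by simp
  next
    fix \<xi> assume \<xi>: "\<xi> \<in> Fl (d - 1)"
    moreover have "\<forall>P\<in>?S. tame_symbol C \<xi> P = \<one>\<^bsub>residue_field C P\<^esub>"
      using fil_tame[OF \<xi>] by (auto simp: points_ge_def)
    ultimately show "\<xi> \<in> {\<xi> \<in> carrier K2. \<forall>P\<in>?S. tame_symbol C \<xi> P = \<one>\<^bsub>residue_field C P\<^esub>}"
      using fil_carrier by simp
  qed
  have surj: "?h ` carrier K2 = carrier (residue_units C ?S)"
  proof (rule equalityI)
    show "?h ` carrier K2 \<subseteq> carrier (residue_units C ?S)"
      using hom_in_carrier[OF tame_part_hom[OF S]] by blast
    show "carrier (residue_units C ?S) \<subseteq> ?h ` carrier K2"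
    proof
      fix y assume y: "y \<in> carrier (residue_units C ?S)"
      obtain \<xi> where \<xi>: "\<xi> \<in> carrier K2" "\<forall>P\<in>?S. tame_symbol C \<xi> P = extend_by_one C ?S y P"
        using fil_total_surjective[OF hom_in_carrier[OF extend_by_one_hom[OF S] y]] by blast
      have "?h \<xi> = y"
      proof (rule residue_units_eqI[OF S _ y])
        show "?h \<xi> \<in> carrier (residue_units C ?S)" by (rule hom_in_carrier[OF tame_part_hom[OF S] \<xi>(1)])
        show "?h \<xi> P = y P" if "P \<in> ?S" for P
          using \<xi>(2) that S by (auto simp: tame_part_def extend_by_one_def)
      qed
      then show "y \<in> ?h ` carrier K2" using \<xi>(1) by blast
    qed
  qed
  show ?thesis by (rule quotient_iso[OF h surj ker])
qed

abbreviation "low \<equiv> {Q} \<union> points_le K C (d - 1)"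

lemma low_subset: "low \<subseteq> allpts" using Q_closed by (auto simp: points_le_def)

lemma low_complement: "P \<in> allpts \<Longrightarrow> P \<notin> low \<longleftrightarrow> P \<in> points_ge K C d - {Q}"
  by (auto simp: points_le_def points_ge_def)

lemma extend_tame_part:
  assumes \<xi>: "\<xi> \<in> carrier K2" and triv: "\<And>P. P \<in> points_ge K C d - {Q} \<Longrightarrow> tame_symbol C \<xi> P = \<one>\<^bsub>residue_field C P\<^esub>"
  shows "extend_by_one C low (tame_part C low \<xi>) = tame_symbol C \<xi>"
proof (rule extensionalityI[OF _ tame_symbol_carrier(1)[OF \<xi>]])
  show "extend_by_one C low (tame_part C low \<xi>) \<in> extensional allpts" by (simp add: extend_by_one_def)
  show "extend_by_one C low (tame_part C low \<xi>) P = tame_symbol C \<xi> P" if "P \<in> allpts" for P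
    using triv low_complement[OF that] that by (cases "P \<in> low") (simp_all add: extend_by_one_def tame_part_def)
qed

lemma fil_low: "\<xi> \<in> Fl (d - 1) \<Longrightarrow> P \<in> points_ge K C d - {Q} \<Longrightarrow> tame_symbol C \<xi> P = \<one>\<^bsub>residue_field C P\<^esub>"
  using fil_tame[of \<xi> "d - 1" P] by (auto simp: points_ge_def)

text \<open>An element with trivial tame symbol is in particular trivial in degrees at least
  \<open>d\<close> away from \<open>Q\<close>, and so already lies in
  \<open>Fl (d - 1)\<close>.\<close>

lemma kernels_agree:
  "kernel (K2\<lparr>carrier := Fl (d - 1)\<rparr>) (residue_units C low) (tame_part C low)
    = kernel K2 (residue_units C allpts) (tame_symbol C)"
proof -
  have one: "tame_symbol C \<xi> = \<one>\<^bsub>residue_units C allpts\<^esub> \<longleftrightarrow> (\<forall>P\<in>allpts. tame_symbol C \<xi> P = \<one>\<^bsub>residue_field C P\<^esub>)"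
    if "\<xi> \<in> carrier K2" for \<xi>
    using extensional_restrict[OF tame_symbol_carrier(1)[OF that]] tame_part_one_iff[of allpts \<xi>]
    by (simp add: tame_part_def)
  show ?thesis
    unfolding kernel_def tame_part_one_iff
  proof (rule Set.set_eqI, rule iffI)
    fix \<xi> assume "\<xi> \<in> {\<xi> \<in> carrier (K2\<lparr>carrier := Fl (d - 1)\<rparr>). \<forall>P\<in>low. tame_symbol C \<xi> P = \<one>\<^bsub>residue_field C P\<^esub>}"
    then have \<xi>: "\<xi> \<in> Fl (d - 1)" "\<forall>P\<in>low. tame_symbol C \<xi> P = \<one>\<^bsub>residue_field C P\<^esub>" by simp_all
    then have "\<forall>P\<in>allpts. tame_symbol C \<xi> P = \<one>\<^bsub>residue_field C P\<^esub>" using fil_low[OF \<xi>(1)] low_complement by blast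
    then show "\<xi> \<in> {\<xi> \<in> carrier K2. tame_symbol C \<xi> = \<one>\<^bsub>residue_units C allpts\<^esub>}"
      using one fil_carrier[OF \<xi>(1)] by simp
  next
    fix \<xi> assume "\<xi> \<in> {\<xi> \<in> carrier K2. tame_symbol C \<xi> = \<one>\<^bsub>residue_units C allpts\<^esub>}"
    then have "\<xi> \<in> carrier K2" "tame_symbol C \<xi> = \<one>\<^bsub>residue_units C allpts\<^esub>" by blast+
    then have \<xi>: "\<xi> \<in> carrier K2" "\<forall>P\<in>allpts. tame_symbol C \<xi> P = \<one>\<^bsub>residue_field C P\<^esub>"
      using one by blast+
    have "\<xi> \<in> Fl (d - 1)" by (rule fil_total_kernel[OF \<xi>(1)]) (use \<xi>(2) in \<open>auto simp: points_ge_def\<close>)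
    then show "\<xi> \<in> {\<xi> \<in> carrier (K2\<lparr>carrier := Fl (d - 1)\<rparr>). \<forall>P\<in>low. tame_symbol C \<xi> P = \<one>\<^bsub>residue_field C P\<^esub>}"
      using \<xi>(2) subsetD[OF low_subset] by simp
  qed
qed

text \<open>Injectivity: if an extension by one is a tame symbol, that symbol is trivial in high
  degree and comes from \<open>Fl (d - 1)\<close>. Surjectivity: every class has a representative
  supported on \<open>low\<close>, because its values in high degree can be divided out by a tame
  symbol.\<close>

lemma cokernels_agree:
  "\<exists>\<psi>\<in>iso (residue_units C low Mod tame_part C low ` Fl (d - 1))
      (residue_units C allpts Mod tame_symbol C ` carrier K2).
    \<forall>y\<in>carrier (residue_units C low).
      \<psi> ((tame_part C low ` Fl (d - 1)) #>\<^bsub>residue_units C low\<^esub> y) =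
        (tame_symbol C ` carrier K2) #>\<^bsub>residue_units C allpts\<^esub> extend_by_one C low y"
proof -
  let ?H = "residue_units C allpts"
  let ?HS = "residue_units C low"
  let ?B = "tame_symbol C ` carrier K2"
  let ?e = "extend_by_one C low"
  let ?h = "\<lambda>y. ?B #>\<^bsub>?H\<^esub> ?e y"
  interpret K2: comm_group "K2 :: ('f \<times> 'f \<Rightarrow>\<^sub>0 int) set set monoid" by (rule comm_group_K2)
  interpret H: comm_group ?H by (rule comm_group_residue_units) simp
  interpret HS: comm_group ?HS by (rule comm_group_residue_units[OF low_subset])
  interpret T: group_hom K2 ?H "tame_symbol C"
    by (intro group_hom.intro group_hom_axioms.intro K2.is_group H.is_group tame_symbol(1))
  have B: "subgroup ?B ?H" by (rule T.img_is_subgroup)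
  have nB: "?B \<lhd> ?H" by (rule H.subgroup_imp_normal[OF B])
  have "?h \<in> hom ?HS (?H Mod ?B)"
    using hom_compose[OF extend_by_one_hom[OF low_subset] normal.r_coset_hom_Mod[OF nB]] unfolding comp_def .
  then have h: "group_hom ?HS (?H Mod ?B) ?h"
    by (intro group_hom.intro group_hom_axioms.intro HS.is_group normal.factorgroup_is_group[OF nB])
  have eH: "?e y \<in> carrier ?H" if "y \<in> carrier ?HS" for y
    using hom_in_carrier[OF extend_by_one_hom[OF low_subset] that] .
  have eB: "?B #>\<^bsub>?H\<^esub> z = ?B \<longleftrightarrow> z \<in> ?B" if "z \<in> carrier ?H" for z
    using H.coset_join1[OF _ that B] H.coset_join2[OF that B] by blast
  have Tpart: "tame_part C low \<xi> \<in> carrier ?HS" if "\<xi> \<in> carrier K2" for \<xi>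
    using hom_in_carrier[OF tame_part_hom[OF low_subset] that] .
  have ker: "kernel ?HS (?H Mod ?B) ?h = tame_part C low ` Fl (d - 1)"
  proof (rule Set.set_eqI, rule iffI)
    fix y assume "y \<in> kernel ?HS (?H Mod ?B) ?h"
    then have y: "y \<in> carrier ?HS" "?h y = ?B" by (simp_all add: kernel_def)
    then obtain \<xi> where \<xi>: "\<xi> \<in> carrier K2" "?e y = tame_symbol C \<xi>" using eB[OF eH[OF y(1)]] by blast
    have "\<xi> \<in> Fl (d - 1)"
    proof (rule fil_total_kernel[OF \<xi>(1)])
      fix P assume P: "P \<in> points_ge K C d - {Q}"
      then have "P \<in> allpts" "P \<notin> low" using low_complement by (auto simp: points_ge_def)
      then show "tame_symbol C \<xi> P = \<one>\<^bsub>residue_field C P\<^esub>" unfolding \<xi>(2)[symmetric] by (simp add: extend_by_one_def)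
    qed
    moreover have "y = tame_part C low \<xi>"
    proof (rule residue_units_eqI[OF low_subset y(1) Tpart[OF \<xi>(1)]])
      fix P assume P: "P \<in> low"
      then have "P \<in> allpts" using low_subset by blast
      then show "y P = tame_part C low \<xi> P"
        unfolding tame_part_def \<xi>(2)[symmetric] using P by (simp add: extend_by_one_def)
    qed
    ultimately show "y \<in> tame_part C low ` Fl (d - 1)" by blast
  next
    fix y assume "y \<in> tame_part C low ` Fl (d - 1)"
    then obtain \<xi> where \<xi>: "\<xi> \<in> Fl (d - 1)" "y = tame_part C low \<xi>" by blast
    have \<xi>c: "\<xi> \<in> carrier K2" by (rule fil_carrier[OF \<xi>(1)])
    have yc: "y \<in> carrier ?HS" unfolding \<xi>(2) by (rule Tpart[OF \<xi>c])
    have "?e y = tame_symbol C \<xi>" unfolding \<xi>(2) by (rule extend_tame_part[OF \<xi>c fil_low[OF \<xi>(1)]])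
    then have "?e y \<in> ?B" using \<xi>c by blast
    then have "?h y = ?B" using eB[OF eH[OF yc]] by blast
    then show "y \<in> kernel ?HS (?H Mod ?B) ?h" using yc by (simp add: kernel_def)
  qed
  have surj: "?h ` carrier ?HS = carrier (?H Mod ?B)"
  proof (rule equalityI)
    show "?h ` carrier ?HS \<subseteq> carrier (?H Mod ?B)" unfolding carrier_FactGroup using eH by blast
    show "carrier (?H Mod ?B) \<subseteq> ?h ` carrier ?HS"
    proof
      fix Z assume "Z \<in> carrier (?H Mod ?B)"
      then obtain z where z: "z \<in> carrier ?H" "Z = ?B #>\<^bsub>?H\<^esub> z" unfolding carrier_FactGroup by blast
      obtain \<xi> where \<xi>: "\<xi> \<in> carrier K2" "\<forall>P\<in>points_ge K C d - {Q}. tame_symbol C \<xi> P = z P"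
        using fil_total_surjective[OF z(1)] by blast
      define b where "b = inv\<^bsub>?H\<^esub> tame_symbol C \<xi>"
      have b: "b \<in> ?B" unfolding b_def by (rule subgroup.m_inv_closed[OF B]) (use \<xi>(1) in blast)
      have bc: "b \<in> carrier ?H" using subgroup.subset[OF B] b by blast
      \<comment> \<open>The representative of the same class whose components outside
        \<open>low\<close> are trivial.\<close>
      define w where "w = z \<otimes>\<^bsub>?H\<^esub> b"
      have wc: "w \<in> carrier ?H" unfolding w_def by (rule H.m_closed[OF z(1) bc])
      have wT: "w \<otimes>\<^bsub>?H\<^esub> tame_symbol C \<xi> = z"
        unfolding w_def b_def using z(1) \<xi>(1) by (simp add: H.m_assoc)
      have w1: "w P = \<one>\<^bsub>residue_field C P\<^esub>" if P: "P \<in> allpts" "P \<notin> low" for P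
      proof -
        interpret U: group "RU P" by (rule RU_group(2)[OF P(1)])
        have "w P \<otimes>\<^bsub>residue_field C P\<^esub> z P = z P"
          using fun_cong[OF wT, of P] P \<xi>(2) low_complement[OF P(1)] by (simp add: residue_units_mult)
        moreover have "w P \<in> carrier (RU P)" "z P \<in> carrier (RU P)"
          using wc z(1) P(1) by (simp_all add: residue_units_carrier)
        ultimately show ?thesis using U.r_cancel_one[of "z P" "w P"] by simp
      qed
      have yc: "restrict w low \<in> carrier ?HS" by (rule restrict_residue_units[OF low_subset wc])
      have "?e (restrict w low) = w"
      proof (rule residue_units_eqI[OF order_refl eH[OF yc] wc])
        show "?e (restrict w low) P = w P" if "P \<in> allpts" for P
          using w1[OF that] that by (simp add: extend_by_one_def)
      qed
      moreover have "?B #>\<^bsub>?H\<^esub> w = ?B #>\<^bsub>?H\<^esub> z"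
      proof -
        have "w \<otimes>\<^bsub>?H\<^esub> inv\<^bsub>?H\<^esub> z = b"
          unfolding w_def using z(1) bc by (simp add: H.m_comm[of z b] H.m_assoc)
        then show ?thesis using H.coset_eq_iff[OF B wc z(1)] b by simp
      qed
      ultimately have "Z = ?h (restrict w low)" unfolding z(2) by (simp only:)
      then show "Z \<in> ?h ` carrier ?HS" using yc by blast
    qed
  qed
  show ?thesis by (rule quotient_iso[OF h surj ker])
qed

end

end

theorem theorem1p3:
  fixes K :: "'f::field set" and C :: "('p, 'f) scheme_data" and Q :: 'p and t d :: int
  assumes curve: "regular_projective_curve K C"
    and genus: "t = arithmetic_genus K C"
    and rational: "rational_point K C Q"
    and d: "d \<ge> 3 * t + 1"
  shows
    "let T = tame_symbol C;
         Fil = K2_filtration K C;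
         all = closed_points C;
         S = {Q} \<union> points_le K C (d - 1);
         T' = tame_part C S
     in
       (\<exists>\<phi>\<in>iso (K2\<lparr>carrier := Fil d\<rparr> Mod Fil (d - 1)) (residue_units C (points_eq K C d - {Q})).
          \<forall>\<xi>\<in>Fil d. \<phi> (Fil (d - 1) #>\<^bsub>K2\<^esub> \<xi>) = tame_part C (points_eq K C d - {Q}) \<xi>) \<and>
       (\<exists>\<phi>\<in>iso (K2 Mod Fil (d - 1)) (residue_units C (points_ge K C d - {Q})).
          \<forall>\<xi>\<in>carrier K2. \<phi> (Fil (d - 1) #>\<^bsub>K2\<^esub> \<xi>) = tame_part C (points_ge K C d - {Q}) \<xi>) \<and>
       T' \<in> hom (K2\<lparr>carrier := Fil (d - 1)\<rparr>) (residue_units C S) \<and>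
       (\<forall>\<xi>\<in>Fil (d - 1). extend_by_one C S (T' \<xi>) = T \<xi>) \<and>
       kernel (K2\<lparr>carrier := Fil (d - 1)\<rparr>) (residue_units C S) T' =
         kernel K2 (residue_units C all) T \<and>
       (\<exists>\<psi>\<in>iso (residue_units C S Mod T' ` Fil (d - 1))
              (residue_units C all Mod T ` carrier K2).
          \<forall>y\<in>carrier (residue_units C S).
            \<psi> ((T' ` Fil (d - 1)) #>\<^bsub>residue_units C S\<^esub> y) =
              (T ` carrier K2) #>\<^bsub>residue_units C all\<^esub> extend_by_one C S y)"
proof -
  obtain n c where "closed_immersion_in_projective_space K C n c"
    using curve by (auto simp: regular_projective_curve_def projective_over_def)
  then interpret curve K C Q n c by (intro curve.intro curve rational)
  have d: "d \<ge> 3 * arithmetic_genus K C + 1" using d genus by simp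
  show ?thesis
    unfolding Let_def
  proof (intro conjI ballI)
    fix \<xi> assume \<xi>: "\<xi> \<in> K2_filtration K C (d - 1)"
    show "extend_by_one C ({Q} \<union> points_le K C (d - 1)) (tame_part C ({Q} \<union> points_le K C (d - 1)) \<xi>) = tame_symbol C \<xi>"
      by (rule extend_tame_part[OF d fil_carrier[OF d \<xi>] fil_low[OF d \<xi>]])
  qed (rule graded_iso[OF d] total_iso[OF d] tame_part_fil_hom[OF d low_subset[OF d]] kernels_agree[OF d]
      cokernels_agree[OF d])+
qed

end
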